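(* Let $\Omega\subset\mathbb{R}^n$ be a bounded, strictly convex domain with smooth boundary, and suppose there is a constant $k_0>0$ such that the curvature matrix $K=\{k_{ij}\}_{i,j=1}^{n-1}$ of $\partial\Omega$ satisfies $K\ge k_0 I$ at every point of $\partial\Omega$. Let $N$ be the inward unit normal to $\partial\Omega$. Then there exist a sufficiently small constant $\epsilon_1\in(0,1)$ depending only on $\partial\Omega$ and a sufficiently small constant $\epsilon_2>0$ depending only on $n$ such that the following holds. Let $F$ be an admissible anisotropy on $\mathbb{R}^{n+1}$ with structure constants $c_1,c_2$ (as defined in the context) satisfying $$\frac{c_2}{c_1}<\epsilon_2 .$$ Let $\theta\in C^3(\overline\Omega)$ satisfy $|\cos\theta|\le\epsilon_1<1$ on $\overline{\Omega}$ and $\|D\theta\|_{C^1(\overline\Omega)}\le\epsilon_1$, so that $\theta$ is bounded away from $0$ and $\pi$. Let $u_0\in C^3(\overline\Omega)$ satisfy $D_Nu_0=-\cos\theta\sqrt{1+|Du_0|^2}$ on $\partial\Omega$. Then there exists a constant $C$, independent of time (that is, independent of $T$), such that for every $T>0$ any solution $u\in C^{3,2}(\overline{Q_T})$ of $$\begin{cases} u_t=\sqrt{1+|Du|^2}\;D^2_{p_ip_j}F(Du,-1)\,u_{x_ix_j} & \text{in } Q_T=\Omega\times[0,T],\\ D_Nu=-\cos\theta\,\sqrt{1+|Du|^2} & \text{on } \Gamma_T=\partial\Omega\times[0,T],\\ u(\cdot,0)=u_0 & \text{in }\Omega\end{cases}$$ satisfies $$\sup_{\overline{Q_T}}|Du|\le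 C .$$
   Context: Summation over repeated indices $1\le i,j\le n$ is understood; $Du$ is the spatial gradient and $D_N u$ the derivative in the direction $N$. $D^2_{p_ip_j}F$ ($1\le i,j\le n$) denotes second partial derivatives of $F$ with respect to its first $n$ variables. The curvature matrix of $\partial\Omega$ is the matrix of the differential of the normal map, with the sign making it positive for strictly convex domains. $C^{3,2}(\overline{Q_T})$ denotes functions of class $C^3$ in $x$ and $C^2$ in $t$ up to the boundary. Admissible anisotropy. $F:\mathbb{R}^{n+1}\to\mathbb{R}$ is smooth on $\mathbb{R}^{n+1}\setminus\{0\}$, positive there, convex, homogeneous of degree one ($F(\lambda p)=\lambda F(p)$ for all $\lambda\ge 0$), and symmetric in the last variable: $F(p',-1)=F(p',1)$ for all $p'\in\mathbb{R}^n$. Structure constants. For $p'\in\mathbb{R}^n\setminus\{0\}$ put $p=(p',-1)$, and let $\phi^1,\dots,\phi^n$ be any orthonormal basis of $\mathbb{R}^n$ with $\phi^n=p'/|p'|$; vectors of $\mathbb{R}^n$ are identified with vectors $(\cdot,0)\in\mathbb{R}^{n+1}$. Set $\tau^{\alpha\beta}=|p|\,D^2F|_{(p',-1)}(\phi^\alpha,\phi^\beta)$ for $1\le\alpha,\beta\le n$, and define the tensor on $\mathbb{R}^n$ $$T^3_{ijl}=-\frac{\partial}{\partial p_l}\big(|p|\,D^2_{p_ip_j}F\big)\Big|_{(p',-1)},\qquad T^3(a,b,c)=T^3_{ijl}a_ib_jc_l,\qquad 1\le i,j,l\le n .$$ Structure constants are positive constants $c_1,c_2,c_3$ such that, for all $1\le\alpha,\beta\le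 n-1$ with $\alpha\ne\beta$ and for all $p'\neq 0$ and all such bases, $$c_1\le\tau^{\alpha\alpha}\le c_3,\quad \frac{c_1}{|p|^2}\le\tau^{nn}\le\frac{c_3}{|p|^2},\quad |\tau^{\alpha\beta}|\le c_2,\quad |\tau^{\alpha n}|\le\frac{c_2}{|p|^2},$$ and such that $c_1\le C_5$ and $C_4\le c_2$, where $C_4,C_5,C_6$ are positive constants depending only on $F$ for which, for all $|p'|>1$, all such bases and all $1\le\alpha,\beta\le n-1$, $$|T^3(\phi^\alpha,\phi^\alpha,\phi^\beta)|\le\frac{C_4}{|p|},\qquad |T^3(\phi^\alpha,\phi^n,\phi^\beta)|\le\frac{C_4}{|p|}\ (\alpha\ne\beta),$$ $$|T^3(\phi^\alpha,\phi^\alpha,\phi^n)|,\ |T^3(\phi^\alpha,\phi^n,\phi^n)|,\ |T^3(\phi^n,\phi^n,\phi^\alpha)|\le\frac{C_4}{|p|^3},$$ $$\frac{C_5}{|p|}\le T^3(\phi^\alpha,\phi^n,\phi^\alpha)\le\frac{C_6}{|p|},\qquad \frac{C_5}{|p|^3}\le T^3(\phi^n,\phi^n,\phi^n)\le\frac{C_6}{|p|^3}.$$ *)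

theory Defs
  imports "HOL-Analysis.Analysis"
begin

text \<open>
  All derivatives are taken \<^emph>\<open>within\<close> a set \<open>S\<close>.  For open \<open>S\<close> this is the ordinary derivative.
  For the closure of a convex domain the derivative within \<open>S\<close> is still unique at every boundary
  point (directions into the interior span the space), and it is the continuous extension
  of the interior derivative whenever the latter exists.
\<close>

definition dderiv ::
    "'a::real_normed_vector set \<Rightarrow> ('a \<Rightarrow> 'b::real_normed_vector) \<Rightarrow> 'a \<Rightarrow> 'a \<Rightarrow> 'b" where
  "dderiv S f v x = frechet_derivative f (at x within S) v"

definition grad :: "(real^'n) set \<Rightarrow> (real^'n \<Rightarrow> real) \<Rightarrow> real^'n \<Rightarrow> real^'n" where
  "grad S f x = (\<chi> i. dderiv S f (axis i 1) x)"

definition hess ::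
    "'a::real_normed_vector set \<Rightarrow> ('a \<Rightarrow> real) \<Rightarrow> 'a \<Rightarrow> 'a \<Rightarrow> 'a \<Rightarrow> real" where
  "hess S f x a b = dderiv S (\<lambda>y. dderiv S f a y) b x"

text \<open>
  For finite-dimensional domains: \<open>C\<^sup>k(S)\<close> for open \<open>S\<close>, and \<open>C\<^sup>k\<close> up to the boundary
  for \<open>S\<close> the closure of a convex domain.
\<close>

fun Ck_on :: "nat \<Rightarrow> 'a::real_normed_vector set \<Rightarrow> ('a \<Rightarrow> real) \<Rightarrow> bool" where
  "Ck_on 0 S f \<longleftrightarrow> continuous_on S f"
| "Ck_on (Suc k) S f \<longleftrightarrow>
     continuous_on S f \<and> f differentiable_on S \<and> (\<forall>v. Ck_on k S (dderiv S f v))"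

definition smooth_fun_on :: "'a::real_normed_vector set \<Rightarrow> ('a \<Rightarrow> real) \<Rightarrow> bool" where
  "smooth_fun_on S f \<longleftrightarrow> (\<forall>k. Ck_on k S f)"

fun Ck_fst_on :: "nat \<Rightarrow> 'a::real_normed_vector set \<Rightarrow> 'b::topological_space set \<Rightarrow>
    ('a \<Rightarrow> 'b \<Rightarrow> real) \<Rightarrow> bool" where
  "Ck_fst_on 0 X Y u \<longleftrightarrow> continuous_on (X \<times> Y) (\<lambda>(x, y). u x y)"
| "Ck_fst_on (Suc k) X Y u \<longleftrightarrow>
     continuous_on (X \<times> Y) (\<lambda>(x, y). u x y) \<and>
     (\<forall>y\<in>Y. (\<lambda>x. u x y) differentiable_on X) \<and>
     (\<forall>v. Ck_fst_on k X Y (\<lambda>x y. dderiv X (\<lambda>z. u z y) v x))"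

text \<open>No condition is imposed on mixed derivatives in \<open>x\<close> and \<open>t\<close>.\<close>

definition C32_on :: "(real^'n) set \<Rightarrow> real set \<Rightarrow> (real^'n \<Rightarrow> real \<Rightarrow> real) \<Rightarrow> bool" where
  "C32_on X J u \<longleftrightarrow> Ck_fst_on 3 X J u \<and> Ck_fst_on 2 J X (\<lambda>t x. u x t)"

definition C1_norm :: "(real^'n) set \<Rightarrow> (real^'n \<Rightarrow> real^'n) \<Rightarrow> real" where
  "C1_norm S G = (SUP x\<in>S. norm (G x)) + (SUP x\<in>S. onorm (\<lambda>v. dderiv S G v x))"

text \<open>Frames are indexed by \<open>1, \<dots>, n\<close> with \<open>n = CARD('n)\<close>.\<close>

definition orthonormal_frame :: "(nat \<Rightarrow> real^'n) \<Rightarrow> bool" where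
  "orthonormal_frame e \<longleftrightarrow>
     (\<forall>i\<in>{1..CARD('n)}. \<forall>j\<in>{1..CARD('n)}. e i \<bullet> e j = (if i = j then 1 else 0))"

definition strictly_convex_set :: "'a::euclidean_space set \<Rightarrow> bool" where
  "strictly_convex_set S \<longleftrightarrow>
     (\<forall>x\<in>closure S. \<forall>y\<in>closure S. x \<noteq> y \<longrightarrow> open_segment x y \<subseteq> interior S)"

definition local_defining_function ::
    "(real^'n) set \<Rightarrow> (real^'n) set \<Rightarrow> (real^'n \<Rightarrow> real) \<Rightarrow> bool" where
  "local_defining_function \<Omega> U \<rho> \<longleftrightarrow>
     open U \<and> smooth_fun_on U \<rho> \<and> \<Omega> \<inter> U = {x \<in> U. \<rho> x > 0} \<and>
     (\<forall>x\<in>U. \<rho> x = 0 \<longrightarrow> grad U \<rho> x \<noteq> 0)"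

definition smooth_boundary :: "(real^'n) set \<Rightarrow> bool" where
  "smooth_boundary \<Omega> \<longleftrightarrow>
     (\<forall>x\<in>frontier \<Omega>. \<exists>U \<rho>. x \<in> U \<and> local_defining_function \<Omega> U \<rho>)"

text \<open>Any two local defining functions have gradients in the same direction on \<open>\<partial>\<Omega>\<close>.\<close>

definition inward_normal :: "(real^'n) set \<Rightarrow> real^'n \<Rightarrow> real^'n" where
  "inward_normal \<Omega> x =
     (THE \<nu>. \<exists>U \<rho>. x \<in> U \<and> local_defining_function \<Omega> U \<rho> \<and>
                    \<nu> = grad U \<rho> x /\<^sub>R norm (grad U \<rho> x))"

text \<open>
  Minus the differential of the inward normal map \<open>\<partial>\<Omega> \<rightarrow> S\<^sup>n\<^sup>-\<^sup>1\<close>, paired with a second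
  tangent vector; it is \<open>(a \<bullet> b) / R\<close> for a ball of radius \<open>R\<close>.  A derivative within the
  hypersurface \<open>\<partial>\<Omega>\<close> is determined on tangent vectors, so the form is meaningful only for tangent
  \<open>a\<close>, \<open>b\<close>.
\<close>

definition curvature_form :: "(real^'n) set \<Rightarrow> real^'n \<Rightarrow> real^'n \<Rightarrow> real^'n \<Rightarrow> real" where
  "curvature_form \<Omega> x a b = - (dderiv (frontier \<Omega>) (inward_normal \<Omega>) a x \<bullet> b)"

text \<open>
  \<open>K \<ge> k\<^sub>0 I\<close> as quadratic forms, where \<open>k\<^sub>i\<^sub>j\<close>, \<open>1 \<le> i, j \<le> n - 1\<close>, is the curvature matrix in any
  orthonormal frame \<open>e\<^sub>1, \<dots>, e\<^sub>n\<^sub>-\<^sub>1\<close> of the tangent space.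
\<close>

definition curvature_ge :: "(real^'n) set \<Rightarrow> real \<Rightarrow> bool" where
  "curvature_ge \<Omega> k0 \<longleftrightarrow>
     (\<forall>x\<in>frontier \<Omega>. \<forall>e. orthonormal_frame e \<and> e (CARD('n)) = inward_normal \<Omega> x \<longrightarrow>
        (\<forall>\<xi>::nat \<Rightarrow> real.
           (\<Sum>i\<in>{1..<CARD('n)}. \<Sum>j\<in>{1..<CARD('n)}.
              curvature_form \<Omega> x (e i) (e j) * \<xi> i * \<xi> j)
           \<ge> k0 * (\<Sum>i\<in>{1..<CARD('n)}. (\<xi> i)\<^sup>2)))"

text \<open>\<open>\<real>\<^sup>n\<^sup>+\<^sup>1\<close> is \<open>\<real>\<^sup>n \<times> \<real>\<close>, whose norm is Euclidean.\<close>

definition admissible_anisotropy :: "((real^'n) \<times> real \<Rightarrow> real) \<Rightarrow> bool" where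
  "admissible_anisotropy F \<longleftrightarrow>
     smooth_fun_on (- {0}) F \<and>
     (\<forall>p. p \<noteq> 0 \<longrightarrow> F p > 0) \<and>
     convex_on UNIV F \<and>
     (\<forall>l\<ge>0. \<forall>p. F (l *\<^sub>R p) = l * F p) \<and>
     (\<forall>p'. F (p', -1) = F (p', 1))"

definition aniso_tau ::
    "((real^'n) \<times> real \<Rightarrow> real) \<Rightarrow> real^'n \<Rightarrow> real^'n \<Rightarrow> real^'n \<Rightarrow> real" where
  "aniso_tau F p' a b = norm (p', -1::real) * hess UNIV F (p', -1) (a, 0) (b, 0)"

definition aniso_T3_comp ::
    "((real^'n) \<times> real \<Rightarrow> real) \<Rightarrow> real^'n \<Rightarrow> 'n \<Rightarrow> 'n \<Rightarrow> 'n \<Rightarrow> real" where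
  "aniso_T3_comp F p' i j l =
     - dderiv UNIV (\<lambda>p. norm p * hess UNIV F p (axis i 1, 0) (axis j 1, 0)) (axis l 1, 0) (p', -1)"

definition aniso_T3 ::
    "((real^'n) \<times> real \<Rightarrow> real) \<Rightarrow> real^'n \<Rightarrow> real^'n \<Rightarrow> real^'n \<Rightarrow> real^'n \<Rightarrow> real" where
  "aniso_T3 F p' a b c =
     (\<Sum>i\<in>UNIV. \<Sum>j\<in>UNIV. \<Sum>l\<in>UNIV. aniso_T3_comp F p' i j l * a $ i * b $ j * c $ l)"

definition adapted_frame :: "real^'n \<Rightarrow> (nat \<Rightarrow> real^'n) \<Rightarrow> bool" where
  "adapted_frame p' \<phi> \<longleftrightarrow> orthonormal_frame \<phi> \<and> \<phi> (CARD('n)) = p' /\<^sub>R norm p'"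

definition tau_bounds ::
    "((real^'n) \<times> real \<Rightarrow> real) \<Rightarrow> real \<Rightarrow> real \<Rightarrow> real \<Rightarrow> bool" where
  "tau_bounds F c1 c2 c3 \<longleftrightarrow>
     (\<forall>p' \<phi>. p' \<noteq> 0 \<and> adapted_frame p' \<phi> \<longrightarrow>
        (let n = CARD('n); P = norm (p', -1::real); \<tau> = (\<lambda>\<alpha> \<beta>. aniso_tau F p' (\<phi> \<alpha>) (\<phi> \<beta>)) in
           (\<forall>\<alpha>\<in>{1..<n}. c1 \<le> \<tau> \<alpha> \<alpha> \<and> \<tau> \<alpha> \<alpha> \<le> c3) \<and>
           c1 / P\<^sup>2 \<le> \<tau> n n \<and> \<tau> n n \<le> c3 / P\<^sup>2 \<and>
           (\<forall>\<alpha>\<in>{1..<n}. \<forall>\<beta>\<in>{1..<n}. \<alpha> \<noteq> \<beta> \<longrightarrow> \<bar>\<tau> \<alpha> \<beta>\<bar> \<le> c2) \<and>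
           (\<forall>\<alpha>\<in>{1..<n}. \<bar>\<tau> \<alpha> n\<bar> \<le> c2 / P\<^sup>2)))"

definition T3_bounds ::
    "((real^'n) \<times> real \<Rightarrow> real) \<Rightarrow> real \<Rightarrow> real \<Rightarrow> real \<Rightarrow> bool" where
  "T3_bounds F C4 C5 C6 \<longleftrightarrow>
     (\<forall>p' \<phi>. norm p' > 1 \<and> adapted_frame p' \<phi> \<longrightarrow>
        (let n = CARD('n); P = norm (p', -1::real);
             T = (\<lambda>\<alpha> \<beta> \<gamma>. aniso_T3 F p' (\<phi> \<alpha>) (\<phi> \<beta>) (\<phi> \<gamma>)) in
           (\<forall>\<alpha>\<in>{1..<n}. \<forall>\<beta>\<in>{1..<n}. \<bar>T \<alpha> \<alpha> \<beta>\<bar> \<le> C4 / P) \<and>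
           (\<forall>\<alpha>\<in>{1..<n}. \<forall>\<beta>\<in>{1..<n}. \<alpha> \<noteq> \<beta> \<longrightarrow> \<bar>T \<alpha> n \<beta>\<bar> \<le> C4 / P) \<and>
           (\<forall>\<alpha>\<in>{1..<n}. \<bar>T \<alpha> \<alpha> n\<bar> \<le> C4 / P ^ 3 \<and> \<bar>T \<alpha> n n\<bar> \<le> C4 / P ^ 3 \<and>
                         \<bar>T n n \<alpha>\<bar> \<le> C4 / P ^ 3) \<and>
           (\<forall>\<alpha>\<in>{1..<n}. C5 / P \<le> T \<alpha> n \<alpha> \<and> T \<alpha> n \<alpha> \<le> C6 / P) \<and>
           C5 / P ^ 3 \<le> T n n n \<and> T n n n \<le> C6 / P ^ 3))"

definition structure_constants ::
    "((real^'n) \<times> real \<Rightarrow> real) \<Rightarrow> real \<Rightarrow> real \<Rightarrow> real \<Rightarrow> bool" where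
  "structure_constants F c1 c2 c3 \<longleftrightarrow>
     c1 > 0 \<and> c2 > 0 \<and> c3 > 0 \<and> tau_bounds F c1 c2 c3 \<and>
     (\<exists>C4 C5 C6. C4 > 0 \<and> C5 > 0 \<and> C6 > 0 \<and> T3_bounds F C4 C5 C6 \<and> c1 \<le> C5 \<and> C4 \<le> c2)"

definition capillary_condition ::
    "(real^'n) set \<Rightarrow> (real^'n \<Rightarrow> real) \<Rightarrow> (real^'n \<Rightarrow> real) \<Rightarrow> bool" where
  "capillary_condition \<Omega> \<theta> v \<longleftrightarrow>
     (\<forall>x\<in>frontier \<Omega>. dderiv (closure \<Omega>) v (inward_normal \<Omega> x) x =
        - cos (\<theta> x) * sqrt (1 + (norm (grad (closure \<Omega>) v x))\<^sup>2))"

definition flow_solution ::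
    "((real^'n) \<times> real \<Rightarrow> real) \<Rightarrow> (real^'n) set \<Rightarrow> (real^'n \<Rightarrow> real) \<Rightarrow> (real^'n \<Rightarrow> real) \<Rightarrow>
     real \<Rightarrow> (real^'n \<Rightarrow> real \<Rightarrow> real) \<Rightarrow> bool" where
  "flow_solution F \<Omega> \<theta> u0 T u \<longleftrightarrow>
     C32_on (closure \<Omega>) {0..T} u \<and>
     (\<forall>x\<in>\<Omega>. \<forall>t\<in>{0..T}.
        dderiv {0..T} (\<lambda>s. u x s) 1 t =
          (let Du = grad (closure \<Omega>) (\<lambda>y. u y t) x in
             sqrt (1 + (norm Du)\<^sup>2) *
             (\<Sum>i\<in>UNIV. \<Sum>j\<in>UNIV. hess UNIV F (Du, -1) (axis i 1, 0) (axis j 1, 0) *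
                hess (closure \<Omega>) (\<lambda>y. u y t) x (axis i 1) (axis j 1)))) \<and>
     (\<forall>t\<in>{0..T}. capillary_condition \<Omega> \<theta> (\<lambda>y. u y t)) \<and>
     (\<forall>x\<in>\<Omega>. u x 0 = u0 x)"

end

theory Submission
  imports Defs
begin

text \<open>The gradient bound is a Lipschitz bound \<open>u x t - u y t \<le> C * norm (x - y)\<close> that does not deteriorate
with time, and it comes from a maximum principle in the two points \<open>x\<close>, \<open>y\<close>
(lemma \<open>two_point_comparison\<close>).

Write \<open>m = (x + y) / 2\<close> and \<open>h = x - y\<close>, and compare \<open>u x t - u y t\<close> with the barrier
\<open>R(x, y) = b(m) \<bar>h\<bar> - Z(m) \<bullet> h\<close>.  Let \<open>p\<close> be the \<open>x\<close>-gradient of \<open>R\<close> and \<open>q\<close> minus its \<open>y\<close>-gradient.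
At an interior positive maximum of \<open>u x t - u y t - R - \<delta> t\<close> one has \<open>Du(x) = p\<close> and \<open>Du(y) = q\<close>.  The matrix
\<open>\<tau>(p) = \<bar>(p,-1)\<bar> D\<^sup>2F(p,-1)\<close> is exactly the diffusion matrix of the equation, so if
\<open>\<tau>(p) = \<Sum> w\<^sub>k \<otimes> w\<^sub>k\<close> and \<open>\<tau>(q) = \<Sum> z\<^sub>k \<otimes> z\<^sub>k\<close>, then adding the second-order conditions along the directions
\<open>(w\<^sub>k, z\<^sub>k)\<close> bounds \<open>u\<^sub>t(x) - u\<^sub>t(y)\<close> by the sum of the second derivatives of \<open>R\<close> along them.  The
contradiction with \<open>u\<^sub>t(x) - u\<^sub>t(y) \<ge> \<delta>\<close> only needs this sum to be nonpositive.

\<^emph>\<open>Interior.\<close>  With \<open>b(m) = L (1 - \<eta> \<bar>m\<bar>\<^sup>2)\<close> and \<open>g\<^sub>k = (w\<^sub>k + z\<^sub>k) / 2\<close>, the sum is bounded by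
\<open>L (2 \<Sum> \<bar>w\<^sub>k - z\<^sub>k\<bar>\<^sup>2 / \<bar>h\<bar> - c \<bar>h\<bar> \<Sum> \<bar>g\<^sub>k\<bar>\<^sup>2)\<close> with \<open>c\<close> comparable to \<open>\<eta>\<close>.  The two momenta differ only by
\<open>O(\<eta> L \<bar>h\<bar>)\<close>, while both have size comparable to \<open>L\<close>.  The crucial algebraic fact, lemma
\<open>coupled_decompositions\<close>, is that the vectors can then be chosen with
\<open>\<Sum> \<bar>w\<^sub>k - z\<^sub>k\<bar>\<^sup>2 \<le> const(n) (\<bar>p - q\<bar> / L)\<^sup>2 \<Sum> \<bar>g\<^sub>k\<bar>\<^sup>2\<close>, which is \<open>O(\<eta>\<^sup>2 \<bar>h\<bar>\<^sup>2) \<Sum> \<bar>g\<^sub>k\<bar>\<^sup>2\<close>; a small \<open>\<eta>\<close> makes the negative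
term win.  This is where the structure constants enter.  If \<open>c2 \<le> c1 / (4 n)\<close>, the matrix
\<open>\<tau>\<close>, written in a frame adapted to \<open>p\<close> with its radial direction rescaled by \<open>\<bar>(p,-1)\<bar>\<close>, is diagonally dominant,
hence an explicit sum of squares; and the bounds on \<open>\<tau>\<close> and \<open>T\<^sup>3\<close> say that the rescaled entries are
Lipschitz functions of \<open>p / \<bar>p\<bar>\<close> and \<open>log \<bar>p\<bar>\<close> with constants of size \<open>c2\<close>.  The larger constants \<open>c3\<close> and
\<open>C6\<close> occur only in the rescaled radial entry, where a negative power of \<open>L\<close> absorbs them.  This is why \<open>\<eta>\<close>, and with it
the smallness imposed on \<open>\<theta>\<close>, does not depend on \<open>F\<close>, although \<open>L\<close> does.

\<^emph>\<open>Boundary.\<close>  The field is \<open>Z = sqrt (1 + b\<^sup>2) * (cos \<theta> / sqrt (1 - cos\<^sup>2 \<theta>)) \<nu>\<close> with a \<open>C\<^sup>2\<close> extension \<open>\<nu>\<close> of the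
inward normal.  It is chosen so that a covector \<open>b e - Z\<close> with \<open>e\<close> a unit tangent vector satisfies the
boundary condition exactly.  Along a chord \<open>e = h / \<bar>h\<bar>\<close> is not tangent but points outwards, and the
curvature bound quantifies this: \<open>-e \<bullet> N \<ge> \<kappa> \<bar>h\<bar>\<close> (lemma \<open>quantitative_convexity\<close>).  The resulting strict sign
beats the errors, which are \<open>O(\<eta> L \<bar>h\<bar>)\<close>, once \<open>\<eta>\<close> is small compared with \<open>\<kappa>\<close>.  Smallness of \<open>cos \<theta>\<close> and
of the derivatives of \<open>\<theta>\<close> makes \<open>Z\<close> small in \<open>C\<^sup>2\<close> relative to \<open>L\<close>.

Finally \<open>L\<close> is taken large enough for the initial datum and for \<open>F\<close>.  In dimension one there are no tangential
directions; there \<open>R = L \<bar>h\<bar>\<close> already works (lemma \<open>uniform_lipschitz_interval\<close>).\<close>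

section \<open>Derivatives within a set\<close>

lemma frechet_within_open:
  "open S \<Longrightarrow> x \<in> S \<Longrightarrow> dderiv S f v x = frechet_derivative f (at x) v"
  by (simp add: dderiv_def at_within_open[of x S])

lemma dderiv_eq:
  assumes "(f has_derivative f') (at x)" "open S" "x \<in> S"
  shows "dderiv S f v x = f' v"
  using assms frechet_derivative_at[OF assms(1)] by (simp add: frechet_within_open)

lemma differentiable_has_dderiv:
  assumes "f differentiable (at x within S)"
  shows "(f has_derivative (\<lambda>v. dderiv S f v x)) (at x within S)"
  using assms unfolding dderiv_def by (simp add: frechet_derivative_works)

lemma dderiv_linear:
  assumes "f differentiable (at x within S)"
  shows "linear (\<lambda>v. dderiv S f v x)"
  using differentiable_has_dderiv[OF assms] by (rule has_derivative_linear)

lemma grad_inner: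
  assumes "f differentiable (at x within S)"
  shows "dderiv S f v x = grad S f x \<bullet> v"
proof -
  interpret linear "\<lambda>v. dderiv S f v x" by (rule dderiv_linear[OF assms])
  have "dderiv S f v x = dderiv S f (\<Sum>i\<in>UNIV. v $ i *\<^sub>R axis i 1) x"
    by (simp add: basis_expansion scalar_mult_eq_scaleR[symmetric])
  also have "\<dots> = (\<Sum>i\<in>UNIV. v $ i * dderiv S f (axis i 1) x)"
    by (simp add: sum scale)
  also have "\<dots> = grad S f x \<bullet> v"
    by (simp add: grad_def inner_vec_def mult.commute)
  finally show ?thesis .
qed

lemma dderiv_cong_open:
  assumes "open S" "x \<in> S" "\<And>y. y \<in> S \<Longrightarrow> f y = g y"
  shows "dderiv T f v x = dderiv T g v x"
proof -
  have "(f has_derivative f') (at x within T) = (g has_derivative f') (at x within T)" for f'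
    using has_derivative_transform_within_open[OF _ assms(1,2), of f f' T g]
      has_derivative_transform_within_open[OF _ assms(1,2), of g f' T f] assms(3) by metis
  then show ?thesis unfolding dderiv_def frechet_derivative_def by simp
qed

lemma Ck_on_differentiable:
  "Ck_on (Suc k) S f \<Longrightarrow> x \<in> S \<Longrightarrow> f differentiable (at x within S)"
  by (auto simp: differentiable_on_def)

lemma Ck_on_dderiv: "Ck_on (Suc k) S f \<Longrightarrow> Ck_on k S (dderiv S f v)"
  by simp

lemma Ck_on_cont: "Ck_on k S f \<Longrightarrow> continuous_on S f"
  by (cases k) auto

lemma has_vector_derivative_line:
  assumes "(f has_derivative D) (at (x + t *\<^sub>R a))"
  shows "((\<lambda>t. f (x + t *\<^sub>R a)) has_vector_derivative D a) (at t)"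
proof -
  have "((\<lambda>t. x + t *\<^sub>R a) has_derivative (\<lambda>h. h *\<^sub>R a)) (at t)"
    by (auto intro!: derivative_eq_intros)
  from has_derivative_compose[OF this, of f D] assms
  have "((\<lambda>t. f (x + t *\<^sub>R a)) has_derivative (\<lambda>h. D (h *\<^sub>R a))) (at t)" by blast
  then show ?thesis
    using has_derivative_linear[OF assms] by (simp add: linear_scale has_vector_derivative_def)
qed

lemma mvt_line:
  fixes f :: "'a::real_normed_vector \<Rightarrow> real"
  assumes "0 < s"
    "\<And>t. 0 \<le> t \<Longrightarrow> t \<le> s \<Longrightarrow> (f has_derivative D (x + t *\<^sub>R a)) (at (x + t *\<^sub>R a))"
  obtains t where "0 < t" "t < s" "f (x + s *\<^sub>R a) - f x = s * D (x + t *\<^sub>R a) a"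
proof -
  have der: "((\<lambda>t. f (x + t *\<^sub>R a)) has_real_derivative D (x + t *\<^sub>R a) a) (at t)"
    if "0 \<le> t" "t \<le> s" for t
    using has_vector_derivative_line[of f "D (x + t *\<^sub>R a)", OF assms(2)[OF that]]
    by (simp add: has_real_derivative_iff_has_vector_derivative)
  from MVT2[OF assms(1), of "\<lambda>t. f (x + t *\<^sub>R a)" "\<lambda>t. D (x + t *\<^sub>R a) a"] der
  obtain t where "t > 0" "t < s" "f (x + s *\<^sub>R a) - f (x + 0 *\<^sub>R a) = (s - 0) * D (x + t *\<^sub>R a) a"
    by auto
  then show ?thesis using that by simp
qed

text \<open>The mixed second difference quotient converges to the iterated derivative, which uses continuity of only this
one iterated derivative.  The left-hand side is symmetric in \<open>a\<close> and \<open>b\<close>; this yields the symmetry of second derivatives for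
\<open>Ck_on\<close> below.\<close>

lemma second_difference:
  fixes f :: "'a::real_normed_vector \<Rightarrow> real"
  assumes S: "open S" "x \<in> S" and C: "Ck_on 2 S f" and "e > 0"
  shows "\<exists>d>0. \<forall>s. 0 < s \<and> s < d \<longrightarrow>
    \<bar>f (x + s *\<^sub>R a + s *\<^sub>R b) - f (x + s *\<^sub>R a) - f (x + s *\<^sub>R b) + f x
       - s\<^sup>2 * dderiv S (dderiv S f a) b x\<bar> \<le> s\<^sup>2 * e"
proof -
  let ?H = "\<lambda>y. dderiv S (dderiv S f a) b y"
  have C1: "Ck_on (Suc 1) S f" using C by (simp add: numeral_2_eq_2)
  have C2: "Ck_on (Suc 0) S (dderiv S f v)" for v using Ck_on_dderiv[OF C1] by simp
  have "continuous_on S ?H" using Ck_on_cont[OF Ck_on_dderiv[OF C2]] .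
  then obtain r1 where r1: "r1 > 0" "\<And>y. y \<in> S \<Longrightarrow> dist y x < r1 \<Longrightarrow> dist (?H y) (?H x) < e"
    unfolding continuous_on_iff using S(2) \<open>e > 0\<close> by blast
  obtain r2 where r2: "r2 > 0" "ball x r2 \<subseteq> S" using S openE by blast
  define r where "r = min r1 r2"
  define d where "d = r / (norm a + norm b + 1)"
  have rp: "r > 0" using r1 r2 by (simp add: r_def)
  have dp: "d > 0" using rp by (simp add: d_def add_nonneg_pos)
  have near: "x + p *\<^sub>R a + q *\<^sub>R b \<in> S \<and> dist (x + p *\<^sub>R a + q *\<^sub>R b) x < r"
    if "0 \<le> p" "p \<le> s" "0 \<le> q" "q \<le> s" "s < d" for p q s
  proof -
    have "norm (p *\<^sub>R a + q *\<^sub>R b) \<le> p * norm a + q * norm b"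
      using that by (metis abs_of_nonneg norm_scaleR norm_triangle_ineq)
    also have "\<dots> \<le> s * norm a + s * norm b"
      using that by (intro add_mono mult_right_mono) auto
    also have "\<dots> \<le> s * (norm a + norm b + 1)" using that by (simp add: algebra_simps)
    also have "\<dots> < d * (norm a + norm b + 1)"
      using that by (intro mult_strict_right_mono) (auto simp: add_nonneg_pos)
    also have "\<dots> = r"
    proof -
      have "norm a + norm b + 1 \<noteq> 0" using norm_ge_zero[of a] norm_ge_zero[of b] by linarith
      then show ?thesis by (simp add: d_def)
    qed
    finally have "dist (x + p *\<^sub>R a + q *\<^sub>R b) x < r" by (simp add: dist_norm add.assoc)
    then show ?thesis using r2(2) by (auto simp: r_def dist_commute subset_iff)
  qed
  have hd: "(g has_derivative (\<lambda>v. dderiv S g v y)) (at y)" if "Ck_on (Suc k) S g" "y \<in> S" for g y k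
    using differentiable_has_dderiv[OF Ck_on_differentiable[OF that]] at_within_open[OF that(2) S(1)]
    by simp
  show ?thesis
  proof (intro exI[of _ d] conjI dp allI impI)
    fix s assume s: "0 < s \<and> s < d"
    define g where "g = (\<lambda>y. f (y + s *\<^sub>R b) - f y)"
    have "(g has_derivative (\<lambda>v. dderiv S f v (x + t *\<^sub>R a + s *\<^sub>R b) - dderiv S f v (x + t *\<^sub>R a)))
            (at (x + t *\<^sub>R a))"
      if "0 \<le> t" "t \<le> s" for t
    proof -
      have m: "x + t *\<^sub>R a + s *\<^sub>R b \<in> S" "x + t *\<^sub>R a \<in> S"
        using near[of t s s] near[of t s 0] that s by auto
      have "((\<lambda>y. f (y + s *\<^sub>R b)) has_derivative (\<lambda>v. dderiv S f v (x + t *\<^sub>R a + s *\<^sub>R b)))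
          (at (x + t *\<^sub>R a))"
        using has_derivative_compose[of "\<lambda>y. y + s *\<^sub>R b" "\<lambda>v. v" "x + t *\<^sub>R a" UNIV f
            "\<lambda>v. dderiv S f v (x + t *\<^sub>R a + s *\<^sub>R b)"] hd[OF C1 m(1)]
          has_derivative_add[OF has_derivative_ident has_derivative_const, of "s *\<^sub>R b"]
        by simp
      then show ?thesis unfolding g_def using hd[OF C1 m(2)] by (intro has_derivative_diff)
    qed
    from mvt_line[of s g "\<lambda>y v. dderiv S f v (y + s *\<^sub>R b) - dderiv S f v y" x a, OF _ this]
    obtain t where t: "0 < t" "t < s" "g (x + s *\<^sub>R a) - g x =
      s * (dderiv S f a (x + t *\<^sub>R a + s *\<^sub>R b) - dderiv S f a (x + t *\<^sub>R a))"
      using s by auto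
    have "(dderiv S f a has_derivative (\<lambda>v. dderiv S (dderiv S f a) v (x + t *\<^sub>R a + q *\<^sub>R b)))
            (at (x + t *\<^sub>R a + q *\<^sub>R b))" if "0 \<le> q" "q \<le> s" for q
      using near[of t s q] that t s by (intro hd[OF C2]) auto
    from mvt_line[of s "dderiv S f a" "\<lambda>y v. dderiv S (dderiv S f a) v y" "x + t *\<^sub>R a" b, OF _ this]
    obtain q where q: "0 < q" "q < s" "dderiv S f a (x + t *\<^sub>R a + s *\<^sub>R b) - dderiv S f a (x + t *\<^sub>R a)
        = s * ?H (x + t *\<^sub>R a + q *\<^sub>R b)" using s by auto
    have "f (x + s *\<^sub>R a + s *\<^sub>R b) - f (x + s *\<^sub>R a) - f (x + s *\<^sub>R b) + f x = g (x + s *\<^sub>R a) - g x"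
      by (simp add: g_def)
    also have "\<dots> = s\<^sup>2 * ?H (x + t *\<^sub>R a + q *\<^sub>R b)" using t q by (simp add: power2_eq_square)
    finally have eq: "f (x + s *\<^sub>R a + s *\<^sub>R b) - f (x + s *\<^sub>R a) - f (x + s *\<^sub>R b) + f x - s\<^sup>2 * ?H x
        = s\<^sup>2 * (?H (x + t *\<^sub>R a + q *\<^sub>R b) - ?H x)" by (simp add: algebra_simps)
    have "\<bar>?H (x + t *\<^sub>R a + q *\<^sub>R b) - ?H x\<bar> \<le> e"
      using r1(2)[of "x + t *\<^sub>R a + q *\<^sub>R b"] near[of t s q] t q s by (auto simp: r_def dist_real_def)
    then show "\<bar>f (x + s *\<^sub>R a + s *\<^sub>R b) - f (x + s *\<^sub>R a) - f (x + s *\<^sub>R b) + f x - s\<^sup>2 * ?H x\<bar> \<le> s\<^sup>2 * e"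
      unfolding eq by (simp add: abs_mult mult_left_mono)
  qed
qed

lemma second_dderiv_symmetric:
  fixes f :: "'a::real_normed_vector \<Rightarrow> real"
  assumes "open S" "x \<in> S" "Ck_on 2 S f"
  shows "dderiv S (dderiv S f a) b x = dderiv S (dderiv S f b) a x"
proof -
  let ?A = "dderiv S (dderiv S f a) b x" and ?B = "dderiv S (dderiv S f b) a x"
  have "\<bar>?A - ?B\<bar> \<le> e" if "e > 0" for e
  proof -
    from second_difference[OF assms, of "e/2" a b] that obtain d where d: "d > 0"
      "\<And>s. 0 < s \<Longrightarrow> s < d \<Longrightarrow> \<bar>f (x + s *\<^sub>R a + s *\<^sub>R b) - f (x + s *\<^sub>R a) - f (x + s *\<^sub>R b) + f x - s\<^sup>2 * ?A\<bar> \<le> s\<^sup>2 * (e/2)"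
      by auto
    from second_difference[OF assms, of "e/2" b a] that obtain d' where d': "d' > 0"
      "\<And>s. 0 < s \<Longrightarrow> s < d' \<Longrightarrow> \<bar>f (x + s *\<^sub>R b + s *\<^sub>R a) - f (x + s *\<^sub>R b) - f (x + s *\<^sub>R a) + f x - s\<^sup>2 * ?B\<bar> \<le> s\<^sup>2 * (e/2)"
      by auto
    define s where "s = min d d' / 2"
    have s: "0 < s" "s < d" "s < d'" using d(1) d'(1) by (auto simp: s_def)
    have eq: "x + s *\<^sub>R b + s *\<^sub>R a = x + s *\<^sub>R a + s *\<^sub>R b" by simp
    have "\<bar>s\<^sup>2 * ?A - s\<^sup>2 * ?B\<bar> \<le> s\<^sup>2 * e"
      using d(2)[OF s(1,2)] d'(2)[OF s(1,3)] unfolding eq by linarith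
    then have "s\<^sup>2 * \<bar>?A - ?B\<bar> \<le> s\<^sup>2 * e" by (simp add: abs_mult flip: right_diff_distrib)
    then show ?thesis using s(1) by simp
  qed
  then have "\<bar>?A - ?B\<bar> \<le> 0" by (rule field_le_epsilon[of _ 0, simplified])
  then show ?thesis by simp
qed

text \<open>A one-sided first-order condition: the derivative within \<open>S\<close> is nonpositive at a maximum in every direction that
enters \<open>S\<close>.  It serves at boundary points in space as well as at the final time.\<close>

lemma has_derivative_at_max_inward:
  fixes f :: "'a::real_normed_vector \<Rightarrow> real"
  assumes der: "(f has_derivative f') (at x within S)"
    and max: "\<And>y. y \<in> S \<Longrightarrow> f y \<le> f x"
    and e: "e > 0" "\<And>t. 0 < t \<Longrightarrow> t < e \<Longrightarrow> x + t *\<^sub>R v \<in> S"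
  shows "f' v \<le> 0"
proof -
  define g where "g = (\<lambda>t. f (x + t *\<^sub>R v))"
  have sub: "(\<lambda>t. x + t *\<^sub>R v) ` {0<..<e} \<subseteq> S" using e(2) by auto
  have "((\<lambda>t. f (x + t *\<^sub>R v)) has_derivative (\<lambda>h. f' (h *\<^sub>R v))) (at 0 within {0<..<e})"
    by (rule has_derivative_in_compose[where g=f])
       (auto intro!: derivative_eq_intros has_derivative_subset[OF der sub])
  moreover have "f' (h *\<^sub>R v) = f' v * h" for h
    using has_derivative_linear[OF der] by (simp add: linear_scale)
  ultimately have "(g has_field_derivative f' v) (at 0 within {0<..<e})"
    by (simp add: has_field_derivative_def g_def)
  then have "((\<lambda>t. (g t - g 0) / (t - 0)) \<longlongrightarrow> f' v) (at 0 within {0<..<e})"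
    by (simp add: has_field_derivative_iff)
  moreover have "at 0 within {0<..<e} \<noteq> bot"
    using e(1) by (simp add: trivial_limit_within islimpt_greaterThanLessThan1)
  moreover have "\<forall>\<^sub>F t in at 0 within {0<..<e}. (g t - g 0) / (t - 0) \<le> 0"
    unfolding eventually_at_topological
    by (rule exI[of _ UNIV]) (auto simp: g_def divide_nonpos_pos max e)
  ultimately show ?thesis using tendsto_upperbound by blast
qed

text \<open>At a boundary point a derivative within \<open>S\<close> is in general not unique, but its value in a direction entering \<open>S\<close> is
the limit of difference quotients taken inside \<open>S\<close>.\<close>

lemma has_derivative_within_unique_inward:
  fixes f :: "'a::real_normed_vector \<Rightarrow> 'b::real_normed_vector"
  assumes f1: "(f has_derivative f1) (at x within S)" and f2: "(f has_derivative f2) (at x within S)"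
    and e: "e > 0" "\<And>t. 0 < t \<Longrightarrow> t < e \<Longrightarrow> x + t *\<^sub>R v \<in> S"
  shows "f1 v = f2 v"
proof -
  define D where "D = (\<lambda>v. f1 v - f2 v)"
  have d: "((\<lambda>y. 0) has_derivative D) (at x within S)"
    using has_derivative_diff[OF f1 f2] by (simp add: D_def)
  have sub: "(\<lambda>t. x + t *\<^sub>R v) ` {0<..<e} \<subseteq> S" using e(2) by auto
  have l: "((\<lambda>t. x + t *\<^sub>R v) has_derivative (\<lambda>h. h *\<^sub>R v)) (at 0 within {0<..<e})"
    by (auto intro!: derivative_eq_intros)
  have "((\<lambda>y. 0) has_derivative D) (at (x + 0 *\<^sub>R v) within (\<lambda>t. x + t *\<^sub>R v) ` {0<..<e})"
    using has_derivative_subset[OF d sub] by simp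
  from has_derivative_in_compose[OF l this]
  have "((\<lambda>t::real. 0::'b) has_derivative (\<lambda>h. D (h *\<^sub>R v))) (at 0 within {0<..<e})" .
  moreover have "D (h *\<^sub>R v) = h *\<^sub>R D v" for h
    using linear_scale[OF has_derivative_linear[OF d]] .
  ultimately have "((\<lambda>t::real. 0::'b) has_vector_derivative D v) (at 0 within {0<..<e})"
    by (simp add: has_vector_derivative_def)
  moreover have "at (0::real) within {0<..<e} \<noteq> bot"
    using e(1) by (simp add: trivial_limit_within islimpt_greaterThanLessThan1)
  ultimately have "D v = 0"
    using vector_derivative_unique_within[OF _ _ has_vector_derivative_const] by blast
  then show ?thesis by (simp add: D_def)
qed

lemma second_derivative_at_max:
  fixes g :: "real \<Rightarrow> real"
  assumes max: "\<forall>\<^sub>F t in nhds 0. g t \<le> g 0"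
    and d1: "\<forall>\<^sub>F t in nhds 0. (g has_real_derivative g1 t) (at t)"
    and d2: "(g1 has_real_derivative g2) (at 0)"
  shows "g2 \<le> 0"
proof (rule ccontr)
  assume "\<not> g2 \<le> 0"
  obtain e where e: "e > 0" "\<And>t. \<bar>t\<bar> < e \<Longrightarrow> g t \<le> g 0 \<and> (g has_real_derivative g1 t) (at t)"
    using eventually_conj[OF max d1] unfolding eventually_nhds_metric by (auto simp: dist_real_def)
  have z: "g1 0 = 0"
    by (rule DERIV_local_max[of g "g1 0" 0 e]) (use e in auto)
  from DERIV_pos_inc_right[OF d2] \<open>\<not> g2 \<le> 0\<close> obtain d where d: "d > 0"
    "\<And>h. 0 < h \<Longrightarrow> h < d \<Longrightarrow> g1 0 < g1 (0 + h)" by auto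
  define h where "h = min d e / 2"
  have h: "0 < h" "h < d" "h < e" using d e by (auto simp: h_def)
  from MVT2[of 0 h g g1] h e obtain z where "0 < z" "z < h" "g h - g 0 = h * g1 z" by auto
  moreover have "g1 z > 0" using d(2)[of z] \<open>g1 0 = 0\<close> calculation h by auto
  moreover have "g h \<le> g 0" using e(2)[of h] h by auto
  ultimately show False using h mult_pos_pos[of h "g1 z"] by linarith
qed

section \<open>Pointwise bounds up to second order\<close>

text \<open>Numerical bounds for a function and its first two derivatives at a single point; the second derivative \<open>f2\<close> is represented
through the derivative of \<open>y \<mapsto> f1 y v\<close> for each fixed \<open>v\<close>.  Keeping explicit constants matters because
the smallness of the barrier field has to be traced through products and compositions.\<close>

definition C2_bounds_at :: "real \<Rightarrow> real \<Rightarrow> real \<Rightarrow>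
    ('a::real_normed_vector \<Rightarrow> 'b::real_normed_vector) \<Rightarrow> 'a \<Rightarrow> bool" where
  "C2_bounds_at A B C f x \<longleftrightarrow> (\<exists>f1 f2.
     (\<forall>\<^sub>F y in nhds x. (f has_derivative f1 y) (at y)) \<and>
     (\<forall>v. ((\<lambda>y. f1 y v) has_derivative f2 v) (at x)) \<and>
     norm (f x) \<le> A \<and> (\<forall>v. norm (f1 x v) \<le> B * norm v) \<and>
     (\<forall>v w. norm (f2 v w) \<le> C * norm v * norm w))"

lemma C2_bounds_at_mono:
  assumes "C2_bounds_at A B C f x" "A \<le> A'" "B \<le> B'" "C \<le> C'"
  shows "C2_bounds_at A' B' C' f x"
proof -
  from assms(1) obtain f1 f2 where *: "\<forall>\<^sub>F y in nhds x. (f has_derivative f1 y) (at y)"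
    "\<forall>v. ((\<lambda>y. f1 y v) has_derivative f2 v) (at x)" "norm (f x) \<le> A"
    "\<And>v. norm (f1 x v) \<le> B * norm v" "\<And>v w. norm (f2 v w) \<le> C * norm v * norm w"
    unfolding C2_bounds_at_def by auto
  have "norm (f1 x v) \<le> B' * norm v" for v
    using *(4)[of v] assms(3) by (meson mult_right_mono norm_ge_zero order_trans)
  moreover have "norm (f2 v w) \<le> C' * norm v * norm w" for v w
    using *(5)[of v w] assms(4) by (meson mult_right_mono norm_ge_zero order_trans)
  moreover have "norm (f x) \<le> A'" using *(3) assms(2) by simp
  ultimately show ?thesis unfolding C2_bounds_at_def
    using *(1,2) by (intro exI[of _ f1] exI[of _ f2] conjI allI) auto
qed

lemma C2_bounds_at_cong:
  assumes "C2_bounds_at A B C f x" "\<forall>\<^sub>F y in nhds x. f y = g y"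
  shows "C2_bounds_at A B C g x"
proof -
  from assms(1) obtain f1 f2 where *: "\<forall>\<^sub>F y in nhds x. (f has_derivative f1 y) (at y)"
    "\<forall>v. ((\<lambda>y. f1 y v) has_derivative f2 v) (at x)" "norm (f x) \<le> A"
    "\<And>v. norm (f1 x v) \<le> B * norm v" "\<And>v w. norm (f2 v w) \<le> C * norm v * norm w"
    unfolding C2_bounds_at_def by auto
  obtain S where S: "open S" "x \<in> S" "\<And>y. y \<in> S \<Longrightarrow> f y = g y"
    using assms(2) unfolding eventually_nhds by auto
  have "\<forall>\<^sub>F y in nhds x. (g has_derivative f1 y) (at y)"
  proof (rule eventually_elim2[OF *(1) eventually_nhds_in_open[OF S(1,2)]])
    fix y assume y: "(f has_derivative f1 y) (at y)" "y \<in> S"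
    show "(g has_derivative f1 y) (at y)"
      by (rule has_derivative_transform_within_open[OF y(1) S(1) y(2) S(3)])
  qed
  moreover have "f x = g x" using S by auto
  ultimately show ?thesis unfolding C2_bounds_at_def
    using *(2-) by (intro exI[of _ f1] exI[of _ f2] conjI allI) auto
qed

lemma C2_bounds_at_nonneg:
  assumes "C2_bounds_at A B C (f :: 'a::euclidean_space \<Rightarrow> 'b::real_normed_vector) x"
  shows "A \<ge> 0" "B \<ge> 0" "C \<ge> 0"
proof -
  from assms obtain f1 f2 :: "'a \<Rightarrow> 'a \<Rightarrow> 'b" where *: "norm (f x) \<le> A"
    "\<And>v. norm (f1 x v) \<le> B * norm v" "\<And>v w. norm (f2 v w) \<le> C * norm v * norm w"
    unfolding C2_bounds_at_def by blast
  obtain b :: 'a where b: "norm b = 1" using vector_choose_size[of 1] by auto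
  show "A \<ge> 0" using *(1) norm_ge_zero order_trans by blast
  show "B \<ge> 0" using *(2)[of b] b norm_ge_zero[of "f1 x b"] by (metis mult.right_neutral order_trans)
  show "C \<ge> 0" using *(3)[of b b] b norm_ge_zero[of "f2 b b"] by (metis mult.right_neutral order_trans)
qed

lemma C2_bounds_at_const: "C2_bounds_at (norm c) 0 0 (\<lambda>x. c) x"
  unfolding C2_bounds_at_def by (intro exI[of _ "\<lambda>_ _. 0"]) auto

lemma C2_bounds_at_add:
  assumes "C2_bounds_at A B C f x" "C2_bounds_at A' B' C' g x"
  shows "C2_bounds_at (A + A') (B + B') (C + C') (\<lambda>x. f x + g x) x"
proof -
  from assms(1) obtain f1 f2 where f: "\<forall>\<^sub>F y in nhds x. (f has_derivative f1 y) (at y)"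
    "\<And>v. ((\<lambda>y. f1 y v) has_derivative f2 v) (at x)" "norm (f x) \<le> A"
    "\<And>v. norm (f1 x v) \<le> B * norm v" "\<And>v w. norm (f2 v w) \<le> C * norm v * norm w"
    unfolding C2_bounds_at_def by auto
  from assms(2) obtain g1 g2 where g: "\<forall>\<^sub>F y in nhds x. (g has_derivative g1 y) (at y)"
    "\<And>v. ((\<lambda>y. g1 y v) has_derivative g2 v) (at x)" "norm (g x) \<le> A'"
    "\<And>v. norm (g1 x v) \<le> B' * norm v" "\<And>v w. norm (g2 v w) \<le> C' * norm v * norm w"
    unfolding C2_bounds_at_def by auto
  show ?thesis unfolding C2_bounds_at_def
  proof (rule exI[of _ "\<lambda>y v. f1 y v + g1 y v"], rule exI[of _ "\<lambda>v w. f2 v w + g2 v w"], intro conjI allI)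
    show "\<forall>\<^sub>F y in nhds x. ((\<lambda>x. f x + g x) has_derivative (\<lambda>v. f1 y v + g1 y v)) (at y)"
      using f(1) g(1) by eventually_elim (rule has_derivative_add)
    show "((\<lambda>y. f1 y v + g1 y v) has_derivative (\<lambda>w. f2 v w + g2 v w)) (at x)" for v
      by (rule has_derivative_add[OF f(2) g(2)])
    show "norm (f x + g x) \<le> A + A'" using f(3) g(3) by norm
    show "norm (f1 x v + g1 x v) \<le> (B + B') * norm v" for v
      using norm_triangle_ineq[of "f1 x v" "g1 x v"] f(4)[of v] g(4)[of v] by (simp add: algebra_simps)
    show "norm (f2 v w + g2 v w) \<le> (C + C') * norm v * norm w" for v w
      using norm_triangle_ineq[of "f2 v w" "g2 v w"] f(5)[of v w] g(5)[of v w]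
      by (simp add: algebra_simps)
  qed
qed

lemma C2_bounds_at_prod:
  fixes f :: "'a::euclidean_space \<Rightarrow> 'b::real_normed_vector"
  assumes bil: "bounded_bilinear bp" and bp: "\<And>a b. norm (bp a b) \<le> norm a * norm b"
  assumes Fs: "C2_bounds_at A B C f x" and Gs: "C2_bounds_at A' B' C' g x"
  shows "C2_bounds_at (A * A') (A * B' + B * A') (A * C' + 2 * (B * B') + C * A') (\<lambda>x. bp (f x) (g x)) x"
proof -
  interpret bounded_bilinear bp by (rule bil)
  note nn = C2_bounds_at_nonneg[OF Fs] C2_bounds_at_nonneg[OF Gs]
  from Fs obtain f1 f2 where f: "\<forall>\<^sub>F y in nhds x. (f has_derivative f1 y) (at y)"
    "\<And>v. ((\<lambda>y. f1 y v) has_derivative f2 v) (at x)" "norm (f x) \<le> A"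
    "\<And>v. norm (f1 x v) \<le> B * norm v" "\<And>v w. norm (f2 v w) \<le> C * norm v * norm w"
    unfolding C2_bounds_at_def by auto
  from Gs obtain g1 g2 where g: "\<forall>\<^sub>F y in nhds x. (g has_derivative g1 y) (at y)"
    "\<And>v. ((\<lambda>y. g1 y v) has_derivative g2 v) (at x)" "norm (g x) \<le> A'"
    "\<And>v. norm (g1 x v) \<le> B' * norm v" "\<And>v w. norm (g2 v w) \<le> C' * norm v * norm w"
    unfolding C2_bounds_at_def by auto
  have bpm: "norm (bp a b) \<le> c * d" if "norm a \<le> c" "norm b \<le> d" for a b c d
    using bp[of a b] mult_mono[OF that] norm_ge_zero[of a] norm_ge_zero[of b] that(1) by linarith
  have f1x: "(f has_derivative f1 x) (at x)" using f(1) by (rule eventually_nhds_x_imp_x)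
  have g1x: "(g has_derivative g1 x) (at x)" using g(1) by (rule eventually_nhds_x_imp_x)
  show ?thesis unfolding C2_bounds_at_def
  proof (rule exI[of _ "\<lambda>y v. bp (f y) (g1 y v) + bp (f1 y v) (g y)"],
      rule exI[of _ "\<lambda>v w. (bp (f x) (g2 v w) + bp (f1 x w) (g1 x v)) + (bp (f1 x v) (g1 x w) + bp (f2 v w) (g x))"],
      intro conjI allI)
    show "\<forall>\<^sub>F y in nhds x. ((\<lambda>x. bp (f x) (g x)) has_derivative (\<lambda>v. bp (f y) (g1 y v) + bp (f1 y v) (g y))) (at y)"
      using f(1) g(1) by eventually_elim (rule FDERIV)
    show "((\<lambda>y. bp (f y) (g1 y v) + bp (f1 y v) (g y)) has_derivative
        (\<lambda>w. bp (f x) (g2 v w) + bp (f1 x w) (g1 x v) + (bp (f1 x v) (g1 x w) + bp (f2 v w) (g x)))) (at x)" for v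
      by (intro has_derivative_add FDERIV f1x g1x f(2) g(2))
    show "norm (bp (f x) (g x)) \<le> A * A'" by (rule bpm[OF f(3) g(3)])
    show "norm (bp (f x) (g1 x v) + bp (f1 x v) (g x)) \<le> (A * B' + B * A') * norm v" for v
      using norm_triangle_ineq[of "bp (f x) (g1 x v)" "bp (f1 x v) (g x)"]
        bpm[OF f(3) g(4)[of v]] bpm[OF f(4)[of v] g(3)] by (simp add: algebra_simps)
    show "norm (bp (f x) (g2 v w) + bp (f1 x w) (g1 x v) + (bp (f1 x v) (g1 x w) + bp (f2 v w) (g x)))
      \<le> (A * C' + 2 * (B * B') + C * A') * norm v * norm w" for v w
    proof -
      have "norm (bp (f x) (g2 v w) + bp (f1 x w) (g1 x v) + (bp (f1 x v) (g1 x w) + bp (f2 v w) (g x)))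
        \<le> norm (bp (f x) (g2 v w)) + norm (bp (f1 x w) (g1 x v)) + (norm (bp (f1 x v) (g1 x w)) + norm (bp (f2 v w) (g x)))"
        by (intro order_trans[OF norm_triangle_ineq] add_mono norm_triangle_ineq)
      then show ?thesis
        using bpm[OF f(3) g(5)[of v w]] bpm[OF f(4)[of w] g(4)[of v]] bpm[OF f(4)[of v] g(4)[of w]]
          bpm[OF f(5)[of v w] g(3)] by (simp add: algebra_simps)
    qed
  qed
qed

lemma C2_bounds_at_compose:
  fixes f :: "'a::euclidean_space \<Rightarrow> real" and \<phi> :: "real \<Rightarrow> real"
  assumes Fs: "C2_bounds_at A B C f x"
    and O: "open J" "f x \<in> J" "\<And>w. w \<in> J \<Longrightarrow> (\<phi> has_real_derivative \<phi>1 w) (at w)"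
    and d2: "(\<phi>1 has_real_derivative d) (at (f x))"
    and A': "\<bar>\<phi> (f x)\<bar> \<le> A'" and B': "\<bar>\<phi>1 (f x)\<bar> * B \<le> B'"
    and C': "\<bar>d\<bar> * B\<^sup>2 + \<bar>\<phi>1 (f x)\<bar> * C \<le> C'"
  shows "C2_bounds_at A' B' C' (\<lambda>y. \<phi> (f y)) x"
proof -
  from Fs obtain f1 f2 where f: "\<forall>\<^sub>F y in nhds x. (f has_derivative f1 y) (at y)"
    "\<And>v. ((\<lambda>y. f1 y v) has_derivative f2 v) (at x)" "norm (f x) \<le> A"
    "\<And>v. norm (f1 x v) \<le> B * norm v" "\<And>v w. norm (f2 v w) \<le> C * norm v * norm w"
    unfolding C2_bounds_at_def by auto
  have f1x: "(f has_derivative f1 x) (at x)" using f(1) by (rule eventually_nhds_x_imp_x)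
  have "isCont f x" by (rule has_derivative_continuous[OF f1x])
  then have evJ: "\<forall>\<^sub>F y in nhds x. f y \<in> J"
    using O(1,2) by (metis continuous_at_open eventually_nhds isCont_def tendsto_at_iff_tendsto_nhds topological_tendstoD)
  have comp: "((\<lambda>y. \<phi> (f y)) has_derivative (\<lambda>v. \<phi>1 (f y) * f1 y v)) (at y)"
    if "(f has_derivative f1 y) (at y)" "f y \<in> J" for y
    using has_derivative_compose[OF that(1), of \<phi> "\<lambda>h. \<phi>1 (f y) * h"] O(3)[OF that(2)]
    by (simp add: has_field_derivative_def)
  have comp1: "((\<lambda>y. \<phi>1 (f y)) has_derivative (\<lambda>v. d * f1 x v)) (at x)"
    using has_derivative_compose[OF f1x, of \<phi>1 "\<lambda>h. d * h"] d2
    by (simp add: has_field_derivative_def)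
  show ?thesis unfolding C2_bounds_at_def
  proof (rule exI[of _ "\<lambda>y v. \<phi>1 (f y) * f1 y v"],
      rule exI[of _ "\<lambda>v w. \<phi>1 (f x) * f2 v w + (d * f1 x w) * f1 x v"], intro conjI allI)
    show "\<forall>\<^sub>F y in nhds x. ((\<lambda>y. \<phi> (f y)) has_derivative (\<lambda>v. \<phi>1 (f y) * f1 y v)) (at y)"
      using f(1) evJ by eventually_elim (rule comp)
    show "((\<lambda>y. \<phi>1 (f y) * f1 y v) has_derivative (\<lambda>w. \<phi>1 (f x) * f2 v w + d * f1 x w * f1 x v)) (at x)" for v
      by (rule has_derivative_mult[OF comp1 f(2)])
    show "norm (\<phi> (f x)) \<le> A'" using A' by simp
    show "norm (\<phi>1 (f x) * f1 x v) \<le> B' * norm v" for v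
    proof -
      have "norm (\<phi>1 (f x) * f1 x v) \<le> \<bar>\<phi>1 (f x)\<bar> * (B * norm v)"
        using f(4)[of v] by (simp add: abs_mult mult_left_mono)
      also have "\<dots> \<le> B' * norm v" using B' by (simp add: mult_right_mono flip: mult.assoc)
      finally show ?thesis .
    qed
    show "norm (\<phi>1 (f x) * f2 v w + d * f1 x w * f1 x v) \<le> C' * norm v * norm w" for v w
    proof -
      have "\<bar>f1 x w\<bar> * \<bar>f1 x v\<bar> \<le> (B * norm w) * (B * norm v)"
        using f(4)[of v] f(4)[of w] by (intro mult_mono) (auto intro: order_trans[OF abs_ge_zero])
      then have "\<bar>d\<bar> * (\<bar>f1 x w\<bar> * \<bar>f1 x v\<bar>) \<le> \<bar>d\<bar> * ((B * norm w) * (B * norm v))"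
        by (rule mult_left_mono) simp
      moreover have "\<bar>\<phi>1 (f x)\<bar> * \<bar>f2 v w\<bar> \<le> \<bar>\<phi>1 (f x)\<bar> * (C * norm v * norm w)"
        using f(5)[of v w] by (intro mult_left_mono) auto
      moreover have "norm (\<phi>1 (f x) * f2 v w + d * f1 x w * f1 x v) \<le>
          \<bar>\<phi>1 (f x)\<bar> * \<bar>f2 v w\<bar> + \<bar>d\<bar> * (\<bar>f1 x w\<bar> * \<bar>f1 x v\<bar>)"
        by (simp add: abs_mult[symmetric] mult.assoc)
      moreover have "(\<bar>d\<bar> * B\<^sup>2 + \<bar>\<phi>1 (f x)\<bar> * C) * (norm v * norm w) \<le> C' * (norm v * norm w)"
        using C' by (intro mult_right_mono) auto
      ultimately show ?thesis by (simp add: algebra_simps power2_eq_square)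
    qed
  qed
qed

text \<open>The qualitative form, for estimates in which only boundedness is needed.\<close>

definition C2_bounded_on :: "'a::euclidean_space set \<Rightarrow> ('a \<Rightarrow> 'b::real_normed_vector) \<Rightarrow> bool" where
  "C2_bounded_on S f \<longleftrightarrow> (\<exists>K. \<forall>x\<in>S. C2_bounds_at K K K f x)"

lemma C2_bounded_onI:
  assumes "\<And>x. x \<in> S \<Longrightarrow> C2_bounds_at A B C f x" shows "C2_bounded_on S f"
  unfolding C2_bounded_on_def
  by (intro exI[of _ "max A (max B C)"] ballI C2_bounds_at_mono[OF assms]) auto

lemma C2_bounded_on_const: "C2_bounded_on S (\<lambda>x. c)"
  by (rule C2_bounded_onI[OF C2_bounds_at_const])

lemma C2_bounded_on_add:
  "C2_bounded_on S f \<Longrightarrow> C2_bounded_on S g \<Longrightarrow> C2_bounded_on S (\<lambda>x. f x + g x)"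
  unfolding C2_bounded_on_def using C2_bounds_at_add by blast

lemma C2_bounded_on_sum:
  "finite I \<Longrightarrow> (\<And>i. i \<in> I \<Longrightarrow> C2_bounded_on S (f i)) \<Longrightarrow> C2_bounded_on S (\<lambda>x. \<Sum>i\<in>I. f i x)"
  by (induction I rule: finite_induct) (simp_all add: C2_bounded_on_const C2_bounded_on_add)

lemma C2_bounded_on_prod:
  assumes "bounded_bilinear bp" "\<And>a b. norm (bp a b) \<le> norm a * norm b"
    "C2_bounded_on S f" "C2_bounded_on S g"
  shows "C2_bounded_on S (\<lambda>x. bp (f x) (g x))"
proof -
  obtain K K' where "\<And>x. x \<in> S \<Longrightarrow> C2_bounds_at K K K f x" "\<And>x. x \<in> S \<Longrightarrow> C2_bounds_at K' K' K' g x"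
    using assms(3,4) unfolding C2_bounded_on_def by auto
  then show ?thesis
    using C2_bounds_at_prod[OF assms(1,2)] by (intro C2_bounded_onI) blast
qed

lemma C2_bounded_on_scaleR:
  "C2_bounded_on S f \<Longrightarrow> C2_bounded_on S g \<Longrightarrow> C2_bounded_on S (\<lambda>x. f x *\<^sub>R g x)"
  by (rule C2_bounded_on_prod[OF bounded_bilinear_scaleR]) auto

lemma C2_bounded_on_inner:
  "C2_bounded_on S f \<Longrightarrow> C2_bounded_on S g \<Longrightarrow> C2_bounded_on S (\<lambda>x. f x \<bullet> g x)"
  by (rule C2_bounded_on_prod[OF bounded_bilinear_inner]) (auto simp: Cauchy_Schwarz_ineq2)

lemma C2_bounded_on_compose:
  fixes f :: "'a::euclidean_space \<Rightarrow> real" and \<phi> :: "real \<Rightarrow> real"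
  assumes f: "C2_bounded_on S f" and J: "open J" "f ` S \<subseteq> I" "I \<subseteq> J" "compact I"
    and d1: "\<And>w. w \<in> J \<Longrightarrow> (\<phi> has_real_derivative \<phi>1 w) (at w)"
    and d2: "\<And>w. w \<in> J \<Longrightarrow> (\<phi>1 has_real_derivative \<phi>2 w) (at w)"
    and c2: "continuous_on I \<phi>2"
  shows "C2_bounded_on S (\<lambda>x. \<phi> (f x))"
proof -
  obtain K where K: "\<And>x. x \<in> S \<Longrightarrow> C2_bounds_at K K K f x"
    using f unfolding C2_bounded_on_def by auto
  have "continuous_on I \<phi>" "continuous_on I \<phi>1"
    using d1 d2 J(3) by (meson DERIV_continuous continuous_at_imp_continuous_on subsetD)+
  then have "bounded (\<phi> ` I)" "bounded (\<phi>1 ` I)" "bounded (\<phi>2 ` I)"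
    using J(4) c2 by (meson compact_continuous_image compact_imp_bounded)+
  then have "\<exists>M. \<forall>w\<in>I. \<bar>\<phi> w\<bar> \<le> M" "\<exists>M. \<forall>w\<in>I. \<bar>\<phi>1 w\<bar> \<le> M" "\<exists>M. \<forall>w\<in>I. \<bar>\<phi>2 w\<bar> \<le> M"
    unfolding bounded_iff by auto
  then obtain M0 M1 M2 where M: "\<And>w. w \<in> I \<Longrightarrow> \<bar>\<phi> w\<bar> \<le> M0" "\<And>w. w \<in> I \<Longrightarrow> \<bar>\<phi>1 w\<bar> \<le> M1"
    "\<And>w. w \<in> I \<Longrightarrow> \<bar>\<phi>2 w\<bar> \<le> M2"
    by metis
  show ?thesis
  proof (rule C2_bounded_onI)
    fix x assume x: "x \<in> S"
    then have fx: "f x \<in> I" "f x \<in> J" using J by auto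
    note nn = C2_bounds_at_nonneg[OF K[OF x]]
    show "C2_bounds_at M0 (M1 * K) (M2 * K\<^sup>2 + M1 * K) (\<lambda>x. \<phi> (f x)) x"
      by (rule C2_bounds_at_compose[OF K[OF x] J(1) fx(2) d1 d2[OF fx(2)]])
         (use M(1)[OF fx(1)] M(2)[OF fx(1)] M(3)[OF fx(1)] nn in \<open>auto intro!: add_mono mult_right_mono\<close>)
  qed
qed

lemma C2_bounds_at_continuous:
  "C2_bounds_at A B C f x \<Longrightarrow> isCont f x"
  unfolding C2_bounds_at_def
  by (metis eventually_nhds_x_imp_x has_derivative_continuous)

lemma C2_bounded_on_continuous: "C2_bounded_on S f \<Longrightarrow> continuous_on S f"
  unfolding C2_bounded_on_def
  by (meson C2_bounds_at_continuous continuous_at_imp_continuous_on)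

lemma C2_bounds_at_lipschitz:
  fixes f :: "'a::euclidean_space \<Rightarrow> 'b::real_normed_vector"
  assumes "convex S" "\<And>x. x \<in> S \<Longrightarrow> C2_bounds_at A B C f x" "x \<in> S" "y \<in> S"
  shows "norm (f x - f y) \<le> B * norm (x - y)"
proof -
  have "\<forall>x\<in>S. \<exists>f'. (f has_derivative f') (at x) \<and> (\<forall>v. norm (f' v) \<le> B * norm v)"
    using assms(2) unfolding C2_bounds_at_def by (metis eventually_nhds_x_imp_x)
  then obtain f' where f': "\<And>x. x \<in> S \<Longrightarrow> (f has_derivative f' x) (at x)"
    "\<And>x v. x \<in> S \<Longrightarrow> norm (f' x v) \<le> B * norm v" by metis
  show ?thesis
    by (rule differentiable_bound[OF assms(1) has_derivative_at_withinI[OF f'(1)] _ assms(3,4)])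
       (auto intro!: onorm_le f'(2))
qed

text \<open>Powers of the positive part supply cut-off functions: the cube is twice continuously differentiable.\<close>

lemma has_real_derivative_pos_part_power:
  "((\<lambda>t. (max 0 t) ^ Suc (Suc n)) has_real_derivative real (Suc (Suc n)) * (max 0 t) ^ Suc n) (at t)"
proof -
  consider "t < 0" | "t > 0" | "t = 0" by linarith
  then show ?thesis
  proof cases
    case 1
    have "((\<lambda>t. 0) has_real_derivative 0) (at t)" by simp
    then have "((\<lambda>t. (max 0 t) ^ Suc (Suc n)) has_real_derivative 0) (at t)"
      by (rule has_field_derivative_transform_within_open[of _ _ _ "{..<0}"]) (use 1 in auto)
    then show ?thesis using 1 by simp
  next
    case 2
    have "((\<lambda>t. t ^ Suc (Suc n)) has_real_derivative real (Suc (Suc n)) * t ^ Suc n) (at t)"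
      using DERIV_pow[of "Suc (Suc n)" t] by simp
    then have "((\<lambda>t. (max 0 t) ^ Suc (Suc n)) has_real_derivative real (Suc (Suc n)) * t ^ Suc n) (at t)"
      by (rule has_field_derivative_transform_within_open[of _ _ _ "{0<..}"]) (use 2 in auto)
    then show ?thesis using 2 by simp
  next
    case 3
    have "((\<lambda>h::real. max 0 h ^ Suc (Suc n) / h) \<longlongrightarrow> 0) (at 0)"
    proof (rule Lim_null_comparison)
      show "\<forall>\<^sub>F h::real in at 0. norm (max 0 h ^ Suc (Suc n) / h) \<le> \<bar>h\<bar> ^ Suc n"
        by (intro always_eventually allI) (auto simp: max_def abs_mult intro!: mult_nonpos_nonneg)
      show "((\<lambda>h::real. \<bar>h\<bar> ^ Suc n) \<longlongrightarrow> 0) (at 0)" by (auto intro!: tendsto_eq_intros)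
    qed
    then show ?thesis using 3 by (simp add: DERIV_def)
  qed
qed

section \<open>The diffusion matrix of the anisotropy\<close>

lemma dderiv_UNIV: "x \<noteq> 0 \<Longrightarrow> dderiv UNIV f v x = dderiv (- {0}) f v x"
  by (simp add: dderiv_def at_within_open[of x "- {0}"] open_delete[of UNIV, simplified Compl_eq_Diff_UNIV[symmetric]])

lemma open_Compl_0: "open (- {0::'a::real_normed_vector})"
  by auto

locale smooth_anisotropy =
  fixes F :: "(real^'n) \<times> real \<Rightarrow> real"
  assumes smooth: "smooth_fun_on (- {0}) F"
begin

lemma Ck: "Ck_on k (- {0}) F"
  using smooth by (simp add: smooth_fun_on_def)

lemma hess_punctured:
  assumes "p \<noteq> 0"
  shows "hess UNIV F p a b = dderiv (- {0}) (dderiv (- {0}) F a) b p"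
  unfolding hess_def dderiv_UNIV[OF assms]
  by (rule dderiv_cong_open[OF open_Compl_0]) (use assms in \<open>auto simp: dderiv_UNIV\<close>)

lemma hess_symmetric: "p \<noteq> 0 \<Longrightarrow> hess UNIV F p a b = hess UNIV F p b a"
  unfolding hess_punctured by (rule second_dderiv_symmetric[OF open_Compl_0 _ Ck]) auto

lemma hess_linear: "p \<noteq> 0 \<Longrightarrow> linear (hess UNIV F p a)"
proof -
  assume p: "p \<noteq> 0"
  have "dderiv (- {0}) F a differentiable (at p within - {0})"
    by (rule Ck_on_differentiable[OF Ck_on_dderiv[OF Ck[of "Suc (Suc 0)"]]]) (use p in auto)
  from dderiv_linear[OF this] show ?thesis
    by (simp add: hess_punctured[OF p, abs_def])
qed

lemma aniso_tau_symmetric: "aniso_tau F q v w = aniso_tau F q w v"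
  unfolding aniso_tau_def by (subst hess_symmetric) (auto simp: zero_prod_def)

lemma aniso_tau_linear: "linear (aniso_tau F q v)"
proof -
  interpret linear "hess UNIV F (q, -1) (v, 0)" by (rule hess_linear) (simp add: zero_prod_def)
  have "(a + b, 0::real) = (a, 0) + (b, 0)" "(r *\<^sub>R a, 0::real) = r *\<^sub>R (a, 0)" for a b :: "real^'n" and r
    by auto
  then show ?thesis unfolding aniso_tau_def
    by (intro linearI) (simp_all only: add scale, simp_all add: algebra_simps)
qed

lemma aniso_tau_bilinear: "bilinear (aniso_tau F q)"
proof -
  have "(\<lambda>x. aniso_tau F q x y) = aniso_tau F q y" for y
    by (rule ext) (rule aniso_tau_symmetric)
  then show ?thesis by (simp add: bilinear_def aniso_tau_linear)
qed

lemmas aniso_tau_simps =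
  bilinear_ladd[OF aniso_tau_bilinear] bilinear_radd[OF aniso_tau_bilinear]
  bilinear_lmul[OF aniso_tau_bilinear] bilinear_rmul[OF aniso_tau_bilinear]
  bilinear_lsub[OF aniso_tau_bilinear] bilinear_rsub[OF aniso_tau_bilinear]
  bilinear_lneg[OF aniso_tau_bilinear] bilinear_rneg[OF aniso_tau_bilinear]
  bilinear_lzero[OF aniso_tau_bilinear] bilinear_rzero[OF aniso_tau_bilinear]

lemma aniso_tau_expand:
  "aniso_tau F q v w = (\<Sum>i\<in>UNIV. \<Sum>j\<in>UNIV. aniso_tau F q (axis i 1) (axis j 1) * v $ i * w $ j)"
proof -
  have "aniso_tau F q v w = aniso_tau F q (\<Sum>i\<in>UNIV. v $ i *\<^sub>R axis i 1) (\<Sum>j\<in>UNIV. w $ j *\<^sub>R axis j 1)"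
    by (simp add: basis_expansion scalar_mult_eq_scaleR[symmetric])
  also have "\<dots> = (\<Sum>i\<in>UNIV. \<Sum>j\<in>UNIV. aniso_tau F q (v $ i *\<^sub>R axis i 1) (w $ j *\<^sub>R axis j 1))"
    by (simp add: bilinear_sum[OF aniso_tau_bilinear] sum.cartesian_product)
  finally show ?thesis by (simp add: aniso_tau_simps mult_ac)
qed

definition hess_comp :: "'n \<Rightarrow> 'n \<Rightarrow> (real^'n) \<times> real \<Rightarrow> real" where
  "hess_comp i j p = norm p * hess UNIV F p (axis i 1, 0) (axis j 1, 0)"

lemma hess_differentiable:
  assumes "p \<noteq> 0"
  shows "(\<lambda>p. hess UNIV F p a b) differentiable (at p)"
proof -
  have "dderiv (- {0}) (dderiv (- {0}) F a) b differentiable (at p)"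
    using Ck_on_differentiable[OF Ck_on_dderiv[OF Ck_on_dderiv[OF Ck[of "Suc (Suc (Suc 0))"]]], of p]
      assms at_within_open[of p "- {0}", OF _ open_Compl_0] by auto
  then obtain D where "(dderiv (- {0}) (dderiv (- {0}) F a) b has_derivative D) (at p)"
    unfolding differentiable_def by blast
  from has_derivative_transform_within_open[OF this open_Compl_0, of "\<lambda>p. hess UNIV F p a b"]
  have "((\<lambda>p. hess UNIV F p a b) has_derivative D) (at p)"
    using assms by (simp add: hess_punctured)
  then show ?thesis by (rule differentiableI)
qed

lemma hess_comp_has_derivative:
  assumes "p \<noteq> 0"
  shows "(hess_comp i j has_derivative (\<lambda>v. dderiv UNIV (hess_comp i j) v p)) (at p)"
    and "dderiv UNIV (hess_comp i j) v p = (p \<bullet> v / norm p) * hess UNIV F p (axis i 1, 0) (axis j 1, 0)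
      + norm p * dderiv UNIV (\<lambda>p. hess UNIV F p (axis i 1, 0) (axis j 1, 0)) v p"
proof -
  let ?h = "\<lambda>p. hess UNIV F p (axis i 1, 0) (axis j 1, 0)"
  have h: "(?h has_derivative (\<lambda>v. dderiv UNIV ?h v p)) (at p)"
    by (rule differentiable_has_dderiv[OF hess_differentiable[OF assms]])
  have *: "(hess_comp i j has_derivative
     (\<lambda>v. norm p * dderiv UNIV ?h v p + (v \<bullet> sgn p) * ?h p)) (at p)"
    unfolding hess_comp_def
    by (rule has_derivative_mult[OF has_derivative_norm[OF assms] h])
  then show "(hess_comp i j has_derivative (\<lambda>v. dderiv UNIV (hess_comp i j) v p)) (at p)"
    by (intro differentiable_has_dderiv) (auto simp: differentiable_def)
  show "dderiv UNIV (hess_comp i j) v p = (p \<bullet> v / norm p) * ?h p + norm p * dderiv UNIV ?h v p"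
    using dderiv_eq[OF * open_UNIV, of v] by (simp add: sgn_div_norm inner_commute divide_inverse)
qed

lemma T3_comp_has_derivative:
  "((\<lambda>q. aniso_tau F q (axis i 1) (axis j 1)) has_derivative
     (\<lambda>c. - (\<Sum>l\<in>UNIV. aniso_T3_comp F q i j l * c $ l))) (at q)"
proof -
  have nz: "(q, -1::real) \<noteq> 0" by (simp add: zero_prod_def)
  have d: "(hess_comp i j has_derivative (\<lambda>v. dderiv UNIV (hess_comp i j) v (q, -1))) (at (q, -1))"
    by (rule hess_comp_has_derivative(1)[OF nz])
  have "((\<lambda>q. (q, -1::real)) has_derivative (\<lambda>c. (c, 0))) (at q)"
    by (auto intro!: derivative_eq_intros)
  from has_derivative_compose[OF this d]
  have "((\<lambda>q. hess_comp i j (q, -1)) has_derivative (\<lambda>c. dderiv UNIV (hess_comp i j) (c, 0) (q, -1))) (at q)" .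
  moreover have "dderiv UNIV (hess_comp i j) (c, 0) (q, -1) = - (\<Sum>l\<in>UNIV. aniso_T3_comp F q i j l * c $ l)" for c
  proof -
    interpret linear "\<lambda>v. dderiv UNIV (hess_comp i j) v (q, -1)"
      by (rule has_derivative_linear[OF d])
    have "(c, 0::real) = (\<Sum>l\<in>UNIV. c $ l *\<^sub>R (axis l 1, 0))"
      by (rule prod_eqI) (simp_all add: fst_sum snd_sum basis_expansion scalar_mult_eq_scaleR[symmetric])
    then have "dderiv UNIV (hess_comp i j) (c, 0) (q, -1) =
        (\<Sum>l\<in>UNIV. c $ l * dderiv UNIV (hess_comp i j) (axis l 1, 0) (q, -1))"
      by (simp add: sum scale del: scaleR_Pair)
    then show ?thesis
      by (simp add: aniso_T3_comp_def hess_comp_def[abs_def] mult.commute sum_negf)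
  qed
  ultimately show ?thesis
    by (simp add: aniso_tau_def hess_comp_def)
qed

text \<open>The derivative of the diffusion matrix in its base point is minus the tensor \<open>T\<^sup>3\<close>, so bounds on \<open>T\<^sup>3\<close> become
Lipschitz bounds along curves once moving frame vectors are taken into account.\<close>

lemma aniso_tau_along_path:
  assumes p: "(p has_vector_derivative p') (at s)"
    and v: "(v has_vector_derivative v') (at s)" and w: "(w has_vector_derivative w') (at s)"
  shows "((\<lambda>s. aniso_tau F (p s) (v s) (w s)) has_real_derivative
     (- aniso_T3 F (p s) (v s) (w s) p' + aniso_tau F (p s) v' (w s) + aniso_tau F (p s) (v s) w')) (at s)"
proof -
  have comp: "((\<lambda>s. f s $ i) has_real_derivative f' $ i) (at s)"
    if "(f has_vector_derivative f') (at s)" for f :: "real \<Rightarrow> real^'n" and f' i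
    using bounded_linear.has_vector_derivative[OF bounded_linear_vec_nth that]
    by (simp add: has_real_derivative_iff_has_vector_derivative)
  have tau: "((\<lambda>s. aniso_tau F (p s) (axis i 1) (axis j 1)) has_real_derivative
      - (\<Sum>l\<in>UNIV. aniso_T3_comp F (p s) i j l * p' $ l)) (at s)" for i j
  proof -
    have "((\<lambda>s. aniso_tau F (p s) (axis i 1) (axis j 1)) has_derivative
        (\<lambda>h. - (\<Sum>l\<in>UNIV. aniso_T3_comp F (p s) i j l * (h *\<^sub>R p') $ l))) (at s)"
      using p unfolding has_vector_derivative_def
      by (rule has_derivative_compose[OF _ T3_comp_has_derivative])
    moreover have "- (\<Sum>l\<in>UNIV. aniso_T3_comp F (p s) i j l * (h *\<^sub>R p') $ l) =
        (- (\<Sum>l\<in>UNIV. aniso_T3_comp F (p s) i j l * p' $ l)) * h" for h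
      by (simp add: sum_distrib_left sum_distrib_right mult_ac)
    ultimately show ?thesis by (simp only: has_field_derivative_def)
  qed
  have "((\<lambda>s. \<Sum>i\<in>UNIV. \<Sum>j\<in>UNIV. aniso_tau F (p s) (axis i 1) (axis j 1) * v s $ i * w s $ j) has_real_derivative
     (\<Sum>i\<in>UNIV. \<Sum>j\<in>UNIV.
        ((- (\<Sum>l\<in>UNIV. aniso_T3_comp F (p s) i j l * p' $ l)) * v s $ i +
          v' $ i * aniso_tau F (p s) (axis i 1) (axis j 1)) * w s $ j +
        w' $ j * (aniso_tau F (p s) (axis i 1) (axis j 1) * v s $ i))) (at s)"
    by (intro DERIV_sum DERIV_mult tau comp v w)
  moreover have "(\<lambda>s. \<Sum>i\<in>UNIV. \<Sum>j\<in>UNIV. aniso_tau F (p s) (axis i 1) (axis j 1) * v s $ i * w s $ j)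
      = (\<lambda>s. aniso_tau F (p s) (v s) (w s))"
    by (rule ext) (rule aniso_tau_expand[symmetric])
  moreover have "(\<Sum>i\<in>UNIV. \<Sum>j\<in>UNIV.
        ((- (\<Sum>l\<in>UNIV. aniso_T3_comp F (p s) i j l * p' $ l)) * v s $ i +
          v' $ i * aniso_tau F (p s) (axis i 1) (axis j 1)) * w s $ j +
        w' $ j * (aniso_tau F (p s) (axis i 1) (axis j 1) * v s $ i))
     = - aniso_T3 F (p s) (v s) (w s) p' + aniso_tau F (p s) v' (w s) + aniso_tau F (p s) (v s) w'"
    unfolding aniso_T3_def aniso_tau_expand[of "p s" v' "w s"] aniso_tau_expand[of "p s" "v s" w']
    by (simp add: algebra_simps sum.distrib sum_negf sum_distrib_left sum_distrib_right sum_subtractf)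
  ultimately show ?thesis by simp
qed

lemma T3_comp_symmetric: "aniso_T3_comp F q i j l = aniso_T3_comp F q j i l"
proof -
  have "dderiv UNIV (\<lambda>p. norm p * hess UNIV F p (axis i 1, 0) (axis j 1, 0)) v (q, -1) =
    dderiv UNIV (\<lambda>p. norm p * hess UNIV F p (axis j 1, 0) (axis i 1, 0)) v (q, -1)" for v
    by (rule dderiv_cong_open[OF open_Compl_0]) (auto simp: zero_prod_def hess_symmetric)
  then show ?thesis by (simp add: aniso_T3_comp_def)
qed

text \<open>Third derivatives of \<open>F\<close> are symmetric in all slots.  Hence \<open>T\<^sup>3\<close> fails to be symmetric in its last two slots only
through the derivative of the factor \<open>\<bar>p\<bar>\<close>.\<close>

lemma T3_comp_swap:
  "aniso_T3_comp F q i j l - aniso_T3_comp F q i l j =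
    (q $ j * aniso_tau F q (axis i 1) (axis l 1) - q $ l * aniso_tau F q (axis i 1) (axis j 1)) / (norm (q, -1::real))\<^sup>2"
proof -
  let ?p = "(q, -1::real)" and ?e = "\<lambda>i. (axis i 1 :: real^'n, 0::real)"
  have nz: "?p \<noteq> 0" by (simp add: zero_prod_def)
  have np: "norm ?p > 0" using nz by simp
  have T: "aniso_T3_comp F q i j l = - ((q $ l / norm ?p) * hess UNIV F ?p (?e i) (?e j)
      + norm ?p * dderiv UNIV (\<lambda>p. hess UNIV F p (?e i) (?e j)) (?e l) ?p)" for i j l
    using hess_comp_has_derivative(2)[OF nz, of i j "?e l"]
    by (simp add: aniso_T3_comp_def hess_comp_def[abs_def] inner_axis)
  have D3: "dderiv UNIV (\<lambda>p. hess UNIV F p (?e i) b) c ?p = dderiv (- {0}) (dderiv (- {0}) (dderiv (- {0}) F (?e i)) b) c ?p" for b c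
    unfolding dderiv_UNIV[OF nz]
    by (rule dderiv_cong_open[OF open_Compl_0]) (use nz in \<open>auto simp: hess_punctured\<close>)
  have "Ck_on 2 (- {0}) (dderiv (- {0}) F (?e i))"
    using Ck_on_dderiv[OF Ck[of "Suc 2"]] .
  then have "dderiv UNIV (\<lambda>p. hess UNIV F p (?e i) (?e j)) (?e l) ?p =
      dderiv UNIV (\<lambda>p. hess UNIV F p (?e i) (?e l)) (?e j) ?p"
    unfolding D3 using second_dderiv_symmetric[OF open_Compl_0] nz by auto
  then show ?thesis
    unfolding T aniso_tau_def using np by (simp add: field_simps power2_eq_square)
qed

lemma aniso_T3_symmetric: "aniso_T3 F q a b c = aniso_T3 F q b a c"
  unfolding aniso_T3_def
  by (subst sum.swap) (simp add: T3_comp_symmetric mult_ac)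

lemma aniso_T3_swap:
  "aniso_T3 F q a b c - aniso_T3 F q a c b =
    ((q \<bullet> b) * aniso_tau F q a c - (q \<bullet> c) * aniso_tau F q a b) / (norm (q, -1::real))\<^sup>2"
proof -
  let ?N = "(norm (q, -1::real))\<^sup>2" and ?t = "\<lambda>i j. aniso_tau F q (axis i 1) (axis j 1)"
  have "aniso_T3 F q a c b = (\<Sum>i\<in>UNIV. \<Sum>l\<in>UNIV. \<Sum>j\<in>UNIV. aniso_T3_comp F q i l j * a $ i * c $ l * b $ j)"
    by (simp add: aniso_T3_def)
  also have "\<dots> = (\<Sum>i\<in>UNIV. \<Sum>j\<in>UNIV. \<Sum>l\<in>UNIV. aniso_T3_comp F q i l j * a $ i * c $ l * b $ j)"
    by (intro sum.cong refl sum.swap)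
  finally have "aniso_T3 F q a b c - aniso_T3 F q a c b =
      (\<Sum>i\<in>UNIV. \<Sum>j\<in>UNIV. \<Sum>l\<in>UNIV. (aniso_T3_comp F q i j l - aniso_T3_comp F q i l j) * (a $ i * b $ j * c $ l))"
    by (simp add: aniso_T3_def sum_subtractf[symmetric] algebra_simps)
  also have "\<dots> = (\<Sum>i\<in>UNIV. \<Sum>j\<in>UNIV. \<Sum>l\<in>UNIV.
      (q $ j * b $ j) * (?t i l * a $ i * c $ l) - (q $ l * c $ l) * (?t i j * a $ i * b $ j)) / ?N"
    unfolding T3_comp_swap by (simp add: sum_divide_distrib algebra_simps diff_divide_distrib)
  also have "(\<Sum>i\<in>UNIV. \<Sum>j\<in>UNIV. \<Sum>l\<in>UNIV.
      (q $ j * b $ j) * (?t i l * a $ i * c $ l) - (q $ l * c $ l) * (?t i j * a $ i * b $ j)) =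
      (\<Sum>i\<in>UNIV. (q \<bullet> b) * (\<Sum>l\<in>UNIV. ?t i l * a $ i * c $ l) - (q \<bullet> c) * (\<Sum>j\<in>UNIV. ?t i j * a $ i * b $ j))"
  proof (intro sum.cong refl)
    fix i
    have "(\<Sum>j\<in>UNIV. \<Sum>l\<in>UNIV. (q $ j * b $ j) * (?t i l * a $ i * c $ l)) =
        (q \<bullet> b) * (\<Sum>l\<in>UNIV. ?t i l * a $ i * c $ l)"
      by (simp add: inner_vec_def sum_product)
    moreover have "(\<Sum>j\<in>UNIV. \<Sum>l\<in>UNIV. (q $ l * c $ l) * (?t i j * a $ i * b $ j)) =
        (q \<bullet> c) * (\<Sum>j\<in>UNIV. ?t i j * a $ i * b $ j)"
      by (subst sum.swap) (simp add: inner_vec_def sum_product)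
    ultimately show "(\<Sum>j\<in>UNIV. \<Sum>l\<in>UNIV.
      (q $ j * b $ j) * (?t i l * a $ i * c $ l) - (q $ l * c $ l) * (?t i j * a $ i * b $ j)) =
      (q \<bullet> b) * (\<Sum>l\<in>UNIV. ?t i l * a $ i * c $ l) - (q \<bullet> c) * (\<Sum>j\<in>UNIV. ?t i j * a $ i * b $ j)"
      by (simp only: sum_subtractf)
  qed
  also have "\<dots> = (q \<bullet> b) * aniso_tau F q a c - (q \<bullet> c) * aniso_tau F q a b"
    by (simp add: aniso_tau_expand[of q a] sum_subtractf sum_distrib_left)
  finally show ?thesis .
qed

lemma aniso_T3_add:
  "aniso_T3 F q (a + a') b c = aniso_T3 F q a b c + aniso_T3 F q a' b c"
  "aniso_T3 F q a (b + b') c = aniso_T3 F q a b c + aniso_T3 F q a b' c"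
  "aniso_T3 F q a b (c + c') = aniso_T3 F q a b c + aniso_T3 F q a b c'"
  by (simp_all add: aniso_T3_def algebra_simps sum.distrib)

lemma aniso_T3_scale:
  "aniso_T3 F q (r *\<^sub>R a) b c = r * aniso_T3 F q a b c"
  "aniso_T3 F q a (r *\<^sub>R b) c = r * aniso_T3 F q a b c"
  "aniso_T3 F q a b (r *\<^sub>R c) = r * aniso_T3 F q a b c"
  by (simp_all add: aniso_T3_def sum_distrib_left mult_ac)

lemma aniso_T3_diff:
  "aniso_T3 F q (a - a') b c = aniso_T3 F q a b c - aniso_T3 F q a' b c"
  "aniso_T3 F q a (b - b') c = aniso_T3 F q a b c - aniso_T3 F q a b' c"
  "aniso_T3 F q a b (c - c') = aniso_T3 F q a b c - aniso_T3 F q a b c'"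
  by (simp_all add: aniso_T3_def algebra_simps sum_subtractf)

end

section \<open>Adapted frames and the third-order bounds\<close>

text \<open>Rotation by the angle \<open>s\<close> in the plane of the \<open>a\<close>-th and \<open>b\<close>-th frame vectors, turning the \<open>b\<close>-th towards the \<open>a\<close>-th.\<close>

definition rotate_frame :: "(nat \<Rightarrow> real^'n) \<Rightarrow> nat \<Rightarrow> nat \<Rightarrow> real \<Rightarrow> nat \<Rightarrow> real^'n" where
  "rotate_frame \<phi> a b s i =
     (if i = a then cos s *\<^sub>R \<phi> a - sin s *\<^sub>R \<phi> b
      else if i = b then cos s *\<^sub>R \<phi> b + sin s *\<^sub>R \<phi> a else \<phi> i)"

lemma orthonormal_rotate_frame:
  fixes \<phi> :: "nat \<Rightarrow> real^'n"
  assumes on: "orthonormal_frame \<phi>" and a: "a \<in> {1..CARD('n)}" and b: "b \<in> {1..CARD('n)}" and ab: "a \<noteq> b"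
  shows "orthonormal_frame (rotate_frame \<phi> a b s)"
proof -
  have o: "\<phi> i \<bullet> \<phi> j = (if i = j then 1 else 0)" if "i \<in> {1..CARD('n)}" "j \<in> {1..CARD('n)}" for i j
    using on that unfolding orthonormal_frame_def by blast
  have cs: "cos s * cos s + sin s * sin s = 1" "sin s * sin s + cos s * cos s = 1"
    using sin_cos_squared_add3[of s] by (auto simp: algebra_simps)
  show ?thesis unfolding orthonormal_frame_def
  proof (intro ballI)
    fix i j assume ij: "i \<in> {1..CARD('n)}" "j \<in> {1..CARD('n)}"
    show "rotate_frame \<phi> a b s i \<bullet> rotate_frame \<phi> a b s j = (if i = j then 1 else 0)"
      using o[OF a a] o[OF a b] o[OF b a] o[OF b b] o[OF a ij(1)] o[OF b ij(1)] o[OF a ij(2)] o[OF b ij(2)]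
        o[OF ij] o[OF ij(1) a] o[OF ij(1) b] o[OF ij(2) a] o[OF ij(2) b] ab cs
      by (auto simp: rotate_frame_def inner_simps)
  qed
qed

lemma frame_with_two_vectors:
  fixes u e :: "real^'n"
  assumes n: "CARD('n) \<ge> 2" and u: "norm u = 1" and e: "norm e = 1" and ue: "u \<bullet> e = 0"
  obtains \<phi> where "orthonormal_frame \<phi>" "\<phi> (CARD('n)) = u" "\<phi> 1 = e"
proof -
  have une: "u \<noteq> e" using u ue by (auto simp: norm_eq_1)
  have po: "pairwise orthogonal {u, e}"
    using ue by (auto simp: pairwise_def orthogonal_def inner_commute)
  obtain U where U: "U \<inter> (insert 0 {u, e}) = {}" "pairwise orthogonal ({u, e} \<union> U)" "span ({u, e} \<union> U) = span ({u, e} \<union> UNIV)"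
    using orthogonal_extension_strong[OF po, of UNIV] by metis
  define g where "g = (\<lambda>x::real^'n. x /\<^sub>R norm x)"
  define V where "V = {u, e} \<union> U"
  have V0: "0 \<notin> V" using U(1) u e by (auto simp: V_def)
  have gV: "g u = u" "g e = e" using u e by (auto simp: g_def)
  have indV: "independent V" using U(2) V0 by (simp add: V_def pairwise_orthogonal_independent)
  have finV: "finite V" using indV independent_imp_finite by blast
  have "span V = UNIV" using U(3) by (simp add: V_def)
  then have "dim V = DIM(real^'n)" using dim_eq_full by blast
  then have cardV: "card V = CARD('n)" using indV by (simp add: dim_eq_card_independent)
  have "card (V - {u, e}) = CARD('n) - 2"
    using cardV une card_Diff_subset[of "{u, e}" V] by (simp add: V_def)
  then have "card (V - {u, e}) = card {2..<CARD('n)}" by simp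
  then obtain h where h: "bij_betw h {2..<CARD('n)} (V - {u, e})"
    using finV by (metis finite_Diff finite_atLeastLessThan finite_same_card_bij)
  define \<psi> where "\<psi> i = (if i = 1 then e else if i = CARD('n) then u else h i)" for i
  have h': "h i \<in> V - {u, e}" if "i \<in> {1..CARD('n)}" "i \<noteq> 1" "i \<noteq> CARD('n)" for i
    using bij_betwE[OF h] that by auto
  have inj: "i = j" if "i \<in> {1..CARD('n)}" "j \<in> {1..CARD('n)}" "\<psi> i = \<psi> j" for i j
  proof -
    have "h i = h j \<Longrightarrow> i = j" if "i \<noteq> 1" "i \<noteq> CARD('n)" "j \<noteq> 1" "j \<noteq> CARD('n)"
      using h that \<open>i \<in> _\<close> \<open>j \<in> _\<close> unfolding bij_betw_def inj_on_def by auto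
    then show ?thesis
      using that h'[of i] h'[of j] une n by (auto simp: \<psi>_def split: if_splits)
  qed
  have inV: "\<psi> i \<in> V" if "i \<in> {1..CARD('n)}" for i
    using h'[OF that] by (auto simp: \<psi>_def V_def)
  define \<phi> where "\<phi> i = g (\<psi> i)" for i
  have "orthonormal_frame \<phi>" unfolding orthonormal_frame_def
  proof (intro ballI)
    fix i j assume ij: "i \<in> {1..CARD('n)}" "j \<in> {1..CARD('n)}"
    show "\<phi> i \<bullet> \<phi> j = (if i = j then 1 else 0)"
    proof (cases "i = j")
      case True
      have "\<psi> i \<noteq> 0" using inV[OF ij(1)] V0 by metis
      then show ?thesis using True by (simp add: \<phi>_def g_def dot_square_norm power2_eq_square)
    next
      case False
      then have "\<psi> i \<noteq> \<psi> j" using inj ij by blast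
      then have "\<psi> i \<bullet> \<psi> j = 0" using U(2) inV ij unfolding V_def[symmetric] pairwise_def orthogonal_def by blast
      then show ?thesis using False by (simp add: \<phi>_def g_def)
    qed
  qed
  moreover have "\<phi> (CARD('n)) = u" "\<phi> 1 = e" using n gV by (auto simp: \<phi>_def \<psi>_def)
  ultimately show ?thesis using that by blast
qed

text \<open>A crude converse of \<open>sin s \<le> s\<close> on the first quadrant; it turns a bound on a chord into one on the angle.\<close>

lemma angle_le_twice_sin:
  assumes "0 \<le> s" "s \<le> pi / 2"
  shows "s \<le> 2 * sin s"
proof (cases "s \<le> pi / 3")
  case True
  show ?thesis
  proof (cases "s = 0")
    case False
    then have "0 < s" using assms by simp
    from MVT2[OF this, of sin cos] obtain z where z: "0 < z" "z < s" "sin s - sin 0 = (s - 0) * cos z"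
      by (auto intro: DERIV_sin)
    have "cos (pi / 3) \<le> cos z" using z True by (intro cos_monotone_0_pi_le) auto
    then have "cos z \<ge> 1 / 2" by (simp add: cos_60)
    then show ?thesis using z(3) mult_left_mono[of "1/2" "cos z" s] assms by simp
  qed simp
next
  case False
  have "sin (pi / 3) \<le> sin s" using False assms by (intro sin_monotone_2pi_le) auto
  then have "sqrt 3 / 2 \<le> sin s" by (simp add: sin_60)
  moreover have "sqrt 3 \<ge> 1.7" by (rule real_le_rsqrt) (simp add: power2_eq_square)
  moreover have "pi < 3.2" using pi_approx by simp
  ultimately show ?thesis using assms by linarith
qed

lemma orthonormal_frame_inner:
  fixes \<phi> :: "nat \<Rightarrow> real^'n"
  assumes "orthonormal_frame \<phi>" "i \<in> {1..CARD('n)}" "j \<in> {1..CARD('n)}"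
  shows "\<phi> i \<bullet> \<phi> j = (if i = j then 1 else 0)"
  using assms unfolding orthonormal_frame_def by blast

lemma orthonormal_frame_norm:
  fixes \<phi> :: "nat \<Rightarrow> real^'n"
  assumes "orthonormal_frame \<phi>" "i \<in> {1..CARD('n)}"
  shows "norm (\<phi> i) = 1"
  using orthonormal_frame_inner[OF assms(1,2,2)] by (simp add: norm_eq_1)

lemma adapted_frame_direction:
  fixes \<phi> :: "nat \<Rightarrow> real^'n"
  assumes "adapted_frame q \<phi>" "q \<noteq> 0"
  shows "q = norm q *\<^sub>R \<phi> (CARD('n))"
  using assms by (simp add: adapted_frame_def)

lemma adapted_frame_orthogonal:
  fixes \<phi> :: "nat \<Rightarrow> real^'n"
  assumes "adapted_frame q \<phi>" "q \<noteq> 0" "i \<in> {1..<CARD('n)}"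
  shows "q \<bullet> \<phi> i = 0"
proof -
  have "\<phi> (CARD('n)) \<bullet> \<phi> i = 0"
    using orthonormal_frame_inner[of \<phi> "CARD('n)" i] assms by (auto simp: adapted_frame_def)
  then show ?thesis by (subst adapted_frame_direction[OF assms(1,2)]) simp
qed

text \<open>Two gradients can be given adapted frames which differ by a rotation in a single coordinate plane, the one spanned by the
two gradients.  All the change between the two frames is then controlled by one angle.\<close>

lemma adapted_frames_in_plane:
  fixes p q :: "real^'n"
  assumes n: "CARD('n) \<ge> 2" and p: "norm p \<ge> l" and q: "norm q \<ge> l" and l: "l > 0"
    and d: "norm (p - q) \<le> D * l" and D: "D \<le> 1"
  obtains \<phi> s where "adapted_frame p \<phi>" "adapted_frame q (rotate_frame \<phi> 1 (CARD('n)) s)" "0 \<le> s" "s \<le> 2 * D"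
proof -
  let ?n = "CARD('n)"
  have nz: "p \<noteq> 0" "q \<noteq> 0" using p q l by auto
  have D0: "0 \<le> D" using d l norm_ge_zero[of "p - q"] by (metis mult_less_0_iff not_less order_trans)
  define u where "u = p /\<^sub>R norm p"
  have u: "norm u = 1" using nz by (simp add: u_def)
  have uu: "u \<bullet> u = 1" using u by (simp add: norm_eq_1)
  define w where "w = q - (q \<bullet> u) *\<^sub>R u"
  have wu: "u \<bullet> w = 0" by (simp add: w_def inner_simps uu inner_commute)
  have "\<exists>e. norm e = 1 \<and> u \<bullet> e = 0 \<and> w = norm w *\<^sub>R e"
  proof (cases "w = 0")
    case True
    obtain x where x: "x \<noteq> 0" "orthogonal u x"
      using orthogonal_to_vector_exists[of u] n by auto
    define e where "e = x /\<^sub>R norm x"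
    have "norm e = 1" "orthogonal u e"
      using x by (simp_all add: e_def orthogonal_def)
    then show ?thesis using True by (auto simp: orthogonal_def)
  next
    case False
    then show ?thesis using wu by (intro exI[of _ "w /\<^sub>R norm w"]) auto
  qed
  then obtain e where e: "norm e = 1" "u \<bullet> e = 0" "w = norm w *\<^sub>R e" by blast
  obtain \<phi> where \<phi>: "orthonormal_frame \<phi>" "\<phi> ?n = u" "\<phi> 1 = e"
    using frame_with_two_vectors[OF n u e(1,2)] by blast
  have pyth: "(norm q)\<^sup>2 = (q \<bullet> u)\<^sup>2 + (norm w)\<^sup>2"
  proof -
    have "q \<bullet> q = (w + (q \<bullet> u) *\<^sub>R u) \<bullet> (w + (q \<bullet> u) *\<^sub>R u)" by (simp add: w_def)
    also have "\<dots> = w \<bullet> w + (q \<bullet> u)\<^sup>2" using wu uu by (simp add: inner_simps inner_commute power2_eq_square)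
    finally show ?thesis by (simp add: dot_square_norm)
  qed
  have "((q \<bullet> u) / norm q)\<^sup>2 + (norm w / norm q)\<^sup>2 = 1"
    unfolding power_divide add_divide_distrib[symmetric] pyth[symmetric] using nz by simp
  \<comment> \<open>The angle between the gradients is at most a right one, because they are closer to each other than their lengths.\<close>
  moreover have qu: "q \<bullet> u \<ge> 0"
  proof -
    have "norm (p - q) \<le> l" using d D l mult_right_mono[of D 1 l] by linarith
    then have "(norm (p - q))\<^sup>2 \<le> l\<^sup>2" by (simp add: power_mono)
    moreover have "l\<^sup>2 \<le> (norm p)\<^sup>2" "l\<^sup>2 \<le> (norm q)\<^sup>2" using p q l by (simp_all add: power_mono)
    moreover have "(norm (p - q))\<^sup>2 = (norm p)\<^sup>2 + (norm q)\<^sup>2 - 2 * (q \<bullet> p)"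
      by (simp add: power2_norm_eq_inner inner_simps inner_commute)
    ultimately have "2 * (q \<bullet> p) \<ge> l\<^sup>2" by linarith
    then have "q \<bullet> p \<ge> 0" using zero_le_power2[of l] by linarith
    then show ?thesis by (simp add: u_def)
  qed
  ultimately obtain s where s: "0 \<le> s" "s \<le> pi / 2" "(q \<bullet> u) / norm q = cos s" "norm w / norm q = sin s"
    using sincos_total_pi_half[of "(q \<bullet> u) / norm q" "norm w / norm q"] by auto
  have "q /\<^sub>R norm q = cos s *\<^sub>R u + sin s *\<^sub>R e"
  proof -
    have "q = (q \<bullet> u) *\<^sub>R u + norm w *\<^sub>R e" using e(3) by (simp add: w_def)
    then have "q /\<^sub>R norm q = ((q \<bullet> u) / norm q) *\<^sub>R u + (norm w / norm q) *\<^sub>R e"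
      by (metis (no_types, lifting) divide_inverse_commute scaleR_add_right scaleR_scaleR)
    then show ?thesis using s by simp
  qed
  then have aq: "adapted_frame q (rotate_frame \<phi> 1 ?n s)"
    using orthonormal_rotate_frame[OF \<phi>(1), of 1 ?n s] n \<phi>
    by (auto simp: adapted_frame_def rotate_frame_def)
  have "norm w \<le> norm (p - q)"
  proof -
    have "w = (q - p) - ((q - p) \<bullet> u) *\<^sub>R u"
      using nz by (simp add: w_def u_def inner_simps algebra_simps dot_square_norm power2_eq_square)
    moreover have "(v - (v \<bullet> u) *\<^sub>R u) \<bullet> (v - (v \<bullet> u) *\<^sub>R u) = v \<bullet> v - (v \<bullet> u)\<^sup>2" for v
      using uu by (simp add: inner_simps inner_commute power2_eq_square)
    ultimately have "w \<bullet> w = (q - p) \<bullet> (q - p) - ((q - p) \<bullet> u)\<^sup>2" by simp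
    then have "(norm w)\<^sup>2 \<le> (norm (q - p))\<^sup>2" by (simp add: power2_norm_eq_inner)
    then show ?thesis by (simp add: norm_minus_commute)
  qed
  then have "norm w \<le> D * norm q" using d mult_left_mono[OF q D0] by linarith
  then have "sin s \<le> D" using s(4) nz by (metis divide_le_eq zero_less_norm_iff)
  then have "s \<le> 2 * D" using angle_le_twice_sin[OF s(1,2)] by linarith
  moreover have "adapted_frame p \<phi>" using \<phi> by (simp add: adapted_frame_def u_def)
  ultimately show ?thesis using that aq s(1) by blast
qed

text \<open>The structure constants, with \<open>C4\<close> already replaced by its upper bound \<open>c2\<close>.\<close>

locale anisotropy_bounds = smooth_anisotropy F for F :: "(real^'n) \<times> real \<Rightarrow> real" +
  fixes c1 c2 c3 C5 C6 :: real
  assumes n2: "CARD('n) \<ge> 2"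
    and pos: "0 < c1" "0 < c2" "0 < c3" "0 < C5" "0 < C6"
    and tau: "tau_bounds F c1 c2 c3"
    and T3: "T3_bounds F c2 C5 C6"
begin

lemma tau_frame:
  assumes "adapted_frame q \<phi>" "q \<noteq> 0"
  shows "i \<in> {1..<CARD('n)} \<Longrightarrow> c1 \<le> aniso_tau F q (\<phi> i) (\<phi> i)"
    and "i \<in> {1..<CARD('n)} \<Longrightarrow> aniso_tau F q (\<phi> i) (\<phi> i) \<le> c3"
    and "c1 / (norm (q, -1::real))\<^sup>2 \<le> aniso_tau F q (\<phi> (CARD('n))) (\<phi> (CARD('n)))"
    and "aniso_tau F q (\<phi> (CARD('n))) (\<phi> (CARD('n))) \<le> c3 / (norm (q, -1::real))\<^sup>2"
    and "i \<in> {1..<CARD('n)} \<Longrightarrow> j \<in> {1..<CARD('n)} \<Longrightarrow> i \<noteq> j \<Longrightarrow> \<bar>aniso_tau F q (\<phi> i) (\<phi> j)\<bar> \<le> c2"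
    and "i \<in> {1..<CARD('n)} \<Longrightarrow> \<bar>aniso_tau F q (\<phi> i) (\<phi> (CARD('n)))\<bar> \<le> c2 / (norm (q, -1::real))\<^sup>2"
  using tau assms unfolding tau_bounds_def Let_def by blast+

lemma T3_frame:
  assumes "adapted_frame q \<phi>" "norm q > 1"
  shows "i \<in> {1..<CARD('n)} \<Longrightarrow> j \<in> {1..<CARD('n)} \<Longrightarrow> \<bar>aniso_T3 F q (\<phi> i) (\<phi> i) (\<phi> j)\<bar> \<le> c2 / norm (q, -1::real)"
    and "i \<in> {1..<CARD('n)} \<Longrightarrow> \<bar>aniso_T3 F q (\<phi> i) (\<phi> i) (\<phi> (CARD('n)))\<bar> \<le> c2 / norm (q, -1::real) ^ 3"
    and "i \<in> {1..<CARD('n)} \<Longrightarrow> \<bar>aniso_T3 F q (\<phi> i) (\<phi> (CARD('n))) (\<phi> (CARD('n)))\<bar> \<le> c2 / norm (q, -1::real) ^ 3"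
    and "i \<in> {1..<CARD('n)} \<Longrightarrow> \<bar>aniso_T3 F q (\<phi> (CARD('n))) (\<phi> (CARD('n))) (\<phi> i)\<bar> \<le> c2 / norm (q, -1::real) ^ 3"
    and "C5 / norm (q, -1::real) ^ 3 \<le> aniso_T3 F q (\<phi> (CARD('n))) (\<phi> (CARD('n))) (\<phi> (CARD('n)))"
    and "aniso_T3 F q (\<phi> (CARD('n))) (\<phi> (CARD('n))) (\<phi> (CARD('n))) \<le> C6 / norm (q, -1::real) ^ 3"
  using T3 assms unfolding T3_bounds_def Let_def by blast+

lemma adapted_rotate:
  fixes \<phi> :: "nat \<Rightarrow> real^'n"
  assumes "adapted_frame q \<phi>" "i \<in> {1..<CARD('n)}" "j \<in> {1..<CARD('n)}" "i \<noteq> j"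
  shows "adapted_frame q (rotate_frame \<phi> i j s)"
  using assms orthonormal_rotate_frame[of \<phi> i j s] by (auto simp: adapted_frame_def rotate_frame_def)

text \<open>The hypotheses on \<open>T\<^sup>3\<close> control tangential arguments only when the first two coincide, but they do so in every
adapted frame.  Rotating the frame by \<open>\<pi>/4\<close> therefore recovers distinct arguments by polarization.\<close>

lemma T3_polarize:
  fixes \<phi> :: "nat \<Rightarrow> real^'n"
  assumes "i \<noteq> j"
  defines "\<psi> \<equiv> rotate_frame \<phi> i j (pi / 4)"
  shows "aniso_T3 F q (\<psi> j) (\<psi> j) c - aniso_T3 F q (\<psi> i) (\<psi> i) c = 2 * aniso_T3 F q (\<phi> i) (\<phi> j) c"
    and "\<phi> i = (sqrt 2 / 2) *\<^sub>R (\<psi> i + \<psi> j)"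
proof -
  have r: "sqrt 2 / 2 * (sqrt 2 / 2) = (1/2::real)" by simp
  have \<psi>: "\<psi> i = (sqrt 2 / 2) *\<^sub>R (\<phi> i - \<phi> j)" "\<psi> j = (sqrt 2 / 2) *\<^sub>R (\<phi> j + \<phi> i)"
    using assms(1) by (simp_all add: \<psi>_def rotate_frame_def cos_45 sin_45 algebra_simps)
  have sym: "aniso_T3 F q (\<phi> j) (\<phi> i) c = aniso_T3 F q (\<phi> i) (\<phi> j) c" by (rule aniso_T3_symmetric)
  show "aniso_T3 F q (\<psi> j) (\<psi> j) c - aniso_T3 F q (\<psi> i) (\<psi> i) c = 2 * aniso_T3 F q (\<phi> i) (\<phi> j) c"
    unfolding \<psi> by (simp add: aniso_T3_add aniso_T3_diff aniso_T3_scale sym algebra_simps)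
  show "\<phi> i = (sqrt 2 / 2) *\<^sub>R (\<psi> i + \<psi> j)"
    unfolding \<psi> scaleR_add_right[symmetric] scaleR_scaleR r by (simp add: scaleR_2[symmetric])
qed

text \<open>Polarization keeps the radial third argument fixed, so the cubic decay is inherited.\<close>

lemma T3_tangential_radial:
  assumes ad: "adapted_frame q \<phi>" "norm q > 1" and ij: "i \<in> {1..<CARD('n)}" "j \<in> {1..<CARD('n)}"
  shows "\<bar>aniso_T3 F q (\<phi> i) (\<phi> j) (\<phi> (CARD('n)))\<bar> \<le> c2 / norm (q, -1::real) ^ 3"
proof (cases "i = j")
  case True then show ?thesis using T3_frame(2)[OF ad] ij by auto
next
  case False
  let ?\<psi> = "rotate_frame \<phi> i j (pi / 4)"
  have ad': "adapted_frame q ?\<psi>" by (rule adapted_rotate[OF ad(1) ij False])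
  have "?\<psi> (CARD('n)) = \<phi> (CARD('n))" using ij by (auto simp: rotate_frame_def)
  then show ?thesis
    using T3_polarize(1)[OF False, where q = q and \<phi> = \<phi> and c = "\<phi> (CARD('n))"]
      T3_frame(2)[OF ad' ad(2) ij(1)] T3_frame(2)[OF ad' ad(2) ij(2)] by simp
qed

text \<open>If the third argument is one of the two polarized vectors, it is expressed through the rotated frame as well; this
is what costs the factor two.\<close>

lemma T3_tangential:
  assumes ad: "adapted_frame q \<phi>" "norm q > 1" and ijk: "i \<in> {1..<CARD('n)}" "j \<in> {1..<CARD('n)}" "k \<in> {1..<CARD('n)}"
  shows "\<bar>aniso_T3 F q (\<phi> i) (\<phi> j) (\<phi> k)\<bar> \<le> 2 * c2 / norm (q, -1::real)"
proof -
  let ?b = "c2 / norm (q, -1::real)"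
  have b: "?b \<ge> 0" using pos by simp
  \<comment> \<open>Polarization in the plane of \<open>i\<close> and \<open>j\<close> handles a third argument outside this plane or equal to the first; \<open>k = j\<close> reduces to it by symmetry.\<close>
  have gen: "\<bar>aniso_T3 F q (\<phi> i) (\<phi> j) c\<bar> \<le> 2 * ?b"
    if ne: "i \<noteq> j" and ij: "i \<in> {1..<CARD('n)}" "j \<in> {1..<CARD('n)}" and c: "c = \<phi> i \<or> (\<exists>k\<in>{1..<CARD('n)}. k \<noteq> i \<and> k \<noteq> j \<and> c = \<phi> k)" for i j c
  proof -
    let ?\<psi> = "rotate_frame \<phi> i j (pi / 4)"
    have ad': "adapted_frame q ?\<psi>" by (rule adapted_rotate[OF ad(1) ij ne])
    note B = T3_frame(1)[OF ad' ad(2)]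
    note P = T3_polarize(1)[OF ne, where q = q and \<phi> = \<phi>] T3_polarize(2)[OF ne, where \<phi> = \<phi>]
    from c show ?thesis
    proof
      assume c: "c = \<phi> i"
      have r2: "sqrt 2 \<le> (2::real)" by (rule real_le_lsqrt) auto
      have e: "aniso_T3 F q a b c = (sqrt 2 / 2) * (aniso_T3 F q a b (?\<psi> i) + aniso_T3 F q a b (?\<psi> j))" for a b
        unfolding c by (subst P(2)) (simp only: aniso_T3_scale aniso_T3_add)
      have "2 * aniso_T3 F q (\<phi> i) (\<phi> j) c = (sqrt 2 / 2) *
         (aniso_T3 F q (?\<psi> j) (?\<psi> j) (?\<psi> i) + aniso_T3 F q (?\<psi> j) (?\<psi> j) (?\<psi> j) -
          (aniso_T3 F q (?\<psi> i) (?\<psi> i) (?\<psi> i) + aniso_T3 F q (?\<psi> i) (?\<psi> i) (?\<psi> j)))"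
        using P(1)[of c] e[of "?\<psi> j" "?\<psi> j"] e[of "?\<psi> i" "?\<psi> i"] by (simp add: algebra_simps)
      also have "\<bar>\<dots>\<bar> \<le> (sqrt 2 / 2) * (4 * ?b)"
        unfolding abs_mult using B[OF ij(2,1)] B[OF ij(2,2)] B[OF ij(1,1)] B[OF ij(1,2)]
        by (intro mult_mono) auto
      also have "\<dots> \<le> 4 * ?b" using r2 b mult_right_mono[of "sqrt 2 / 2" 1 "4 * ?b"] by simp
      finally show ?thesis by simp
    next
      assume "\<exists>k\<in>{1..<CARD('n)}. k \<noteq> i \<and> k \<noteq> j \<and> c = \<phi> k"
      then obtain k where k: "k \<in> {1..<CARD('n)}" "?\<psi> k = c" by (auto simp: rotate_frame_def)
      then show ?thesis using P(1)[of c] B[OF ij(1) k(1)] B[OF ij(2) k(1)] b by simp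
    qed
  qed
  consider "i = j" | "i \<noteq> j" "k = j" | "i \<noteq> j" "k \<noteq> j" by blast
  then have "\<bar>aniso_T3 F q (\<phi> i) (\<phi> j) (\<phi> k)\<bar> \<le> 2 * ?b"
  proof cases
    case 1 then show ?thesis using T3_frame(1)[OF ad ijk(1,3)] b by simp
  next
    case 2 then show ?thesis using gen[of j i "\<phi> k"] ijk aniso_T3_symmetric[of q "\<phi> i"] by auto
  next
    case 3
    then have "\<phi> k = \<phi> i \<or> (\<exists>l\<in>{1..<CARD('n)}. l \<noteq> i \<and> l \<noteq> j \<and> \<phi> k = \<phi> l)"
      using ijk by (cases "k = i") auto
    then show ?thesis using gen[OF 3(1) ijk(1,2)] by blast
  qed
  then show ?thesis by simp
qed

text \<open>Moving the radial vector from the second slot to the third exposes the term \<open>\<tau>\<close> that the rotation of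
the frame produces with the opposite sign; the two almost cancel below.\<close>

lemma T3_radial_slot:
  assumes ad: "adapted_frame q \<phi>" "norm q > 1" and ij: "i \<in> {1..<CARD('n)}" "j \<in> {1..<CARD('n)}"
  shows "norm q * aniso_T3 F q (\<phi> i) (\<phi> (CARD('n))) (\<phi> j) =
    norm q * aniso_T3 F q (\<phi> i) (\<phi> j) (\<phi> (CARD('n))) + (norm q)\<^sup>2 / (norm (q, -1::real))\<^sup>2 * aniso_tau F q (\<phi> i) (\<phi> j)"
proof -
  have nz: "q \<noteq> 0" using ad(2) by auto
  have "q \<bullet> \<phi> j = 0" by (rule adapted_frame_orthogonal[OF ad(1) nz ij(2)])
  moreover have "q \<bullet> \<phi> (CARD('n)) = norm q"
    using ad(1) nz by (simp add: adapted_frame_def dot_square_norm power2_eq_square)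
  ultimately have "aniso_T3 F q (\<phi> i) (\<phi> (CARD('n))) (\<phi> j) = aniso_T3 F q (\<phi> i) (\<phi> j) (\<phi> (CARD('n)))
     + norm q * aniso_tau F q (\<phi> i) (\<phi> j) / (norm (q, -1::real))\<^sup>2"
    using aniso_T3_swap[of q "\<phi> i" "\<phi> (CARD('n))" "\<phi> j"] by simp
  then show ?thesis by (simp add: algebra_simps power2_eq_square)
qed

end

section \<open>Lipschitz dependence of the rescaled diffusion matrix\<close>

lemma norm_lift: "norm (q :: 'a::real_normed_vector, -1::real) = sqrt (1 + (norm q)\<^sup>2)"
  by (simp add: norm_Pair add.commute)

lemma norm_lift_facts:
  fixes q :: "'a::real_normed_vector"
  shows "1 \<le> norm (q, -1::real)" "norm q \<le> norm (q, -1::real)" "(norm (q, -1::real))\<^sup>2 = 1 + (norm q)\<^sup>2"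
proof -
  show "1 \<le> norm (q, -1::real)" by (simp add: norm_lift)
  show "norm q \<le> norm (q, -1::real)" unfolding norm_lift by (rule real_le_rsqrt) simp
  show "(norm (q, -1::real))\<^sup>2 = 1 + (norm q)\<^sup>2" unfolding norm_lift by (simp add: add_nonneg_nonneg)
qed

context anisotropy_bounds
begin

text \<open>The radial frame vector is rescaled by \<open>\<bar>(q,-1)\<bar>\<close>.  After this all diagonal entries lie between \<open>c1\<close> and \<open>c3\<close>
and all off-diagonal ones are at most \<open>c2\<close>, although \<open>\<tau>\<close> itself degenerates in the radial direction.\<close>

definition scaled_tau :: "real^'n \<Rightarrow> (nat \<Rightarrow> real^'n) \<Rightarrow> nat \<Rightarrow> nat \<Rightarrow> real" where
  "scaled_tau q \<phi> i j = (if i = CARD('n) then norm (q, -1::real) else 1) *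
     (if j = CARD('n) then norm (q, -1::real) else 1) * aniso_tau F q (\<phi> i) (\<phi> j)"

lemma scaled_tau_symmetric: "scaled_tau q \<phi> i j = scaled_tau q \<phi> j i"
  by (simp add: scaled_tau_def aniso_tau_symmetric mult_ac)

lemma scaled_tau_bounds:
  assumes ad: "adapted_frame q \<phi>" and q: "q \<noteq> 0" and ij: "i \<in> {1..CARD('n)}" "j \<in> {1..CARD('n)}"
  shows "c1 \<le> scaled_tau q \<phi> i i" "scaled_tau q \<phi> i i \<le> c3" "i \<noteq> j \<Longrightarrow> \<bar>scaled_tau q \<phi> i j\<bar> \<le> c2"
proof -
  let ?P = "norm (q, -1::real)"
  have P: "?P \<ge> 1" "?P > 0" using norm_lift_facts(1)[of q] by linarith+
  note b = tau_frame[OF ad q]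
  have d: "c1 \<le> scaled_tau q \<phi> i i \<and> scaled_tau q \<phi> i i \<le> c3"
  proof (cases "i = CARD('n)")
    case True
    then have "scaled_tau q \<phi> i i = ?P\<^sup>2 * aniso_tau F q (\<phi> i) (\<phi> i)" by (simp add: scaled_tau_def power2_eq_square)
    then show ?thesis using b(3,4) P True by (simp add: field_simps)
  next
    case False
    then show ?thesis using b(1,2)[of i] ij by (simp add: scaled_tau_def)
  qed
  then show "c1 \<le> scaled_tau q \<phi> i i" "scaled_tau q \<phi> i i \<le> c3" by auto
  have n: "\<bar>scaled_tau q \<phi> i (CARD('n))\<bar> \<le> c2" if "i \<in> {1..<CARD('n)}" for i
  proof -
    have "\<bar>scaled_tau q \<phi> i (CARD('n))\<bar> = ?P * \<bar>aniso_tau F q (\<phi> i) (\<phi> (CARD('n)))\<bar>"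
      using that by (simp add: scaled_tau_def abs_mult)
    also have "\<dots> \<le> ?P * (c2 / ?P\<^sup>2)" using b(6)[OF that] P by (intro mult_left_mono) auto
    also have "\<dots> = c2 / ?P" by (simp add: power2_eq_square)
    also have "\<dots> \<le> c2" using pos P by (simp add: divide_le_eq)
    finally show ?thesis .
  qed
  show "\<bar>scaled_tau q \<phi> i j\<bar> \<le> c2" if "i \<noteq> j"
  proof -
    consider "i = CARD('n)" "j \<in> {1..<CARD('n)}" | "j = CARD('n)" "i \<in> {1..<CARD('n)}"
      | "i \<in> {1..<CARD('n)}" "j \<in> {1..<CARD('n)}" using ij \<open>i \<noteq> j\<close> by fastforce
    then show ?thesis
    proof cases
      case 1 then show ?thesis using n[of j] scaled_tau_symmetric by metis
    next
      case 2 then show ?thesis using n[of i] by simp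
    next
      case 3 then show ?thesis using b(5)[OF 3 that] by (simp add: scaled_tau_def)
    qed
  qed
qed

text \<open>Along a ray the frame is constant, so only the radial third argument of \<open>T\<^sup>3\<close> and the derivative of the scaling factors
occur.  Each contribution decays in the base point, giving a Lipschitz constant with the factor \<open>1 / l\<close>; only the purely radial entry sees
\<open>c3\<close> and \<open>C6\<close>.\<close>

lemma scaled_tau_radial:
  assumes on: "orthonormal_frame \<phi>" and l: "l > 1" and r: "r1 \<ge> l" "r2 \<ge> l"
    and ij: "i \<in> {1..CARD('n)}" "j \<in> {1..CARD('n)}"
  shows "\<bar>scaled_tau (r1 *\<^sub>R \<phi> (CARD('n))) \<phi> i j - scaled_tau (r2 *\<^sub>R \<phi> (CARD('n))) \<phi> i j\<bar>
    \<le> (if i = CARD('n) \<and> j = CARD('n) then (C6 + 2 * c3) / l else 2 * c2 / l) * \<bar>r1 - r2\<bar>"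
proof -
  let ?n = "CARD('n)" and ?q = "\<lambda>r. r *\<^sub>R \<phi> (CARD('n))"
  define P where "P r = sqrt (1 + r\<^sup>2)" for r :: real
  define g where "g r i j = aniso_tau F (?q r) (\<phi> i) (\<phi> j)" for r i j
  define T where "T r i j = aniso_T3 F (?q r) (\<phi> i) (\<phi> j) (\<phi> ?n)" for r i j
  have nn: "norm (\<phi> ?n) = 1" using orthonormal_frame_norm[OF on] by simp
  have NP: "norm (?q r, -1::real) = P r" for r by (simp add: norm_lift nn P_def)
  have ad: "adapted_frame (?q r) \<phi>" "norm (?q r) > 1" "?q r \<noteq> 0" if "r \<ge> l" for r
    using that l nn on by (auto simp: adapted_frame_def)
  have Pl: "P r \<ge> l" "P r \<ge> r" "P r > 0" "P r \<ge> 1" if "r \<ge> l" for r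
    using norm_lift_facts(1,2)[of "?q r"] that l nn unfolding NP by auto
  have dg: "((\<lambda>r. g r i j) has_real_derivative - T r i j) (at r)" for r i j
  proof -
    have "(?q has_vector_derivative \<phi> ?n) (at r)"
      by (auto intro!: derivative_eq_intros simp: has_vector_derivative_def)
    from aniso_tau_along_path[OF this has_vector_derivative_const[of "\<phi> i"] has_vector_derivative_const[of "\<phi> j"]]
    show ?thesis by (simp add: g_def T_def aniso_tau_simps)
  qed
  have dP: "(P has_real_derivative r / P r) (at r)" for r
  proof -
    have "1 + r\<^sup>2 > 0" by (simp add: add_pos_nonneg)
    then show ?thesis unfolding P_def by (auto intro!: derivative_eq_intros simp: field_simps)
  qed
  have lip: "\<bar>h r1 - h r2\<bar> \<le> K * \<bar>r1 - r2\<bar>"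
    if "\<And>r. r \<ge> l \<Longrightarrow> (h has_real_derivative h' r) (at r)" "\<And>r. r \<ge> l \<Longrightarrow> \<bar>h' r\<bar> \<le> K" for h h' K
    using field_differentiable_bound[of "{l..}" h h' K r1 r2] that r
    by (auto intro: has_field_derivative_at_within)
  have tan: "\<bar>scaled_tau (?q r1) \<phi> i j - scaled_tau (?q r2) \<phi> i j\<bar> \<le> 2 * c2 / l * \<bar>r1 - r2\<bar>"
    if ij: "i \<in> {1..<?n}" "j \<in> {1..<?n}" for i j
  proof -
    have "\<bar>- T r i j\<bar> \<le> 2 * c2 / l" if r: "r \<ge> l" for r
    proof -
      have "\<bar>T r i j\<bar> \<le> c2 / P r ^ 3"
        using T3_tangential_radial[OF ad(1,2)[OF r] ij] by (simp add: T_def NP)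
      also have "\<dots> \<le> c2 / l"
      proof (rule divide_left_mono)
        have "P r ^ 1 \<le> P r ^ 3" using Pl[OF r] by (intro power_increasing) auto
        then show "l \<le> P r ^ 3" using Pl[OF r] by simp
      qed (use pos l Pl[OF r] in auto)
      also have "\<dots> \<le> 2 * c2 / l" using pos l by (simp add: divide_right_mono)
      finally show ?thesis by simp
    qed
    from lip[OF dg this] ij show ?thesis by (simp add: scaled_tau_def g_def)
  qed
  have mix: "\<bar>scaled_tau (?q r1) \<phi> i ?n - scaled_tau (?q r2) \<phi> i ?n\<bar> \<le> 2 * c2 / l * \<bar>r1 - r2\<bar>"
    if i: "i \<in> {1..<?n}" for i
  proof -
    have d: "((\<lambda>r. P r * g r i ?n) has_real_derivative (r / P r * g r i ?n + - T r i ?n * P r)) (at r)" for r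
      by (rule DERIV_mult[OF dP dg])
    have "\<bar>r / P r * g r i ?n + - T r i ?n * P r\<bar> \<le> 2 * c2 / l" if r: "r \<ge> l" for r
    proof -
      have "\<bar>r / P r\<bar> \<le> 1" using Pl[OF r] r l by (simp add: divide_le_eq)
      moreover have "\<bar>g r i ?n\<bar> \<le> c2 / (P r)\<^sup>2"
        using tau_frame(6)[OF ad(1,3)[OF r] i] by (simp add: g_def NP)
      ultimately have 1: "\<bar>r / P r * g r i ?n\<bar> \<le> c2 / (P r)\<^sup>2"
        unfolding abs_mult by (metis abs_ge_zero mult_left_le_one_le order_trans)
      have "\<bar>T r i ?n\<bar> * P r \<le> c2 / P r ^ 3 * P r"
        using T3_frame(3)[OF ad(1,2)[OF r] i] Pl[OF r] by (intro mult_right_mono) (auto simp: T_def NP)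
      also have "\<dots> = c2 / (P r)\<^sup>2" using Pl[OF r] by (simp add: power2_eq_square power3_eq_cube)
      finally have 2: "\<bar>- T r i ?n * P r\<bar> \<le> c2 / (P r)\<^sup>2" using Pl[OF r] by (simp add: abs_mult)
      have "c2 / (P r)\<^sup>2 \<le> c2 / l"
      proof (rule divide_left_mono)
        have "P r ^ 1 \<le> (P r)\<^sup>2" using Pl[OF r] by (intro power_increasing) auto
        then show "l \<le> (P r)\<^sup>2" using Pl[OF r] by simp
      qed (use pos l Pl[OF r] in auto)
      moreover have "2 * c2 / l = c2 / l + c2 / l" by simp
      ultimately show ?thesis
        using 1 2 abs_triangle_ineq[of "r / P r * g r i ?n" "- T r i ?n * P r"] by (smt (verit))
    qed
    from lip[OF d this] i show ?thesis by (simp add: scaled_tau_def g_def NP)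
  qed
  have nor: "\<bar>scaled_tau (?q r1) \<phi> ?n ?n - scaled_tau (?q r2) \<phi> ?n ?n\<bar> \<le> (C6 + 2 * c3) / l * \<bar>r1 - r2\<bar>"
  proof -
    have d: "((\<lambda>r. P r * P r * g r ?n ?n) has_real_derivative
        ((r / P r * P r + r / P r * P r) * g r ?n ?n + - T r ?n ?n * (P r * P r))) (at r)" for r
      by (rule DERIV_mult[OF DERIV_mult[OF dP dP] dg])
    have "\<bar>(r / P r * P r + r / P r * P r) * g r ?n ?n + - T r ?n ?n * (P r * P r)\<bar> \<le> (C6 + 2 * c3) / l" if r: "r \<ge> l" for r
    proof -
      have "\<bar>g r ?n ?n\<bar> \<le> c3 / (P r)\<^sup>2"
        using tau_frame(3,4)[OF ad(1,3)[OF r]] pos order_trans[of 0 "c1 / (P r)\<^sup>2"] by (auto simp: g_def NP)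
      then have "\<bar>(r / P r * P r + r / P r * P r) * g r ?n ?n\<bar> \<le> (2 * P r) * (c3 / (P r)\<^sup>2)"
        unfolding abs_mult using Pl[OF r] r l by (intro mult_mono) auto
      also have "\<dots> = 2 * c3 / P r" using Pl[OF r] by (simp add: power2_eq_square)
      finally have 1: "\<bar>(r / P r * P r + r / P r * P r) * g r ?n ?n\<bar> \<le> 2 * c3 / P r" .
      have "0 < C5 / P r ^ 3" using pos Pl[OF r] by simp
      then have "\<bar>T r ?n ?n\<bar> \<le> C6 / P r ^ 3"
        using T3_frame(5,6)[OF ad(1,2)[OF r]] by (simp add: T_def NP)
      then have "\<bar>T r ?n ?n\<bar> * (P r * P r) \<le> C6 / P r ^ 3 * (P r * P r)"
        using Pl[OF r] by (intro mult_right_mono) auto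
      also have "\<dots> = C6 / P r" using Pl[OF r] by (simp add: power3_eq_cube)
      finally have 2: "\<bar>- T r ?n ?n * (P r * P r)\<bar> \<le> C6 / P r" using Pl[OF r] by (simp add: abs_mult)
      have "C6 / P r + 2 * c3 / P r \<le> (C6 + 2 * c3) / l"
        using divide_left_mono[OF Pl(1)[OF r], of "C6 + 2 * c3"] pos l Pl[OF r] by (simp add: add_divide_distrib)
      then show ?thesis using 1 2 by linarith
    qed
    from lip[OF d this] show ?thesis by (simp add: scaled_tau_def g_def NP)
  qed
  consider "i = ?n" "j = ?n" | "i = ?n" "j \<in> {1..<?n}" | "j = ?n" "i \<in> {1..<?n}"
    | "i \<in> {1..<?n}" "j \<in> {1..<?n}" using ij by fastforce
  then show ?thesis
  proof cases
    case 1 then show ?thesis using nor by simp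
  next
    case 2 then show ?thesis using mix[of j] by (simp add: scaled_tau_symmetric[of _ _ ?n j])
  next
    case 3 then show ?thesis using mix[of i] by simp
  next
    case 4 then show ?thesis using tan[OF 4] by simp
  qed
qed

text \<open>On a sphere of radius \<open>R\<close> the derivative with respect to the angle has size \<open>R * T\<^sup>3\<close> plus the terms from the
rotating frame.  For the mixed entries these are individually too large after rescaling: \<open>R * T\<^sup>3\<close> behaves like
\<open>\<tau>\<close>, not like \<open>\<tau> / R\<close>.  They cancel up to a factor \<open>1 / P\<^sup>2\<close>, since the radial slot of \<open>T\<^sup>3\<close> reproduces
\<open>(R\<^sup>2 / P\<^sup>2) \<tau>\<close>.  The hypothesis \<open>2 * c3 \<le> c2 * R\<close> absorbs what is left of \<open>c3\<close>.\<close>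

lemma scaled_tau_rotation:
  assumes on: "orthonormal_frame \<phi>" and R: "R > 1" "2 * c3 \<le> c2 * R"
    and ij: "i \<in> {1..CARD('n)}" "j \<in> {1..CARD('n)}"
  defines "\<psi> \<equiv> \<lambda>s. rotate_frame \<phi> 1 (CARD('n)) s"
  shows "\<bar>scaled_tau (R *\<^sub>R \<psi> s (CARD('n))) (\<psi> s) i j - scaled_tau (R *\<^sub>R \<psi> 0 (CARD('n))) (\<psi> 0) i j\<bar> \<le> 4 * c2 * \<bar>s\<bar>"
proof -
  let ?n = "CARD('n)" and ?q = "\<lambda>s. R *\<^sub>R \<psi> s (CARD('n))"
  define P where "P = sqrt (1 + R\<^sup>2)"
  define g where "g s i j = aniso_tau F (?q s) (\<psi> s i) (\<psi> s j)" for s i j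
  define T where "T s i j k = aniso_T3 F (?q s) (\<psi> s i) (\<psi> s j) (\<psi> s k)" for s i j k
  \<comment> \<open>The angular velocity of the frame.\<close>
  define w where "w s i = (if i = 1 then - \<psi> s ?n else if i = ?n then \<psi> s 1 else 0)" for s i
  have ne: "1 \<noteq> ?n" "1 \<in> {1..<?n}" using n2 by auto
  have ons: "orthonormal_frame (\<psi> s)" for s
    unfolding \<psi>_def using orthonormal_rotate_frame[OF on] n2 by simp
  have nn: "norm (\<psi> s ?n) = 1" for s using orthonormal_frame_norm[OF ons] by simp
  have NP: "norm (?q s, -1::real) = P" for s by (simp add: norm_lift nn P_def)
  have nq: "norm (?q s) = R" for s using nn R by simp
  have ad: "adapted_frame (?q s) (\<psi> s)" "norm (?q s) > 1" "?q s \<noteq> 0" for s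
  proof -
    show "norm (?q s) > 1" using nq R by simp
    then show "?q s \<noteq> 0" by force
    show "adapted_frame (?q s) (\<psi> s)" using R ons nq by (simp add: adapted_frame_def)
  qed
  have Pl: "P \<ge> R" "P > 0" "P \<ge> 1"
    using norm_lift_facts(1,2)[of "?q 0"] R unfolding NP nq by auto
  have P2: "P\<^sup>2 = 1 + R\<^sup>2" using norm_lift_facts(3)[of "?q 0"] unfolding NP nq .
  have d\<psi>: "((\<lambda>s. \<psi> s i) has_vector_derivative w s i) (at s)" for i s
    unfolding \<psi>_def w_def rotate_frame_def using ne
    by (auto intro!: derivative_eq_intros simp: has_vector_derivative_def algebra_simps)
  have dg: "((\<lambda>s. g s i j) has_real_derivative
      (- R * T s i j 1 + aniso_tau F (?q s) (w s i) (\<psi> s j) + aniso_tau F (?q s) (\<psi> s i) (w s j))) (at s)" for i j s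
  proof -
    have "(?q has_vector_derivative R *\<^sub>R \<psi> s 1) (at s)"
      using has_vector_derivative_scaleR[OF DERIV_const d\<psi>[of ?n s], of R] ne by (simp add: w_def)
    from aniso_tau_along_path[OF this d\<psi> d\<psi>] show ?thesis
      by (simp add: g_def T_def aniso_T3_scale)
  qed
  have lip: "\<bar>h s - h 0\<bar> \<le> K * \<bar>s\<bar>"
    if "\<And>s. (h has_real_derivative h' s) (at s)" "\<And>s. \<bar>h' s\<bar> \<le> K" for h h' K
    using field_differentiable_bound[of UNIV h h' K s 0] that by auto
  note tf = tau_frame[OF ad(1,3), unfolded NP]
  have c2P: "c2 / P\<^sup>2 \<le> c2" using pos Pl by (simp add: divide_le_eq one_le_power)
  have RP3: "R * (c / P ^ 3) \<le> c / P\<^sup>2" if "c > 0" for c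
  proof -
    have "R * (c / P ^ 3) \<le> P * (c / P ^ 3)" using Pl that by (intro mult_right_mono) auto
    also have "\<dots> = c / P\<^sup>2" using Pl by (simp add: power2_eq_square power3_eq_cube)
    finally show ?thesis .
  qed
  have gn: "\<bar>g s i ?n\<bar> \<le> c2 / P\<^sup>2" "\<bar>g s ?n i\<bar> \<le> c2 / P\<^sup>2" if "i \<in> {1..<?n}" for s i
    using tf(6)[OF that] by (auto simp: g_def aniso_tau_symmetric)
  have tan: "\<bar>scaled_tau (?q s) (\<psi> s) i j - scaled_tau (?q 0) (\<psi> 0) i j\<bar> \<le> 4 * c2 * \<bar>s\<bar>"
    if ij: "i \<in> {1..<?n}" "j \<in> {1..<?n}" for i j
  proof -
    have "\<bar>- R * T s i j 1 + aniso_tau F (?q s) (w s i) (\<psi> s j) + aniso_tau F (?q s) (\<psi> s i) (w s j)\<bar> \<le> 4 * c2" for s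
    proof -
      have "\<bar>T s i j 1\<bar> \<le> 2 * c2 / P" using T3_tangential[OF ad(1,2) ij ne(2)] by (simp add: T_def NP)
      then have "R * \<bar>T s i j 1\<bar> \<le> R * (2 * c2 / P)" using R by (intro mult_left_mono) auto
      also have "\<dots> \<le> P * (2 * c2 / P)" using Pl pos by (intro mult_right_mono) auto
      finally have "\<bar>- R * T s i j 1\<bar> \<le> 2 * c2" using R Pl by (simp add: abs_mult)
      moreover have "\<bar>aniso_tau F (?q s) (w s i) (\<psi> s j)\<bar> \<le> c2"
        using gn(2)[OF ij(2), of s] c2P ij pos by (auto simp: w_def g_def aniso_tau_simps)
      moreover have "\<bar>aniso_tau F (?q s) (\<psi> s i) (w s j)\<bar> \<le> c2"
        using gn(1)[OF ij(1), of s] c2P ij pos by (auto simp: w_def g_def aniso_tau_simps)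
      ultimately show ?thesis by linarith
    qed
    from lip[OF dg this] ij show ?thesis by (simp add: scaled_tau_def g_def)
  qed
  have mix: "\<bar>scaled_tau (?q s) (\<psi> s) i ?n - scaled_tau (?q 0) (\<psi> 0) i ?n\<bar> \<le> 4 * c2 * \<bar>s\<bar>"
    if i: "i \<in> {1..<?n}" for i
  proof -
    let ?d = "\<lambda>s. - R * T s i ?n 1 + aniso_tau F (?q s) (w s i) (\<psi> s ?n) + aniso_tau F (?q s) (\<psi> s i) (w s ?n)"
    have d: "((\<lambda>s. P * g s i ?n) has_real_derivative P * ?d s) (at s)" for s
      by (rule DERIV_cmult[OF dg])
    have "\<bar>P * ?d s\<bar> \<le> 4 * c2" for s
    proof -
      have "R * T s i ?n 1 = R * T s i 1 ?n + R\<^sup>2 / P\<^sup>2 * g s i 1"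
        using T3_radial_slot[OF ad(1,2) i ne(2), of s] unfolding nq NP T_def g_def .
      moreover have "aniso_tau F (?q s) (\<psi> s i) (w s ?n) = g s i 1" using ne by (simp add: w_def g_def)
      \<comment> \<open>The cancellation between the rotating frame and the radial slot of \<open>T\<^sup>3\<close>.\<close>
      moreover have "g s i 1 - R\<^sup>2 / P\<^sup>2 * g s i 1 = g s i 1 / P\<^sup>2"
      proof -
        have "R\<^sup>2 / P\<^sup>2 = (P\<^sup>2 - 1) / P\<^sup>2" using P2 by simp
        also have "\<dots> = 1 - 1 / P\<^sup>2" using Pl by (simp add: diff_divide_distrib)
        finally have "R\<^sup>2 / P\<^sup>2 = 1 - 1 / P\<^sup>2" .
        then show ?thesis by (simp only: left_diff_distrib) simp
      qed
      ultimately have eq: "?d s = - R * T s i 1 ?n + g s i 1 / P\<^sup>2 + aniso_tau F (?q s) (w s i) (\<psi> s ?n)"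
        by linarith
      have "\<bar>T s i 1 ?n\<bar> \<le> c2 / P ^ 3" using T3_tangential_radial[OF ad(1,2) i ne(2)] by (simp add: T_def NP)
      then have "R * \<bar>T s i 1 ?n\<bar> \<le> R * (c2 / P ^ 3)" using R by (intro mult_left_mono) auto
      then have 1: "\<bar>- R * T s i 1 ?n\<bar> \<le> c2 / P\<^sup>2" using RP3[OF pos(2)] R by (simp add: abs_mult)
      have 2: "\<bar>g s i 1 / P\<^sup>2 + aniso_tau F (?q s) (w s i) (\<psi> s ?n)\<bar> \<le> (c2 + 2 * c3) / P\<^sup>2"
      proof (cases "i = 1")
        case True
        have "\<bar>g s i 1\<bar> \<le> c3" using tf(1,2)[OF ne(2), of s] pos True by (simp add: g_def)
        then have "\<bar>g s i 1 / P\<^sup>2\<bar> \<le> c3 / P\<^sup>2" by (simp add: divide_right_mono)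
        moreover have "0 < c1 / P\<^sup>2" using pos Pl by simp
        then have "\<bar>aniso_tau F (?q s) (w s i) (\<psi> s ?n)\<bar> \<le> c3 / P\<^sup>2"
          using tf(3,4)[of s] True by (simp add: w_def aniso_tau_simps)
        moreover have "0 \<le> c2 / P\<^sup>2" using pos by simp
        moreover have "(c2 + 2 * c3) / P\<^sup>2 = c2 / P\<^sup>2 + c3 / P\<^sup>2 + c3 / P\<^sup>2"
          by (simp add: add_divide_distrib)
        ultimately show ?thesis
          using abs_triangle_ineq[of "g s i 1 / P\<^sup>2" "aniso_tau F (?q s) (w s i) (\<psi> s ?n)"] by linarith
      next
        case False
        have "\<bar>g s i 1\<bar> \<le> c2" using tf(5)[OF i ne(2) False, of s] by (simp add: g_def)
        then have "\<bar>g s i 1 / P\<^sup>2\<bar> \<le> c2 / P\<^sup>2" by (simp add: divide_right_mono)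
        moreover have "0 \<le> c3 / P\<^sup>2" using pos by simp
        ultimately show ?thesis using False i by (simp add: w_def aniso_tau_simps add_divide_distrib)
      qed
      have "\<bar>?d s\<bar> \<le> (2 * c2 + 2 * c3) / P\<^sup>2"
        unfolding eq using 1 2 by (simp add: add_divide_distrib)
      then have "P * \<bar>?d s\<bar> \<le> P * ((2 * c2 + 2 * c3) / P\<^sup>2)" using Pl by (intro mult_left_mono) auto
      also have "\<dots> = (2 * c2 + 2 * c3) / P" using Pl by (simp add: power2_eq_square)
      also have "\<dots> = 2 * c2 / P + 2 * c3 / P" by (simp add: add_divide_distrib)
      also have "\<dots> \<le> 2 * c2 + c2"
      proof (rule add_mono)
        show "2 * c2 / P \<le> 2 * c2" using Pl pos by (simp add: divide_le_eq)
        have "2 * c3 \<le> c2 * P" using R(2) mult_left_mono[OF Pl(1), of c2] pos by linarith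
        then show "2 * c3 / P \<le> c2" using Pl by (simp add: divide_le_eq)
      qed
      finally show ?thesis using Pl pos by (simp add: abs_mult)
    qed
    from lip[OF d this] i show ?thesis by (simp add: scaled_tau_def g_def NP)
  qed
  have nor: "\<bar>scaled_tau (?q s) (\<psi> s) ?n ?n - scaled_tau (?q 0) (\<psi> 0) ?n ?n\<bar> \<le> 4 * c2 * \<bar>s\<bar>"
  proof -
    let ?d = "\<lambda>s. - R * T s ?n ?n 1 + aniso_tau F (?q s) (w s ?n) (\<psi> s ?n) + aniso_tau F (?q s) (\<psi> s ?n) (w s ?n)"
    have d: "((\<lambda>s. P\<^sup>2 * g s ?n ?n) has_real_derivative P\<^sup>2 * ?d s) (at s)" for s
      by (rule DERIV_cmult[OF dg])
    have "\<bar>P\<^sup>2 * ?d s\<bar> \<le> 4 * c2" for s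
    proof -
      have "\<bar>T s ?n ?n 1\<bar> \<le> c2 / P ^ 3" using T3_frame(4)[OF ad(1,2) ne(2)] by (simp add: T_def NP)
      then have "R * \<bar>T s ?n ?n 1\<bar> \<le> R * (c2 / P ^ 3)" using R by (intro mult_left_mono) auto
      then have "\<bar>- R * T s ?n ?n 1\<bar> \<le> c2 / P\<^sup>2" using RP3[OF pos(2)] R by (simp add: abs_mult)
      moreover have "\<bar>aniso_tau F (?q s) (w s ?n) (\<psi> s ?n)\<bar> \<le> c2 / P\<^sup>2"
          "\<bar>aniso_tau F (?q s) (\<psi> s ?n) (w s ?n)\<bar> \<le> c2 / P\<^sup>2"
        using gn[OF ne(2), of s] ne by (auto simp: w_def g_def)
      ultimately have "\<bar>?d s\<bar> \<le> 3 * (c2 / P\<^sup>2)" by linarith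
      then have "P\<^sup>2 * \<bar>?d s\<bar> \<le> P\<^sup>2 * (3 * (c2 / P\<^sup>2))" by (intro mult_left_mono) auto
      also have "\<dots> = 3 * c2" using Pl by simp
      finally show ?thesis using pos by (simp add: abs_mult)
    qed
    from lip[OF d this] show ?thesis by (simp add: scaled_tau_def g_def NP power2_eq_square)
  qed
  consider "i = ?n" "j = ?n" | "i = ?n" "j \<in> {1..<?n}" | "j = ?n" "i \<in> {1..<?n}"
    | "i \<in> {1..<?n}" "j \<in> {1..<?n}" using ij by fastforce
  then show ?thesis
  proof cases
    case 1 then show ?thesis using nor by simp
  next
    case 2 then show ?thesis using mix[of j] by (simp add: scaled_tau_symmetric[of _ _ ?n j])
  next
    case 3 then show ?thesis using mix[of i] by simp
  next
    case 4 then show ?thesis using tan[OF 4] by simp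
  qed
qed

text \<open>Go from \<open>p\<close> to \<open>q\<close> by first changing the length and then the direction.\<close>

lemma scaled_tau_lipschitz:
  assumes ad: "adapted_frame p \<phi>" "adapted_frame q (rotate_frame \<phi> 1 (CARD('n)) s)" and s: "0 \<le> s" "s \<le> 2 * D"
    and l: "l > 1" "2 * c3 \<le> c2 * l" and p: "norm p \<ge> l" and q: "norm q \<ge> l" and d: "norm (p - q) \<le> D * l"
    and ij: "i \<in> {1..CARD('n)}" "j \<in> {1..CARD('n)}"
  shows "\<bar>scaled_tau p \<phi> i j - scaled_tau q (rotate_frame \<phi> 1 (CARD('n)) s) i j\<bar>
    \<le> (if i = CARD('n) \<and> j = CARD('n) then C6 + 2 * c3 + 8 * c2 else 10 * c2) * D"
proof -
  let ?n = "CARD('n)" and ?\<psi> = "rotate_frame \<phi> 1 (CARD('n))"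
  have on: "orthonormal_frame \<phi>" using ad by (simp add: adapted_frame_def)
  have nz: "p \<noteq> 0" "q \<noteq> 0" using p q l by auto
  have pe: "p = norm p *\<^sub>R \<phi> ?n" "q = norm q *\<^sub>R ?\<psi> s ?n"
    using adapted_frame_direction ad nz by blast+
  have z: "?\<psi> 0 = \<phi>" by (rule ext) (simp add: rotate_frame_def)
  have "\<bar>norm p - norm q\<bar> \<le> D * l" using norm_triangle_ineq3[of p q] d by linarith
  then have "K / l * \<bar>norm p - norm q\<bar> \<le> K / l * (D * l)" if "K \<ge> 0" for K
    using that l by (intro mult_left_mono) auto
  then have K: "K / l * \<bar>norm p - norm q\<bar> \<le> K * D" if "K \<ge> 0" for K
    using that l by simp
  have 1: "\<bar>scaled_tau (norm p *\<^sub>R \<phi> ?n) \<phi> i j - scaled_tau (norm q *\<^sub>R \<phi> ?n) \<phi> i j\<bar>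
     \<le> (if i = ?n \<and> j = ?n then C6 + 2 * c3 else 2 * c2) * D"
    using scaled_tau_radial[OF on l(1) p q ij] K[of "C6 + 2 * c3"] K[of "2 * c2"] pos
    by (auto split: if_splits)
  have R: "norm q > 1" "2 * c3 \<le> c2 * norm q"
    using q l mult_left_mono[OF q, of c2] pos by linarith+
  have "\<bar>scaled_tau (norm q *\<^sub>R ?\<psi> s ?n) (?\<psi> s) i j - scaled_tau (norm q *\<^sub>R \<phi> ?n) \<phi> i j\<bar> \<le> 4 * c2 * \<bar>s\<bar>"
    using scaled_tau_rotation[OF on R ij, of s] z by simp
  also have "\<dots> \<le> 8 * c2 * D" using s pos mult_left_mono[of s "2 * D" "4 * c2"] by simp
  finally show ?thesis using 1 pe by (auto simp: algebra_simps split: if_splits)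
qed

end

section \<open>Diagonally dominant matrices as sums of squares\<close>

lemma sqrt_diff_square_le:
  assumes "0 \<le> r" "0 < r'" shows "(sqrt r - sqrt r')\<^sup>2 \<le> (r - r')\<^sup>2 / r'"
proof -
  have "(r - r')\<^sup>2 = ((sqrt r - sqrt r') * (sqrt r + sqrt r'))\<^sup>2"
    using assms by (simp add: algebra_simps)
  also have "\<dots> = (sqrt r - sqrt r')\<^sup>2 * (sqrt r + sqrt r')\<^sup>2" by (rule power_mult_distrib)
  also have "\<dots> \<ge> (sqrt r - sqrt r')\<^sup>2 * (sqrt r')\<^sup>2"
    using assms by (intro mult_left_mono power_mono) auto
  finally show ?thesis using assms by (simp add: pos_le_divide_eq)
qed

lemma norm_square_diff_scaled:
  fixes v v' :: "'a::real_inner"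
  assumes "0 \<le> r" "0 < r'"
  shows "(norm (sqrt r *\<^sub>R v - sqrt r' *\<^sub>R v'))\<^sup>2 \<le> 2 * ((r - r')\<^sup>2 / r') * (norm v)\<^sup>2 + 2 * r' * (norm (v - v'))\<^sup>2"
proof -
  have "sqrt r *\<^sub>R v - sqrt r' *\<^sub>R v' = (sqrt r - sqrt r') *\<^sub>R v + sqrt r' *\<^sub>R (v - v')"
    by (simp add: algebra_simps)
  then have "norm (sqrt r *\<^sub>R v - sqrt r' *\<^sub>R v') \<le> \<bar>sqrt r - sqrt r'\<bar> * norm v + sqrt r' * norm (v - v')"
    using norm_triangle_ineq[of "(sqrt r - sqrt r') *\<^sub>R v" "sqrt r' *\<^sub>R (v - v')"] assms by simp
  then have "(norm (sqrt r *\<^sub>R v - sqrt r' *\<^sub>R v'))\<^sup>2 \<le> (\<bar>sqrt r - sqrt r'\<bar> * norm v + sqrt r' * norm (v - v'))\<^sup>2"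
    by (intro power_mono) auto
  also have "\<dots> \<le> 2 * (\<bar>sqrt r - sqrt r'\<bar> * norm v)\<^sup>2 + 2 * (sqrt r' * norm (v - v'))\<^sup>2"
    using sum_squares_ge_zero[of "\<bar>sqrt r - sqrt r'\<bar> * norm v - sqrt r' * norm (v - v')" 0]
    by (simp add: power2_eq_square algebra_simps)
  also have "\<dots> = 2 * (sqrt r - sqrt r')\<^sup>2 * (norm v)\<^sup>2 + 2 * r' * (norm (v - v'))\<^sup>2"
    using assms by (simp add: power_mult_distrib)
  also have "\<dots> \<le> 2 * ((r - r')\<^sup>2 / r') * (norm v)\<^sup>2 + 2 * r' * (norm (v - v'))\<^sup>2"
    using sqrt_diff_square_le[OF assms] by (intro add_right_mono mult_right_mono mult_left_mono) auto
  finally show ?thesis .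
qed

text \<open>With \<open>v\<^sub>\<plusminus> = \<psi>\<^sub>i \<plusminus> \<psi>\<^sub>j\<close>, the identity behind the decomposition is
\<open>(\<delta> + m) / 4 * v\<^sub>+ \<otimes> v\<^sub>+ + (\<delta> - m) / 4 * v\<^sub>- \<otimes> v\<^sub>- = \<delta>/2 * (\<psi>\<^sub>i \<otimes> \<psi>\<^sub>i + \<psi>\<^sub>j \<otimes> \<psi>\<^sub>j) + m/2 * (\<psi>\<^sub>i \<otimes> \<psi>\<^sub>j + \<psi>\<^sub>j \<otimes> \<psi>\<^sub>i)\<close>.
Summed over all pairs, the first part contributes \<open>n * \<delta>\<close> to each diagonal entry, which is subtracted beforehand.\<close>

definition sq_coeff :: "nat \<Rightarrow> real \<Rightarrow> (nat \<Rightarrow> nat \<Rightarrow> real) \<Rightarrow> nat \<Rightarrow> nat \<Rightarrow> bool \<Rightarrow> real" where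
  "sq_coeff n \<delta> t i j \<sigma> = (\<delta> + (if \<sigma> then 1 else -1) * (t i j - (if i = j then real n * \<delta> else 0))) / 4"

definition sq_vec :: "(nat \<Rightarrow> 'a::real_vector) \<Rightarrow> nat \<Rightarrow> nat \<Rightarrow> bool \<Rightarrow> 'a" where
  "sq_vec \<psi> i j \<sigma> = \<psi> i + (if \<sigma> then 1 else -1) *\<^sub>R \<psi> j"

definition sq_factor :: "nat \<Rightarrow> real \<Rightarrow> (nat \<Rightarrow> nat \<Rightarrow> real) \<Rightarrow> (nat \<Rightarrow> 'a::real_vector) \<Rightarrow> nat \<times> nat \<times> bool \<Rightarrow> 'a" where
  "sq_factor n \<delta> t \<psi> = (\<lambda>(i, j, \<sigma>). sqrt (sq_coeff n \<delta> t i j \<sigma>) *\<^sub>R sq_vec \<psi> i j \<sigma>)"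

definition sq_index :: "nat \<Rightarrow> (nat \<times> nat \<times> bool) set" where
  "sq_index n = {1..n} \<times> {1..n} \<times> UNIV"

lemma sq_vec_diag: "sq_vec \<psi> i i False = 0"
  by (simp add: sq_vec_def)

text \<open>Diagonal dominance keeps the coefficients away from zero, which makes their square roots Lipschitz in the matrix.\<close>

lemma sq_coeff_lower:
  assumes "0 < \<delta>" "\<And>i j. i \<in> {1..n} \<Longrightarrow> j \<in> {1..n} \<Longrightarrow> i \<noteq> j \<Longrightarrow> \<bar>t i j\<bar> \<le> \<delta> / 2"
    and "\<And>i. i \<in> {1..n} \<Longrightarrow> 2 * real n * \<delta> \<le> t i i"
    and ij: "i \<in> {1..n}" "j \<in> {1..n}" "i \<noteq> j \<or> \<sigma>"
  shows "\<delta> / 8 \<le> sq_coeff n \<delta> t i j \<sigma>"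
proof (cases "i = j")
  case True
  define x where "x = real n * \<delta>"
  have "x \<ge> 0" using assms(1) by (simp add: x_def)
  moreover have "sq_coeff n \<delta> t i j \<sigma> = (\<delta> + (t i i - x)) / 4"
    using True ij(3) by (simp add: sq_coeff_def x_def)
  moreover have "2 * x \<le> t i i" using assms(3)[OF ij(1)] by (simp add: x_def)
  moreover note \<open>0 < \<delta>\<close>
  ultimately have "0 \<le> x" "sq_coeff n \<delta> t i j \<sigma> * 4 = \<delta> + t i i - x" "2 * x \<le> t i i" "0 < \<delta>" by simp_all
  then have "\<delta> \<le> sq_coeff n \<delta> t i j \<sigma> * 4" by simp
  with \<open>0 < \<delta>\<close> show ?thesis by simp
next
  case False
  then show ?thesis using assms(2)[OF ij(1,2) False] unfolding sq_coeff_def by auto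
qed

lemma sum_sq_index: "(\<Sum>k\<in>sq_index n. f k) = (\<Sum>i\<in>{1..n}. \<Sum>j\<in>{1..n}. f (i, j, True) + f (i, j, False))"
  by (simp add: sq_index_def sum.cartesian_product' UNIV_bool add.commute)

lemma sq_factor_sum:
  fixes \<psi> :: "nat \<Rightarrow> 'a::real_inner"
  assumes d: "0 < \<delta>" and off: "\<And>i j. i \<in> {1..n} \<Longrightarrow> j \<in> {1..n} \<Longrightarrow> i \<noteq> j \<Longrightarrow> \<bar>t i j\<bar> \<le> \<delta> / 2"
    and dia: "\<And>i. i \<in> {1..n} \<Longrightarrow> 2 * real n * \<delta> \<le> t i i"
    and sym: "\<And>i j. t i j = t j i"
  shows "(\<Sum>k\<in>sq_index n. (sq_factor n \<delta> t \<psi> k \<bullet> a) * (sq_factor n \<delta> t \<psi> k \<bullet> b)) =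
    (\<Sum>i\<in>{1..n}. \<Sum>j\<in>{1..n}. t i j * (\<psi> i \<bullet> a) * (\<psi> j \<bullet> b))"
proof -
  let ?A = "\<lambda>i. \<psi> i \<bullet> a" and ?B = "\<lambda>i. \<psi> i \<bullet> b"
  let ?m = "\<lambda>i j. t i j - (if i = j then real n * \<delta> else 0)"
  have trm: "(sq_factor n \<delta> t \<psi> (i, j, \<sigma>) \<bullet> a) * (sq_factor n \<delta> t \<psi> (i, j, \<sigma>) \<bullet> b) =
      sq_coeff n \<delta> t i j \<sigma> * ((sq_vec \<psi> i j \<sigma> \<bullet> a) * (sq_vec \<psi> i j \<sigma> \<bullet> b))"
    if "i \<in> {1..n}" "j \<in> {1..n}" for i j \<sigma>
  proof (cases "i \<noteq> j \<or> \<sigma>")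
    case True
    have "0 \<le> sq_coeff n \<delta> t i j \<sigma>" using sq_coeff_lower[of \<delta> n t, OF d off dia that True] d by simp
    then show ?thesis by (simp add: sq_factor_def)
  next
    case False then show ?thesis by (simp add: sq_factor_def sq_vec_diag)
  qed
  have "(sq_factor n \<delta> t \<psi> (i, j, True) \<bullet> a) * (sq_factor n \<delta> t \<psi> (i, j, True) \<bullet> b) +
     (sq_factor n \<delta> t \<psi> (i, j, False) \<bullet> a) * (sq_factor n \<delta> t \<psi> (i, j, False) \<bullet> b) =
     \<delta> / 2 * (?A i * ?B i) + \<delta> / 2 * (?A j * ?B j) + ?m i j / 2 * (?A i * ?B j) + ?m i j / 2 * (?A j * ?B i)"
    if ij: "i \<in> {1..n}" "j \<in> {1..n}" for i j
    unfolding trm[OF ij] by (simp add: sq_coeff_def sq_vec_def inner_simps field_simps)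
  then have "(\<Sum>k\<in>sq_index n. (sq_factor n \<delta> t \<psi> k \<bullet> a) * (sq_factor n \<delta> t \<psi> k \<bullet> b)) =
    (\<Sum>i\<in>{1..n}. \<Sum>j\<in>{1..n}. \<delta> / 2 * (?A i * ?B i) + \<delta> / 2 * (?A j * ?B j) + ?m i j / 2 * (?A i * ?B j) + ?m i j / 2 * (?A j * ?B i))"
    unfolding sum_sq_index by simp
  also have "\<dots> = real n * \<delta> * (\<Sum>i\<in>{1..n}. ?A i * ?B i) +
      (\<Sum>i\<in>{1..n}. \<Sum>j\<in>{1..n}. ?m i j * (?A i * ?B j))"
  proof -
    have "(\<Sum>i\<in>{1..n}. \<Sum>j\<in>{1..n}. ?m i j / 2 * (?A j * ?B i)) = (\<Sum>i\<in>{1..n}. \<Sum>j\<in>{1..n}. ?m i j / 2 * (?A i * ?B j))"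
      by (subst sum.swap) (intro sum.cong refl, simp add: sym)
    moreover have "(\<Sum>i\<in>{1..n}. \<Sum>j\<in>{1..n}. \<delta> / 2 * (?A j * ?B j)) = real n * (\<delta> / 2 * (\<Sum>i\<in>{1..n}. ?A i * ?B i))"
      "(\<Sum>i\<in>{1..n}. \<Sum>j\<in>{1..n}. \<delta> / 2 * (?A i * ?B i)) = real n * (\<delta> / 2 * (\<Sum>i\<in>{1..n}. ?A i * ?B i))"
      by (simp_all add: sum_distrib_left)
    moreover have "(\<Sum>i\<in>{1..n}. \<Sum>j\<in>{1..n}. ?m i j * (?A i * ?B j)) =
      (\<Sum>i\<in>{1..n}. \<Sum>j\<in>{1..n}. ?m i j / 2 * (?A i * ?B j)) + (\<Sum>i\<in>{1..n}. \<Sum>j\<in>{1..n}. ?m i j / 2 * (?A i * ?B j))"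
      unfolding sum.distrib[symmetric] by (intro sum.cong refl) simp
    moreover have "real n * (\<delta> / 2 * (\<Sum>i\<in>{1..n}. ?A i * ?B i)) = real n * \<delta> * (\<Sum>i\<in>{1..n}. ?A i * ?B i) / 2"
      by simp
    ultimately show ?thesis unfolding sum.distrib by linarith
  qed
  also have "(\<Sum>i\<in>{1..n}. \<Sum>j\<in>{1..n}. ?m i j * (?A i * ?B j)) =
     (\<Sum>i\<in>{1..n}. \<Sum>j\<in>{1..n}. t i j * ?A i * ?B j) - real n * \<delta> * (\<Sum>i\<in>{1..n}. ?A i * ?B i)"
  proof -
    have "(\<Sum>j\<in>{1..n}. ?m i j * (?A i * ?B j)) = (\<Sum>j\<in>{1..n}. t i j * ?A i * ?B j) - real n * \<delta> * (?A i * ?B i)"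
      if "i \<in> {1..n}" for i
    proof -
      have "(\<Sum>j\<in>{1..n}. ?m i j * (?A i * ?B j)) =
        (\<Sum>j\<in>{1..n}. t i j * ?A i * ?B j - (if i = j then real n * \<delta> * (?A i * ?B i) else 0))"
        by (intro sum.cong refl) (auto simp: algebra_simps)
      also have "\<dots> = (\<Sum>j\<in>{1..n}. t i j * ?A i * ?B j) - real n * \<delta> * (?A i * ?B i)"
        using that by (simp add: sum_subtractf)
      finally show ?thesis .
    qed
    then show ?thesis by (simp add: sum_subtractf sum_distrib_left)
  qed
  finally show ?thesis by simp
qed

text \<open>Each of the at most \<open>2 * n\<^sup>2\<close> differences is estimated by the change of its coefficient and the change of its vector.  All errors
have size \<open>\<delta> * D\<^sup>2\<close>, or \<open>t' i i * D\<^sup>2\<close> on the tangential diagonal, and the tangential trace dominates both.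
For the radial pair \<open>(n, n)\<close> the coefficient changes by the possibly large \<open>E * D\<close>, but the radial vectors have
length at most \<open>1 / l\<close>, which compensates.\<close>

lemma sq_factor_close:
  fixes \<psi> \<psi>' :: "nat \<Rightarrow> 'a::real_inner"
  assumes n: "2 \<le> n" and d: "0 < \<delta>" and D: "0 \<le> D" and l: "1 \<le> l"
    and off: "\<And>i j. i \<in> {1..n} \<Longrightarrow> j \<in> {1..n} \<Longrightarrow> i \<noteq> j \<Longrightarrow> \<bar>t i j\<bar> \<le> \<delta> / 2"
      "\<And>i j. i \<in> {1..n} \<Longrightarrow> j \<in> {1..n} \<Longrightarrow> i \<noteq> j \<Longrightarrow> \<bar>t' i j\<bar> \<le> \<delta> / 2"
    and dia: "\<And>i. i \<in> {1..n} \<Longrightarrow> 2 * real n * \<delta> \<le> t i i" "\<And>i. i \<in> {1..n} \<Longrightarrow> 2 * real n * \<delta> \<le> t' i i"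
    and nn: "t' n n \<le> c" "\<bar>t n n - t' n n\<bar> \<le> E * D" "2 * E \<le> \<delta> * l" "18 * c \<le> \<delta> * l\<^sup>2" "0 \<le> E"
    and lip: "\<And>i j. i \<in> {1..n} \<Longrightarrow> j \<in> {1..n} \<Longrightarrow> (i, j) \<noteq> (n, n) \<Longrightarrow> \<bar>t i j - t' i j\<bar> \<le> 5 * \<delta> * D"
    and \<psi>: "\<And>i. i \<in> {1..n} \<Longrightarrow> norm (\<psi> i) \<le> 1" "norm (\<psi> n) \<le> 1 / l"
      "\<And>i. i \<in> {1..<n} \<Longrightarrow> norm (\<psi> i - \<psi>' i) \<le> 2 * D" "norm (\<psi> n - \<psi>' n) \<le> 3 * D / l"
  shows "(\<Sum>k\<in>sq_index n. (norm (sq_factor n \<delta> t \<psi> k - sq_factor n \<delta> t' \<psi>' k))\<^sup>2)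
    \<le> 128 * real n * D\<^sup>2 * (\<Sum>i\<in>{1..<n}. t' i i)"
proof -
  let ?d = "\<lambda>k. (norm (sq_factor n \<delta> t \<psi> k - sq_factor n \<delta> t' \<psi>' k))\<^sup>2"
  define S where "S = (\<Sum>i\<in>{1..<n}. t' i i)"
  have tp: "0 \<le> t' i i" if "i \<in> {1..n}" for i
    using dia(2)[OF that] d order_trans[of 0 "2 * real n * \<delta>"] by simp
  have dS: "2 * real n * \<delta> \<le> S"
  proof -
    have "t' 1 1 \<le> S" unfolding S_def using n tp by (intro member_le_sum) auto
    then show ?thesis using dia(2)[of 1] n by auto
  qed
  have l1: "3 * D / l \<le> 3 * D" using mult_left_mono[OF l, of D] D l by (simp add: divide_le_eq)
  have bound: "?d (i, j, \<sigma>) \<le> 120 * \<delta> * D\<^sup>2 + (if i = j \<and> i \<noteq> n \<and> \<sigma> then 8 * t' i i * D\<^sup>2 else 0)"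
    if ij: "i \<in> {1..n}" "j \<in> {1..n}" for i j \<sigma>
  proof (cases "i = j \<and> \<not> \<sigma>")
    case True
    then show ?thesis using d by (simp add: sq_factor_def sq_vec_diag)
  next
    case False
    define r where "r = sq_coeff n \<delta> t i j \<sigma>"
    define r' where "r' = sq_coeff n \<delta> t' i j \<sigma>"
    have r: "\<delta> / 8 \<le> r" and r': "\<delta> / 8 \<le> r'"
      using sq_coeff_lower[of \<delta> n t i j \<sigma>] sq_coeff_lower[of \<delta> n t' i j \<sigma>] d off dia ij False
      by (auto simp: r_def r'_def)
    have rr: "r - r' = (if \<sigma> then 1 else -1) * (t i j - t' i j) / 4"
      by (simp add: r_def r'_def sq_coeff_def field_simps)
    have base: "?d (i, j, \<sigma>) \<le> 2 * ((r - r')\<^sup>2 / r') * (norm (sq_vec \<psi> i j \<sigma>))\<^sup>2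
        + 2 * r' * (norm (sq_vec \<psi> i j \<sigma> - sq_vec \<psi>' i j \<sigma>))\<^sup>2"
      unfolding sq_factor_def prod.case r_def[symmetric] r'_def[symmetric]
      by (rule norm_square_diff_scaled) (use r r' d in auto)
    have v: "norm (sq_vec \<psi> i j \<sigma>) \<le> norm (\<psi> i) + norm (\<psi> j)"
      unfolding sq_vec_def by (auto intro: norm_triangle_ineq norm_triangle_ineq4)
    have "sq_vec \<psi> i j \<sigma> - sq_vec \<psi>' i j \<sigma> =
        (if \<sigma> then (\<psi> i - \<psi>' i) + (\<psi> j - \<psi>' j) else (\<psi> i - \<psi>' i) - (\<psi> j - \<psi>' j))"
      by (simp add: sq_vec_def algebra_simps)
    then have dv: "norm (sq_vec \<psi> i j \<sigma> - sq_vec \<psi>' i j \<sigma>) \<le> norm (\<psi> i - \<psi>' i) + norm (\<psi> j - \<psi>' j)"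
      using norm_triangle_ineq[of "\<psi> i - \<psi>' i" "\<psi> j - \<psi>' j"]
        norm_triangle_ineq4[of "\<psi> i - \<psi>' i" "\<psi> j - \<psi>' j"] by (cases \<sigma>) simp_all
    have est: "2 * ((r - r')\<^sup>2 / r') * (norm (sq_vec \<psi> i j \<sigma>))\<^sup>2 + 2 * r' * (norm (sq_vec \<psi> i j \<sigma> - sq_vec \<psi>' i j \<sigma>))\<^sup>2
       \<le> 2 * (a\<^sup>2 / (\<delta> / 8)) * b\<^sup>2 + 2 * g * h\<^sup>2"
      if "\<bar>r - r'\<bar> \<le> a" "norm (sq_vec \<psi> i j \<sigma>) \<le> b" "r' \<le> g" "norm (sq_vec \<psi> i j \<sigma> - sq_vec \<psi>' i j \<sigma>) \<le> h" for a b g h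
    proof (intro add_mono mult_mono power_mono)
      have "(r - r')\<^sup>2 \<le> a\<^sup>2" using that(1) by (metis abs_ge_zero power2_abs power_mono)
      then show "(r - r')\<^sup>2 / r' \<le> a\<^sup>2 / (\<delta> / 8)" using r' d by (intro frac_le) auto
    qed (use that r' d in \<open>auto intro: order_trans[OF norm_ge_zero]\<close>)
    show ?thesis
    proof (cases "i = n \<and> j = n")
      case True
      then have s: "\<sigma>" using False by simp
      have "\<bar>r - r'\<bar> = \<bar>t n n - t' n n\<bar> / 4" using rr True s by (simp only: abs_divide) simp
      then have "\<bar>r - r'\<bar> \<le> E * D / 4" using nn(2) by simp
      moreover have "norm (sq_vec \<psi> i j \<sigma>) \<le> 2 / l" using v \<psi>(2) True by simp
      moreover have "r' \<le> c / 4"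
      proof -
        have "\<delta> \<le> real n * \<delta>" using n d by simp
        then show ?thesis using nn(1) True s by (simp add: r'_def sq_coeff_def)
      qed
      moreover have "norm (sq_vec \<psi> i j \<sigma> - sq_vec \<psi>' i j \<sigma>) \<le> 6 * D / l" using dv \<psi>(4) True by simp
      ultimately have "?d (i, j, \<sigma>) \<le> 2 * ((E * D / 4)\<^sup>2 / (\<delta> / 8)) * (2 / l)\<^sup>2 + 2 * (c / 4) * (6 * D / l)\<^sup>2"
        using base est[of "E * D / 4" "2 / l" "c / 4" "6 * D / l"] by linarith
      also have "2 * ((E * D / 4)\<^sup>2 / (\<delta> / 8)) * (2 / l)\<^sup>2 = (4 * E\<^sup>2) * D\<^sup>2 / (\<delta> * l\<^sup>2)"
        using d l by (simp add: field_simps power2_eq_square)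
      also have "\<dots> \<le> (\<delta>\<^sup>2 * l\<^sup>2) * D\<^sup>2 / (\<delta> * l\<^sup>2)"
      proof -
        have "(2 * E)\<^sup>2 \<le> (\<delta> * l)\<^sup>2" using nn(3,5) by (intro power_mono) auto
        then show ?thesis using d l by (intro divide_right_mono mult_right_mono) (auto simp: power_mult_distrib)
      qed
      also have "\<dots> = \<delta> * D\<^sup>2" using d l by (simp add: power2_eq_square)
      also have "2 * (c / 4) * (6 * D / l)\<^sup>2 = (18 * c) * (D\<^sup>2 / l\<^sup>2)" by (simp add: power2_eq_square field_simps)
      also have "\<dots> \<le> (\<delta> * l\<^sup>2) * (D\<^sup>2 / l\<^sup>2)" using nn(4) by (intro mult_right_mono) auto
      also have "\<dots> = \<delta> * D\<^sup>2" using l by simp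
      finally have "?d (i, j, \<sigma>) \<le> 2 * (\<delta> * D\<^sup>2)" by simp
      also have "\<dots> \<le> 120 * \<delta> * D\<^sup>2" using d by simp
      finally show ?thesis using True by simp
    next
      case notn: False
      have "\<bar>r - r'\<bar> = \<bar>t i j - t' i j\<bar> / 4" unfolding rr by (simp add: abs_mult)
      then have a: "\<bar>r - r'\<bar> \<le> 5 * \<delta> * D / 4" using lip[OF ij] notn by auto
      have b: "norm (sq_vec \<psi> i j \<sigma>) \<le> 2" using v \<psi>(1)[OF ij(1)] \<psi>(1)[OF ij(2)] by simp
      have A: "2 * ((5 * \<delta> * D / 4)\<^sup>2 / (\<delta> / 8)) * 2\<^sup>2 = 100 * \<delta> * D\<^sup>2"
        using d by (simp add: power2_eq_square field_simps)
      show ?thesis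
      proof (cases "i = j")
        case True
        then have s: "\<sigma>" and i: "i \<in> {1..<n}" using False notn ij by auto
        have "r' \<le> t' i i / 4"
        proof -
          have "\<delta> \<le> real n * \<delta>" using n d by simp
          then show ?thesis using True s by (simp add: r'_def sq_coeff_def)
        qed
        moreover have "norm (sq_vec \<psi> i j \<sigma> - sq_vec \<psi>' i j \<sigma>) \<le> 4 * D" using dv \<psi>(3)[OF i] True by simp
        ultimately have "?d (i, j, \<sigma>) \<le> 100 * \<delta> * D\<^sup>2 + 2 * (t' i i / 4) * (4 * D)\<^sup>2"
          unfolding A[symmetric] by (intro order_trans[OF base est[OF a b]])
        also have "\<dots> \<le> 120 * \<delta> * D\<^sup>2 + 8 * t' i i * D\<^sup>2"
          using d D by (simp add: power2_eq_square)
        finally show ?thesis using True s i by simp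
      next
        case ne: False
        have "r' \<le> 3 * \<delta> / 8" using off(2)[OF ij ne] ne by (auto simp: r'_def sq_coeff_def)
        moreover have "norm (sq_vec \<psi> i j \<sigma> - sq_vec \<psi>' i j \<sigma>) \<le> 5 * D"
        proof -
          have "norm (\<psi> k - \<psi>' k) \<le> (if k = n then 3 * D else 2 * D)" if "k \<in> {1..n}" for k
            using \<psi>(3)[of k] \<psi>(4) l1 that by auto
          then show ?thesis using dv ij ne D by (smt (verit))
        qed
        ultimately have "?d (i, j, \<sigma>) \<le> 100 * \<delta> * D\<^sup>2 + 2 * (3 * \<delta> / 8) * (5 * D)\<^sup>2"
          unfolding A[symmetric] by (intro order_trans[OF base est[OF a b]])
        also have "\<dots> \<le> 120 * \<delta> * D\<^sup>2" using d D by (simp add: power2_eq_square)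
        finally show ?thesis using ne by simp
      qed
    qed
  qed
  have "(\<Sum>k\<in>sq_index n. ?d k) \<le> (\<Sum>i\<in>{1..n}. \<Sum>j\<in>{1..n}. 240 * \<delta> * D\<^sup>2 + (if i = j then if i \<noteq> n then 8 * t' i i * D\<^sup>2 else 0 else 0))"
    unfolding sum_sq_index
  proof (intro sum_mono)
    fix i j assume ij: "i \<in> {1..n}" "j \<in> {1..n}"
    show "?d (i, j, True) + ?d (i, j, False) \<le> 240 * \<delta> * D\<^sup>2 + (if i = j then if i \<noteq> n then 8 * t' i i * D\<^sup>2 else 0 else 0)"
    proof -
      have "?d (i, j, True) \<le> 120 * \<delta> * D\<^sup>2 + (if i = j then if i \<noteq> n then 8 * t' i i * D\<^sup>2 else 0 else 0)"
        by (rule order_trans[OF bound[OF ij]]) simp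
      moreover have "?d (i, j, False) \<le> 120 * \<delta> * D\<^sup>2"
        by (rule order_trans[OF bound[OF ij]]) simp
      ultimately show ?thesis by simp
    qed
  qed
  also have "\<dots> = real n * real n * (240 * \<delta> * D\<^sup>2) + (\<Sum>i\<in>{1..n}. if i \<noteq> n then 8 * t' i i * D\<^sup>2 else 0)"
    by (simp add: sum.distrib)
  finally have total: "(\<Sum>k\<in>sq_index n. ?d k) \<le> real n * real n * (240 * \<delta> * D\<^sup>2) +
      (\<Sum>i\<in>{1..n}. if i \<noteq> n then 8 * t' i i * D\<^sup>2 else 0)" .
  have "(\<Sum>i\<in>{1..n}. if i \<noteq> n then 8 * t' i i * D\<^sup>2 else 0) = (\<Sum>i\<in>{1..<n}. 8 * t' i i * D\<^sup>2)"
    by (rule sum.mono_neutral_cong_right) auto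
  also have "\<dots> = 8 * (D\<^sup>2 * S)" by (simp add: S_def sum_distrib_left mult_ac)
  also have "\<dots> \<le> 8 * real n * (D\<^sup>2 * S)"
  proof -
    have "0 \<le> D\<^sup>2 * S" using dS d order_trans[of 0 "2 * real n * \<delta>" S] by simp
    then show ?thesis using n by (intro mult_right_mono) auto
  qed
  also have "\<dots> = 8 * real n * D\<^sup>2 * S" by simp
  finally have 1: "(\<Sum>i\<in>{1..n}. if i \<noteq> n then 8 * t' i i * D\<^sup>2 else 0) \<le> 8 * real n * D\<^sup>2 * S" .
  have "real n * real n * (240 * \<delta> * D\<^sup>2) = (120 * real n * D\<^sup>2) * (2 * real n * \<delta>)" by simp
  also have "\<dots> \<le> (120 * real n * D\<^sup>2) * S" using dS by (intro mult_left_mono) auto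
  finally have 2: "real n * real n * (240 * \<delta> * D\<^sup>2) \<le> (120 * real n * D\<^sup>2) * S" .
  have "(120 * real n * D\<^sup>2) * S + 8 * real n * D\<^sup>2 * S = 128 * real n * D\<^sup>2 * S" by simp
  then show ?thesis using total 1 2 unfolding S_def by linarith
qed

section \<open>Nearby decompositions at nearby gradients\<close>

lemma orthonormal_frame_expand:
  fixes \<phi> :: "nat \<Rightarrow> real^'n"
  assumes on: "orthonormal_frame \<phi>"
  shows "(\<Sum>i\<in>{1..CARD('n)}. (\<phi> i \<bullet> a) *\<^sub>R \<phi> i) = a"
proof -
  let ?I = "{1..CARD('n)}"
  have o: "\<phi> i \<bullet> \<phi> j = (if i = j then 1 else 0)" if "i \<in> ?I" "j \<in> ?I" for i j
    using orthonormal_frame_inner[OF on that] .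
  have inj: "inj_on \<phi> ?I"
    by (rule inj_onI) (metis o zero_neq_one)
  have po: "pairwise orthogonal (\<phi> ` ?I)"
    unfolding pairwise_def orthogonal_def using o by auto
  have n1: "norm b = 1" if "b \<in> \<phi> ` ?I" for b
    using that orthonormal_frame_norm[OF on] by auto
  then have "0 \<notin> \<phi> ` ?I" by (metis norm_zero zero_neq_one)
  then have "independent (\<phi> ` ?I)" using po by (intro pairwise_orthogonal_independent)
  then have "dim (\<phi> ` ?I) = DIM(real^'n)"
    using inj by (simp add: dim_eq_card_independent card_image)
  then have "span (\<phi> ` ?I) = UNIV" using dim_eq_full by blast
  then have "(\<Sum>b\<in>\<phi> ` ?I. (a \<bullet> b) *\<^sub>R b) = a"
    by (intro orthonormal_basis_expand) (use po n1 in auto)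
  then show ?thesis unfolding sum.reindex[OF inj] o_def by (simp only: inner_commute)
qed

lemma orthonormal_frame_parseval:
  fixes \<phi> :: "nat \<Rightarrow> real^'n"
  assumes on: "orthonormal_frame \<phi>"
  shows "(\<Sum>i\<in>{1..CARD('n)}. (\<phi> i \<bullet> a)\<^sup>2) = (norm a)\<^sup>2"
proof -
  have "(norm a)\<^sup>2 = a \<bullet> (\<Sum>i\<in>{1..CARD('n)}. (\<phi> i \<bullet> a) *\<^sub>R \<phi> i)"
    by (simp only: orthonormal_frame_expand[OF on] power2_norm_eq_inner)
  also have "\<dots> = (\<Sum>i\<in>{1..CARD('n)}. (\<phi> i \<bullet> a)\<^sup>2)"
    by (simp add: inner_sum_right power2_eq_square inner_commute)
  finally show ?thesis by simp
qed

lemma norm_rotate_frame_diff: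
  fixes \<phi> :: "nat \<Rightarrow> real^'n"
  assumes on: "orthonormal_frame \<phi>" and n: "CARD('n) \<ge> 2" and i: "i \<in> {1..CARD('n)}"
  shows "norm (\<phi> i - rotate_frame \<phi> 1 (CARD('n)) s i) \<le> \<bar>s\<bar>"
proof -
  let ?n = "CARD('n)"
  have o: "\<phi> 1 \<bullet> \<phi> 1 = 1" "\<phi> ?n \<bullet> \<phi> ?n = 1" "\<phi> 1 \<bullet> \<phi> ?n = 0" "\<phi> ?n \<bullet> \<phi> 1 = 0"
    using orthonormal_frame_inner[OF on, of 1 1] orthonormal_frame_inner[OF on, of ?n ?n]
      orthonormal_frame_inner[OF on, of 1 ?n] orthonormal_frame_inner[OF on, of ?n 1] n by auto
  have "(sin (s / 2))\<^sup>2 \<le> (s / 2)\<^sup>2"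
    using abs_sin_x_le_abs_x[of "s / 2"] by (metis abs_le_square_iff)
  moreover have "cos s = 1 - 2 * (sin (s / 2))\<^sup>2" using cos_double_sin[of "s / 2"] by simp
  ultimately have cs: "2 - 2 * cos s \<le> s\<^sup>2" by (simp add: power_divide)
  have sc: "sin s * sin s = 1 - cos s * cos s" by (simp add: sin_squared_eq flip: power2_eq_square)
  have "(norm (\<phi> i - rotate_frame \<phi> 1 ?n s i))\<^sup>2 \<le> s\<^sup>2"
  proof -
    consider "i = 1" | "i = ?n" | "i \<noteq> 1" "i \<noteq> ?n" by blast
    then show ?thesis
    proof cases
      case 1
      have "(norm (\<phi> i - rotate_frame \<phi> 1 ?n s i))\<^sup>2 = 2 - 2 * cos s"
        unfolding power2_norm_eq_inner using 1 o sc by (simp add: rotate_frame_def inner_simps algebra_simps)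
      then show ?thesis using cs by simp
    next
      case 2
      have "(norm (\<phi> i - rotate_frame \<phi> 1 ?n s i))\<^sup>2 = 2 - 2 * cos s"
        unfolding power2_norm_eq_inner using 2 n o sc by (simp add: rotate_frame_def inner_simps algebra_simps)
      then show ?thesis using cs by simp
    next
      case 3 then show ?thesis by (simp add: rotate_frame_def)
    qed
  qed
  then show ?thesis using abs_le_square_iff[of "norm (\<phi> i - rotate_frame \<phi> 1 ?n s i)" s] by simp
qed

lemma parallelogram_half:
  fixes w z :: "'a::real_inner"
  shows "2 * (norm ((w + z) /\<^sub>R 2))\<^sup>2 + (norm (w - z))\<^sup>2 / 2 = (norm w)\<^sup>2 + (norm z)\<^sup>2"
  unfolding power2_norm_eq_inner by (simp add: inner_simps inner_commute field_simps)

lemma norm_lift_diff: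
  fixes p q :: "'a::real_normed_vector"
  shows "\<bar>norm (p, -1::real) - norm (q, -1::real)\<bar> \<le> norm (p - q)"
  using norm_triangle_ineq3[of "(p, -1::real)" "(q, -1::real)"] by (simp add: norm_Pair)

context anisotropy_bounds
begin

text \<open>The frame dual to the rescaling of the matrix: it gives back the original form.\<close>

definition scaled_frame :: "real^'n \<Rightarrow> (nat \<Rightarrow> real^'n) \<Rightarrow> nat \<Rightarrow> real^'n" where
  "scaled_frame q \<phi> i = (if i = CARD('n) then \<phi> i /\<^sub>R norm (q, -1::real) else \<phi> i)"

lemma aniso_tau_scaled_frame:
  assumes "orthonormal_frame \<phi>"
  shows "(\<Sum>i\<in>{1..CARD('n)}. \<Sum>j\<in>{1..CARD('n)}. scaled_tau q \<phi> i j * (scaled_frame q \<phi> i \<bullet> a) * (scaled_frame q \<phi> j \<bullet> b))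
    = aniso_tau F q a b"
proof -
  have P: "norm (q, -1::real) \<noteq> 0" using norm_lift_facts(1)[of q] by linarith
  have "aniso_tau F q a b = aniso_tau F q (\<Sum>i\<in>{1..CARD('n)}. (\<phi> i \<bullet> a) *\<^sub>R \<phi> i) (\<Sum>j\<in>{1..CARD('n)}. (\<phi> j \<bullet> b) *\<^sub>R \<phi> j)"
    by (simp only: orthonormal_frame_expand[OF assms])
  also have "\<dots> = (\<Sum>i\<in>{1..CARD('n)}. \<Sum>j\<in>{1..CARD('n)}. (\<phi> i \<bullet> a) * (\<phi> j \<bullet> b) * aniso_tau F q (\<phi> i) (\<phi> j))"
    by (simp add: bilinear_sum[OF aniso_tau_bilinear] sum.cartesian_product' aniso_tau_simps mult_ac)
  also have "\<dots> = (\<Sum>i\<in>{1..CARD('n)}. \<Sum>j\<in>{1..CARD('n)}. scaled_tau q \<phi> i j * (scaled_frame q \<phi> i \<bullet> a) * (scaled_frame q \<phi> j \<bullet> b))"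
    by (intro sum.cong refl) (use P in \<open>simp add: scaled_tau_def scaled_frame_def field_simps\<close>)
  finally show ?thesis by simp
qed

text \<open>The diffusion matrices at two gradients of size at least \<open>l\<close> with relative distance \<open>D\<close> have decompositions into the same
number of rank-one forms with quadratically small mutual distance.  The constant depends on the dimension alone; the
sizes of \<open>c3\<close> and \<open>C6\<close> only affect the threshold \<open>l0\<close>.\<close>

lemma coupled_decompositions:
  assumes ratio: "c2 \<le> c1 / (4 * real CARD('n))"
  obtains l0 where "1 \<le> l0"
    "\<And>p q l D. l0 \<le> l \<Longrightarrow> l \<le> norm p \<Longrightarrow> l \<le> norm q \<Longrightarrow> norm (p - q) \<le> D * l \<Longrightarrow> 0 \<le> D \<Longrightarrow>
       128 * real CARD('n) * D\<^sup>2 \<le> 1 \<Longrightarrow>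
       \<exists>w z :: nat \<times> nat \<times> bool \<Rightarrow> real^'n.
         (\<forall>a b. (\<Sum>k\<in>sq_index (CARD('n)). (w k \<bullet> a) * (w k \<bullet> b)) = aniso_tau F p a b) \<and>
         (\<forall>a b. (\<Sum>k\<in>sq_index (CARD('n)). (z k \<bullet> a) * (z k \<bullet> b)) = aniso_tau F q a b) \<and>
         (\<Sum>k\<in>sq_index (CARD('n)). (norm (w k - z k))\<^sup>2) \<le>
           512 * real CARD('n) * D\<^sup>2 * (\<Sum>k\<in>sq_index (CARD('n)). (norm ((w k + z k) /\<^sub>R 2))\<^sup>2)"
proof -
  let ?n = "CARD('n)"
  \<comment> \<open>This choice turns the hypothesis on \<open>c2 / c1\<close> into diagonal dominance: diagonal entries at least \<open>2 * n * \<delta>\<close>, the others at most \<open>\<delta> / 2\<close>.\<close>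
  define \<delta> where "\<delta> = c1 / (2 * real ?n)"
  define E where "E = C6 + 2 * c3 + 8 * c2"
  \<comment> \<open>Each summand pays for one appearance of the uncontrolled constants \<open>c3\<close> and \<open>C6\<close>.\<close>
  define l0 where "l0 = 2 + 2 * c3 / c2 + 2 * E / \<delta> + 18 * c3 / \<delta>"
  have \<delta>: "\<delta> > 0" "c2 \<le> \<delta> / 2" "2 * real ?n * \<delta> = c1"
    using pos ratio n2 by (simp_all add: \<delta>_def)
  have E: "E > 0" using pos by (simp add: E_def)
  have parts: "0 \<le> 2 * c3 / c2" "0 \<le> 2 * E / \<delta>" "0 \<le> 18 * c3 / \<delta>" using pos E \<delta> by simp_all
  have l0: "1 \<le> l0" using parts by (simp add: l0_def)
  show ?thesis
  proof (rule that[OF l0])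
    fix p q :: "real^'n" and l D :: real
    assume l: "l0 \<le> l" and p: "l \<le> norm p" and q: "l \<le> norm q" and d: "norm (p - q) \<le> D * l"
      and D: "0 \<le> D" "128 * real ?n * D\<^sup>2 \<le> 1"
    have l2: "2 \<le> l" using l parts unfolding l0_def by linarith
    have lc: "2 * c3 \<le> c2 * l" "2 * E \<le> \<delta> * l" "18 * c3 \<le> \<delta> * l"
    proof -
      have "2 * c3 / c2 \<le> l" "2 * E / \<delta> \<le> l" "18 * c3 / \<delta> \<le> l" using l parts unfolding l0_def by linarith+
      then show "2 * c3 \<le> c2 * l" "2 * E \<le> \<delta> * l" "18 * c3 \<le> \<delta> * l"
        using pos \<delta> by (simp_all add: divide_le_eq mult.commute)
    qed
    have "\<delta> * l \<le> \<delta> * l\<^sup>2" using \<delta> l2 by (intro mult_left_mono) (auto simp: power2_eq_square)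
    then have lc4: "18 * c3 \<le> \<delta> * l\<^sup>2" using lc by linarith
    have "D\<^sup>2 \<le> 1"
    proof -
      have "1 * D\<^sup>2 \<le> 128 * real ?n * D\<^sup>2" using n2 by (intro mult_right_mono) auto
      then show ?thesis using D by linarith
    qed
    then have D1: "D \<le> 1" using D by (simp add: power_le_one_iff)
    have nz: "p \<noteq> 0" "q \<noteq> 0" using p q l2 by auto
    obtain \<phi> s where ad: "adapted_frame p \<phi>" "adapted_frame q (rotate_frame \<phi> 1 ?n s)" and s: "0 \<le> s" "s \<le> 2 * D"
      using adapted_frames_in_plane[OF n2 p q _ d D1] l2 by auto
    define \<phi>' where "\<phi>' = rotate_frame \<phi> 1 ?n s"
    have on: "orthonormal_frame \<phi>" "orthonormal_frame \<phi>'" using ad by (auto simp: adapted_frame_def \<phi>'_def)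
    define t where "t = scaled_tau p \<phi>"
    define t' where "t' = scaled_tau q \<phi>'"
    define \<psi> where "\<psi> = scaled_frame p \<phi>"
    define \<psi>' where "\<psi>' = scaled_frame q \<phi>'"
    note tb = scaled_tau_bounds[OF ad(1) nz(1), folded t_def]
    note tb' = scaled_tau_bounds[OF ad(2) nz(2), folded \<phi>'_def, folded t'_def]
    note lip = scaled_tau_lipschitz[OF ad s _ lc(1) p q d, folded \<phi>'_def, folded t_def t'_def]
    have off: "\<bar>t i j\<bar> \<le> \<delta> / 2" "\<bar>t' i j\<bar> \<le> \<delta> / 2" if "i \<in> {1..?n}" "j \<in> {1..?n}" "i \<noteq> j" for i j
      using tb(3)[OF that] tb'(3)[OF that] \<delta>(2) by linarith+
    have dia: "2 * real ?n * \<delta> \<le> t i i" "2 * real ?n * \<delta> \<le> t' i i" if "i \<in> {1..?n}" for i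
      unfolding \<delta>(3) using tb(1)[OF that that] tb'(1)[OF that that] by auto
    have sym: "t i j = t j i" "t' i j = t' j i" for i j
      by (simp_all add: t_def t'_def scaled_tau_symmetric)
    define w where "w = sq_factor ?n \<delta> t \<psi>"
    define z where "z = sq_factor ?n \<delta> t' \<psi>'"
    have w: "(\<Sum>k\<in>sq_index ?n. (w k \<bullet> a) * (w k \<bullet> b)) = aniso_tau F p a b" for a b
    proof -
      have "(\<Sum>k\<in>sq_index ?n. (w k \<bullet> a) * (w k \<bullet> b)) =
          (\<Sum>i\<in>{1..?n}. \<Sum>j\<in>{1..?n}. t i j * (\<psi> i \<bullet> a) * (\<psi> j \<bullet> b))"
        unfolding w_def by (rule sq_factor_sum) (use \<delta> off dia sym in auto)
      then show ?thesis using aniso_tau_scaled_frame[OF on(1)] by (simp add: t_def \<psi>_def)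
    qed
    have z: "(\<Sum>k\<in>sq_index ?n. (z k \<bullet> a) * (z k \<bullet> b)) = aniso_tau F q a b" for a b
    proof -
      have "(\<Sum>k\<in>sq_index ?n. (z k \<bullet> a) * (z k \<bullet> b)) =
          (\<Sum>i\<in>{1..?n}. \<Sum>j\<in>{1..?n}. t' i j * (\<psi>' i \<bullet> a) * (\<psi>' j \<bullet> b))"
        unfolding z_def by (rule sq_factor_sum) (use \<delta> off dia sym in auto)
      then show ?thesis using aniso_tau_scaled_frame[OF on(2)] by (simp add: t'_def \<psi>'_def)
    qed
    have Pp: "norm (p, -1::real) \<ge> l" "norm (q, -1::real) \<ge> l"
      using norm_lift_facts(2)[of p] norm_lift_facts(2)[of q] p q by linarith+
    define S where "S = (\<Sum>i\<in>{1..<?n}. t' i i)"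
    have close: "(\<Sum>k\<in>sq_index ?n. (norm (w k - z k))\<^sup>2) \<le> 128 * real ?n * D\<^sup>2 * S"
      unfolding w_def z_def S_def
    proof (rule sq_factor_close[where E=E and c=c3 and l=l])
      show "t' ?n ?n \<le> c3" using tb'(2)[of ?n ?n] n2 by simp
      show "\<bar>t ?n ?n - t' ?n ?n\<bar> \<le> E * D" using lip[of ?n ?n] l2 n2 by (simp add: E_def)
      show "\<bar>t i j - t' i j\<bar> \<le> 5 * \<delta> * D" if "i \<in> {1..?n}" "j \<in> {1..?n}" "(i, j) \<noteq> (?n, ?n)" for i j
      proof -
        have "\<bar>t i j - t' i j\<bar> \<le> 10 * c2 * D" using lip[of i j] l2 that by (auto split: if_splits)
        also have "\<dots> \<le> 5 * \<delta> * D" using \<delta>(2) D by (intro mult_right_mono) auto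
        finally show ?thesis .
      qed
      show "norm (\<psi> i) \<le> 1" if "i \<in> {1..?n}" for i
        using orthonormal_frame_norm[OF on(1) that] Pp l2
        by (auto simp: \<psi>_def scaled_frame_def divide_simps)
      show "norm (\<psi> ?n) \<le> 1 / l"
      proof -
        have "1 / norm (p, -1::real) \<le> 1 / l" using Pp l2 by (intro frac_le) auto
        then show ?thesis
          using orthonormal_frame_norm[OF on(1), of ?n]
          by (simp add: \<psi>_def scaled_frame_def inverse_eq_divide)
      qed
      show "norm (\<psi> i - \<psi>' i) \<le> 2 * D" if "i \<in> {1..<?n}" for i
        using norm_rotate_frame_diff[OF on(1) n2, of i s] that s
        by (simp add: \<psi>_def \<psi>'_def scaled_frame_def \<phi>'_def)
      show "norm (\<psi> ?n - \<psi>' ?n) \<le> 3 * D / l"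
      proof -
        let ?P = "norm (p, -1::real)" and ?Q = "norm (q, -1::real)"
        have "\<psi> ?n - \<psi>' ?n = (\<phi> ?n - \<phi>' ?n) /\<^sub>R ?P + (inverse ?P - inverse ?Q) *\<^sub>R \<phi>' ?n"
          by (simp add: \<psi>_def \<psi>'_def scaled_frame_def algebra_simps)
        then have "norm (\<psi> ?n - \<psi>' ?n) \<le> norm ((\<phi> ?n - \<phi>' ?n) /\<^sub>R ?P) + norm ((inverse ?P - inverse ?Q) *\<^sub>R \<phi>' ?n)"
          by (simp only: norm_triangle_ineq)
        also have "\<dots> = norm (\<phi> ?n - \<phi>' ?n) / ?P + \<bar>inverse ?P - inverse ?Q\<bar>"
          using orthonormal_frame_norm[OF on(2), of ?n] by (simp add: divide_inverse mult.commute)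
        also have "\<dots> \<le> 2 * D / l + D / l"
        proof (rule add_mono)
          have "norm (\<phi> ?n - \<phi>' ?n) \<le> 2 * D"
            using norm_rotate_frame_diff[OF on(1) n2, of ?n s] s by (simp add: \<phi>'_def)
          then show "norm (\<phi> ?n - \<phi>' ?n) / ?P \<le> 2 * D / l" using Pp l2 D by (intro frac_le) auto
          have "?P > 0" "?Q > 0" using Pp l2 by linarith+
          then have "inverse ?P - inverse ?Q = (?Q - ?P) / (?P * ?Q)" by (simp add: field_simps)
          also have "\<bar>\<dots>\<bar> = \<bar>?P - ?Q\<bar> / (?P * ?Q)" by (simp add: abs_divide abs_mult abs_minus_commute)
          also have "\<dots> \<le> (D * l) / (l * l)"
            using norm_lift_diff[of p q] d Pp l2 D by (intro frac_le mult_mono) auto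
          also have "\<dots> = D / l" using l2 by simp
          finally show "\<bar>inverse ?P - inverse ?Q\<bar> \<le> D / l" .
        qed
        also have "\<dots> = 3 * D / l" by (simp add: add_divide_distrib[symmetric])
        finally show ?thesis .
      qed
    qed (use n2 \<delta> D l2 off dia tb' lc lc4 E in auto)
    \<comment> \<open>\<open>S\<close> is part of the trace of the diffusion matrix at \<open>q\<close>, and the trace is the sum of the squared lengths of the \<open>z k\<close>.\<close>
    have trace: "S \<le> (\<Sum>k\<in>sq_index ?n. (norm (z k))\<^sup>2)"
    proof -
      have "S = (\<Sum>i\<in>{1..<?n}. \<Sum>k\<in>sq_index ?n. (\<phi>' i \<bullet> z k)\<^sup>2)"
        unfolding S_def
      proof (intro sum.cong refl)
        fix i assume "i \<in> {1..<?n}"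
        then have "t' i i = aniso_tau F q (\<phi>' i) (\<phi>' i)" by (simp add: t'_def scaled_tau_def)
        then show "t' i i = (\<Sum>k\<in>sq_index ?n. (\<phi>' i \<bullet> z k)\<^sup>2)"
          using z[of "\<phi>' i" "\<phi>' i"] by (simp add: power2_eq_square inner_commute)
      qed
      also have "\<dots> = (\<Sum>k\<in>sq_index ?n. \<Sum>i\<in>{1..<?n}. (\<phi>' i \<bullet> z k)\<^sup>2)" by (rule sum.swap)
      also have "\<dots> \<le> (\<Sum>k\<in>sq_index ?n. \<Sum>i\<in>{1..?n}. (\<phi>' i \<bullet> z k)\<^sup>2)"
        by (intro sum_mono sum_mono2) auto
      finally show ?thesis by (simp only: orthonormal_frame_parseval[OF on(2)])
    qed
    define G where "G = (\<Sum>k\<in>sq_index ?n. (norm ((w k + z k) /\<^sub>R 2))\<^sup>2)"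
    define Q where "Q = (\<Sum>k\<in>sq_index ?n. (norm (w k - z k))\<^sup>2)"
    have "(norm (z k))\<^sup>2 \<le> 2 * (norm ((w k + z k) /\<^sub>R 2))\<^sup>2 + (norm (w k - z k))\<^sup>2 / 2" for k
      unfolding parallelogram_half by simp
    then have "(\<Sum>k\<in>sq_index ?n. (norm (z k))\<^sup>2) \<le> (\<Sum>k\<in>sq_index ?n. 2 * (norm ((w k + z k) /\<^sub>R 2))\<^sup>2 + (norm (w k - z k))\<^sup>2 / 2)"
      by (intro sum_mono) simp
    also have "\<dots> = 2 * G + Q / 2" by (simp add: G_def Q_def sum.distrib sum_distrib_left sum_divide_distrib)
    finally have "S \<le> 2 * G + Q / 2" using trace by simp
    moreover have Q: "Q \<le> 128 * real ?n * D\<^sup>2 * S" using close by (simp add: Q_def)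
    moreover have Spos: "0 \<le> S"
      unfolding S_def using dia(2) \<delta>(3) pos by (intro sum_nonneg) (metis atLeastAtMost_iff atLeastLessThan_iff less_imp_le order_trans)
    moreover have "128 * real ?n * D\<^sup>2 * S \<le> 1 * S" using D Spos by (intro mult_right_mono) auto
    \<comment> \<open>The smallness of \<open>D\<close> lets the sum of squares of the midpoints replace that of the endpoints.\<close>
    ultimately have "S \<le> 4 * G" by linarith
    then have "128 * real ?n * D\<^sup>2 * S \<le> 128 * real ?n * D\<^sup>2 * (4 * G)" by (intro mult_left_mono) auto
    moreover have "128 * real ?n * D\<^sup>2 * (4 * G) = 512 * real ?n * D\<^sup>2 * G" by simp
    ultimately have "Q \<le> 512 * real ?n * D\<^sup>2 * G" using Q by linarith
    then show "\<exists>w z :: nat \<times> nat \<times> bool \<Rightarrow> real^'n.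
         (\<forall>a b. (\<Sum>k\<in>sq_index ?n. (w k \<bullet> a) * (w k \<bullet> b)) = aniso_tau F p a b) \<and>
         (\<forall>a b. (\<Sum>k\<in>sq_index ?n. (z k \<bullet> a) * (z k \<bullet> b)) = aniso_tau F q a b) \<and>
         (\<Sum>k\<in>sq_index ?n. (norm (w k - z k))\<^sup>2) \<le>
           512 * real ?n * D\<^sup>2 * (\<Sum>k\<in>sq_index ?n. (norm ((w k + z k) /\<^sub>R 2))\<^sup>2)"
      using w z unfolding Q_def G_def by blast
  qed
qed

end

section \<open>Smooth strictly convex domains\<close>

lemma grad_has_derivative_within:
  fixes f :: "real^'n \<Rightarrow> real"
  assumes "Ck_on (Suc (Suc k)) S f" "y \<in> S"
  shows "(grad S f has_derivative (\<lambda>v. \<chi> i. dderiv S (dderiv S f (axis i 1)) v y)) (at y within S)"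
proof -
  have d: "(dderiv S f (axis i 1) has_derivative (\<lambda>v. dderiv S (dderiv S f (axis i 1)) v y)) (at y within S)" for i
    by (rule differentiable_has_dderiv[OF Ck_on_differentiable[OF Ck_on_dderiv[OF assms(1)] assms(2)]])
  show ?thesis
    by (subst has_derivative_componentwise_within)
       (auto simp: Basis_vec_def inner_axis grad_def d)
qed

lemma grad_has_derivative:
  fixes f :: "real^'n \<Rightarrow> real"
  assumes "open U" "Ck_on (Suc (Suc k)) U f" "y \<in> U"
  shows "(grad U f has_derivative (\<lambda>v. \<chi> i. dderiv U (dderiv U f (axis i 1)) v y)) (at y)"
  using grad_has_derivative_within[OF assms(2,3)] at_within_open[OF assms(3,1)] by simp

lemma second_dderiv_inner:
  fixes f :: "real^'n \<Rightarrow> real"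
  assumes "open U" "Ck_on (Suc (Suc k)) U f" "y \<in> U"
  shows "dderiv U (dderiv U f a) b y = (\<chi> i. dderiv U (dderiv U f (axis i 1)) b y) \<bullet> a"
proof -
  have "dderiv U f a z = grad U f z \<bullet> a" if "z \<in> U" for z
    using grad_inner[OF Ck_on_differentiable[OF assms(2) that]] .
  then have "dderiv U (dderiv U f a) b y = dderiv U (\<lambda>z. grad U f z \<bullet> a) b y"
    by (intro dderiv_cong_open[OF assms(1,3)])
  also have "\<dots> = (\<chi> i. dderiv U (dderiv U f (axis i 1)) b y) \<bullet> a"
    by (rule dderiv_eq[OF _ assms(1,3)])
       (rule has_derivative_inner_left[OF grad_has_derivative[OF assms]])
  finally show ?thesis .
qed

lemma second_dderiv_expand:
  fixes f :: "real^'n \<Rightarrow> real"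
  assumes "open U" "Ck_on (Suc (Suc k)) U f" "y \<in> U"
  shows "dderiv U (dderiv U f a) b y =
    (\<Sum>i\<in>UNIV. \<Sum>j\<in>UNIV. dderiv U (dderiv U f (axis i 1)) (axis j 1) y * a $ i * b $ j)"
proof -
  have "dderiv U (dderiv U f a) b y = (\<chi> i. dderiv U (dderiv U f (axis i 1)) b y) \<bullet> a"
    by (rule second_dderiv_inner[OF assms])
  also have "\<dots> = (\<Sum>i\<in>UNIV. a $ i * dderiv U (dderiv U f (axis i 1)) b y)"
    by (simp add: inner_vec_def mult.commute)
  also have "\<dots> = (\<Sum>i\<in>UNIV. a $ i * (\<Sum>j\<in>UNIV. dderiv U (dderiv U f (axis i 1)) (axis j 1) y * b $ j))"
    by (intro sum.cong refl arg_cong2[of _ _ _ _ times],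
        subst grad_inner[OF Ck_on_differentiable[OF Ck_on_dderiv[OF assms(2)] assms(3)]])
       (simp add: grad_def inner_vec_def)
  finally show ?thesis by (simp add: sum_distrib_left mult_ac)
qed

lemma bounded_on_compact:
  fixes f :: "'i::finite \<Rightarrow> 'a::topological_space \<Rightarrow> real"
  assumes "compact C" "\<And>i. continuous_on C (f i)"
  obtains M where "0 \<le> M" "\<And>i x. x \<in> C \<Longrightarrow> \<bar>f i x\<bar> \<le> M"
proof -
  have "\<exists>M. \<forall>x\<in>C. \<bar>f i x\<bar> \<le> M" for i
    using compact_imp_bounded[OF compact_continuous_image[OF assms(2,1)]] by (auto simp: bounded_iff)
  then obtain M where M: "\<And>i x. x \<in> C \<Longrightarrow> \<bar>f i x\<bar> \<le> M i" by metis
  have "\<bar>f i x\<bar> \<le> (\<Sum>i\<in>UNIV. \<bar>M i\<bar>)" if "x \<in> C" for i x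
  proof -
    have "\<bar>f i x\<bar> \<le> \<bar>M i\<bar>" using M[OF that, of i] by linarith
    also have "\<dots> \<le> (\<Sum>i\<in>UNIV. \<bar>M i\<bar>)" by (rule member_le_sum) auto
    finally show ?thesis .
  qed
  then show ?thesis using that[of "\<Sum>i\<in>UNIV. \<bar>M i\<bar>"] by (simp add: sum_nonneg)
qed

lemma C2_bounded_on_compact_Ck:
  fixes f :: "real^'n \<Rightarrow> real"
  assumes U: "open U" and C: "compact C" "C \<subseteq> U" and f: "Ck_on 2 U f"
  shows "C2_bounded_on C f"
proof -
  have f2: "Ck_on (Suc (Suc 0)) U f" using f by (simp add: numeral_2_eq_2)
  let ?D = "\<lambda>i. dderiv U f (axis i 1)" and ?H = "\<lambda>p. dderiv U (dderiv U f (axis (fst p) 1)) (axis (snd p) 1)"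
  have cont: "continuous_on C f" "\<And>i. continuous_on C (?D i)" "\<And>p. continuous_on C (?H p)"
    using f2 C(2) by (auto intro: continuous_on_subset)
  obtain M0 where M0: "\<And>x. x \<in> C \<Longrightarrow> \<bar>f x\<bar> \<le> M0"
    using bounded_on_compact[of C "\<lambda>i::unit. f"] C(1) cont(1) by metis
  obtain M1 where M1: "0 \<le> M1" "\<And>i x. x \<in> C \<Longrightarrow> \<bar>?D i x\<bar> \<le> M1"
    using bounded_on_compact[of C ?D] C(1) cont(2) by metis
  obtain M2 where M2: "0 \<le> M2" "\<And>p x. x \<in> C \<Longrightarrow> \<bar>?H p x\<bar> \<le> M2"
    using bounded_on_compact[of C ?H] C(1) cont(3) by metis
  show ?thesis
  proof (rule C2_bounded_onI)
    fix x assume x: "x \<in> C"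
    then have xU: "x \<in> U" using C by auto
    have hd: "(g has_derivative (\<lambda>v. dderiv U g v y)) (at y)" if "Ck_on (Suc k) U g" "y \<in> U" for g y k
      using differentiable_has_dderiv[OF Ck_on_differentiable[OF that]] at_within_open[OF that(2) U] by simp
    show "C2_bounds_at M0 (real CARD('n) * M1) (real CARD('n) * (real CARD('n) * M2)) f x"
      unfolding C2_bounds_at_def
    proof (rule exI[of _ "\<lambda>y v. dderiv U f v y"], rule exI[of _ "\<lambda>v w. dderiv U (dderiv U f v) w x"], intro conjI allI)
      show "\<forall>\<^sub>F y in nhds x. (f has_derivative (\<lambda>v. dderiv U f v y)) (at y)"
        using eventually_nhds_in_open[OF U xU] by eventually_elim (rule hd[OF f2])
      show "((\<lambda>y. dderiv U f v y) has_derivative (\<lambda>w. dderiv U (dderiv U f v) w x)) (at x)" for v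
        by (rule hd[OF Ck_on_dderiv[OF f2] xU])
      show "norm (f x) \<le> M0" using M0[OF x] by simp
      show "norm (dderiv U f v x) \<le> real CARD('n) * M1 * norm v" for v
      proof -
        have "dderiv U f v x = (\<Sum>i\<in>UNIV. ?D i x * v $ i)"
          by (subst grad_inner[OF Ck_on_differentiable[OF f2 xU]]) (simp add: grad_def inner_vec_def)
        also have "\<bar>\<dots>\<bar> \<le> (\<Sum>i\<in>(UNIV::'n set). M1 * norm v)"
          by (rule order_trans[OF sum_abs], rule sum_mono)
             (auto simp: abs_mult intro!: mult_mono M1 x component_le_norm_cart)
        finally show ?thesis by (simp add: mult_ac)
      qed
      show "norm (dderiv U (dderiv U f v) w x) \<le> real CARD('n) * (real CARD('n) * M2) * norm v * norm w" for v w
      proof -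
        have T: "\<bar>dderiv U (dderiv U f (axis i 1)) (axis j 1) x * v $ i * w $ j\<bar> \<le> M2 * norm v * norm w" for i j
        proof -
          have "\<bar>?H (i, j) x\<bar> * \<bar>v $ i\<bar> * \<bar>w $ j\<bar> \<le> M2 * norm v * norm w"
            by (intro mult_mono M2(2)[OF x] component_le_norm_cart mult_nonneg_nonneg M2(1) abs_ge_zero norm_ge_zero)
          then show ?thesis by (simp only: abs_mult fst_conv snd_conv)
        qed
        have "\<bar>dderiv U (dderiv U f v) w x\<bar> \<le> (\<Sum>i\<in>(UNIV::'n set). \<Sum>j\<in>(UNIV::'n set). M2 * norm v * norm w)"
          by (subst second_dderiv_expand[OF U f2 xU], rule order_trans[OF sum_abs], rule sum_mono, rule order_trans[OF sum_abs], rule sum_mono, rule T)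
        also have "\<dots> = real CARD('n) * (real CARD('n) * M2) * norm v * norm w" by simp
        finally show ?thesis by (simp only: real_norm_def)
      qed
    qed
  qed
qed

locale smooth_convex_domain =
  fixes \<Omega> :: "(real^'n) set"
  assumes op: "open \<Omega>" and ne: "\<Omega> \<noteq> {}" and bdd: "bounded \<Omega>"
    and sc: "strictly_convex_set \<Omega>" and sb: "smooth_boundary \<Omega>"
begin

lemma cl: "closure \<Omega> = \<Omega> \<union> frontier \<Omega>"
  using op by (simp add: frontier_def interior_open Un_absorb1[OF closure_subset] Un_Diff_cancel)

lemma frontier_notin: "x \<in> frontier \<Omega> \<Longrightarrow> x \<notin> \<Omega>"
  using op by (simp add: frontier_def interior_open)

lemma frontier_closure: "x \<in> frontier \<Omega> \<Longrightarrow> x \<in> closure \<Omega>"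
  by (simp add: frontier_def)

lemma compact_cl: "compact (closure \<Omega>)" and compact_fr: "compact (frontier \<Omega>)"
  using bdd by (auto simp: compact_frontier_bounded)

lemma open_segment_in:
  "x \<in> closure \<Omega> \<Longrightarrow> y \<in> closure \<Omega> \<Longrightarrow> x \<noteq> y \<Longrightarrow> open_segment x y \<subseteq> \<Omega>"
  using sc op unfolding strictly_convex_set_def by (simp add: interior_open)

lemma convex: "convex \<Omega>"
  unfolding convex_contains_open_segment
  using open_segment_in closure_subset by (metis open_segment_idem empty_subsetI subsetD)

lemma midpoint_in:
  "x \<in> closure \<Omega> \<Longrightarrow> y \<in> closure \<Omega> \<Longrightarrow> x \<noteq> y \<Longrightarrow> (x + y) /\<^sub>R 2 \<in> \<Omega>"
  using open_segment_in[of x y] midpoint_in_open_segment[of x y] by (auto simp: midpoint_def)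

context
  fixes U \<rho> x
  assumes ldf: "local_defining_function \<Omega> U \<rho>" and xU: "x \<in> U" and xf: "x \<in> frontier \<Omega>"
begin

lemma ldf_open: "open U" and ldf_Ck: "Ck_on k U \<rho>" and ldf_iff: "y \<in> U \<Longrightarrow> y \<in> \<Omega> \<longleftrightarrow> \<rho> y > 0"
  using ldf unfolding local_defining_function_def smooth_fun_on_def by blast+

lemma ldf_derivative:
  assumes "y \<in> U" shows "(\<rho> has_derivative (\<lambda>v. grad U \<rho> y \<bullet> v)) (at y)"
proof -
  have d: "\<rho> differentiable (at y within U)" by (rule Ck_on_differentiable[OF ldf_Ck[of "Suc 0"] assms])
  show ?thesis
    using differentiable_has_dderiv[OF d] grad_inner[OF d] at_within_open[OF assms ldf_open] by simp
qed

lemma ldf_nonneg: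
  assumes "y \<in> U" "y \<in> closure \<Omega>" shows "\<rho> y \<ge> 0"
proof (rule ccontr)
  assume "\<not> \<rho> y \<ge> 0"
  moreover have "isCont \<rho> y" by (rule has_derivative_continuous[OF ldf_derivative[OF assms(1)]])
  ultimately obtain d where d: "d > 0" "\<And>z. dist z y < d \<Longrightarrow> dist (\<rho> z) (\<rho> y) < - \<rho> y"
    unfolding continuous_at_eps_delta by (metis neg_0_less_iff_less not_le)
  obtain r where r: "r > 0" "ball y r \<subseteq> U" using ldf_open assms(1) openE by blast
  obtain z where z: "z \<in> \<Omega>" "dist z y < min d r"
    using assms(2) d(1) r(1) unfolding closure_approachable by (metis min_less_iff_conj)
  then have "z \<in> U" using r by (auto simp: dist_commute subset_iff)
  then have "\<rho> z > 0" using ldf_iff z by blast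
  then show False using d(2)[of z] z by (auto simp: dist_real_def)
qed

lemma ldf_zero: "\<rho> x = 0"
  using ldf_nonneg[OF xU frontier_closure[OF xf]] ldf_iff[OF xU] frontier_notin[OF xf] by linarith

lemma ldf_grad_nonzero: "grad U \<rho> x \<noteq> 0"
  using ldf ldf_zero xU unfolding local_defining_function_def by blast

text \<open>A defining function increases from zero in a direction that has positive product with its gradient.\<close>

lemma ldf_inward:
  assumes v: "grad U \<rho> x \<bullet> v > 0"
  obtains e where "e > 0" "\<And>t. 0 < t \<Longrightarrow> t < e \<Longrightarrow> x + t *\<^sub>R v \<in> \<Omega>"
proof -
  have "((\<lambda>t. \<rho> (x + t *\<^sub>R v)) has_vector_derivative grad U \<rho> x \<bullet> v) (at 0)"
    by (rule has_vector_derivative_line) (use ldf_derivative[OF xU] in simp)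
  then have "((\<lambda>t. \<rho> (x + t *\<^sub>R v)) has_real_derivative grad U \<rho> x \<bullet> v) (at 0)"
    by (simp add: has_real_derivative_iff_has_vector_derivative)
  from DERIV_pos_inc_right[OF this v] obtain d where d: "d > 0"
    "\<And>h. 0 < h \<Longrightarrow> h < d \<Longrightarrow> \<rho> x < \<rho> (x + h *\<^sub>R v)" by auto
  obtain r where r: "r > 0" "ball x r \<subseteq> U" using ldf_open xU openE by blast
  have v0: "v \<noteq> 0" using v by auto
  show ?thesis
  proof (rule that[of "min d (r / norm v)"])
    show "min d (r / norm v) > 0" using d r v0 by simp
    fix t assume t: "0 < t" "t < min d (r / norm v)"
    then have "t * norm v < r" using v0 by (simp add: pos_less_divide_eq)
    then have "x + t *\<^sub>R v \<in> U" using r(2) t by (auto simp: subset_iff dist_norm)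
    moreover have "\<rho> (x + t *\<^sub>R v) > 0" using d(2)[of t] t ldf_zero by simp
    ultimately show "x + t *\<^sub>R v \<in> \<Omega>" using ldf_iff by blast
  qed
qed

end

text \<open>If two normalized gradients \<open>g \<noteq> g'\<close> occurred, then \<open>g - g'\<close> and its opposite would both point into \<open>\<Omega>\<close>, and the boundary
point would be the midpoint of two points of the convex set \<open>\<Omega>\<close>.\<close>

lemma ldf_normal_unique:
  assumes "local_defining_function \<Omega> U \<rho>" "x \<in> U" "local_defining_function \<Omega> U' \<rho>'" "x \<in> U'" "x \<in> frontier \<Omega>"
  shows "grad U \<rho> x /\<^sub>R norm (grad U \<rho> x) = grad U' \<rho>' x /\<^sub>R norm (grad U' \<rho>' x)"
proof (rule ccontr)
  define g where "g = grad U \<rho> x /\<^sub>R norm (grad U \<rho> x)"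
  define g' where "g' = grad U' \<rho>' x /\<^sub>R norm (grad U' \<rho>' x)"
  assume "\<not> ?thesis"
  then have neq: "g \<noteq> g'" by (simp add: g_def g'_def)
  have nz: "grad U \<rho> x \<noteq> 0" "grad U' \<rho>' x \<noteq> 0"
    using ldf_grad_nonzero assms by blast+
  then have n1: "norm g = 1" "norm g' = 1" by (simp_all add: g_def g'_def)
  have "g \<bullet> g' < 1"
    using neq n1 norm_cauchy_schwarz[of g g'] norm_cauchy_schwarz_eq[of g g'] by fastforce
  moreover have "g \<bullet> g = 1" "g' \<bullet> g' = 1" using n1 by (simp_all add: norm_eq_1)
  ultimately have "g \<bullet> (g - g') > 0" "g' \<bullet> (g' - g) > 0"
    using inner_commute[of g' g] unfolding inner_diff_right by linarith+
  moreover have gv: "g \<bullet> v = (grad U \<rho> x \<bullet> v) / norm (grad U \<rho> x)"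
      "g' \<bullet> v = (grad U' \<rho>' x \<bullet> v) / norm (grad U' \<rho>' x)" for v
    by (simp_all add: g_def g'_def divide_inverse mult.commute)
  ultimately have 1: "grad U \<rho> x \<bullet> (g - g') > 0" and 2: "grad U' \<rho>' x \<bullet> (g' - g) > 0"
    using nz unfolding gv by (simp_all only: zero_less_divide_iff zero_less_norm_iff norm_not_less_zero simp_thms)
  obtain e where e: "e > 0" "\<And>t. 0 < t \<Longrightarrow> t < e \<Longrightarrow> x + t *\<^sub>R (g - g') \<in> \<Omega>"
    using ldf_inward[OF assms(1,2,5) 1] by blast
  obtain e' where e': "e' > 0" "\<And>t. 0 < t \<Longrightarrow> t < e' \<Longrightarrow> x + t *\<^sub>R (g' - g) \<in> \<Omega>"
    using ldf_inward[OF assms(3,4,5) 2] by blast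
  define t where "t = min e e' / 2"
  have t: "0 < t" "t < e" "t < e'" using e(1) e'(1) by (auto simp: t_def)
  have "(1/2) *\<^sub>R (x + t *\<^sub>R (g - g')) + (1/2) *\<^sub>R (x + t *\<^sub>R (g' - g)) \<in> \<Omega>"
    using convex e(2)[OF t(1,2)] e'(2)[OF t(1,3)] by (intro convexD) auto
  moreover have "(1/2) *\<^sub>R (x + t *\<^sub>R (g - g')) + (1/2) *\<^sub>R (x + t *\<^sub>R (g' - g)) = x"
    by (simp add: vec_eq_iff field_simps)
  ultimately show False using frontier_notin[OF assms(5)] by simp
qed

lemma inward_normal_eq:
  assumes "local_defining_function \<Omega> U \<rho>" "x \<in> U" "x \<in> frontier \<Omega>"
  shows "inward_normal \<Omega> x = grad U \<rho> x /\<^sub>R norm (grad U \<rho> x)"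
  unfolding inward_normal_def
proof (rule the_equality)
  show "\<exists>Ua \<rho>'. x \<in> Ua \<and> local_defining_function \<Omega> Ua \<rho>' \<and>
      grad U \<rho> x /\<^sub>R norm (grad U \<rho> x) = grad Ua \<rho>' x /\<^sub>R norm (grad Ua \<rho>' x)"
    using assms by blast
qed (use ldf_normal_unique assms in blast)

lemma obtain_ldf:
  assumes "x \<in> frontier \<Omega>"
  obtains U \<rho> where "x \<in> U" "local_defining_function \<Omega> U \<rho>"
  using sb assms unfolding smooth_boundary_def by blast

lemma norm_normal:
  assumes x: "x \<in> frontier \<Omega>" shows "norm (inward_normal \<Omega> x) = 1"
proof -
  obtain U \<rho> where U: "x \<in> U" "local_defining_function \<Omega> U \<rho>" using obtain_ldf[OF x] .
  show ?thesis
    using ldf_grad_nonzero[OF U(2,1) x] by (simp add: inward_normal_eq[OF U(2,1) x])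
qed

lemma inward_direction:
  assumes x: "x \<in> frontier \<Omega>" and v: "v \<bullet> inward_normal \<Omega> x > 0"
  obtains e where "e > 0" "\<And>t. 0 < t \<Longrightarrow> t < e \<Longrightarrow> x + t *\<^sub>R v \<in> \<Omega>"
proof -
  obtain U \<rho> where U: "x \<in> U" "local_defining_function \<Omega> U \<rho>" using obtain_ldf[OF x] .
  have "grad U \<rho> x \<noteq> 0" by (rule ldf_grad_nonzero[OF U(2,1) x])
  then have "grad U \<rho> x \<bullet> v > 0"
    using v unfolding inward_normal_eq[OF U(2,1) x] by (simp add: inner_commute zero_less_mult_iff)
  then show ?thesis using ldf_inward[OF U(2,1) x] that by blast
qed

text \<open>If \<open>y\<close> lay strictly behind the tangent plane, continuing the segment from \<open>y\<close> through \<open>x\<close> would enter \<open>\<Omega>\<close>,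
and \<open>x\<close> would lie inside an open segment between points of the closure, hence in \<open>\<Omega>\<close>.\<close>

lemma supporting:
  assumes x: "x \<in> frontier \<Omega>" and y: "y \<in> closure \<Omega>"
  shows "(y - x) \<bullet> inward_normal \<Omega> x \<ge> 0"
proof (rule ccontr)
  assume "\<not> ?thesis"
  then have "(x - y) \<bullet> inward_normal \<Omega> x > 0" by (simp add: inner_diff_left)
  from inward_direction[OF x this] obtain e where e: "e > 0" "\<And>t. 0 < t \<Longrightarrow> t < e \<Longrightarrow> x + t *\<^sub>R (x - y) \<in> \<Omega>" by blast
  define z where "z = x + (e/2) *\<^sub>R (x - y)"
  have z: "z \<in> \<Omega>" unfolding z_def by (rule e(2)) (use e(1) in auto)
  have "z \<noteq> y"
  proof
    assume "z = y"
    then have "(1 + e/2) *\<^sub>R (x - y) = 0" by (simp add: z_def algebra_simps)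
    then have "x = y" using e(1) by simp
    then show False using z \<open>z = y\<close> frontier_notin[OF x] by simp
  qed
  moreover have "x \<in> open_segment y z"
  proof -
    have "x = (1 - 1/(1 + e/2)) *\<^sub>R y + (1/(1 + e/2)) *\<^sub>R z"
    proof -
      have "(1 + e/2) *\<^sub>R x = (e/2) *\<^sub>R y + z" by (simp add: z_def algebra_simps)
      then have "x = inverse (1 + e/2) *\<^sub>R ((e/2) *\<^sub>R y + z)"
        using e(1) by (metis add_pos_pos half_gt_zero less_numeral_extra(1,3) left_inverse scaleR_one scaleR_scaleR)
      moreover have "inverse (1 + e/2) * (e/2) = 1 - 1/(1 + e/2)" using e(1) by (simp add: field_simps)
      ultimately show ?thesis by (simp add: scaleR_add_right inverse_eq_divide)
    qed
    then show ?thesis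
      unfolding in_segment using \<open>z \<noteq> y\<close> e(1) by (intro conjI exI[of _ "1/(1 + e/2)"]) (auto simp: field_simps)
  qed
  ultimately have "x \<in> \<Omega>" using open_segment_in[OF y, of z] z closure_subset by blast
  then show False using frontier_notin[OF x] by simp
qed

text \<open>The midpoint of the chord has a whole ball around it in \<open>\<Omega>\<close>, which lies on the inner side of the tangent plane.\<close>

lemma strictly_supporting:
  assumes x: "x \<in> frontier \<Omega>" and y: "y \<in> closure \<Omega>" and ne: "x \<noteq> y"
  shows "(y - x) \<bullet> inward_normal \<Omega> x > 0"
proof -
  let ?N = "inward_normal \<Omega> x"
  define m where "m = (x + y) /\<^sub>R 2"
  have "m \<in> \<Omega>" unfolding m_def by (rule midpoint_in[OF frontier_closure[OF x] y ne])
  then obtain r where r: "r > 0" "ball m r \<subseteq> \<Omega>" using op openE by blast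
  have "m - (r/2) *\<^sub>R ?N \<in> ball m r" using r norm_normal[OF x] by (simp add: dist_norm)
  then have "m - (r/2) *\<^sub>R ?N \<in> closure \<Omega>" using r closure_subset by blast
  from supporting[OF x this] have "(m - x) \<bullet> ?N \<ge> r/2"
    using norm_normal[OF x] by (simp add: inner_simps dot_square_norm norm_eq_1)
  moreover have "m - x = (y - x) /\<^sub>R 2" by (simp add: m_def vec_eq_iff field_simps)
  ultimately show ?thesis using r by simp
qed

lemma continuous_normal: "continuous_on (frontier \<Omega>) (inward_normal \<Omega>)"
proof (rule continuous_on_eq_continuous_within[THEN iffD2], rule ballI)
  fix x assume x: "x \<in> frontier \<Omega>"
  obtain U \<rho> where U: "x \<in> U" "local_defining_function \<Omega> U \<rho>" using obtain_ldf[OF x] .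
  have oU: "open U" and ck: "Ck_on (Suc (Suc 0)) U \<rho>" using ldf_open[OF U(2,1) x] ldf_Ck[OF U(2,1) x] by auto
  have "isCont (grad U \<rho>) x" by (rule has_derivative_continuous[OF grad_has_derivative[OF oU ck U(1)]])
  then have "isCont (\<lambda>y. grad U \<rho> y /\<^sub>R norm (grad U \<rho> y)) x"
    using ldf_grad_nonzero[OF U(2,1) x] by (intro continuous_intros) auto
  then have "continuous (at x within frontier \<Omega>) (\<lambda>y. grad U \<rho> y /\<^sub>R norm (grad U \<rho> y))"
    using continuous_at_imp_continuous_within by blast
  moreover obtain d where d: "d > 0" "ball x d \<subseteq> U" using oU U(1) openE by blast
  ultimately show "continuous (at x within frontier \<Omega>) (inward_normal \<Omega>)"
    by (rule_tac continuous_transform_within[OF _ d(1) x])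
       (use inward_normal_eq[OF U(2)] d(2) in \<open>auto simp: dist_commute subset_iff\<close>)
qed

end

section \<open>Curvature and second derivatives of a defining function\<close>

text \<open>The differential of the normal is only a derivative within the boundary hypersurface.  Its value on a vector that is approximated
by secants of the set is nevertheless determined.\<close>

lemma has_derivative_within_unique_tangent:
  fixes f :: "'a::real_normed_vector \<Rightarrow> 'b::real_normed_vector"
  assumes f1: "(f has_derivative f1) (at x within S)" and f2: "(f has_derivative f2) (at x within S)"
    and tan: "\<And>e. e > 0 \<Longrightarrow> \<exists>y\<in>S. \<exists>t>0. t < e \<and> norm (y - x - t *\<^sub>R a) \<le> e * t"
  shows "f1 a = f2 a"
proof -
  define D where "D v = f1 v - f2 v" for v
  have d: "((\<lambda>y. 0) has_derivative D) (at x within S)"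
    using has_derivative_diff[OF f1 f2] by (simp add: D_def[abs_def])
  interpret D: bounded_linear D by (rule has_derivative_bounded_linear[OF d])
  obtain K where K: "K > 0" "\<And>v. norm (D v) \<le> norm v * K" using D.pos_bounded by blast
  have "norm (D a) \<le> e * (norm a + 1 + K)" if e: "0 < e" "e < 1" for e
  proof -
    obtain d where d: "d > 0" "\<And>y. y \<in> S \<Longrightarrow> norm (y - x) < d \<Longrightarrow> norm (D (y - x)) \<le> e * norm (y - x)"
      using d e(1) unfolding has_derivative_within_alt by fastforce
    define e' where "e' = min e (d / (norm a + 2))"
    have na: "norm a + 2 > 0" by (simp add: add_nonneg_pos)
    have "e' \<le> d / (norm a + 2)" by (simp add: e'_def)
    then have "e' * (norm a + 2) \<le> d" using na by (simp only: pos_le_divide_eq)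
    moreover have "e' > 0" "e' \<le> e" "e' \<le> 1" using e d na by (simp_all add: e'_def)
    ultimately have e': "e' > 0" "e' \<le> e" "e' \<le> 1" "e' * (norm a + 2) \<le> d" by blast+
    obtain y t where y: "y \<in> S" "t > 0" "t < e'" "norm (y - x - t *\<^sub>R a) \<le> e' * t"
      using tan[OF e'(1)] by blast
    have et: "e' * t \<le> e * t" "e' * t \<le> t" using e' y by (auto simp: mult_right_mono mult_le_cancel_right1)
    have "norm (y - x) \<le> norm (t *\<^sub>R a) + norm (y - x - t *\<^sub>R a)"
      using norm_triangle_ineq[of "t *\<^sub>R a" "y - x - t *\<^sub>R a"] by simp
    moreover have "norm (t *\<^sub>R a) = t * norm a" using y by simp
    moreover have "t * (norm a + 1) = t * norm a + t" by (simp add: algebra_simps)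
    ultimately have nyx: "norm (y - x) \<le> t * (norm a + 1)" using y(4) et(2) by linarith
    have "t * (norm a + 1) < e' * (norm a + 2)"
    proof -
      have "t * (norm a + 1) \<le> t * (norm a + 2)" using y by (intro mult_left_mono) auto
      also have "\<dots> < e' * (norm a + 2)" using y na by (intro mult_strict_right_mono)
      finally show ?thesis .
    qed
    then have "norm (y - x) < d" using nyx e' by linarith
    then have 1: "norm (D (y - x)) \<le> e * (t * (norm a + 1))"
      using d(2)[OF y(1)] nyx e(1) by (meson mult_left_mono less_imp_le order_trans)
    have 2: "norm (D (y - x - t *\<^sub>R a)) \<le> e * t * K"
      using K(2)[of "y - x - t *\<^sub>R a"] y(4) et(1) K(1) by (meson mult_right_mono less_imp_le order_trans)
    have "t *\<^sub>R D a = D (y - x) - D (y - x - t *\<^sub>R a)" by (simp add: D.diff D.scaleR)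
    then have "norm (t *\<^sub>R D a) \<le> norm (D (y - x)) + norm (D (y - x - t *\<^sub>R a))"
      by (simp add: norm_triangle_ineq4)
    then have "t * norm (D a) \<le> t * (e * (norm a + 1 + K))"
      using 1 2 y(2) by (simp add: algebra_simps)
    then show ?thesis using y(2) by simp
  qed
  then have ev: "\<forall>\<^sub>F e in at_right 0. norm (D a) \<le> e * (norm a + 1 + K)"
    unfolding eventually_at_right_field by (intro exI[of _ 1]) auto
  have "((\<lambda>e. e * (norm a + 1 + K)) \<longlongrightarrow> 0 * (norm a + 1 + K)) (at_right 0)"
    by (intro tendsto_intros)
  then have "norm (D a) \<le> 0 * (norm a + 1 + K)"
    using ev by (intro tendsto_lowerbound[where f = "\<lambda>e. e * (norm a + 1 + K)"]) auto
  then show ?thesis by (simp add: D_def)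
qed

lemma taylor2_upper:
  fixes f g :: "real \<Rightarrow> real"
  assumes f: "\<And>s. 0 \<le> s \<Longrightarrow> s \<le> 1 \<Longrightarrow> (f has_real_derivative g s) (at s)"
    and g: "\<And>s. 0 \<le> s \<Longrightarrow> s \<le> 1 \<Longrightarrow> (g has_real_derivative g' s) (at s)"
    and M: "\<And>s. 0 \<le> s \<Longrightarrow> s \<le> 1 \<Longrightarrow> g' s \<le> M"
  shows "f 1 \<le> f 0 + g 0 + M / 2"
proof -
  have gb: "g s \<le> g 0 + M * s" if s: "0 < s" "s < 1" for s
  proof -
    obtain z where "0 < z" "z < s" "g s - g 0 = (s - 0) * g' z"
      using MVT2[OF s(1), of g g'] g s by (metis less_imp_le less_trans order.trans)
    moreover have "s * g' z \<le> s * M" using M[of z] calculation s by (intro mult_left_mono) auto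
    ultimately show ?thesis unfolding diff_0_right mult.commute[of M s] by linarith
  qed
  define h where "h s = f s - g 0 * s - M * s\<^sup>2 / 2" for s
  have dh: "(h has_real_derivative g s - g 0 - M * s) (at s)" if "0 \<le> s" "s \<le> 1" for s
    unfolding h_def using f[OF that] by (auto intro!: derivative_eq_intros)
  obtain z where z: "0 < z" "z < 1" "h 1 - h 0 = (1 - 0) * (g z - g 0 - M * z)"
    using MVT2[of 0 1 h "\<lambda>s. g s - g 0 - M * s"] dh by auto
  then have "h 1 \<le> h 0" using gb[of z] by simp
  then show ?thesis by (simp add: h_def)
qed

context smooth_convex_domain
begin

text \<open>Above the tangent vector there is a point of \<open>\<Omega>\<close> and below it a point outside; the segment joining them meets the boundary.\<close>

lemma tangent_approximation:
  assumes x: "x \<in> frontier \<Omega>" and a: "a \<bullet> inward_normal \<Omega> x = 0" and e: "e > 0"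
  shows "\<exists>y\<in>frontier \<Omega>. \<exists>t>0. t < e \<and> norm (y - x - t *\<^sub>R a) \<le> e * t"
proof -
  let ?N = "inward_normal \<Omega> x"
  have N: "norm ?N = 1" "?N \<bullet> ?N = 1" using norm_normal[OF x] by (auto simp: norm_eq_1)
  have "(a + e *\<^sub>R ?N) \<bullet> ?N > 0" using a e N by (simp add: inner_add_left)
  from inward_direction[OF x this] obtain d where d: "d > 0"
    "\<And>t. 0 < t \<Longrightarrow> t < d \<Longrightarrow> x + t *\<^sub>R (a + e *\<^sub>R ?N) \<in> \<Omega>" by blast
  define t where "t = min d e / 2"
  have t: "0 < t" "t < d" "t < e" using d e by (auto simp: t_def)
  define p where "p = x + t *\<^sub>R (a + e *\<^sub>R ?N)"
  define q where "q = x + t *\<^sub>R (a - e *\<^sub>R ?N)"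
  have p: "p \<in> \<Omega>" unfolding p_def by (rule d(2)[OF t(1,2)])
  have "(q - x) \<bullet> ?N = - (t * e)" using a N by (simp add: q_def inner_simps)
  then have "(q - x) \<bullet> ?N < 0" using t e by simp
  then have "q \<notin> closure \<Omega>" using supporting[OF x, of q] by linarith
  then have "q \<notin> \<Omega>" using closure_subset by blast
  then obtain y where y: "y \<in> closed_segment p q" "y \<in> frontier \<Omega>"
    using connected_Int_frontier[of "closed_segment p q" \<Omega>] p by auto
  then obtain u where u: "0 \<le> u" "u \<le> 1" "y = (1 - u) *\<^sub>R p + u *\<^sub>R q" unfolding in_segment by blast
  have "y - x - t *\<^sub>R a = (t * e * (1 - 2 * u)) *\<^sub>R ?N"
    by (simp add: u p_def q_def vec_eq_iff algebra_simps)
  then have "norm (y - x - t *\<^sub>R a) = \<bar>t * e * (1 - 2 * u)\<bar>" using N by simp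
  also have "\<dots> = (e * t) * \<bar>1 - 2 * u\<bar>" using t e by (simp add: abs_mult)
  also have "\<dots> \<le> (e * t) * 1" using u t e by (intro mult_left_mono) auto
  finally show ?thesis using y t by (intro bexI[of _ y] exI[of _ t]) auto
qed

text \<open>Differentiating \<open>N = D\<rho> / \<bar>D\<rho>\<bar>\<close> in a tangent direction identifies the second fundamental form with minus the tangential
Hessian of the defining function, divided by the length of its gradient.\<close>

lemma curvature_second_derivative:
  assumes n2: "CARD('n) \<ge> 2" and k: "curvature_ge \<Omega> k0"
    and U: "local_defining_function \<Omega> U \<rho>" "x \<in> U" and x: "x \<in> frontier \<Omega>"
    and a: "a \<bullet> inward_normal \<Omega> x = 0"
  shows "dderiv U (dderiv U \<rho> a) a x \<le> - k0 * norm (grad U \<rho> x) * (norm a)\<^sup>2"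
proof -
  let ?N = "inward_normal \<Omega>" and ?g = "grad U \<rho>"
  have oU: "open U" and ck: "Ck_on (Suc (Suc 0)) U \<rho>" using ldf_open[OF U x] ldf_Ck[OF U x] by auto
  have gnz: "?g x \<noteq> 0" by (rule ldf_grad_nonzero[OF U x])
  define G where "G = (\<lambda>v. \<chi> i. dderiv U (dderiv U \<rho> (axis i 1)) v x)"
  have dg: "(?g has_derivative G) (at x)" unfolding G_def by (rule grad_has_derivative[OF oU ck U(2)])
  define \<nu> where "\<nu> y = ?g y /\<^sub>R norm (?g y)" for y
  have dn: "((\<lambda>y. norm (?g y)) has_derivative (\<lambda>h. G h \<bullet> sgn (?g x))) (at x)"
    by (rule has_derivative_compose[OF dg has_derivative_norm[OF gnz]])
  have "norm (?g x) \<noteq> 0" using gnz by simp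
  from has_derivative_scaleR[OF Deriv.has_derivative_inverse[OF this dn] dg]
  obtain \<nu>' where \<nu>': "(\<nu> has_derivative \<nu>') (at x)"
    unfolding \<nu>_def[abs_def] by blast
  obtain d where d: "d > 0" "ball x d \<subseteq> U" using oU U(2) openE by blast
  have N\<nu>: "(?N has_derivative \<nu>') (at x within frontier \<Omega>)"
    by (rule has_derivative_transform_within[OF has_derivative_at_withinI[OF \<nu>'] d(1) x])
       (use inward_normal_eq[OF U(1)] d(2) in \<open>auto simp: \<nu>_def dist_commute subset_iff\<close>)
  define f' where "f' = (\<lambda>v. dderiv (frontier \<Omega>) ?N v x)"
  have Nf: "(?N has_derivative f') (at x within frontier \<Omega>)"
    unfolding f'_def by (rule differentiable_has_dderiv) (use N\<nu> in \<open>auto simp: differentiable_def\<close>)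
  have f\<nu>: "f' b = \<nu>' b" if "b \<bullet> ?N x = 0" for b
    by (rule has_derivative_within_unique_tangent[OF Nf N\<nu> tangent_approximation[OF x that]])
  have Nx: "?N x = ?g x /\<^sub>R norm (?g x)" by (rule inward_normal_eq[OF U x])
  have H: "dderiv U (dderiv U \<rho> b) b x = G b \<bullet> b" for b
    unfolding G_def by (rule second_dderiv_inner[OF oU ck U(2)])
  have key: "\<nu>' b \<bullet> b = (G b \<bullet> b) / norm (?g x)" if b: "b \<bullet> ?N x = 0" for b
  proof -
    have gb: "?g x \<bullet> b = 0" using b gnz unfolding Nx by (simp add: inner_commute)
    have "((\<lambda>y. \<nu> y \<bullet> b) has_derivative (\<lambda>v. \<nu>' v \<bullet> b)) (at x)"
      by (rule has_derivative_inner_left[OF \<nu>'])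
    then have d1: "((\<lambda>y. (\<nu> y \<bullet> b) * norm (?g y)) has_derivative
       (\<lambda>v. (\<nu> x \<bullet> b) * (G v \<bullet> sgn (?g x)) + (\<nu>' v \<bullet> b) * norm (?g x))) (at x)"
      by (rule has_derivative_mult[OF _ dn])
    have "((\<lambda>y. ?g y \<bullet> b) has_derivative (\<lambda>v. G v \<bullet> b)) (at x)"
      by (rule has_derivative_inner_left[OF dg])
    moreover obtain e where e: "e > 0" "\<And>y. dist x y < e \<Longrightarrow> ?g y \<noteq> 0"
      using continuous_at_avoid[OF has_derivative_continuous[OF dg] gnz] by blast
    then have S: "?g y \<bullet> b = (\<nu> y \<bullet> b) * norm (?g y)" if "y \<in> ball x e" for y
      using that by (simp add: \<nu>_def)
    ultimately have d2: "((\<lambda>y. (\<nu> y \<bullet> b) * norm (?g y)) has_derivative (\<lambda>v. G v \<bullet> b)) (at x)"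
      using has_derivative_transform_within_open[of "\<lambda>y. ?g y \<bullet> b" "\<lambda>v. G v \<bullet> b" x UNIV "ball x e" "\<lambda>y. (\<nu> y \<bullet> b) * norm (?g y)"] e(1)
      by simp
    from has_derivative_unique[OF d1 d2] have "(\<nu>' b \<bullet> b) * norm (?g x) = G b \<bullet> b"
      using gb by (auto simp: fun_eq_iff \<nu>_def)
    then show ?thesis using gnz by (simp add: field_simps)
  qed
  show ?thesis
  proof (cases "a = 0")
    case True
    then show ?thesis unfolding H by simp
  next
    case False
    define b where "b = a /\<^sub>R norm a"
    have b: "norm b = 1" "?N x \<bullet> b = 0" using a False by (auto simp: b_def inner_commute)
    obtain e where e: "orthonormal_frame e" "e (CARD('n)) = ?N x" "e 1 = b"
      using frame_with_two_vectors[OF n2 norm_normal[OF x] b] by blast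
    define \<xi> :: "nat \<Rightarrow> real" where "\<xi> i = (if i = 1 then 1 else 0)" for i
    have "(\<Sum>i\<in>{1..<CARD('n)}. \<Sum>j\<in>{1..<CARD('n)}. curvature_form \<Omega> x (e i) (e j) * \<xi> i * \<xi> j)
        \<ge> k0 * (\<Sum>i\<in>{1..<CARD('n)}. (\<xi> i)\<^sup>2)"
      using k x e unfolding curvature_ge_def by blast
    moreover have "(\<Sum>i\<in>{1..<CARD('n)}. (\<xi> i)\<^sup>2) = 1"
      using n2 by (subst sum.cong[OF refl, of _ _ "\<lambda>i. if i = 1 then 1 else 0"]) (auto simp: \<xi>_def)
    moreover have "(\<Sum>i\<in>{1..<CARD('n)}. \<Sum>j\<in>{1..<CARD('n)}. curvature_form \<Omega> x (e i) (e j) * \<xi> i * \<xi> j)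
        = curvature_form \<Omega> x (e 1) (e 1)"
    proof -
      have "(\<Sum>j\<in>{1..<CARD('n)}. curvature_form \<Omega> x (e i) (e j) * \<xi> i * \<xi> j) =
          (if i = 1 then curvature_form \<Omega> x (e 1) (e 1) else 0)" if "i \<in> {1..<CARD('n)}" for i
        using n2 by (subst sum.cong[OF refl, of _ _ "\<lambda>j. if j = 1 then curvature_form \<Omega> x (e i) (e 1) * \<xi> i else 0"])
          (auto simp: \<xi>_def)
      then have "(\<Sum>i\<in>{1..<CARD('n)}. \<Sum>j\<in>{1..<CARD('n)}. curvature_form \<Omega> x (e i) (e j) * \<xi> i * \<xi> j)
          = (\<Sum>i\<in>{1..<CARD('n)}. if i = 1 then curvature_form \<Omega> x (e 1) (e 1) else 0)"
        by (intro sum.cong refl)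
      then show ?thesis using n2 by simp
    qed
    ultimately have "curvature_form \<Omega> x b b \<ge> k0" using e by simp
    then have "- (\<nu>' b \<bullet> b) \<ge> k0"
      using f\<nu>[of b] b by (simp add: curvature_form_def f'_def[symmetric] inner_commute) (simp add: f'_def fun_eq_iff)
    then have "(G b \<bullet> b) / norm (?g x) \<le> - k0" using key[of b] b by (simp add: inner_commute)
    then have Gb: "G b \<bullet> b \<le> - k0 * norm (?g x)" using gnz by (simp add: pos_divide_le_eq)
    have "G a \<bullet> a = (norm a)\<^sup>2 * (G b \<bullet> b)"
    proof -
      have "a = norm a *\<^sub>R b" using False by (simp add: b_def)
      then have "G a \<bullet> a = G (norm a *\<^sub>R b) \<bullet> (norm a *\<^sub>R b)" by simp
      then show ?thesis using linear_scale[OF has_derivative_linear[OF dg]] by (simp add: power2_eq_square)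
    qed
    also have "\<dots> \<le> (norm a)\<^sup>2 * (- k0 * norm (?g x))" using Gb by (intro mult_left_mono) auto
    finally show ?thesis unfolding H by (simp add: mult_ac)
  qed
qed

end

section \<open>Quantitative convexity and extension of the normal\<close>

text \<open>Uniformity in the direction \<open>h\<close> is what continuity of the finitely many second partial derivatives provides.\<close>

lemma second_dderiv_near:
  fixes f :: "real^'n \<Rightarrow> real"
  assumes U: "open U" "x \<in> U" and f: "Ck_on (Suc (Suc 0)) U f" and w: "\<omega> > 0"
  shows "\<forall>\<^sub>F z in nhds x. z \<in> U \<and> (\<forall>h. \<bar>dderiv U (dderiv U f h) h z - dderiv U (dderiv U f h) h x\<bar> \<le> \<omega> * (norm h)\<^sup>2)"
proof -
  let ?H = "\<lambda>i j. dderiv U (dderiv U f (axis i 1)) (axis j 1)"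
  define n where "n = real CARD('n)"
  have n: "n > 0" by (simp add: n_def)
  have "\<forall>\<^sub>F z in nhds x. \<bar>?H i j z - ?H i j x\<bar> < \<omega> / (n * n)" for i j
  proof -
    have "continuous_on U (?H i j)" using f by auto
    then have "isCont (?H i j) x" using U by (simp add: continuous_on_eq_continuous_at)
    then have "(?H i j \<longlongrightarrow> ?H i j x) (nhds x)" by (simp add: isCont_def tendsto_at_iff_tendsto_nhds)
    then show ?thesis using w n by (auto simp: tendsto_iff dist_real_def)
  qed
  then have "\<forall>\<^sub>F z in nhds x. \<forall>i j. \<bar>?H i j z - ?H i j x\<bar> < \<omega> / (n * n)"
    by (simp add: eventually_all_finite)
  with eventually_nhds_in_open[OF U] show ?thesis
  proof eventually_elim
    case (elim z)
    have "\<bar>dderiv U (dderiv U f h) h z - dderiv U (dderiv U f h) h x\<bar> \<le> \<omega> * (norm h)\<^sup>2" for h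
    proof -
      have "dderiv U (dderiv U f h) h z - dderiv U (dderiv U f h) h x =
        (\<Sum>i\<in>UNIV. \<Sum>j\<in>UNIV. (?H i j z - ?H i j x) * h $ i * h $ j)"
        by (subst second_dderiv_expand[OF U(1) f, of z h], use elim in simp, subst second_dderiv_expand[OF U(1) f U(2), of h])
           (simp add: sum_subtractf[symmetric] left_diff_distrib)
      also have "\<bar>\<dots>\<bar> \<le> (\<Sum>i\<in>(UNIV::'n set). \<Sum>j\<in>(UNIV::'n set). \<omega> / (n * n) * norm h * norm h)"
      proof (rule order_trans[OF sum_abs], rule sum_mono, rule order_trans[OF sum_abs], rule sum_mono)
        fix i j
        have "\<bar>?H i j z - ?H i j x\<bar> * \<bar>h $ i\<bar> * \<bar>h $ j\<bar> \<le> \<omega> / (n * n) * norm h * norm h"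
          using elim w n by (intro mult_mono component_le_norm_cart mult_nonneg_nonneg abs_ge_zero norm_ge_zero)
            (auto intro: less_imp_le)
        then show "\<bar>(?H i j z - ?H i j x) * h $ i * h $ j\<bar> \<le> \<omega> / (n * n) * norm h * norm h"
          by (simp only: abs_mult)
      qed
      also have "\<dots> = \<omega> * (norm h)\<^sup>2"
        using n by (simp add: n_def[symmetric] power2_eq_square)
      finally show ?thesis .
    qed
    then show ?case using elim by blast
  qed
qed

context smooth_convex_domain
begin

text \<open>Second-order Taylor expansion of the defining function between the boundary point \<open>x\<close>, where it vanishes, and \<open>y\<close>, where it is nonnegative:
the first-order term must compensate a Hessian that is negative in tangential directions.  The normal part of
the displacement is of the order of the quantity to be bounded from below.\<close>

lemma quantitative_convexity_local:
  assumes n2: "CARD('n) \<ge> 2" and k: "curvature_ge \<Omega> k0" "k0 > 0" and x0: "x0 \<in> frontier \<Omega>"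
  shows "\<exists>\<kappa>>0. \<exists>r>0. \<forall>x y. x \<in> frontier \<Omega> \<and> dist x x0 < r \<and> y \<in> closure \<Omega> \<and> dist y x0 < r \<longrightarrow>
    (y - x) \<bullet> inward_normal \<Omega> x \<ge> \<kappa> * (norm (y - x))\<^sup>2"
proof -
  let ?N = "inward_normal \<Omega>"
  obtain U \<rho> where U: "x0 \<in> U" "local_defining_function \<Omega> U \<rho>" using obtain_ldf[OF x0] .
  let ?g = "grad U \<rho>"
  have oU: "open U" and ck: "Ck_on (Suc (Suc 0)) U \<rho>" using ldf_open[OF U(2,1) x0] ldf_Ck[OF U(2,1) x0] by auto
  define g where "g = norm (?g x0)"
  have g: "g > 0" using ldf_grad_nonzero[OF U(2,1) x0] by (simp add: g_def)
  define G where "G z v = (\<chi> i. dderiv U (dderiv U \<rho> (axis i 1)) v z)" for z v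
  have dg: "(?g has_derivative G z) (at z)" if "z \<in> U" for z
    unfolding G_def by (rule grad_has_derivative[OF oU ck that])
  have Q: "dderiv U (dderiv U \<rho> h) h z = G z h \<bullet> h" if "z \<in> U" for z h
    unfolding G_def by (rule second_dderiv_inner[OF oU ck that])
  interpret G: bounded_linear "G x0" by (rule has_derivative_bounded_linear[OF dg[OF U(1)]])
  obtain C where C: "C > 0" "\<And>v. norm (G x0 v) \<le> norm v * C" using G.pos_bounded by blast
  define C' where "C' = k0 * g + 2 * C"
  have C': "C' > 0" using k g C by (simp add: C'_def add_pos_pos)
  \<comment> \<open>The tolerance for the variation of the Hessian and of the normal: its total effect uses up half of the curvature term.\<close>
  define \<omega> where "\<omega> = k0 * g / (2 * (C' + 1))"
  have w: "\<omega> > 0" using k g C' by (simp add: \<omega>_def)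
  have Qx0: "G x0 h \<bullet> h \<le> - k0 * g * (norm h)\<^sup>2 + C' * \<bar>h \<bullet> ?N x0\<bar> * norm h" for h
  proof -
    define \<sigma> where "\<sigma> = h \<bullet> ?N x0"
    define a where "a = h - \<sigma> *\<^sub>R ?N x0"
    have N1: "?N x0 \<bullet> ?N x0 = 1" using norm_normal[OF x0] by (simp add: norm_eq_1)
    have a0: "a \<bullet> ?N x0 = 0" by (simp add: a_def \<sigma>_def inner_diff_left N1)
    have sh: "\<bar>\<sigma>\<bar> \<le> norm h" unfolding \<sigma>_def using Cauchy_Schwarz_ineq2[of h "?N x0"] norm_normal[OF x0] by simp
    have na: "(norm a)\<^sup>2 = (norm h)\<^sup>2 - \<sigma>\<^sup>2"
    proof -
      have "h \<bullet> ?N x0 = \<sigma>" "?N x0 \<bullet> h = \<sigma>" by (simp_all add: \<sigma>_def inner_commute)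
      then show ?thesis unfolding power2_norm_eq_inner a_def
        by (simp add: inner_diff_left inner_diff_right N1 power2_eq_square)
    qed
    then have "(norm a)\<^sup>2 \<le> (norm h)\<^sup>2" by simp
    then have nah: "norm a \<le> norm h" by (rule power2_le_imp_le) simp
    have 1: "G x0 a \<bullet> a \<le> - k0 * g * (norm a)\<^sup>2"
      using curvature_second_derivative[OF n2 k(1) U(2,1) x0 a0] Q[OF U(1)] by (simp add: g_def)
    have 2: "G x0 h \<bullet> h - G x0 a \<bullet> a = G x0 (h - a) \<bullet> h + G x0 a \<bullet> (h - a)"
      by (simp add: G.diff inner_diff_left inner_diff_right)
    have nha: "norm (h - a) = \<bar>\<sigma>\<bar>" using norm_normal[OF x0] by (simp add: a_def)
    have "G x0 (h - a) \<bullet> h \<le> norm (G x0 (h - a)) * norm h" by (rule norm_cauchy_schwarz)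
    also have "\<dots> \<le> (\<bar>\<sigma>\<bar> * C) * norm h" using C(2)[of "h - a"] nha by (intro mult_right_mono) auto
    finally have 3: "G x0 (h - a) \<bullet> h \<le> C * (\<bar>\<sigma>\<bar> * norm h)" by (simp add: mult_ac)
    have "norm (G x0 a) \<le> norm h * C"
      using C(2)[of a] mult_right_mono[OF nah, of C] C(1) by linarith
    then have "norm (G x0 a) * norm (h - a) \<le> (norm h * C) * \<bar>\<sigma>\<bar>"
      unfolding nha by (intro mult_right_mono) auto
    then have 4: "G x0 a \<bullet> (h - a) \<le> C * (\<bar>\<sigma>\<bar> * norm h)"
      using norm_cauchy_schwarz[of "G x0 a" "h - a"] by (simp add: mult_ac)
    have "\<sigma>\<^sup>2 = \<bar>\<sigma>\<bar> * \<bar>\<sigma>\<bar>" by (simp add: power2_eq_square)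
    also have "\<dots> \<le> \<bar>\<sigma>\<bar> * norm h" using sh by (intro mult_left_mono) auto
    finally have 5: "k0 * g * \<sigma>\<^sup>2 \<le> k0 * g * (\<bar>\<sigma>\<bar> * norm h)"
      using k g by (intro mult_left_mono) auto
    have "G x0 h \<bullet> h \<le> - k0 * g * (norm a)\<^sup>2 + 2 * C * (\<bar>\<sigma>\<bar> * norm h)" using 1 2 3 4 by linarith
    also have "- k0 * g * (norm a)\<^sup>2 = - k0 * g * (norm h)\<^sup>2 + k0 * g * \<sigma>\<^sup>2" unfolding na by (simp add: algebra_simps)
    finally have "G x0 h \<bullet> h \<le> - k0 * g * (norm h)\<^sup>2 + (k0 * g * (\<bar>\<sigma>\<bar> * norm h) + 2 * C * (\<bar>\<sigma>\<bar> * norm h))"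
      using 5 by linarith
    also have "\<dots> = - k0 * g * (norm h)\<^sup>2 + C' * \<bar>\<sigma>\<bar> * norm h" by (simp add: C'_def algebra_simps)
    finally show ?thesis by (simp add: \<sigma>_def)
  qed
  have "\<forall>\<^sub>F z in nhds x0. norm (?g z) < 2 * g"
  proof -
    have "isCont ?g x0" by (rule has_derivative_continuous[OF dg[OF U(1)]])
    then have "((\<lambda>z. norm (?g z)) \<longlongrightarrow> g) (nhds x0)"
      unfolding g_def by (intro tendsto_norm) (simp add: isCont_def tendsto_at_iff_tendsto_nhds)
    then show ?thesis using order_tendstoD(2)[of _ g _ "2 * g"] g by simp
  qed
  then have "\<forall>\<^sub>F z in nhds x0. norm (?g z) < 2 * g \<and> z \<in> U \<and>
      (\<forall>h. \<bar>dderiv U (dderiv U \<rho> h) h z - dderiv U (dderiv U \<rho> h) h x0\<bar> \<le> \<omega> * (norm h)\<^sup>2)"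
    using second_dderiv_near[OF oU U(1) ck w] by (rule eventually_conj)
  then obtain r1 where r1: "r1 > 0" "\<And>z. dist z x0 < r1 \<Longrightarrow> norm (?g z) < 2 * g \<and> z \<in> U \<and>
      (\<forall>h. \<bar>dderiv U (dderiv U \<rho> h) h z - dderiv U (dderiv U \<rho> h) h x0\<bar> \<le> \<omega> * (norm h)\<^sup>2)"
    unfolding eventually_nhds_metric by blast
  obtain r2 where r2: "r2 > 0" "\<And>x. x \<in> frontier \<Omega> \<Longrightarrow> dist x x0 < r2 \<Longrightarrow> dist (?N x) (?N x0) < \<omega>"
    using continuous_normal w x0 unfolding continuous_on_iff by blast
  define r where "r = min (min r1 r2) (1/2)"
  have r: "r > 0" "r \<le> r1" "r \<le> r2" "r \<le> 1/2" using r1 r2 by (auto simp: r_def)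
  define \<kappa> where "\<kappa> = (k0 * g / 2) / (4 * g + C')"
  have \<kappa>: "\<kappa> > 0" using k g C' by (simp add: \<kappa>_def)
  have main: "(y - x) \<bullet> ?N x \<ge> \<kappa> * (norm (y - x))\<^sup>2"
    if x: "x \<in> frontier \<Omega>" "dist x x0 < r" and y: "y \<in> closure \<Omega>" "dist y x0 < r" for x y
  proof -
    define h where "h = y - x"
    have xU: "x \<in> U" and yU: "y \<in> U" using r1(2) x y r by auto
    have seg: "dist (x + s *\<^sub>R h) x0 < r" if "0 \<le> s" "s \<le> 1" for s
    proof -
      have "x + s *\<^sub>R h = (1 - s) *\<^sub>R x + s *\<^sub>R y" by (simp add: h_def algebra_simps)
      moreover have "(1 - s) *\<^sub>R x + s *\<^sub>R y \<in> ball x0 r"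
        using convexD[OF convex_ball[of x0 r], of x y "1 - s" s] that x y by (simp add: dist_commute)
      ultimately show ?thesis by (simp add: dist_commute)
    qed
    have nh: "norm h \<le> 1"
      using dist_triangle_less_add[OF y(2) x(2)] r by (simp add: h_def dist_norm)
    define X where "X = h \<bullet> ?N x"
    have X: "X \<ge> 0" unfolding X_def h_def by (rule supporting[OF x(1) y(1)])
    define M where "M = G x0 h \<bullet> h + \<omega> * (norm h)\<^sup>2"
    have "\<rho> (x + 1 *\<^sub>R h) \<le> \<rho> (x + 0 *\<^sub>R h) + ?g (x + 0 *\<^sub>R h) \<bullet> h + M / 2"
    proof (rule taylor2_upper[where f = "\<lambda>s. \<rho> (x + s *\<^sub>R h)" and g = "\<lambda>s. ?g (x + s *\<^sub>R h) \<bullet> h"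
          and g' = "\<lambda>s. G (x + s *\<^sub>R h) h \<bullet> h"])
      fix s :: real assume s: "0 \<le> s" "s \<le> 1"
      have z: "x + s *\<^sub>R h \<in> U" "\<bar>dderiv U (dderiv U \<rho> h) h (x + s *\<^sub>R h) - dderiv U (dderiv U \<rho> h) h x0\<bar> \<le> \<omega> * (norm h)\<^sup>2"
        using r1(2)[of "x + s *\<^sub>R h"] seg[OF s] r by auto
      show "((\<lambda>s. \<rho> (x + s *\<^sub>R h)) has_real_derivative ?g (x + s *\<^sub>R h) \<bullet> h) (at s)"
        using has_vector_derivative_line[OF ldf_derivative[OF U(2,1) x0 z(1)]]
        by (simp add: has_real_derivative_iff_has_vector_derivative)
      show "((\<lambda>s. ?g (x + s *\<^sub>R h) \<bullet> h) has_real_derivative G (x + s *\<^sub>R h) h \<bullet> h) (at s)"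
        using bounded_linear.has_vector_derivative[OF bounded_linear_inner_left has_vector_derivative_line[OF dg[OF z(1)]]]
        by (simp add: has_real_derivative_iff_has_vector_derivative)
      show "G (x + s *\<^sub>R h) h \<bullet> h \<le> M"
        using z(2) unfolding Q[OF z(1)] Q[OF U(1)] M_def by linarith
    qed
    moreover have "x + 1 *\<^sub>R h = y" "x + 0 *\<^sub>R h = x" by (simp_all add: h_def)
    moreover have "\<rho> x = 0" by (rule ldf_zero[OF U(2) xU x(1)])
    moreover have "\<rho> y \<ge> 0" by (rule ldf_nonneg[OF U(2,1) x0 yU y(1)])
    ultimately have "0 \<le> ?g x \<bullet> h + M / 2" by simp
    moreover have "?g x \<bullet> h \<le> 2 * g * X"
    proof -
      have "?g x \<noteq> 0" by (rule ldf_grad_nonzero[OF U(2) xU x(1)])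
      then have "?g x \<bullet> h = norm (?g x) * X"
        unfolding X_def inward_normal_eq[OF U(2) xU x(1)] by (simp add: inner_commute)
      also have "\<dots> \<le> 2 * g * X" using r1(2)[of x] x(2) r X by (intro mult_right_mono) auto
      finally show ?thesis .
    qed
    moreover have "M \<le> - k0 * g * (norm h)\<^sup>2 + C' * (X + \<omega> * (norm h)\<^sup>2) + \<omega> * (norm h)\<^sup>2"
    proof -
      have "\<bar>h \<bullet> ?N x0\<bar> \<le> X + \<omega> * norm h"
      proof -
        have "h \<bullet> ?N x0 = X - h \<bullet> (?N x - ?N x0)" by (simp add: X_def inner_diff_right)
        moreover have "\<bar>h \<bullet> (?N x - ?N x0)\<bar> \<le> norm h * \<omega>"
        proof (rule order_trans[OF Cauchy_Schwarz_ineq2])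
          have "norm (?N x - ?N x0) \<le> \<omega>" using r2(2)[OF x(1)] x(2) r by (simp add: dist_norm)
          then show "norm h * norm (?N x - ?N x0) \<le> norm h * \<omega>" by (rule mult_left_mono) simp
        qed
        ultimately show ?thesis using X by (simp add: mult.commute)
      qed
      then have "\<bar>h \<bullet> ?N x0\<bar> * norm h \<le> (X + \<omega> * norm h) * norm h" by (intro mult_right_mono) auto
      also have "\<dots> \<le> X + \<omega> * (norm h)\<^sup>2"
        using mult_left_mono[OF nh X] by (simp add: algebra_simps power2_eq_square)
      finally have "C' * (\<bar>h \<bullet> ?N x0\<bar> * norm h) \<le> C' * (X + \<omega> * (norm h)\<^sup>2)" using C' by (intro mult_left_mono) auto
      then show ?thesis using Qx0[of h] unfolding M_def by (simp add: mult.assoc)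
    qed
    ultimately have "k0 * g * (norm h)\<^sup>2 - (C' + 1) * \<omega> * (norm h)\<^sup>2 \<le> (4 * g + C') * X"
      by (simp add: algebra_simps)
    moreover have "(C' + 1) * \<omega> = k0 * g / 2" using C' by (simp add: \<omega>_def field_simps)
    then have "(C' + 1) * \<omega> * (norm h)\<^sup>2 = k0 * g / 2 * (norm h)\<^sup>2" by (simp only:)
    moreover have "k0 * g * (norm h)\<^sup>2 = k0 * g / 2 * (norm h)\<^sup>2 + k0 * g / 2 * (norm h)\<^sup>2" by simp
    ultimately have "(k0 * g / 2) * (norm h)\<^sup>2 \<le> (4 * g + C') * X" by linarith
    moreover have "4 * g + C' > 0" using g C' by simp
    ultimately have "(k0 * g / 2) * (norm h)\<^sup>2 / (4 * g + C') \<le> X"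
      by (simp only: pos_divide_le_eq mult.commute[of X])
    then have "\<kappa> * (norm h)\<^sup>2 \<le> X" by (simp add: \<kappa>_def)
    then show ?thesis by (simp add: X_def h_def)
  qed
  show ?thesis using \<kappa> r(1) main by blast
qed

text \<open>A sequence violating the inequality with constants tending to zero would accumulate at a pair \<open>(x, y)\<close> with
\<open>(y - x) \<bullet> N = 0\<close>, so \<open>x = y\<close> by strict convexity; near the diagonal the local estimate contradicts this.\<close>

lemma quantitative_convexity:
  assumes n2: "CARD('n) \<ge> 2" and k: "curvature_ge \<Omega> k0" "k0 > 0"
  obtains \<kappa> where "\<kappa> > 0"
    "\<And>x y. x \<in> frontier \<Omega> \<Longrightarrow> y \<in> closure \<Omega> \<Longrightarrow> (y - x) \<bullet> inward_normal \<Omega> x \<ge> \<kappa> * (norm (y - x))\<^sup>2"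
proof -
  let ?N = "inward_normal \<Omega>"
  have "\<exists>\<kappa>>0. \<forall>x\<in>frontier \<Omega>. \<forall>y\<in>closure \<Omega>. (y - x) \<bullet> ?N x \<ge> \<kappa> * (norm (y - x))\<^sup>2"
  proof (rule ccontr)
    assume "\<not> ?thesis"
    then have "\<exists>p\<in>frontier \<Omega> \<times> closure \<Omega>. (snd p - fst p) \<bullet> ?N (fst p) < inverse (real (Suc i)) * (norm (snd p - fst p))\<^sup>2" for i
      by (metis (no_types, lifting) SigmaI fst_conv snd_conv inverse_positive_iff_positive not_le of_nat_0_less_iff zero_less_Suc)
    then obtain p where p: "\<And>i. p i \<in> frontier \<Omega> \<times> closure \<Omega>"
      "\<And>i. (snd (p i) - fst (p i)) \<bullet> ?N (fst (p i)) < inverse (real (Suc i)) * (norm (snd (p i) - fst (p i)))\<^sup>2"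
      by metis
    have "compact (frontier \<Omega> \<times> closure \<Omega>)" by (intro compact_Times compact_fr compact_cl)
    then obtain q s where q: "q \<in> frontier \<Omega> \<times> closure \<Omega>" "strict_mono s" "(p \<circ> s) \<longlonglongrightarrow> q"
      using p(1) unfolding compact_def by metis
    define x y where "x = fst q" and "y = snd q"
    have xy: "x \<in> frontier \<Omega>" "y \<in> closure \<Omega>" using q(1) by (auto simp: x_def y_def)
    have lx: "(\<lambda>i. fst (p (s i))) \<longlonglongrightarrow> x" and ly: "(\<lambda>i. snd (p (s i))) \<longlonglongrightarrow> y"
      using tendsto_fst[OF q(3)] tendsto_snd[OF q(3)] by (simp_all add: x_def y_def o_def)
    have lN: "(\<lambda>i. ?N (fst (p (s i)))) \<longlonglongrightarrow> ?N x"
      using continuous_on_tendsto_compose[OF continuous_normal lx xy(1)] p(1) by (auto simp: mem_Times_iff)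
    have "(\<lambda>i. (snd (p (s i)) - fst (p (s i))) \<bullet> ?N (fst (p (s i)))) \<longlonglongrightarrow> (y - x) \<bullet> ?N x"
      by (intro tendsto_intros lx ly lN)
    moreover have "(\<lambda>i. inverse (real (Suc (s i))) * (norm (snd (p (s i)) - fst (p (s i))))\<^sup>2) \<longlonglongrightarrow> 0 * (norm (y - x))\<^sup>2"
      using LIMSEQ_subseq_LIMSEQ[OF LIMSEQ_inverse_real_of_nat q(2)]
      by (intro tendsto_intros lx ly) (simp add: o_def)
    ultimately have "(y - x) \<bullet> ?N x \<le> 0 * (norm (y - x))\<^sup>2"
      by (rule LIMSEQ_le) (rule exI[of _ 0], intro allI impI less_imp_le, rule p(2))
    then have "x = y" using strictly_supporting[OF xy] by fastforce
    obtain \<kappa> r where \<kappa>: "\<kappa> > 0" "r > 0" "\<And>x' y'. x' \<in> frontier \<Omega> \<Longrightarrow> dist x' x < r \<Longrightarrow> y' \<in> closure \<Omega> \<Longrightarrow> dist y' x < r \<Longrightarrow>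
      (y' - x') \<bullet> ?N x' \<ge> \<kappa> * (norm (y' - x'))\<^sup>2"
      using quantitative_convexity_local[OF n2 k xy(1)] by blast
    have "\<forall>\<^sub>F i in sequentially. dist (fst (p (s i))) x < r" "\<forall>\<^sub>F i in sequentially. dist (snd (p (s i))) x < r"
      using tendstoD[OF lx \<kappa>(2)] tendstoD[OF ly \<kappa>(2)] \<open>x = y\<close> by auto
    moreover have "\<forall>\<^sub>F i in sequentially. inverse (real (Suc (s i))) < \<kappa>"
      using LIMSEQ_subseq_LIMSEQ[OF LIMSEQ_inverse_real_of_nat q(2)] \<kappa>(1) order_tendstoD(2)[of _ 0 _ \<kappa>] by (simp add: o_def)
    ultimately have "\<forall>\<^sub>F i in sequentially. False"
    proof eventually_elim
      case (elim i)
      let ?h = "norm (snd (p (s i)) - fst (p (s i)))"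
      have "\<kappa> * ?h\<^sup>2 \<le> (snd (p (s i)) - fst (p (s i))) \<bullet> ?N (fst (p (s i)))"
        using \<kappa>(3)[of "fst (p (s i))" "snd (p (s i))"] elim p(1)[of "s i"] by (auto simp: mem_Times_iff)
      also have "\<dots> < inverse (real (Suc (s i))) * ?h\<^sup>2" by (rule p(2))
      also have "\<dots> \<le> \<kappa> * ?h\<^sup>2" using elim by (intro mult_right_mono) auto
      finally show False by simp
    qed
    then show False by simp
  qed
  then show ?thesis using that by blast
qed

text \<open>Gradients of local defining functions are glued with cut-off functions.  On the boundary the sum \<open>V\<close> is a positive multiple of the
normal, and it remains to divide by its length in a way that is smooth also where \<open>V\<close> vanishes.\<close>

lemma normal_extension:
  obtains \<nu> :: "real^'n \<Rightarrow> real^'n" where "C2_bounded_on (closure \<Omega>) \<nu>" "\<And>x. x \<in> frontier \<Omega> \<Longrightarrow> \<nu> x = inward_normal \<Omega> x"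
proof -
  let ?N = "inward_normal \<Omega>"
  have "\<forall>x\<in>frontier \<Omega>. \<exists>U \<rho> s. local_defining_function \<Omega> U \<rho> \<and> s > 0 \<and> cball x s \<subseteq> U"
  proof
    fix x assume x: "x \<in> frontier \<Omega>"
    obtain U \<rho> where U: "x \<in> U" "local_defining_function \<Omega> U \<rho>" using obtain_ldf[OF x] .
    then show "\<exists>U \<rho> s. local_defining_function \<Omega> U \<rho> \<and> s > 0 \<and> cball x s \<subseteq> U"
      using ldf_open[OF U(2,1) x] open_contains_cball by metis
  qed
  then obtain U \<rho> s where U: "\<And>x. x \<in> frontier \<Omega> \<Longrightarrow> local_defining_function \<Omega> (U x) (\<rho> x)"
    "\<And>x. x \<in> frontier \<Omega> \<Longrightarrow> s x > 0" "\<And>x. x \<in> frontier \<Omega> \<Longrightarrow> cball x (s x) \<subseteq> U x"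
    by metis
  obtain I where I: "I \<subseteq> frontier \<Omega>" "finite I" "frontier \<Omega> \<subseteq> (\<Union>x\<in>I. ball x (s x))"
  proof (rule compactE_image[OF compact_fr, of "frontier \<Omega>" "\<lambda>x. ball x (s x)"])
    show "frontier \<Omega> \<subseteq> (\<Union>c\<in>frontier \<Omega>. ball c (s c))" using U(2) by force
  qed auto
  \<comment> \<open>Cubes of positive parts are \<open>C\<^sup>2\<close> and vanish exactly outside the chosen balls.\<close>
  define bump where "bump p x = (max 0 ((s p)\<^sup>2 - (x - p) \<bullet> (x - p))) ^ 3" for p x :: "real^'n"
  have bump_pos: "bump p x > 0 \<longleftrightarrow> x \<in> ball p (s p)" "bump p x \<ge> 0" if "p \<in> I" for p x
  proof -
    have sp: "s p > 0" using U(2) I that by auto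
    have "(s p)\<^sup>2 - (x - p) \<bullet> (x - p) > 0 \<longleftrightarrow> norm (x - p) < s p"
      using sp power_mono_iff[of "s p" "norm (x - p)" 2] by (auto simp: power2_norm_eq_inner[symmetric] not_le[symmetric])
    then show "bump p x > 0 \<longleftrightarrow> x \<in> ball p (s p)"
      by (auto simp: bump_def dist_norm norm_minus_commute zero_less_power_eq less_max_iff_disj)
    show "bump p x \<ge> 0" by (simp add: bump_def)
  qed
  have d3: "((\<lambda>t. (max 0 t) ^ 3) has_real_derivative 3 * (max 0 t)\<^sup>2) (at t)" for t :: real
    using has_real_derivative_pos_part_power[of 1 t] by (simp add: numeral_3_eq_3 numeral_2_eq_2)
  have d2: "((\<lambda>t. 3 * (max 0 t)\<^sup>2) has_real_derivative 6 * max 0 t) (at t)" for t :: real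
    using DERIV_cmult[OF has_real_derivative_pos_part_power[of 0 t], of 3] by (simp add: numeral_2_eq_2)
  have cube: "C2_bounded_on S (\<lambda>x. (max 0 (f x)) ^ 3)"
    if "C2_bounded_on S f" "f ` S \<subseteq> C" "compact C" for S C and f :: "real^'n \<Rightarrow> real"
    by (rule C2_bounded_on_compose[OF that(1) open_UNIV that(2) _ that(3) d3 d2])
       (auto intro!: continuous_intros)
  define K where "K = closure \<Omega>"
  have cK: "compact K" using compact_cl by (simp add: K_def)
  have idd: "C2_bounded_on S (\<lambda>x. x - p)" if bS: "bounded S" for S and p :: "real^'n"
  proof -
    obtain B where "\<forall>x\<in>S. dist p x \<le> B"
      using bS bounded_any_center[of S p] by blast
    then have B: "norm (x - p) \<le> B" if "x \<in> S" for x
      using that by (simp add: dist_norm norm_minus_commute[of p])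
    show ?thesis
    proof (rule C2_bounded_onI)
      fix x assume "x \<in> S"
      then show "C2_bounds_at B 1 0 (\<lambda>x. x - p) x"
        unfolding C2_bounds_at_def using B
        by (rule_tac exI[of _ "\<lambda>y v. v"], rule_tac exI[of _ "\<lambda>v w. 0"])
           (auto intro!: derivative_eq_intros always_eventually)
    qed
  qed
  have sq: "C2_bounded_on K (\<lambda>x. (s p)\<^sup>2 - (x - p) \<bullet> (x - p))" for p
  proof -
    have "C2_bounded_on K (\<lambda>x. (s p)\<^sup>2 + (-1) *\<^sub>R ((x - p) \<bullet> (x - p)))"
      by (intro C2_bounded_on_add C2_bounded_on_const C2_bounded_on_scaleR C2_bounded_on_inner idd compact_imp_bounded cK)
    then show ?thesis by simp
  qed
  have bump_C2: "C2_bounded_on K (bump p)" for p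
    unfolding bump_def
    by (rule cube[OF sq subset_refl compact_continuous_image[OF C2_bounded_on_continuous[OF sq] cK]])
  define V where "V x = (\<Sum>p\<in>I. bump p x *\<^sub>R grad (U p) (\<rho> p) x)" for x
  have VC2: "C2_bounded_on K V" unfolding V_def
  proof (rule C2_bounded_on_sum[OF I(2)])
    fix p assume p: "p \<in> I"
    then have pf: "p \<in> frontier \<Omega>" using I by auto
    have pU: "p \<in> U p" using U(2,3)[OF pf] by (auto simp: subset_iff dest: less_imp_le)
    have oU: "open (U p)" and ck: "Ck_on k (U p) (\<rho> p)" for k
      using ldf_open[OF U(1)[OF pf] pU pf] ldf_Ck[OF U(1)[OF pf] pU pf] by auto
    have g: "C2_bounded_on (cball p (s p)) (grad (U p) (\<rho> p))"
    proof -
      have "C2_bounded_on (cball p (s p)) (dderiv (U p) (\<rho> p) (axis i 1))" for i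
        by (rule C2_bounded_on_compact_Ck[OF oU compact_cball U(3)[OF pf] Ck_on_dderiv[OF ck]])
      then have "C2_bounded_on (cball p (s p)) (\<lambda>x. \<Sum>i\<in>UNIV. dderiv (U p) (\<rho> p) (axis i 1) x *\<^sub>R (axis i 1 :: real^'n))"
        by (intro C2_bounded_on_sum C2_bounded_on_scaleR C2_bounded_on_const) auto
      moreover have "(\<Sum>i\<in>UNIV. dderiv (U p) (\<rho> p) (axis i 1) x *\<^sub>R (axis i 1 :: real^'n)) = grad (U p) (\<rho> p) x" for x
        by (simp add: grad_def vec_eq_iff axis_def if_distrib cong: if_cong)
      ultimately show ?thesis by simp
    qed
    obtain k1 where k1: "\<And>x. x \<in> cball p (s p) \<Longrightarrow> C2_bounds_at k1 k1 k1 (grad (U p) (\<rho> p)) x"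
      using g unfolding C2_bounded_on_def by blast
    obtain k2 where k2: "\<And>x. x \<in> K \<Longrightarrow> C2_bounds_at k2 k2 k2 (bump p) x"
      using bump_C2[of p] unfolding C2_bounded_on_def by blast
    define m where "m = 4 * \<bar>k2 * k1\<bar>"
    show "C2_bounded_on K (\<lambda>x. bump p x *\<^sub>R grad (U p) (\<rho> p) x)"
      unfolding C2_bounded_on_def
    proof (intro exI[of _ "\<bar>m\<bar>"] ballI)
      fix x assume x: "x \<in> K"
      show "C2_bounds_at \<bar>m\<bar> \<bar>m\<bar> \<bar>m\<bar> (\<lambda>x. bump p x *\<^sub>R grad (U p) (\<rho> p) x) x"
      proof (cases "x \<in> cball p (s p)")
        case True
        have le: "y \<le> \<bar>4 * \<bar>y\<bar>\<bar>" "y + y \<le> \<bar>4 * \<bar>y\<bar>\<bar>" "y + 2 * y + y \<le> \<bar>4 * \<bar>y\<bar>\<bar>" for y :: real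
          by auto
        show ?thesis unfolding m_def
          by (rule C2_bounds_at_mono[OF C2_bounds_at_prod[OF bounded_bilinear_scaleR _ k2[OF x] k1[OF True]] le]) simp
      next
        case False
        have "C2_bounds_at (norm (0::real^'n)) 0 0 (\<lambda>x. 0 :: real^'n) x" by (rule C2_bounds_at_const)
        then have "C2_bounds_at (norm (0::real^'n)) 0 0 (\<lambda>x. bump p x *\<^sub>R grad (U p) (\<rho> p) x) x"
        proof (rule C2_bounds_at_cong)
          have "open (- cball p (s p))" by auto
          from eventually_nhds_in_open[OF this, of x] False
          have "\<forall>\<^sub>F y in nhds x. y \<in> - cball p (s p)" by simp
          then show "\<forall>\<^sub>F y in nhds x. 0 = bump p y *\<^sub>R grad (U p) (\<rho> p) y"
          proof eventually_elim
            case (elim y)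
            then have "\<not> bump p y > 0" using bump_pos(1)[OF p, of y] by auto
            then have "bump p y = 0" using bump_pos(2)[OF p, of y] by simp
            then show ?case by simp
          qed
        qed
        then show ?thesis by (rule C2_bounds_at_mono) auto
      qed
    qed
  qed
  have VN: "\<exists>c>0. V x = c *\<^sub>R ?N x" if x: "x \<in> frontier \<Omega>" for x
  proof -
    have t: "bump p x *\<^sub>R grad (U p) (\<rho> p) x = (bump p x * norm (grad (U p) (\<rho> p) x)) *\<^sub>R ?N x" if "p \<in> I" for p
    proof (cases "bump p x = 0")
      case False
      then have "x \<in> ball p (s p)" using bump_pos[OF that, of x] by auto
      then have xU: "x \<in> U p" using U(3)[of p] that I by (auto simp: subset_iff)
      have ld: "local_defining_function \<Omega> (U p) (\<rho> p)" using U(1) that I by auto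
      show ?thesis
        using ldf_grad_nonzero[OF ld xU x] by (simp add: inward_normal_eq[OF ld xU x])
    qed simp
    define c where "c = (\<Sum>p\<in>I. bump p x * norm (grad (U p) (\<rho> p) x))"
    have "V x = c *\<^sub>R ?N x" unfolding V_def c_def scaleR_sum_left using t by (intro sum.cong) auto
    moreover have "c > 0"
    proof -
      obtain p where p: "p \<in> I" "x \<in> ball p (s p)" using I(3) x by blast
      have xU: "x \<in> U p" using U(3)[of p] p I by (auto simp: subset_iff)
      have ld: "local_defining_function \<Omega> (U p) (\<rho> p)" using U(1) p I by auto
      have "0 < bump p x * norm (grad (U p) (\<rho> p) x)"
        using bump_pos(1)[OF p(1)] p(2) ldf_grad_nonzero[OF ld xU x] by simp
      then show ?thesis unfolding c_def using I(2) p(1) bump_pos(2) by (intro sum_pos2[of I p]) auto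
    qed
    ultimately show ?thesis by blast
  qed
  define q where "q x = V x \<bullet> V x" for x
  have qC2: "C2_bounded_on K q" unfolding q_def by (intro C2_bounded_on_inner VC2)
  have qpos: "q x > 0" if "x \<in> frontier \<Omega>" for x
    using VN[OF that] norm_normal[OF that] by (auto simp: q_def norm_eq_1)
  obtain c where c: "c > 0" "\<And>x. x \<in> frontier \<Omega> \<Longrightarrow> c \<le> q x"
  proof (cases "frontier \<Omega> = {}")
    case False
    have "continuous_on (frontier \<Omega>) q"
      using continuous_on_subset[OF C2_bounded_on_continuous[OF qC2]] frontier_closure by (auto simp: K_def)
    then obtain x where "x \<in> frontier \<Omega>" "\<And>y. y \<in> frontier \<Omega> \<Longrightarrow> q x \<le> q y"
      using continuous_attains_inf[OF compact_fr False] by blast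
    then show ?thesis using that[of "q x"] qpos by blast
  qed (use that[of 1] in auto)
  \<comment> \<open>A positive \<open>C\<^sup>2\<close> function that agrees with \<open>\<bar>V\<bar>\<^sup>2\<close> on the boundary, so that \<open>V / sqrt w\<close> is the normal there and defined everywhere.\<close>
  define w where "w x = q x + (max 0 (c - q x)) ^ 3" for x
  have wC2: "C2_bounded_on K w"
  proof -
    have "C2_bounded_on K (\<lambda>x. c + (-1) *\<^sub>R q x)"
      by (intro C2_bounded_on_add C2_bounded_on_const C2_bounded_on_scaleR qC2)
    then have cq: "C2_bounded_on K (\<lambda>x. c - q x)" by simp
    show ?thesis unfolding w_def
      by (intro C2_bounded_on_add qC2 cube[OF cq subset_refl compact_continuous_image[OF C2_bounded_on_continuous[OF cq] cK]])
  qed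
  have wpos: "w x > 0" for x
  proof -
    have "q x \<ge> 0" by (simp add: q_def)
    then show ?thesis using c(1) by (cases "q x = 0") (auto simp: w_def add_pos_nonneg)
  qed
  define r where "r x = w x powr (-1/2)" for x
  have rC2: "C2_bounded_on K r"
  proof -
    have cw: "compact (w ` K)" by (rule compact_continuous_image[OF C2_bounded_on_continuous[OF wC2] cK])
    have sub: "w ` K \<subseteq> {0<..}" using wpos by auto
    have d: "((\<lambda>t. t powr (-1/2)) has_real_derivative (-1/2) * t powr (-3/2)) (at t)"
      "((\<lambda>t. (-1/2) * t powr (-3/2)) has_real_derivative (3/4) * t powr (-5/2)) (at t)" if "t \<in> {0<..}" for t :: real
      using has_real_derivative_powr[of t "-1/2"] DERIV_cmult[OF has_real_derivative_powr[of t "-3/2"], of "-1/2"] that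
      by simp_all
    have "continuous_on {0<..} (\<lambda>t::real. (3/4) * t powr (-5/2))"
      by (intro continuous_intros) auto
    then have cc: "continuous_on (w ` K) (\<lambda>t. (3/4) * t powr (-5/2))"
      using sub by (rule continuous_on_subset)
    show ?thesis unfolding r_def
      by (rule C2_bounded_on_compose[OF wC2 open_greaterThan subset_refl sub cw d cc])
  qed
  show ?thesis
  proof (rule that[of "\<lambda>x. r x *\<^sub>R V x"])
    show "C2_bounded_on (closure \<Omega>) (\<lambda>x. r x *\<^sub>R V x)"
      using C2_bounded_on_scaleR[OF rC2 VC2] by (simp add: K_def)
    fix x assume x: "x \<in> frontier \<Omega>"
    obtain d where d: "d > 0" "V x = d *\<^sub>R ?N x" using VN[OF x] by blast
    have "q x = d\<^sup>2" using d norm_normal[OF x] by (simp add: q_def norm_eq_1 power2_eq_square)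
    moreover have "w x = q x" using c(2)[OF x] by (simp add: w_def)
    ultimately have "r x = inverse d" using d(1) by (simp add: r_def powr_minus powr_half_sqrt)
    then show "r x *\<^sub>R V x = ?N x" using d by simp
  qed
qed

end

section \<open>The two-point maximum principle\<close>

lemma dderiv_interior:
  assumes "open T" "x \<in> T" "T \<subseteq> S"
  shows "dderiv S f v x = dderiv T f v x"
proof -
  have "x \<in> interior S" using assms interior_maximal by blast
  then have "at x within S = at x" by (rule at_within_interior)
  moreover have "at x within T = at x" by (rule at_within_open[OF assms(2,1)])
  ultimately show ?thesis by (simp only: dderiv_def)
qed

lemma Ck_on_cong_open:
  assumes "open T" "\<And>y. y \<in> T \<Longrightarrow> f y = g y" "Ck_on k T f"
  shows "Ck_on k T g"
  using assms(2,3)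
proof (induction k arbitrary: f g)
  case 0
  then show ?case using continuous_on_cong[of T T f g] by simp
next
  case (Suc k)
  have "g differentiable (at x within T)" if "x \<in> T" for x
    using Suc.prems that differentiable_transform_within[of f x T 1 g]
    by (auto simp: differentiable_on_def)
  moreover have "Ck_on k T (dderiv T g v)" for v
  proof (rule Suc.IH)
    show "Ck_on k T (dderiv T f v)" using Suc.prems(2) by simp
    show "dderiv T f v y = dderiv T g v y" if "y \<in> T" for y
      by (rule dderiv_cong_open[OF assms(1) that Suc.prems(1)])
  qed
  moreover have "continuous_on T g" using Suc.prems continuous_on_cong[of T T f g] by simp
  ultimately show ?case by (simp add: differentiable_on_def)
qed

lemma Ck_on_open_subset:
  assumes "open T" "T \<subseteq> S" "Ck_on k S f"
  shows "Ck_on k T f"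
  using assms(3)
proof (induction k arbitrary: f)
  case 0
  then show ?case using assms(2) continuous_on_subset by auto
next
  case (Suc k)
  have "Ck_on k T (dderiv T f v)" for v
  proof (rule Ck_on_cong_open[OF assms(1)])
    show "Ck_on k T (dderiv S f v)" using Suc by simp
    show "dderiv S f v y = dderiv T f v y" if "y \<in> T" for y
      by (rule dderiv_interior[OF assms(1) that assms(2)])
  qed
  then show ?case using Suc.prems assms(2) continuous_on_subset differentiable_on_subset by auto
qed

lemma Ck_fst_on_slice: "Ck_fst_on k X Y u \<Longrightarrow> y \<in> Y \<Longrightarrow> Ck_on k X (\<lambda>x. u x y)"
proof (induction k arbitrary: u)
  case 0
  have "continuous_on X ((\<lambda>(x, y). u x y) \<circ> (\<lambda>x. (x, y)))"
    using 0 by (intro continuous_on_compose continuous_intros) (auto intro: continuous_on_subset)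
  then show ?case by (simp add: o_def)
next
  case (Suc k)
  have "continuous_on X ((\<lambda>(x, y). u x y) \<circ> (\<lambda>x. (x, y)))"
    using Suc.prems by (intro continuous_on_compose continuous_intros) (auto intro: continuous_on_subset)
  moreover have "Ck_on k X (dderiv X (\<lambda>x. u x y) v)" for v
    using Suc.IH[of "\<lambda>x y. dderiv X (\<lambda>z. u z y) v x"] Suc.prems by auto
  ultimately show ?case using Suc.prems by (simp add: o_def)
qed

text \<open>The multiplier rule at a boundary maximum: a covector that is nonpositive on all inward directions is a
nonpositive multiple of the inward normal.\<close>

lemma functional_on_half_space:
  fixes w N :: "'a::real_inner"
  assumes N: "norm N = 1" and w: "\<And>v. v \<bullet> N > 0 \<Longrightarrow> w \<bullet> v \<le> 0"
  obtains c where "c \<ge> 0" "w = - c *\<^sub>R N"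
proof -
  have NN: "N \<bullet> N = 1" using N by (simp add: norm_eq_1)
  define c where "c = - (w \<bullet> N)"
  have c: "c \<ge> 0" using w[of N] NN by (simp add: c_def)
  define a where "a = w + c *\<^sub>R N"
  have aN: "a \<bullet> N = 0" by (simp add: a_def c_def inner_add_left inner_diff_left NN)
  have wa: "w \<bullet> a = a \<bullet> a"
  proof -
    have "w = a - c *\<^sub>R N" by (simp add: a_def)
    then have "w \<bullet> a = a \<bullet> a - c * (N \<bullet> a)" by (metis inner_diff_left inner_scaleR_left)
    then show ?thesis using aN by (simp add: inner_commute)
  qed
  have "a \<bullet> a \<le> e * c" if "e > 0" for e
    using w[of "a + e *\<^sub>R N"] that aN NN wa by (simp add: inner_add_left inner_add_right c_def)
  then have "\<forall>\<^sub>F e in at_right 0. a \<bullet> a \<le> e * c"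
    unfolding eventually_at_right_field by (intro exI[of _ 1]) auto
  moreover have "((\<lambda>e. e * c) \<longlongrightarrow> 0 * c) (at_right 0)" by (intro tendsto_intros)
  ultimately have "a \<bullet> a \<le> 0 * c" by (intro tendsto_lowerbound[where f = "\<lambda>e. e * c"]) auto
  then have "a \<bullet> a \<le> 0" by simp
  then have "a = 0" using inner_ge_zero[of a] inner_eq_zero_iff[of a] by linarith
  then have "w = - c *\<^sub>R N" by (simp add: a_def eq_neg_iff_add_eq_0)
  then show ?thesis using that c by blast
qed

text \<open>The boundary operator \<open>p \<mapsto> p \<bullet> N + k * sqrt (1 + \<bar>p\<bar>\<^sup>2)\<close> is monotone in the normal direction since the square root
is 1-Lipschitz and \<open>\<bar>k\<bar> \<le> 1\<close>.\<close>

lemma capillary_monotone: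
  fixes p N :: "'a::real_inner"
  assumes N: "norm N = 1" and c: "c \<ge> 0" and k: "\<bar>k\<bar> \<le> 1"
  shows "p \<bullet> N + k * sqrt (1 + (norm p)\<^sup>2) \<le> (p + c *\<^sub>R N) \<bullet> N + k * sqrt (1 + (norm (p + c *\<^sub>R N))\<^sup>2)"
proof -
  let ?a = "sqrt (1 + (norm p)\<^sup>2)" and ?b = "sqrt (1 + (norm (p + c *\<^sub>R N))\<^sup>2)"
  have "\<bar>?a - ?b\<bar> \<le> norm (p - (p + c *\<^sub>R N))" using norm_lift_diff[of p "p + c *\<^sub>R N"] unfolding norm_lift .
  also have "\<dots> = c" using N c by simp
  finally have "\<bar>k * (?a - ?b)\<bar> \<le> 1 * c" unfolding abs_mult using k by (intro mult_mono) auto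
  then have "k * ?a \<le> k * ?b + c" by (simp add: right_diff_distrib abs_le_iff)
  moreover have "(p + c *\<^sub>R N) \<bullet> N = p \<bullet> N + c" using N by (simp add: inner_add_left norm_eq_1)
  ultimately show ?thesis by linarith
qed

definition second_along :: "(real \<Rightarrow> real) \<Rightarrow> real \<Rightarrow> bool" where
  "second_along g s \<longleftrightarrow> (\<exists>g1. (\<forall>\<^sub>F t in nhds 0. (g has_real_derivative g1 t) (at t)) \<and> (g1 has_real_derivative s) (at 0))"

lemma second_along_diff:
  assumes "second_along f s" "second_along g r" shows "second_along (\<lambda>t. f t - g t) (s - r)"
proof -
  obtain f1 where f: "\<forall>\<^sub>F t in nhds 0. (f has_real_derivative f1 t) (at t)" "(f1 has_real_derivative s) (at 0)"
    using assms(1) unfolding second_along_def by blast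
  obtain g1 where g: "\<forall>\<^sub>F t in nhds 0. (g has_real_derivative g1 t) (at t)" "(g1 has_real_derivative r) (at 0)"
    using assms(2) unfolding second_along_def by blast
  have "\<forall>\<^sub>F t in nhds 0. ((\<lambda>t. f t - g t) has_real_derivative f1 t - g1 t) (at t)"
    using f(1) g(1) by eventually_elim (rule DERIV_diff)
  then show ?thesis unfolding second_along_def
    using DERIV_diff[OF f(2) g(2)] by (intro exI[of _ "\<lambda>t. f1 t - g1 t"] conjI)
qed

lemma second_along_max:
  assumes "second_along g s" "\<forall>\<^sub>F t in nhds 0. g t \<le> g 0" shows "s \<le> 0"
  using assms second_derivative_at_max unfolding second_along_def by blast

lemma eventually_line_in_open:
  fixes x w :: "'a::real_normed_vector"
  assumes "open S" "x \<in> S"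
  shows "\<forall>\<^sub>F t in nhds (0::real). x + t *\<^sub>R w \<in> S"
proof -
  have "((\<lambda>t. x + t *\<^sub>R w) \<longlongrightarrow> x + 0 *\<^sub>R w) (nhds 0)" by (intro tendsto_intros filterlim_ident)
  then show ?thesis using topological_tendstoD[of _ "x + 0 *\<^sub>R w" "nhds 0" S] assms by simp
qed

lemma second_along_line:
  fixes f :: "real^'n \<Rightarrow> real"
  assumes S: "open S" "x \<in> S" and f: "Ck_on (Suc (Suc k)) S f"
  shows "second_along (\<lambda>t. f (x + t *\<^sub>R w)) (dderiv S (dderiv S f w) w x)"
proof -
  have hd: "(g has_derivative (\<lambda>v. dderiv S g v y)) (at y)" if "Ck_on (Suc k) S g" "y \<in> S" for g y k
    using differentiable_has_dderiv[OF Ck_on_differentiable[OF that]] at_within_open[OF that(2) S(1)] by simp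
  show ?thesis unfolding second_along_def
  proof (intro exI[of _ "\<lambda>t. dderiv S f w (x + t *\<^sub>R w)"] conjI)
    show "\<forall>\<^sub>F t in nhds 0. ((\<lambda>t. f (x + t *\<^sub>R w)) has_real_derivative dderiv S f w (x + t *\<^sub>R w)) (at t)"
      using eventually_line_in_open[OF S, of w]
    proof eventually_elim
      case (elim t)
      from has_vector_derivative_line[OF hd[OF f this]] show ?case
        by (simp add: has_real_derivative_iff_has_vector_derivative)
    qed
    have "((\<lambda>t. dderiv S f w (x + t *\<^sub>R w)) has_vector_derivative dderiv S (dderiv S f w) w x) (at 0)"
      by (rule has_vector_derivative_line) (use hd[OF Ck_on_dderiv[OF f] S(2)] in simp)
    then show "((\<lambda>t. dderiv S f w (x + t *\<^sub>R w)) has_real_derivative dderiv S (dderiv S f w) w x) (at 0)"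
      by (simp add: has_real_derivative_iff_has_vector_derivative)
  qed
qed

context smooth_convex_domain
begin

text \<open>A barrier that dominates the initial oscillation, has the strict sign for the boundary operator at both endpoints, and has nonpositive second
variation along coupled decompositions of the two diffusion matrices dominates the oscillation for all times.  The
term \<open>\<delta> * t\<close> makes the time derivative strict.\<close>

lemma two_point_comparison:
  fixes R :: "real^'n \<Rightarrow> real^'n \<Rightarrow> real" and px py :: "real^'n \<Rightarrow> real^'n \<Rightarrow> real^'n"
  assumes flow: "flow_solution F \<Omega> \<theta> u0 T u" and T: "T > 0"
    and Rc: "continuous_on (closure \<Omega> \<times> closure \<Omega>) (\<lambda>(x, y). R x y)"
    and R0: "\<And>x. x \<in> closure \<Omega> \<Longrightarrow> R x x \<ge> 0"
    and init: "\<And>x y. x \<in> \<Omega> \<Longrightarrow> y \<in> \<Omega> \<Longrightarrow> u0 x - u0 y \<le> R x y"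
    and Rx: "\<And>x y. x \<in> closure \<Omega> \<Longrightarrow> y \<in> closure \<Omega> \<Longrightarrow> x \<noteq> y \<Longrightarrow>
        ((\<lambda>x'. R x' y) has_derivative (\<lambda>v. px x y \<bullet> v)) (at x within closure \<Omega>)"
    and Ry: "\<And>x y. x \<in> closure \<Omega> \<Longrightarrow> y \<in> closure \<Omega> \<Longrightarrow> x \<noteq> y \<Longrightarrow>
        ((\<lambda>y'. R x y') has_derivative (\<lambda>v. - (py x y \<bullet> v))) (at y within closure \<Omega>)"
    and bdx: "\<And>x y. x \<in> frontier \<Omega> \<Longrightarrow> y \<in> closure \<Omega> \<Longrightarrow> x \<noteq> y \<Longrightarrow>
        px x y \<bullet> inward_normal \<Omega> x + cos (\<theta> x) * sqrt (1 + (norm (px x y))\<^sup>2) < 0"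
    and bdy: "\<And>x y. x \<in> closure \<Omega> \<Longrightarrow> y \<in> frontier \<Omega> \<Longrightarrow> x \<noteq> y \<Longrightarrow>
        py x y \<bullet> inward_normal \<Omega> y + cos (\<theta> y) * sqrt (1 + (norm (py x y))\<^sup>2) > 0"
    and int: "\<And>x y. x \<in> \<Omega> \<Longrightarrow> y \<in> \<Omega> \<Longrightarrow> x \<noteq> y \<Longrightarrow>
       \<exists>(K :: 'k set) w z s. finite K \<and> (\<forall>k\<in>K. second_along (\<lambda>t. R (x + t *\<^sub>R w k) (y + t *\<^sub>R z k)) (s k)) \<and>
         (\<forall>a b. (\<Sum>k\<in>K. (w k \<bullet> a) * (w k \<bullet> b)) = aniso_tau F (px x y) a b) \<and>
         (\<forall>a b. (\<Sum>k\<in>K. (z k \<bullet> a) * (z k \<bullet> b)) = aniso_tau F (py x y) a b) \<and> (\<Sum>k\<in>K. s k) \<le> 0"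
    and xy: "x \<in> closure \<Omega>" "y \<in> closure \<Omega>" and t: "t \<in> {0..T}"
  shows "u x t - u y t \<le> R x y"
proof (rule ccontr)
  let ?C = "closure \<Omega>" and ?N = "inward_normal \<Omega>"
  assume contr: "\<not> ?thesis"
  define m where "m = u x t - u y t - R x y"
  have m: "m > 0" using contr by (simp add: m_def)
  \<comment> \<open>Small enough for \<open>\<delta> * t\<close> to leave half of the excess \<open>m\<close>.\<close>
  define \<delta> where "\<delta> = m / (2 * T)"
  have \<delta>: "\<delta> > 0" using m T by (simp add: \<delta>_def)
  have C32: "C32_on ?C {0..T} u" using flow by (simp add: flow_solution_def)
  then have Cu: "Ck_fst_on 3 ?C {0..T} u" and Ct: "Ck_fst_on 2 {0..T} ?C (\<lambda>t x. u x t)" by (simp_all add: C32_on_def)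
  have uc: "continuous_on (?C \<times> {0..T}) (\<lambda>(x, t). u x t)" using Cu by (simp add: numeral_3_eq_3)
  have slice: "Ck_on (Suc (Suc (Suc 0))) ?C (\<lambda>x. u x t)" if "t \<in> {0..T}" for t
    using Ck_fst_on_slice[OF Cu that] by (simp add: numeral_3_eq_3)
  define Z where "Z = (\<lambda>q. u (fst q) (snd (snd q)) - u (fst (snd q)) (snd (snd q)) - R (fst q) (fst (snd q)) - \<delta> * snd (snd q))"
  let ?D = "?C \<times> ?C \<times> {0..T}"
  have "continuous_on ?D Z"
  proof -
    have 1: "continuous_on ?D ((\<lambda>(x, t). u x t) \<circ> (\<lambda>q. (fst q, snd (snd q))))"
      by (intro continuous_on_compose continuous_intros continuous_on_subset[OF uc]) auto
    have 2: "continuous_on ?D ((\<lambda>(x, t). u x t) \<circ> (\<lambda>q. (fst (snd q), snd (snd q))))"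
      by (intro continuous_on_compose continuous_intros continuous_on_subset[OF uc]) auto
    have 3: "continuous_on ?D ((\<lambda>(x, y). R x y) \<circ> (\<lambda>q. (fst q, fst (snd q))))"
      by (intro continuous_on_compose continuous_intros continuous_on_subset[OF Rc]) auto
    show ?thesis unfolding Z_def using 1 2 3 by (intro continuous_intros) (simp_all add: o_def case_prod_unfold)
  qed
  moreover have "compact ?D" by (intro compact_Times compact_cl compact_Icc)
  moreover have "?D \<noteq> {}" using xy t by auto
  ultimately obtain q where q: "q \<in> ?D" "\<And>q'. q' \<in> ?D \<Longrightarrow> Z q' \<le> Z q"
    using continuous_attains_sup[of ?D Z] by blast
  obtain a b s where abs: "q = (a, b, s)" by (cases q) auto
  have abs': "a \<in> ?C" "b \<in> ?C" "s \<in> {0..T}" using q(1) abs by auto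
  have max: "u x' s' - u y' s' - R x' y' - \<delta> * s' \<le> u a s - u b s - R a b - \<delta> * s"
    if "x' \<in> ?C" "y' \<in> ?C" "s' \<in> {0..T}" for x' y' s'
    using q(2)[of "(x', y', s')"] that by (simp add: Z_def abs)
  have Zpos: "u a s - u b s - R a b - \<delta> * s > 0"
  proof -
    have "\<delta> * t \<le> \<delta> * T" using \<delta> t by (intro mult_left_mono) auto
    also have "\<dots> = m / 2" using T by (simp add: \<delta>_def)
    finally have "u x t - u y t - R x y - \<delta> * t > 0" using m by (simp add: m_def)
    then show ?thesis using max[OF xy t] by linarith
  qed
  have ab: "a \<noteq> b"
  proof
    assume "a = b"
    then have "R a b \<ge> 0" using R0 abs' by simp
    moreover have "\<delta> * s \<ge> 0" using \<delta> abs' by simp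
    ultimately show False using Zpos \<open>a = b\<close> by simp
  qed
  have s0: "s \<noteq> 0"
  proof
    assume s: "s = 0"
    define h where "h p = u (fst p) 0 - u (snd p) 0 - R (fst p) (snd p)" for p
    have 1: "continuous_on (closure (\<Omega> \<times> \<Omega>)) h"
    proof -
      have c0: "continuous_on ?C (\<lambda>x. u x 0)" using slice[of 0] T by (auto intro: Ck_on_cont)
      have 1: "continuous_on (?C \<times> ?C) (\<lambda>p. u (fst p) 0)"
        by (rule continuous_on_compose2[OF c0]) (auto intro: continuous_intros)
      have 2: "continuous_on (?C \<times> ?C) (\<lambda>p. u (snd p) 0)"
        by (rule continuous_on_compose2[OF c0]) (auto intro: continuous_intros)
      show ?thesis unfolding closure_Times h_def using 1 2 Rc by (intro continuous_intros) (simp_all add: case_prod_unfold)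
    qed
    have 2: "h p \<le> 0" if "p \<in> \<Omega> \<times> \<Omega>" for p
      using init[of "fst p" "snd p"] that flow by (auto simp: flow_solution_def h_def)
    have "(a, b) \<in> closure (\<Omega> \<times> \<Omega>)" using abs' by (simp add: closure_Times)
    then have "h (a, b) \<le> 0" using continuous_le_on_closure[OF 1] 2 by blast
    then have "u a 0 - u b 0 - R a b \<le> 0" by (simp add: h_def)
    then show False using Zpos s by simp
  qed
  have hx: "((\<lambda>x'. u x' s - R x' b) has_derivative (\<lambda>v. (grad ?C (\<lambda>x. u x s) a - px a b) \<bullet> v)) (at a within ?C)"
  proof -
    have d: "(\<lambda>x. u x s) differentiable (at a within ?C)" by (rule Ck_on_differentiable[OF slice[OF abs'(3)] abs'(1)])
    from has_derivative_diff[OF differentiable_has_dderiv[OF d] Rx[OF abs'(1,2) ab]]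
    show ?thesis by (simp add: grad_inner[OF d] inner_diff_left)
  qed
  have hy: "((\<lambda>y'. - u y' s - R a y') has_derivative (\<lambda>v. (py a b - grad ?C (\<lambda>x. u x s) b) \<bullet> v)) (at b within ?C)"
  proof -
    have d: "(\<lambda>x. u x s) differentiable (at b within ?C)" by (rule Ck_on_differentiable[OF slice[OF abs'(3)] abs'(2)])
    from has_derivative_diff[OF has_derivative_minus[OF differentiable_has_dderiv[OF d]] Ry[OF abs'(1,2) ab]]
    show ?thesis by (simp add: grad_inner[OF d] inner_diff_left)
  qed
  have mx: "u x' s - R x' b \<le> u a s - R a b" if "x' \<in> ?C" for x' using max[OF that abs'(2,3)] by simp
  have my: "- u y' s - R a y' \<le> - u b s - R a b" if "y' \<in> ?C" for y' using max[OF abs'(1) that abs'(3)] by simp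
  have cap: "grad ?C (\<lambda>x. u x s) z \<bullet> ?N z + cos (\<theta> z) * sqrt (1 + (norm (grad ?C (\<lambda>x. u x s) z))\<^sup>2) = 0"
    if "z \<in> frontier \<Omega>" for z
  proof -
    have d: "(\<lambda>x. u x s) differentiable (at z within ?C)"
      by (rule Ck_on_differentiable[OF slice[OF abs'(3)] frontier_closure[OF that]])
    have "capillary_condition \<Omega> \<theta> (\<lambda>y. u y s)" using flow abs'(3) by (simp add: flow_solution_def)
    then show ?thesis using that grad_inner[OF d, of "?N z"] by (auto simp: capillary_condition_def)
  qed
  have inward: "D v \<le> 0" if D: "(f has_derivative D) (at z within ?C)" "\<And>y. y \<in> ?C \<Longrightarrow> f y \<le> f z"
    and z: "z \<in> frontier \<Omega>" "v \<bullet> ?N z > 0"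
    for f :: "real^'n \<Rightarrow> real" and D z v
  proof -
    obtain e where "e > 0" "\<And>t. 0 < t \<Longrightarrow> t < e \<Longrightarrow> z + t *\<^sub>R v \<in> \<Omega>" using inward_direction[OF z] by blast
    then show ?thesis using has_derivative_at_max_inward[OF D, of e v] closure_subset by blast
  qed
  have interior: "D v = 0" if D: "(f has_derivative D) (at z within ?C)" and fm: "\<And>y. y \<in> ?C \<Longrightarrow> f y \<le> f z" and z: "z \<in> \<Omega>"
    for f :: "real^'n \<Rightarrow> real" and D z v
  proof -
    have le: "D v \<le> 0" for v
    proof -
      obtain e where e: "e > 0" "\<And>t. \<bar>t\<bar> < e \<Longrightarrow> z + t *\<^sub>R v \<in> \<Omega>"
        using eventually_line_in_open[OF op z, of v] unfolding eventually_nhds_metric by (auto simp: dist_real_def)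
      show ?thesis
      proof (rule has_derivative_at_max_inward[OF D fm e(1)])
        show "z + t *\<^sub>R v \<in> ?C" if "0 < t" "t < e" for t
          using e(2)[of t] that closure_subset[of \<Omega>] by auto
      qed
    qed
    have "D (- v) = - D v" by (rule linear_neg[OF has_derivative_linear[OF D]])
    then show ?thesis using le[of v] le[of "- v"] by linarith
  qed
  have a\<Omega>: "a \<in> \<Omega>"
  proof (rule ccontr)
    assume "a \<notin> \<Omega>"
    then have af: "a \<in> frontier \<Omega>" using abs'(1) cl by blast
    obtain c where c: "c \<ge> 0" "grad ?C (\<lambda>x. u x s) a - px a b = - c *\<^sub>R ?N a"
      using functional_on_half_space[OF norm_normal[OF af], of "grad ?C (\<lambda>x. u x s) a - px a b"] inward[OF hx mx af] by metis
    \<comment> \<open>At a boundary maximum the momentum of the barrier exceeds the gradient of \<open>u\<close> in the direction of the inward normal; by monotonicity its boundary operator is nonnegative, against the strict sign.\<close>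
    then have "px a b = grad ?C (\<lambda>x. u x s) a + c *\<^sub>R ?N a" by (simp add: algebra_simps)
    then have "0 \<le> px a b \<bullet> ?N a + cos (\<theta> a) * sqrt (1 + (norm (px a b))\<^sup>2)"
      using capillary_monotone[OF norm_normal[OF af] c(1) abs_cos_le_one, of "grad ?C (\<lambda>x. u x s) a" "\<theta> a"] cap[OF af] by simp
    then show False using bdx[OF af abs'(2) ab] by linarith
  qed
  have b\<Omega>: "b \<in> \<Omega>"
  proof (rule ccontr)
    assume "b \<notin> \<Omega>"
    then have bf: "b \<in> frontier \<Omega>" using abs'(2) cl by blast
    obtain c where c: "c \<ge> 0" "py a b - grad ?C (\<lambda>x. u x s) b = - c *\<^sub>R ?N b"
      using functional_on_half_space[OF norm_normal[OF bf], of "py a b - grad ?C (\<lambda>x. u x s) b"] inward[OF hy my bf] by metis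
    then have "grad ?C (\<lambda>x. u x s) b = py a b + c *\<^sub>R ?N b" by (simp add: algebra_simps)
    then have "py a b \<bullet> ?N b + cos (\<theta> b) * sqrt (1 + (norm (py a b))\<^sup>2) \<le> 0"
      using capillary_monotone[OF norm_normal[OF bf] c(1) abs_cos_le_one, of "py a b" "\<theta> b"] cap[OF bf] by simp
    then show False using bdy[OF abs'(1) bf ab] by linarith
  qed
  have Dua: "grad ?C (\<lambda>x. u x s) a = px a b"
    using interior[OF hx mx a\<Omega>, of "grad ?C (\<lambda>x. u x s) a - px a b"] by simp
  have Dub: "grad ?C (\<lambda>x. u x s) b = py a b"
    using interior[OF hy my b\<Omega>, of "py a b - grad ?C (\<lambda>x. u x s) b"] by simp
  obtain K :: "'k set" and w z r where K: "finite K"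
    "\<forall>k\<in>K. second_along (\<lambda>t. R (a + t *\<^sub>R w k) (b + t *\<^sub>R z k)) (r k)"
    "\<forall>c d. (\<Sum>k\<in>K. (w k \<bullet> c) * (w k \<bullet> d)) = aniso_tau F (px a b) c d"
    "\<forall>c d. (\<Sum>k\<in>K. (z k \<bullet> c) * (z k \<bullet> d)) = aniso_tau F (py a b) c d" "(\<Sum>k\<in>K. r k) \<le> 0"
    using int[OF a\<Omega> b\<Omega> ab] by (elim exE conjE) (rule that)
  let ?H = "\<lambda>x v. dderiv \<Omega> (dderiv \<Omega> (\<lambda>x. u x s) v) v x"
  have sl: "Ck_on (Suc (Suc (Suc 0))) \<Omega> (\<lambda>x. u x s)"
    by (rule Ck_on_open_subset[OF op closure_subset slice[OF abs'(3)]])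
  have sec: "?H a (w k) - ?H b (z k) - r k \<le> 0" if k: "k \<in> K" for k
  proof (rule second_along_max)
    show "second_along (\<lambda>t. u (a + t *\<^sub>R w k) s - u (b + t *\<^sub>R z k) s - R (a + t *\<^sub>R w k) (b + t *\<^sub>R z k)) (?H a (w k) - ?H b (z k) - r k)"
      by (intro second_along_diff second_along_line[OF op a\<Omega> sl] second_along_line[OF op b\<Omega> sl] K(2)[rule_format, OF k])
    show "\<forall>\<^sub>F t in nhds 0. u (a + t *\<^sub>R w k) s - u (b + t *\<^sub>R z k) s - R (a + t *\<^sub>R w k) (b + t *\<^sub>R z k)
      \<le> u (a + 0 *\<^sub>R w k) s - u (b + 0 *\<^sub>R z k) s - R (a + 0 *\<^sub>R w k) (b + 0 *\<^sub>R z k)"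
      using eventually_line_in_open[OF op a\<Omega>, of "w k"] eventually_line_in_open[OF op b\<Omega>, of "z k"]
    proof eventually_elim
      case (elim t)
      then have "a + t *\<^sub>R w k \<in> ?C" "b + t *\<^sub>R z k \<in> ?C" using closure_subset by blast+
      then show ?case using max[of "a + t *\<^sub>R w k" "b + t *\<^sub>R z k" s] abs'(3) by simp
    qed
  qed
  \<comment> \<open>The diffusion matrix contracted with the Hessian is the sum of the second derivatives along any decomposition.\<close>
  have pde: "dderiv {0..T} (\<lambda>s. u x s) 1 s = (\<Sum>k\<in>K. ?H x (v k))"
    if x: "x \<in> \<Omega>" and v: "\<And>c d. (\<Sum>k\<in>K. (v k \<bullet> c) * (v k \<bullet> d)) = aniso_tau F (grad ?C (\<lambda>x. u x s) x) c d" for x v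
  proof -
    let ?p = "grad ?C (\<lambda>x. u x s) x"
    let ?h = "\<lambda>i j. dderiv \<Omega> (dderiv \<Omega> (\<lambda>x. u x s) (axis i 1)) (axis j 1) x"
    have hh: "hess ?C (\<lambda>y. u y s) x (axis i 1) (axis j 1) = ?h i j" for i j
      unfolding hess_def dderiv_interior[OF op x closure_subset]
      by (rule dderiv_cong_open[OF op x]) (rule dderiv_interior[OF op _ closure_subset])
    have "dderiv {0..T} (\<lambda>s. u x s) 1 s = sqrt (1 + (norm ?p)\<^sup>2) *
             (\<Sum>i\<in>UNIV. \<Sum>j\<in>UNIV. hess UNIV F (?p, -1) (axis i 1, 0) (axis j 1, 0) * hess ?C (\<lambda>y. u y s) x (axis i 1) (axis j 1))"
      using flow x abs'(3) by (simp add: flow_solution_def Let_def)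
    also have "\<dots> = (\<Sum>i\<in>UNIV. \<Sum>j\<in>UNIV. aniso_tau F ?p (axis i 1) (axis j 1) * ?h i j)"
      unfolding hh aniso_tau_def norm_lift by (simp add: sum_distrib_left mult.assoc)
    also have "\<dots> = (\<Sum>i\<in>UNIV. \<Sum>j\<in>UNIV. \<Sum>k\<in>K. ?h i j * v k $ i * v k $ j)"
      unfolding v[symmetric] by (simp add: sum_distrib_right inner_axis mult_ac)
    also have "\<dots> = (\<Sum>k\<in>K. \<Sum>i\<in>UNIV. \<Sum>j\<in>UNIV. ?h i j * v k $ i * v k $ j)"
      by (subst sum.swap[where A = UNIV], subst sum.swap[where B = K]) (rule refl)
    also have "\<dots> = (\<Sum>k\<in>K. ?H x (v k))"
      by (intro sum.cong refl second_dderiv_expand[OF op sl x, symmetric])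
    finally show ?thesis .
  qed
  have time: "dderiv {0..T} (\<lambda>s. u a s) 1 s - dderiv {0..T} (\<lambda>s. u b s) 1 s \<ge> \<delta>"
  proof -
    have d: "(\<lambda>s. u z s) differentiable (at s within {0..T})" if "z \<in> ?C" for z
      using Ck_on_differentiable[of "Suc 0" "{0..T}" "\<lambda>s. u z s" s] Ck_fst_on_slice[OF Ct that] abs'(3)
      by (simp add: numeral_2_eq_2)
    let ?D = "\<lambda>v. dderiv {0..T} (\<lambda>s. u a s) v s - dderiv {0..T} (\<lambda>s. u b s) v s - \<delta> * v"
    have hd: "((\<lambda>s. u a s - u b s - \<delta> * s) has_derivative ?D) (at s within {0..T})"
      by (intro has_derivative_diff differentiable_has_dderiv d abs' has_derivative_mult_right has_derivative_ident)
    \<comment> \<open>The maximum over \<open>{0..T}\<close> may sit at the final time, so only the backward direction is available.\<close>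
    have "?D (-1) \<le> 0"
    proof (rule has_derivative_at_max_inward[OF hd])
      show "u a y - u b y - \<delta> * y \<le> u a s - u b s - \<delta> * s" if "y \<in> {0..T}" for y
        using max[OF abs'(1,2) that] by simp
      show "s > 0" using s0 abs'(3) by simp
      show "s + t *\<^sub>R -1 \<in> {0..T}" if "0 < t" "t < s" for t using that abs'(3) by simp
    qed
    moreover have "?D (-1) = - ?D 1" by (rule linear_neg[OF has_derivative_linear[OF hd]])
    ultimately show ?thesis by simp
  qed
  have "dderiv {0..T} (\<lambda>s. u a s) 1 s - dderiv {0..T} (\<lambda>s. u b s) 1 s = (\<Sum>k\<in>K. ?H a (w k)) - (\<Sum>k\<in>K. ?H b (z k))"
    using pde[OF a\<Omega>, of w] pde[OF b\<Omega>, of z] K(3,4) Dua Dub by simp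
  also have "\<dots> = (\<Sum>k\<in>K. ?H a (w k) - ?H b (z k))" by (simp add: sum_subtractf)
  also have "\<dots> \<le> (\<Sum>k\<in>K. r k)" using sec by (intro sum_mono) fastforce
  finally show False using K(5) time \<delta> by linarith
qed

end

section \<open>The barrier\<close>

text \<open>Value, first and second derivative at \<open>0\<close> of a curve; the product rule in this form organizes the
second variation of the barrier.\<close>

definition jet2 :: "(real \<Rightarrow> 'a::real_normed_vector) \<Rightarrow> 'a \<Rightarrow> 'a \<Rightarrow> 'a \<Rightarrow> bool" where
  "jet2 g a b c \<longleftrightarrow> g 0 = a \<and> (\<exists>g1. (\<forall>\<^sub>F t in nhds 0. (g has_vector_derivative g1 t) (at t)) \<and>
     g1 0 = b \<and> (g1 has_vector_derivative c) (at 0))"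

lemma jet2_second_along: "jet2 g a b c \<Longrightarrow> second_along g c"
  unfolding jet2_def second_along_def by (auto simp: has_real_derivative_iff_has_vector_derivative)

lemma jet2_diff:
  assumes "jet2 f a b c" "jet2 g a' b' c'" shows "jet2 (\<lambda>t. f t - g t) (a - a') (b - b') (c - c')"
proof -
  obtain f1 where f: "f 0 = a" "\<forall>\<^sub>F t in nhds 0. (f has_vector_derivative f1 t) (at t)" "f1 0 = b"
    "(f1 has_vector_derivative c) (at 0)" using assms(1) unfolding jet2_def by blast
  obtain g1 where g: "g 0 = a'" "\<forall>\<^sub>F t in nhds 0. (g has_vector_derivative g1 t) (at t)" "g1 0 = b'"
    "(g1 has_vector_derivative c') (at 0)" using assms(2) unfolding jet2_def by blast
  have "\<forall>\<^sub>F t in nhds 0. ((\<lambda>t. f t - g t) has_vector_derivative f1 t - g1 t) (at t)"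
    using f(2) g(2) by eventually_elim (rule has_vector_derivative_diff)
  then show ?thesis unfolding jet2_def
    using f g has_vector_derivative_diff[OF f(4) g(4)] by (intro conjI exI[of _ "\<lambda>t. f1 t - g1 t"]) auto
qed

lemma jet2_bilinear:
  assumes "bounded_bilinear bp" "jet2 f a b c" "jet2 g a' b' c'"
  shows "jet2 (\<lambda>t. bp (f t) (g t)) (bp a a') (bp a b' + bp b a') (bp a c' + bp b b' + (bp b b' + bp c a'))"
proof -
  interpret bounded_bilinear bp by (rule assms(1))
  obtain f1 where f: "f 0 = a" "\<forall>\<^sub>F t in nhds 0. (f has_vector_derivative f1 t) (at t)" "f1 0 = b"
    "(f1 has_vector_derivative c) (at 0)" using assms(2) unfolding jet2_def by blast
  obtain g1 where g: "g 0 = a'" "\<forall>\<^sub>F t in nhds 0. (g has_vector_derivative g1 t) (at t)" "g1 0 = b'"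
    "(g1 has_vector_derivative c') (at 0)" using assms(3) unfolding jet2_def by blast
  have ev: "\<forall>\<^sub>F t in nhds 0. ((\<lambda>t. bp (f t) (g t)) has_vector_derivative (bp (f t) (g1 t) + bp (f1 t) (g t))) (at t)"
    using f(2) g(2) by eventually_elim (rule has_vector_derivative)
  have f0: "(f has_vector_derivative f1 0) (at 0)" and g0: "(g has_vector_derivative g1 0) (at 0)"
    using f(2) g(2) by (auto dest: eventually_nhds_x_imp_x)
  have "((\<lambda>t. bp (f t) (g1 t) + bp (f1 t) (g t)) has_vector_derivative
      (bp (f 0) c' + bp (f1 0) (g1 0)) + (bp (f1 0) (g1 0) + bp c (g 0))) (at 0)"
    by (intro has_vector_derivative_add has_vector_derivative f0 g0 f(4) g(4))
  then show ?thesis unfolding jet2_def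
    using ev f g by (intro conjI exI[of _ "\<lambda>t. bp (f t) (g1 t) + bp (f1 t) (g t)"]) auto
qed

lemma jet2_line: "jet2 (\<lambda>t. h + t *\<^sub>R d) h d 0"
  unfolding jet2_def
  by (intro conjI exI[of _ "\<lambda>t. d"]) (auto intro!: derivative_eq_intros always_eventually simp: has_vector_derivative_def)

lemma jet2_compose_line:
  fixes f :: "'a::real_normed_vector \<Rightarrow> 'b::real_normed_vector"
  assumes f: "\<forall>\<^sub>F y in nhds x. (f has_derivative f1 y) (at y)" and f2: "((\<lambda>y. f1 y g) has_derivative f2) (at x)"
  shows "jet2 (\<lambda>t. f (x + t *\<^sub>R g)) (f x) (f1 x g) (f2 g)"
proof -
  obtain S where S: "open S" "x \<in> S" "\<And>y. y \<in> S \<Longrightarrow> (f has_derivative f1 y) (at y)"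
    using f unfolding eventually_nhds by blast
  have "\<forall>\<^sub>F t in nhds 0. ((\<lambda>t. f (x + t *\<^sub>R g)) has_vector_derivative f1 (x + t *\<^sub>R g) g) (at t)"
    using eventually_line_in_open[OF S(1,2), of g] by eventually_elim (rule has_vector_derivative_line[OF S(3)])
  moreover have "((\<lambda>t. f1 (x + t *\<^sub>R g) g) has_vector_derivative f2 g) (at 0)"
    by (rule has_vector_derivative_line) (use f2 in simp)
  ultimately show ?thesis unfolding jet2_def by (intro conjI exI[of _ "\<lambda>t. f1 (x + t *\<^sub>R g) g"]) auto
qed

lemma jet2_norm_line:
  fixes h d :: "'a::real_inner"
  assumes h: "h \<noteq> 0"
  shows "jet2 (\<lambda>t. norm (h + t *\<^sub>R d)) (norm h) (sgn h \<bullet> d) (((norm d)\<^sup>2 - (sgn h \<bullet> d)\<^sup>2) / norm h)"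
proof -
  have dn: "((\<lambda>t. norm (h + t *\<^sub>R d)) has_real_derivative ((h + t *\<^sub>R d) \<bullet> d) / norm (h + t *\<^sub>R d)) (at t)"
    if "h + t *\<^sub>R d \<noteq> 0" for t
  proof -
    from has_vector_derivative_line[OF has_derivative_norm[OF that]]
    show ?thesis
      by (simp add: has_real_derivative_iff_has_vector_derivative sgn_div_norm inner_commute divide_inverse mult.commute)
  qed
  have "open (- {0::'a})" by auto
  from eventually_line_in_open[OF this, of h d] h
  have "\<forall>\<^sub>F t in nhds 0. h + t *\<^sub>R d \<noteq> 0" by simp
  then have ev: "\<forall>\<^sub>F t in nhds 0. ((\<lambda>t. norm (h + t *\<^sub>R d)) has_vector_derivative ((h + t *\<^sub>R d) \<bullet> d) / norm (h + t *\<^sub>R d)) (at t)"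
    by eventually_elim (use dn in \<open>simp add: has_real_derivative_iff_has_vector_derivative\<close>)
  have num: "((\<lambda>t. (h + t *\<^sub>R d) \<bullet> d) has_real_derivative d \<bullet> d) (at 0)"
    unfolding inner_add_left inner_scaleR_left by (auto intro!: derivative_eq_intros)
  have "((\<lambda>t. ((h + t *\<^sub>R d) \<bullet> d) / norm (h + t *\<^sub>R d)) has_real_derivative
     ((d \<bullet> d) * norm (h + 0 *\<^sub>R d) - ((h + 0 *\<^sub>R d) \<bullet> d) * (((h + 0 *\<^sub>R d) \<bullet> d) / norm (h + 0 *\<^sub>R d))) /
       (norm (h + 0 *\<^sub>R d) * norm (h + 0 *\<^sub>R d))) (at 0)"
    by (rule DERIV_divide[OF num dn]) (use h in auto)
  moreover have "((d \<bullet> d) * norm h - (h \<bullet> d) * ((h \<bullet> d) / norm h)) / (norm h * norm h) =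
      ((norm d)\<^sup>2 - (sgn h \<bullet> d)\<^sup>2) / norm h"
    unfolding power2_norm_eq_inner sgn_div_norm inner_scaleR_left power_mult_distrib
    using h by (simp add: field_simps power2_eq_square)
  ultimately have d2: "((\<lambda>t. ((h + t *\<^sub>R d) \<bullet> d) / norm (h + t *\<^sub>R d)) has_vector_derivative
     ((norm d)\<^sup>2 - (sgn h \<bullet> d)\<^sup>2) / norm h) (at 0)"
    by (simp add: has_real_derivative_iff_has_vector_derivative)
  have "(h \<bullet> d) / norm h = sgn h \<bullet> d" by (simp add: sgn_div_norm divide_inverse mult.commute)
  then show ?thesis unfolding jet2_def using ev d2
    by (intro conjI exI[of _ "\<lambda>t. ((h + t *\<^sub>R d) \<bullet> d) / norm (h + t *\<^sub>R d)"]) auto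
qed

text \<open>The modulus \<open>b\<close> depends on the midpoint to gain concavity; the linear term in \<open>x - y\<close> tilts the gradient of the barrier to
match the contact angle.\<close>

definition barrier :: "('a::real_inner \<Rightarrow> real) \<Rightarrow> ('a \<Rightarrow> 'a) \<Rightarrow> 'a \<Rightarrow> 'a \<Rightarrow> real" where
  "barrier b Z x y = b ((x + y) /\<^sub>R 2) * norm (x - y) - Z ((x + y) /\<^sub>R 2) \<bullet> (x - y)"

text \<open>The gradient, in the midpoint variable, of the barrier with \<open>x - y\<close> held fixed.  It is the difference of the two momenta.\<close>

definition drift :: "(real^'n \<Rightarrow> real) \<Rightarrow> (real^'n \<Rightarrow> real^'n) \<Rightarrow> real^'n \<Rightarrow> real^'n \<Rightarrow> real^'n" where
  "drift b Z x y = (\<chi> i. norm (x - y) * frechet_derivative b (at ((x + y) /\<^sub>R 2)) (axis i 1) -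
     frechet_derivative Z (at ((x + y) /\<^sub>R 2)) (axis i 1) \<bullet> (x - y))"

text \<open>The momentum at \<open>x\<close>, that is, the gradient in \<open>x\<close>.\<close>

definition barrier_px :: "(real^'n \<Rightarrow> real) \<Rightarrow> (real^'n \<Rightarrow> real^'n) \<Rightarrow> real^'n \<Rightarrow> real^'n \<Rightarrow> real^'n" where
  "barrier_px b Z x y = b ((x + y) /\<^sub>R 2) *\<^sub>R sgn (x - y) - Z ((x + y) /\<^sub>R 2) + drift b Z x y /\<^sub>R 2"

text \<open>The momentum at \<open>y\<close>, with the sign that makes it comparable to the momentum at \<open>x\<close>: minus the gradient in \<open>y\<close>.\<close>

definition barrier_py :: "(real^'n \<Rightarrow> real) \<Rightarrow> (real^'n \<Rightarrow> real^'n) \<Rightarrow> real^'n \<Rightarrow> real^'n \<Rightarrow> real^'n" where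
  "barrier_py b Z x y = b ((x + y) /\<^sub>R 2) *\<^sub>R sgn (x - y) - Z ((x + y) /\<^sub>R 2) - drift b Z x y /\<^sub>R 2"

lemma linear_functional_inner:
  fixes f :: "real^'n \<Rightarrow> real"
  assumes "linear f" shows "f v = (\<chi> i. f (axis i 1)) \<bullet> v"
proof -
  interpret linear f by (rule assms)
  have "f v = f (\<Sum>i\<in>UNIV. v $ i *\<^sub>R axis i 1)"
    by (simp add: basis_expansion scalar_mult_eq_scaleR[symmetric])
  also have "\<dots> = (\<Sum>i\<in>UNIV. v $ i * f (axis i 1))" by (simp add: sum scale)
  finally show ?thesis by (simp add: inner_vec_def mult.commute)
qed

lemma drift_inner:
  fixes b :: "real^'n \<Rightarrow> real"
  assumes b: "(b has_derivative b1) (at ((x + y) /\<^sub>R 2))" and Z: "(Z has_derivative Z1) (at ((x + y) /\<^sub>R 2))"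
  shows "drift b Z x y \<bullet> v = norm (x - y) * b1 v - Z1 v \<bullet> (x - y)"
proof -
  have "linear (\<lambda>v. norm (x - y) * b1 v - Z1 v \<bullet> (x - y))"
    using has_derivative_linear[OF b] has_derivative_linear[OF Z]
    by (intro linearI) (simp_all add: linear_add linear_scale algebra_simps inner_add_left)
  from linear_functional_inner[OF this, of v] show ?thesis
    unfolding drift_def frechet_derivative_at[OF b, symmetric] frechet_derivative_at[OF Z, symmetric] by simp
qed

lemma barrier_has_derivative:
  fixes b :: "real^'n \<Rightarrow> real"
  assumes b: "(b has_derivative b1) (at ((x + y) /\<^sub>R 2))" and Z: "(Z has_derivative Z1) (at ((x + y) /\<^sub>R 2))"
    and xy: "x \<noteq> y"
  shows "((\<lambda>x'. barrier b Z x' y) has_derivative (\<lambda>v. barrier_px b Z x y \<bullet> v)) (at x)"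
    and "((\<lambda>y'. barrier b Z x y') has_derivative (\<lambda>v. - (barrier_py b Z x y \<bullet> v))) (at y)"
proof -
  let ?m = "(x + y) /\<^sub>R 2"
  note lin = has_derivative_linear[OF b] has_derivative_linear[OF Z]
  note M = drift_inner[OF b Z]
  have nz: "x - y \<noteq> 0" using xy by simp
  have mx: "((\<lambda>x'. (x' + y) /\<^sub>R 2) has_derivative (\<lambda>v. v /\<^sub>R 2)) (at x)"
    and my: "((\<lambda>y'. (x + y') /\<^sub>R 2) has_derivative (\<lambda>v. v /\<^sub>R 2)) (at y)"
    by (auto intro!: derivative_eq_intros)
  have hx: "((\<lambda>x'. x' - y) has_derivative (\<lambda>v. v)) (at x)"
    and hy: "((\<lambda>y'. x - y') has_derivative (\<lambda>v. - v)) (at y)"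
    by (auto intro!: derivative_eq_intros)
  have nx: "((\<lambda>x'. norm (x' - y)) has_derivative (\<lambda>v. v \<bullet> sgn (x - y))) (at x)"
    by (rule has_derivative_compose[OF hx has_derivative_norm[OF nz]])
  have ny: "((\<lambda>y'. norm (x - y')) has_derivative (\<lambda>v. (- v) \<bullet> sgn (x - y))) (at y)"
    by (rule has_derivative_compose[OF hy has_derivative_norm[OF nz]])
  have "((\<lambda>x'. barrier b Z x' y) has_derivative
     (\<lambda>v. (b ?m * (v \<bullet> sgn (x - y)) + b1 (v /\<^sub>R 2) * norm (x - y)) - (Z ?m \<bullet> v + Z1 (v /\<^sub>R 2) \<bullet> (x - y)))) (at x)"
    unfolding barrier_def
    by (intro has_derivative_diff has_derivative_mult has_derivative_inner nx hx
        has_derivative_compose[OF mx b] has_derivative_compose[OF mx Z])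
  moreover have "(b ?m * (v \<bullet> sgn (x - y)) + b1 (v /\<^sub>R 2) * norm (x - y)) - (Z ?m \<bullet> v + Z1 (v /\<^sub>R 2) \<bullet> (x - y))
      = barrier_px b Z x y \<bullet> v" for v
    unfolding barrier_px_def inner_add_left inner_diff_left inner_scaleR_left M linear_scale[OF lin(1)] linear_scale[OF lin(2)]
    by (simp add: inner_commute algebra_simps)
  ultimately show "((\<lambda>x'. barrier b Z x' y) has_derivative (\<lambda>v. barrier_px b Z x y \<bullet> v)) (at x)" by simp
  have "((\<lambda>y'. barrier b Z x y') has_derivative
     (\<lambda>v. (b ?m * ((- v) \<bullet> sgn (x - y)) + b1 (v /\<^sub>R 2) * norm (x - y)) - (Z ?m \<bullet> (- v) + Z1 (v /\<^sub>R 2) \<bullet> (x - y)))) (at y)"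
    unfolding barrier_def
    by (intro has_derivative_diff has_derivative_mult has_derivative_inner ny hy
        has_derivative_compose[OF my b] has_derivative_compose[OF my Z])
  moreover have "(b ?m * ((- v) \<bullet> sgn (x - y)) + b1 (v /\<^sub>R 2) * norm (x - y)) - (Z ?m \<bullet> (- v) + Z1 (v /\<^sub>R 2) \<bullet> (x - y))
      = - (barrier_py b Z x y \<bullet> v)" for v
    unfolding barrier_py_def inner_diff_left inner_scaleR_left M linear_scale[OF lin(1)] linear_scale[OF lin(2)]
    by (simp add: inner_commute algebra_simps)
  ultimately show "((\<lambda>y'. barrier b Z x y') has_derivative (\<lambda>v. - (barrier_py b Z x y \<bullet> v))) (at y)" by simp
qed

lemma barrier_second_along:
  fixes b :: "real^'n \<Rightarrow> real" and x y w z :: "real^'n"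
  assumes b: "\<forall>\<^sub>F m in nhds ((x + y) /\<^sub>R 2). (b has_derivative b1 m) (at m)"
      "\<And>v. ((\<lambda>m. b1 m v) has_derivative b2 v) (at ((x + y) /\<^sub>R 2))"
    and Z: "\<forall>\<^sub>F m in nhds ((x + y) /\<^sub>R 2). (Z has_derivative Z1 m) (at m)"
      "\<And>v. ((\<lambda>m. Z1 m v) has_derivative Z2 v) (at ((x + y) /\<^sub>R 2))"
    and xy: "x \<noteq> y"
  defines "m \<equiv> (x + y) /\<^sub>R 2" and "h \<equiv> x - y" and "g \<equiv> (w + z) /\<^sub>R 2" and "d \<equiv> w - z"
  shows "second_along (\<lambda>t. barrier b Z (x + t *\<^sub>R w) (y + t *\<^sub>R z))
    (b m * (((norm d)\<^sup>2 - (sgn h \<bullet> d)\<^sup>2) / norm h) + 2 * (b1 m g * (sgn h \<bullet> d)) + b2 g g * norm h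
      - (2 * (Z1 m g \<bullet> d) + Z2 g g \<bullet> h))"
proof -
  have h0: "h \<noteq> 0" using xy by (simp add: h_def)
  have jb: "jet2 (\<lambda>t. b (m + t *\<^sub>R g)) (b m) (b1 m g) (b2 g g)"
    unfolding m_def by (rule jet2_compose_line[OF b])
  have jZ: "jet2 (\<lambda>t. Z (m + t *\<^sub>R g)) (Z m) (Z1 m g) (Z2 g g)"
    unfolding m_def by (rule jet2_compose_line[OF Z])
  have eq: "barrier b Z (x + t *\<^sub>R w) (y + t *\<^sub>R z) = b (m + t *\<^sub>R g) * norm (h + t *\<^sub>R d) - Z (m + t *\<^sub>R g) \<bullet> (h + t *\<^sub>R d)" for t
  proof -
    have "(x + t *\<^sub>R w + (y + t *\<^sub>R z)) /\<^sub>R 2 = m + t *\<^sub>R g" by (simp add: m_def g_def algebra_simps)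
    moreover have "x + t *\<^sub>R w - (y + t *\<^sub>R z) = h + t *\<^sub>R d" by (simp add: h_def d_def algebra_simps)
    ultimately show ?thesis by (simp only: barrier_def)
  qed
  show ?thesis unfolding eq
    using jet2_second_along[OF jet2_diff[OF jet2_bilinear[OF bounded_bilinear_mult jb jet2_norm_line[OF h0, of d]]
      jet2_bilinear[OF bounded_bilinear_inner jZ jet2_line[of h d]]]]
    by (simp add: algebra_simps)
qed

text \<open>For \<open>e \<bullet> N = 0\<close> the left-hand side vanishes; this is how the factor of \<open>N\<close> in \<open>v\<close> is found.  A negative \<open>e \<bullet> N\<close> decreases the first
summand linearly and changes the square root by at most \<open>2 \<bar>k\<bar> \<le> 1\<close> times that; the factor \<open>k\<close> in front of the root leaves at least half of the gain.\<close>

lemma capillary_tangential: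
  fixes e N :: "'a::real_inner"
  assumes e: "norm e = 1" and N: "norm N = 1" and b: "b > 0" and k: "\<bar>k\<bar> \<le> 1/2" and s: "e \<bullet> N \<le> 0"
  defines "v \<equiv> b *\<^sub>R e - (sqrt (1 + b\<^sup>2) * (k / sqrt (1 - k\<^sup>2))) *\<^sub>R N"
  shows "v \<bullet> N + k * sqrt (1 + (norm v)\<^sup>2) \<le> b * (e \<bullet> N) / 2"
proof -
  define s where "s = e \<bullet> N"
  have s0: "s \<le> 0" using assms(5) by (simp add: s_def)
  have kk: "k\<^sup>2 \<le> 1/4" using k power2_le_iff_abs_le[of "1/2" k] by (simp add: power_divide)
  define q where "q = sqrt (1 - k\<^sup>2)"
  have q: "q > 0" "q\<^sup>2 = 1 - k\<^sup>2" using kk by (simp_all add: q_def)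
  define A where "A = sqrt (1 + b\<^sup>2)"
  have A: "A > 0" "A\<^sup>2 = 1 + b\<^sup>2" by (simp_all add: A_def add_pos_nonneg)
  define X where "X = A / q"
  have X: "X > 0" "X * q = A" using A q by (simp_all add: X_def)
  have v: "v = b *\<^sub>R e - (k * X) *\<^sub>R N" by (simp add: v_def A_def[symmetric] q_def[symmetric] X_def)
  have ee: "e \<bullet> e = 1" "N \<bullet> N = 1" using e N by (simp_all add: norm_eq_1)
  have vN: "v \<bullet> N = b * s - k * X" by (simp add: v inner_diff_left ee s_def)
  have "(norm v)\<^sup>2 = b\<^sup>2 - 2 * (b * (k * X) * s) + (k * X)\<^sup>2"
    unfolding power2_norm_eq_inner v
    by (simp add: inner_diff_left inner_diff_right ee s_def inner_commute power2_eq_square algebra_simps)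
  moreover have "X\<^sup>2 * q\<^sup>2 = A\<^sup>2" using X(2) by (simp add: power_mult_distrib[symmetric])
  then have "X\<^sup>2 = 1 + b\<^sup>2 + (k * X)\<^sup>2" unfolding q(2) A(2) by (simp add: algebra_simps power_mult_distrib)
  moreover have "2 * (b * (k * X) * s) = 2 * (b * k * s) * X" by simp
  ultimately have Y2: "1 + (norm v)\<^sup>2 = X\<^sup>2 - 2 * (b * k * s) * X" by linarith
  define Y where "Y = sqrt (1 + (norm v)\<^sup>2)"
  have Y: "Y > 0" "Y\<^sup>2 = X\<^sup>2 - 2 * (b * k * s) * X" by (simp_all add: Y_def Y2[symmetric] add_pos_nonneg)
  have "(Y - X) * (Y + X) = - 2 * (b * k * s) * X" using Y(2) by (simp add: algebra_simps power2_eq_square)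
  then have "\<bar>(Y - X) * (Y + X)\<bar> = \<bar>- 2 * (b * k * s) * X\<bar>" by (rule arg_cong)
  then have "\<bar>Y - X\<bar> * (Y + X) = 2 * \<bar>b * k * s\<bar> * X"
    using X(1) Y(1) by (simp only: abs_mult) simp
  also have "\<dots> \<le> 2 * \<bar>b * k * s\<bar> * (Y + X)" using Y by (intro mult_left_mono) auto
  finally have YX: "\<bar>Y - X\<bar> \<le> 2 * \<bar>b * k * s\<bar>" using X Y by (simp add: add_pos_pos)
  have "k * (Y - X) \<le> \<bar>k\<bar> * \<bar>Y - X\<bar>" by (metis abs_ge_self abs_mult)
  also have "\<dots> \<le> \<bar>k\<bar> * (2 * \<bar>b * k * s\<bar>)" using YX by (intro mult_left_mono) auto
  also have "\<dots> = 2 * (b * k\<^sup>2 * (- s))" using s0 b by (simp add: abs_mult power2_eq_square)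
  also have "\<dots> \<le> 2 * (b * (1/4) * (- s))" using kk s0 b by (intro mult_left_mono mult_right_mono) auto
  finally have "k * Y \<le> k * X - b * s / 2" by (simp add: algebra_simps)
  then show ?thesis unfolding vN Y_def[symmetric] s_def[symmetric] by simp
qed

lemma capillary_lipschitz:
  fixes p v N :: "'a::real_inner"
  assumes N: "norm N = 1" and k: "\<bar>k\<bar> \<le> 1"
  shows "\<bar>(p \<bullet> N + k * sqrt (1 + (norm p)\<^sup>2)) - (v \<bullet> N + k * sqrt (1 + (norm v)\<^sup>2))\<bar> \<le> 2 * norm (p - v)"
proof -
  have "\<bar>sqrt (1 + (norm p)\<^sup>2) - sqrt (1 + (norm v)\<^sup>2)\<bar> \<le> norm (p - v)"
    using norm_lift_diff[of p v] unfolding norm_lift .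
  then have 1: "\<bar>k * (sqrt (1 + (norm p)\<^sup>2) - sqrt (1 + (norm v)\<^sup>2))\<bar> \<le> 1 * norm (p - v)"
    unfolding abs_mult using k by (intro mult_mono) auto
  have 2: "\<bar>(p - v) \<bullet> N\<bar> \<le> norm (p - v)" using Cauchy_Schwarz_ineq2[of "p - v" N] N by simp
  have "(p \<bullet> N + k * sqrt (1 + (norm p)\<^sup>2)) - (v \<bullet> N + k * sqrt (1 + (norm v)\<^sup>2)) =
     (p - v) \<bullet> N + k * (sqrt (1 + (norm p)\<^sup>2) - sqrt (1 + (norm v)\<^sup>2))"
    by (simp add: inner_diff_left algebra_simps)
  then show ?thesis using 1 2 by linarith
qed

section \<open>The Lipschitz estimate in dimension at least two\<close>

text \<open>The variables stand for the quantities in the second variation of the barrier: \<open>nd\<close> and \<open>ng\<close> for the lengths of \<open>w - z\<close> and \<open>(w + z) / 2\<close>,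
\<open>b1\<close>, \<open>z1\<close>, \<open>z2\<close> for derivatives of \<open>b\<close> and of the field.  The cross terms \<open>nd * ng\<close> are split by Young's inequality
with weight \<open>\<delta> * r\<close>, and the price is only the quadratically small \<open>\<delta>\<^sup>2\<close>.\<close>

lemma barrier_second_order_estimate:
  fixes r L b nd ng ed b1 z1 z2 \<eta> R K \<delta> :: real
  assumes r: "r > 0" and L: "L \<ge> 0" and b: "0 \<le> b" "b \<le> L" and n: "0 \<le> nd" "0 \<le> ng" and ed: "\<bar>ed\<bar> \<le> nd"
    and b1: "\<bar>b1\<bar> \<le> 2 * L * \<eta> * R * ng" and z1: "\<bar>z1\<bar> \<le> L * K * ng * nd" and z2: "\<bar>z2\<bar> \<le> L * K * ng\<^sup>2 * r"
    and \<delta>: "\<delta> = 2 * \<eta> * R + K"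
  shows "b * ((nd\<^sup>2 - ed\<^sup>2) / r) + 2 * (b1 * ed) + (- 2 * L * \<eta> * ng\<^sup>2) * r - (2 * z1 + z2)
    \<le> L * (2 * (nd\<^sup>2 / r) - (2 * \<eta> - K - \<delta>\<^sup>2) * (r * ng\<^sup>2))"
proof -
  have 1: "b * ((nd\<^sup>2 - ed\<^sup>2) / r) \<le> L * (nd\<^sup>2 / r)"
    using b L r by (intro mult_mono divide_right_mono) (auto simp: abs_le_square_iff[symmetric] ed n)
  have "b1 * ed \<le> \<bar>b1\<bar> * \<bar>ed\<bar>" by (metis abs_ge_self abs_mult)
  also have "\<dots> \<le> (2 * L * \<eta> * R * ng) * nd" using b1 ed n order_trans[OF abs_ge_zero b1] by (intro mult_mono) auto
  finally have 2: "b1 * ed \<le> (2 * L * \<eta> * R * ng) * nd" .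
  have "0 \<le> (nd - \<delta> * (ng * r))\<^sup>2 / r" using r by simp
  also have "\<dots> = nd\<^sup>2 / r - 2 * \<delta> * nd * ng + \<delta>\<^sup>2 * (r * ng\<^sup>2)"
    using r by (simp add: power2_eq_square field_simps)
  finally have "L * (2 * \<delta> * nd * ng) \<le> L * (nd\<^sup>2 / r + \<delta>\<^sup>2 * (r * ng\<^sup>2))" using L by (intro mult_left_mono) auto
  then have 3: "2 * (L * (2 * \<eta> * R) * nd * ng) + 2 * (L * K * nd * ng) \<le> L * (nd\<^sup>2 / r) + L * (\<delta>\<^sup>2 * (r * ng\<^sup>2))"
    unfolding \<delta> by (simp add: algebra_simps)
  have e1: "(2 * L * \<eta> * R * ng) * nd = L * (2 * \<eta> * R) * nd * ng" by simp
  have e2: "L * K * ng * nd = L * K * nd * ng" by simp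
  have "b * ((nd\<^sup>2 - ed\<^sup>2) / r) + 2 * (b1 * ed) + (- 2 * L * \<eta> * ng\<^sup>2) * r - (2 * z1 + z2)
    \<le> L * (nd\<^sup>2 / r) + (L * (nd\<^sup>2 / r) + L * (\<delta>\<^sup>2 * (r * ng\<^sup>2))) + (- 2 * L * \<eta> * ng\<^sup>2) * r + L * K * ng\<^sup>2 * r"
    using 1 2[unfolded e1] 3 z1[unfolded e2] z2 by (smt (verit))
  also have "\<dots> = L * (2 * (nd\<^sup>2 / r) - (2 * \<eta> - K - \<delta>\<^sup>2) * (r * ng\<^sup>2))" by (simp add: algebra_simps)
  finally show ?thesis .
qed

lemma sgn_inner: "sgn h \<bullet> v = (h \<bullet> v) / norm h" for h v :: "'a::real_inner"
  by (simp add: sgn_div_norm divide_inverse mult.commute)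

context smooth_convex_domain
begin

lemma convex_cl: "convex (closure \<Omega>)"
  by (rule convex_closure[OF convex])

lemma closure_midpoint: "x \<in> closure \<Omega> \<Longrightarrow> y \<in> closure \<Omega> \<Longrightarrow> (x + y) /\<^sub>R 2 \<in> closure \<Omega>"
  using convexD[OF convex_cl, of x y "1/2" "1/2"] by (simp add: scaleR_add_right)

lemma barrier_continuous:
  assumes b: "continuous_on (closure \<Omega>) b" and Z: "continuous_on (closure \<Omega>) Z"
  shows "continuous_on (closure \<Omega> \<times> closure \<Omega>) (\<lambda>(x, y). barrier b Z x y)"
proof -
  have m: "continuous_on (closure \<Omega> \<times> closure \<Omega>) (\<lambda>p. (fst p + snd p) /\<^sub>R 2)" by (intro continuous_intros)
  have im: "(\<lambda>p. (fst p + snd p) /\<^sub>R 2) ` (closure \<Omega> \<times> closure \<Omega>) \<subseteq> closure \<Omega>" using closure_midpoint by auto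
  show ?thesis unfolding barrier_def case_prod_unfold
    by (intro continuous_intros continuous_on_compose2[OF b m im] continuous_on_compose2[OF Z m im])
qed

text \<open>The heart of the argument.  Here \<open>W\<close> is the field \<open>cos \<theta> / sqrt (1 - cos\<^sup>2 \<theta>)\<close> times the extended normal, with all its bounds
summarized by one number \<open>K\<close>.  The smallness conditions on \<open>\<eta>\<close> and \<open>K\<close> involve the domain and the dimension only; the amplitude
\<open>L\<close>, which knows about \<open>F\<close> and \<open>u0\<close>, is chosen afterwards.\<close>

lemma uniform_lipschitz_of_field:
  fixes W :: "real^'n \<Rightarrow> real^'n"
  assumes ab: "anisotropy_bounds F c1 c2 c3 C5 C6" and ratio: "c2 \<le> c1 / (4 * real CARD('n))"
    and R: "R \<ge> 1" "\<And>x. x \<in> closure \<Omega> \<Longrightarrow> norm x \<le> R"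
    and \<kappa>: "\<And>x y. x \<in> frontier \<Omega> \<Longrightarrow> y \<in> closure \<Omega> \<Longrightarrow> (y - x) \<bullet> inward_normal \<Omega> x \<ge> \<kappa> * (norm (y - x))\<^sup>2"
    and \<eta>: "\<eta> > 0" "1000000 * real CARD('n) * R\<^sup>2 * \<eta> \<le> 1" "100 * R * \<eta> \<le> \<kappa>"
    and W: "continuous_on (closure \<Omega>) W" "\<And>m. m \<in> \<Omega> \<Longrightarrow> C2_bounds_at K K K W m"
      "\<And>x y. x \<in> closure \<Omega> \<Longrightarrow> y \<in> closure \<Omega> \<Longrightarrow> norm (W x - W y) \<le> K * norm (x - y)"
      "\<And>m. m \<in> closure \<Omega> \<Longrightarrow> norm (W m) \<le> K"
    and K: "0 \<le> K" "13 * K \<le> \<eta>"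
    and bd: "\<And>x. x \<in> frontier \<Omega> \<Longrightarrow> \<bar>cos (\<theta> x)\<bar> \<le> 1/2"
      "\<And>x. x \<in> frontier \<Omega> \<Longrightarrow> W x = (cos (\<theta> x) / sqrt (1 - (cos (\<theta> x))\<^sup>2)) *\<^sub>R inward_normal \<Omega> x"
    and u0: "\<And>x y. x \<in> \<Omega> \<Longrightarrow> y \<in> \<Omega> \<Longrightarrow> u0 x - u0 y \<le> B * norm (x - y)"
  shows "\<exists>L\<ge>0. \<forall>T>0. \<forall>u. flow_solution F \<Omega> \<theta> u0 T u \<longrightarrow>
     (\<forall>x\<in>closure \<Omega>. \<forall>y\<in>closure \<Omega>. \<forall>t\<in>{0..T}. u x t - u y t \<le> L * norm (x - y))"
proof -
  interpret A: anisotropy_bounds F c1 c2 c3 C5 C6 by (rule ab)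
  define n where "n = real CARD('n)"
  have n: "n \<ge> 2" using A.n2 by (simp add: n_def)
  obtain l0 where l0: "1 \<le> l0"
    "\<And>p q l D. l0 \<le> l \<Longrightarrow> l \<le> norm p \<Longrightarrow> l \<le> norm q \<Longrightarrow> norm (p - q) \<le> D * l \<Longrightarrow> 0 \<le> D \<Longrightarrow>
       128 * n * D\<^sup>2 \<le> 1 \<Longrightarrow>
       \<exists>w z :: nat \<times> nat \<times> bool \<Rightarrow> real^'n.
         (\<forall>a b. (\<Sum>k\<in>sq_index (CARD('n)). (w k \<bullet> a) * (w k \<bullet> b)) = aniso_tau F p a b) \<and>
         (\<forall>a b. (\<Sum>k\<in>sq_index (CARD('n)). (z k \<bullet> a) * (z k \<bullet> b)) = aniso_tau F q a b) \<and>
         (\<Sum>k\<in>sq_index (CARD('n)). (norm (w k - z k))\<^sup>2) \<le>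
           512 * n * D\<^sup>2 * (\<Sum>k\<in>sq_index (CARD('n)). (norm ((w k + z k) /\<^sub>R 2))\<^sup>2)"
    by (rule A.coupled_decompositions[OF ratio, folded n_def]) (rule that)
  \<comment> \<open>Large enough to dominate the initial oscillation by \<open>L / 4\<close> and to push both momenta, which are at least \<open>L / 8\<close>, beyond the threshold \<open>l0\<close>.\<close>
  define L where "L = 1 + 4 * \<bar>B\<bar> + 8 * l0"
  have L: "L \<ge> 1" "4 * B \<le> L" "l0 \<le> L / 8" using l0(1) by (simp_all add: L_def)
  \<comment> \<open>The size of the drift per unit of \<open>L * norm (x - y)\<close>; the factor 13 is the loss in the derivatives of \<open>Z\<close>.\<close>
  define \<delta> where "\<delta> = 2 * \<eta> * R + 13 * K"
  have \<delta>0: "\<delta> \<ge> 0" using \<eta> R K by (simp add: \<delta>_def)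
  have \<eta>R: "\<eta> \<le> \<eta> * R" using \<eta>(1) R(1) by simp
  have \<delta>: "\<delta> \<le> 3 * (\<eta> * R)" proof -
    have "2 * \<eta> * R = 2 * (\<eta> * R)" by simp
    then show ?thesis unfolding \<delta>_def using K(2) \<eta>R by linarith
  qed
  have RR: "R \<le> R\<^sup>2" using R(1) by (simp add: power2_eq_square)
  have nR: "1000000 * (n * (R\<^sup>2 * \<eta>)) \<le> 1" using \<eta>(2) by (simp add: n_def mult.assoc)
  have R2\<eta>: "0 \<le> R\<^sup>2 * \<eta>" "2000000 * (R\<^sup>2 * \<eta>) \<le> 1"
  proof -
    show 1: "0 \<le> R\<^sup>2 * \<eta>" using \<eta> by simp
    have "2 * (R\<^sup>2 * \<eta>) \<le> n * (R\<^sup>2 * \<eta>)" using n 1 by (intro mult_right_mono) auto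
    then show "2000000 * (R\<^sup>2 * \<eta>) \<le> 1" using nR by linarith
  qed
  have R\<eta>: "R * \<eta> \<le> R\<^sup>2 * \<eta>" using RR \<eta> by (intro mult_right_mono) auto
  have \<eta>small: "2000000 * \<eta> \<le> 1" "2000000 * (\<eta> * R) \<le> 1"
  proof -
    have "\<eta> * R = R * \<eta>" by simp
    then show "2000000 * (\<eta> * R) \<le> 1" using R\<eta> R2\<eta> by linarith
    then show "2000000 * \<eta> \<le> 1" using \<eta>R by linarith
  qed
  \<comment> \<open>\<open>\<delta>\<close> is linear in \<open>\<eta>\<close>, so its square is negligible.\<close>
  have \<delta>sq: "65537 * n * \<delta>\<^sup>2 \<le> \<eta>"
  proof -
    have "\<delta>\<^sup>2 \<le> (3 * (\<eta> * R))\<^sup>2" using \<delta> \<delta>0 by (rule power_mono)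
    then have "65537 * n * \<delta>\<^sup>2 \<le> 65537 * n * (3 * (\<eta> * R))\<^sup>2" using n by (intro mult_left_mono) auto
    also have "\<dots> = (589833 * (n * (R\<^sup>2 * \<eta>))) * \<eta>" by (simp add: power2_eq_square)
    also have "\<dots> \<le> 1 * \<eta>"
    proof (rule mult_right_mono)
      have "0 \<le> n * (R\<^sup>2 * \<eta>)" using n R2\<eta>(1) by simp
      then show "589833 * (n * (R\<^sup>2 * \<eta>)) \<le> 1" using nR by linarith
    qed (use \<eta> in simp)
    finally show ?thesis by simp
  qed
  define b where "b m = L * (1 - \<eta> * (m \<bullet> m))" for m :: "real^'n"
  define b1 where "b1 m v = - 2 * L * \<eta> * (m \<bullet> v)" for m v :: "real^'n"
  define b2 where "b2 v w = - 2 * L * \<eta> * (w \<bullet> v)" for v w :: "real^'n"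
  define Z where "Z m = sqrt (1 + (b m)\<^sup>2) *\<^sub>R W m" for m
  have db: "(b has_derivative b1 m) (at m)" for m
    unfolding b_def[abs_def] b1_def[abs_def] by (auto intro!: derivative_eq_intros simp: inner_commute algebra_simps)
  have db1: "((\<lambda>m. b1 m v) has_derivative b2 v) (at m)" for m v
    unfolding b1_def b2_def[abs_def] by (auto intro!: derivative_eq_intros)
  have b1le: "\<bar>b1 m v\<bar> \<le> 2 * L * \<eta> * R * norm v" if "m \<in> closure \<Omega>" for m v
  proof -
    have "\<bar>m \<bullet> v\<bar> \<le> R * norm v"
      using Cauchy_Schwarz_ineq2[of m v] mult_right_mono[OF R(2)[OF that] norm_ge_zero[of v]] by linarith
    then have "(2 * L * \<eta>) * \<bar>m \<bullet> v\<bar> \<le> (2 * L * \<eta>) * (R * norm v)" using L \<eta> by (intro mult_left_mono) auto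
    then show ?thesis using L \<eta> by (simp add: b1_def abs_mult)
  qed
  have bb: "L / 2 \<le> b m" "b m \<le> L" if "m \<in> closure \<Omega>" for m
  proof -
    have "m \<bullet> m \<le> R\<^sup>2" using R(2)[OF that] by (simp add: power2_norm_eq_inner[symmetric] power_mono)
    then have "\<eta> * (m \<bullet> m) \<le> \<eta> * R\<^sup>2" using \<eta> by (intro mult_left_mono) auto
    then have 1: "\<eta> * (m \<bullet> m) \<le> 1/2" using R2\<eta> by (simp add: mult.commute)
    have 2: "0 \<le> \<eta> * (m \<bullet> m)" using \<eta> by simp
    show "L / 2 \<le> b m" using mult_left_mono[of "1/2" "1 - \<eta> * (m \<bullet> m)" L] 1 L by (simp add: b_def)
    show "b m \<le> L" using mult_left_mono[of "1 - \<eta> * (m \<bullet> m)" 1 L] 2 L by (simp add: b_def)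
  qed
  have Ale: "sqrt (1 + (b m)\<^sup>2) \<le> 2 * L" if "m \<in> closure \<Omega>" for m
  proof -
    have "sqrt (1 + (b m)\<^sup>2) \<le> sqrt 1 + sqrt ((b m)\<^sup>2)" by (rule sqrt_add_le_add_sqrt) auto
    then show ?thesis using bb[OF that] L by simp
  qed
  have ZC2: "C2_bounds_at (2 * L * K) (3 * L * K) (13 * L * K) Z m" if m: "m \<in> \<Omega>" for m
  proof -
    have mc: "m \<in> closure \<Omega>" using m closure_subset by blast
    have bC2: "C2_bounds_at L L L b m"
      unfolding C2_bounds_at_def
    proof (rule exI[of _ b1], rule exI[of _ b2], intro conjI allI)
      show "\<forall>\<^sub>F y in nhds m. (b has_derivative b1 y) (at y)" using db by (intro always_eventually allI)
      show "((\<lambda>y. b1 y v) has_derivative b2 v) (at m)" for v by (rule db1)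
      show "norm (b m) \<le> L" using bb[OF mc] L by simp
      show "norm (b1 m v) \<le> L * norm v" for v
      proof -
        have "2 * L * \<eta> * R * norm v = (2 * (\<eta> * R)) * (L * norm v)" by simp
        also have "\<dots> \<le> 1 * (L * norm v)" using \<eta>small L by (intro mult_right_mono) auto
        finally show ?thesis using b1le[OF mc, of v] by simp
      qed
      show "norm (b2 v w) \<le> L * norm v * norm w" for v w
      proof -
        have "\<bar>b2 v w\<bar> = (2 * L * \<eta>) * \<bar>w \<bullet> v\<bar>" using L \<eta> by (simp add: b2_def abs_mult)
        also have "\<dots> \<le> (2 * L * \<eta>) * (norm w * norm v)"
          using L \<eta> Cauchy_Schwarz_ineq2[of w v] by (intro mult_left_mono) auto
        also have "\<dots> = (2 * \<eta>) * (L * norm v * norm w)" by simp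
        also have "\<dots> \<le> 1 * (L * norm v * norm w)" using \<eta>small L by (intro mult_right_mono) auto
        finally show ?thesis by simp
      qed
    qed
    have d1: "((\<lambda>t. sqrt (1 + t\<^sup>2)) has_real_derivative t / sqrt (1 + t\<^sup>2)) (at t)" for t
    proof -
      have "1 + t\<^sup>2 > 0" by (simp add: add_pos_nonneg)
      then show ?thesis by (auto intro!: derivative_eq_intros simp: field_simps)
    qed
    have d2: "((\<lambda>t. t / sqrt (1 + t\<^sup>2)) has_real_derivative 1 / (sqrt (1 + t\<^sup>2)) ^ 3) (at t)" for t
    proof -
      have p: "1 + t\<^sup>2 > 0" by (simp add: add_pos_nonneg)
      then have q: "sqrt (1 + t\<^sup>2) > 0" "sqrt (1 + t\<^sup>2) * sqrt (1 + t\<^sup>2) = 1 + t\<^sup>2" by simp_all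
      have "((\<lambda>t. t / sqrt (1 + t\<^sup>2)) has_real_derivative
          (1 * sqrt (1 + t\<^sup>2) - t * (t / sqrt (1 + t\<^sup>2))) / (sqrt (1 + t\<^sup>2) * sqrt (1 + t\<^sup>2))) (at t)"
        by (rule DERIV_divide[OF DERIV_ident d1]) (use q in simp)
      moreover have "(1 * sqrt (1 + t\<^sup>2) - t * (t / sqrt (1 + t\<^sup>2))) / (sqrt (1 + t\<^sup>2) * sqrt (1 + t\<^sup>2)) = 1 / (sqrt (1 + t\<^sup>2)) ^ 3"
      proof -
        have "1 * sqrt (1 + t\<^sup>2) - t * (t / sqrt (1 + t\<^sup>2)) = (sqrt (1 + t\<^sup>2) * sqrt (1 + t\<^sup>2) - t\<^sup>2) / sqrt (1 + t\<^sup>2)"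
        proof -
          have "1 * s - t * (t / s) = (s * s - t\<^sup>2) / s" if "s > 0" for s
            using that by (simp add: field_simps power2_eq_square)
          then show ?thesis using q(1) by blast
        qed
        also have "\<dots> = 1 / sqrt (1 + t\<^sup>2)" unfolding q(2) by simp
        finally show ?thesis by (simp add: power3_eq_cube)
      qed
      ultimately show ?thesis by simp
    qed
    define s where "s = sqrt (1 + (b m)\<^sup>2)"
    have s: "s \<ge> b m" "s > 0" "s \<ge> 1"
      unfolding s_def by (auto intro!: real_le_rsqrt simp: add_pos_nonneg)
    have "C2_bounds_at (2 * L) L (9 * L) (\<lambda>y. sqrt (1 + (b y)\<^sup>2)) m"
    proof (rule C2_bounds_at_compose[OF bC2 open_UNIV _ d1 d2])
      show "\<bar>sqrt (1 + (b m)\<^sup>2)\<bar> \<le> 2 * L" using Ale[OF mc] s(2) by (simp add: s_def)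
      have 1: "\<bar>b m / sqrt (1 + (b m)\<^sup>2)\<bar> \<le> 1"
        using s bb[OF mc] L by (simp add: s_def[symmetric] abs_divide divide_le_eq)
      then show "\<bar>b m / sqrt (1 + (b m)\<^sup>2)\<bar> * L \<le> L" using L mult_right_mono[OF 1, of L] by simp
      have "s ^ 3 \<ge> (L / 2) ^ 3" using s bb[OF mc] L by (intro power_mono) auto
      then have "1 / s ^ 3 \<le> 1 / (L / 2) ^ 3" using L by (intro divide_left_mono) (auto intro!: mult_pos_pos simp: s)
      then have "1 / s ^ 3 * L\<^sup>2 \<le> 1 / (L / 2) ^ 3 * L\<^sup>2" by (intro mult_right_mono) auto
      also have "\<dots> = 8 / L" using L by (simp add: power2_eq_square power3_eq_cube)
      also have "\<dots> \<le> 8 * L" using L mult_mono[of 1 L 1 L] by (simp add: divide_le_eq)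
      finally have "1 / s ^ 3 * L\<^sup>2 \<le> 8 * L" .
      then show "\<bar>1 / sqrt (1 + (b m)\<^sup>2) ^ 3\<bar> * L\<^sup>2 + \<bar>b m / sqrt (1 + (b m)\<^sup>2)\<bar> * L \<le> 9 * L"
        using 1 L mult_right_mono[OF 1, of L] s(2) by (simp add: s_def[symmetric])
    qed auto
    from C2_bounds_at_prod[OF bounded_bilinear_scaleR _ this W(2)[OF m]]
    show ?thesis unfolding Z_def[abs_def] by (rule C2_bounds_at_mono) (auto simp: algebra_simps)
  qed
  have Zle: "norm (Z m) \<le> L / 8" if "m \<in> closure \<Omega>" for m
  proof -
    have "norm (Z m) = sqrt (1 + (b m)\<^sup>2) * norm (W m)" by (simp add: Z_def add_nonneg_nonneg)
    also have "\<dots> \<le> (2 * L) * K" using Ale[OF that] W(4)[OF that] K L by (intro mult_mono) auto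
    also have "\<dots> \<le> (2 * L) * (1/16)" using K \<eta>small L by (intro mult_left_mono) auto
    finally show ?thesis by simp
  qed
  have bc: "continuous_on (closure \<Omega>) b" unfolding b_def by (intro continuous_intros)
  have Zc: "continuous_on (closure \<Omega>) Z" unfolding Z_def by (intro continuous_intros bc W(1))
  let ?R = "barrier b Z"
  have Rlow: "L / 4 * norm (x - y) \<le> ?R x y" and Rup: "?R x y \<le> 2 * L * norm (x - y)"
    if "x \<in> closure \<Omega>" "y \<in> closure \<Omega>" for x y
  proof -
    let ?m = "(x + y) /\<^sub>R 2"
    have m: "?m \<in> closure \<Omega>" by (rule closure_midpoint[OF that])
    have "\<bar>Z ?m \<bullet> (x - y)\<bar> \<le> L / 8 * norm (x - y)"
      using Cauchy_Schwarz_ineq2[of "Z ?m" "x - y"] mult_right_mono[OF Zle[OF m] norm_ge_zero[of "x - y"]] by linarith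
    moreover have "L / 2 * norm (x - y) \<le> b ?m * norm (x - y)" "b ?m * norm (x - y) \<le> L * norm (x - y)"
      using bb[OF m] by (intro mult_right_mono; simp)+
    moreover have "0 \<le> L * norm (x - y)" using L by simp
    ultimately show "L / 4 * norm (x - y) \<le> ?R x y" "?R x y \<le> 2 * L * norm (x - y)"
      unfolding barrier_def by (simp_all add: abs_le_iff)
  qed
  have point: "\<exists>Z1 Z2. (\<forall>\<^sub>F m' in nhds m. (Z has_derivative Z1 m') (at m')) \<and> (\<forall>v. ((\<lambda>m'. Z1 m' v) has_derivative Z2 v) (at m)) \<and>
      (\<forall>v. norm (Z1 m v) \<le> L * (13 * K) * norm v) \<and> (\<forall>v w. norm (Z2 v w) \<le> L * (13 * K) * norm v * norm w) \<and>
      (Z has_derivative Z1 m) (at m)"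
    if m: "m \<in> \<Omega>" for m
  proof -
    have "C2_bounds_at (2 * L * K) (L * (13 * K)) (L * (13 * K)) Z m"
      by (rule C2_bounds_at_mono[OF ZC2[OF m]]) (use L K in \<open>auto intro!: mult_right_mono\<close>)
    then obtain Z1 Z2 where a: "\<forall>\<^sub>F m' in nhds m. (Z has_derivative Z1 m') (at m')"
      "\<forall>v. ((\<lambda>m'. Z1 m' v) has_derivative Z2 v) (at m)" "norm (Z m) \<le> 2 * L * K"
      "\<forall>v. norm (Z1 m v) \<le> L * (13 * K) * norm v" "\<forall>v w. norm (Z2 v w) \<le> L * (13 * K) * norm v * norm w"
      unfolding C2_bounds_at_def by (elim exE conjE) (rule that)
    have "(Z has_derivative Z1 m) (at m)" using a(1) by (rule eventually_nhds_x_imp_x)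
    then show ?thesis using a(1,2,4,5) by (rule_tac exI[of _ Z1], rule_tac exI[of _ Z2]) (intro conjI)
  qed
  have drift: "norm (drift b Z x y) \<le> L * norm (x - y) * \<delta>"
    if "x \<in> closure \<Omega>" "y \<in> closure \<Omega>" "x \<noteq> y" for x y
  proof -
    let ?m = "(x + y) /\<^sub>R 2" and ?M = "drift b Z x y"
    have m: "?m \<in> \<Omega>" by (rule midpoint_in[OF that])
    then have mc: "?m \<in> closure \<Omega>" using closure_subset by blast
    obtain Z1 where Z1: "(Z has_derivative Z1) (at ?m)" "\<And>v. norm (Z1 v) \<le> L * (13 * K) * norm v"
      using point[OF m] by blast
    have "?M \<bullet> ?M = norm (x - y) * b1 ?m ?M - Z1 ?M \<bullet> (x - y)" by (rule drift_inner[OF db Z1(1)])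
    also have "\<dots> \<le> norm (x - y) * (2 * L * \<eta> * R * norm ?M) + (L * (13 * K) * norm ?M) * norm (x - y)"
    proof -
      have "norm (x - y) * b1 ?m ?M \<le> norm (x - y) * (2 * L * \<eta> * R * norm ?M)"
        using b1le[OF mc, of ?M] by (intro mult_left_mono) auto
      moreover have "\<bar>Z1 ?M \<bullet> (x - y)\<bar> \<le> (L * (13 * K) * norm ?M) * norm (x - y)"
        by (rule order_trans[OF Cauchy_Schwarz_ineq2 mult_right_mono[OF Z1(2)]]) simp
      ultimately show ?thesis by linarith
    qed
    also have "\<dots> = (L * norm (x - y) * \<delta>) * norm ?M" by (simp add: \<delta>_def algebra_simps)
    finally have "norm ?M * norm ?M \<le> (L * norm (x - y) * \<delta>) * norm ?M"
      by (simp add: power2_eq_square[symmetric] power2_norm_eq_inner)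
    then show ?thesis using L \<delta>0 by (cases "?M = 0") auto
  qed
  have dist2R: "norm (x - y) \<le> 2 * R" if "x \<in> closure \<Omega>" "y \<in> closure \<Omega>" for x y
    using norm_triangle_ineq4[of x y] R(2)[OF that(1)] R(2)[OF that(2)] by linarith
  have r\<delta>: "norm (x - y) * \<delta> \<le> 1/300000" if "x \<in> closure \<Omega>" "y \<in> closure \<Omega>" for x y
  proof -
    have "norm (x - y) * \<delta> \<le> (2 * R) * (3 * (\<eta> * R))"
      using dist2R[OF that] \<delta> \<delta>0 R by (intro mult_mono) auto
    also have "\<dots> = 6 * (R\<^sup>2 * \<eta>)" by (simp add: power2_eq_square)
    finally show ?thesis using R2\<eta> by linarith
  qed
  have plow: "L / 8 \<le> norm (barrier_px b Z x y)" "L / 8 \<le> norm (barrier_py b Z x y)"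
    if xy: "x \<in> closure \<Omega>" "y \<in> closure \<Omega>" "x \<noteq> y" for x y
  proof -
    let ?m = "(x + y) /\<^sub>R 2" and ?M = "drift b Z x y"
    have mc: "?m \<in> closure \<Omega>" by (rule closure_midpoint[OF xy(1,2)])
    have "norm ?M \<le> L * (norm (x - y) * \<delta>)" using drift[OF xy] by (simp add: mult.assoc)
    also have "\<dots> \<le> L * (1/300000)" using r\<delta>[OF xy(1,2)] L by (intro mult_left_mono) auto
    finally have M: "norm (?M /\<^sub>R 2) \<le> L / 8" using L by simp
    have "norm (sgn (x - y)) = 1" using xy(3) by (simp add: norm_sgn)
    moreover have "\<bar>b ?m\<bar> = b ?m" using bb(1)[OF mc] L by simp
    ultimately have "norm (b ?m *\<^sub>R sgn (x - y)) = b ?m" by (simp only: norm_scaleR mult_1_right)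
    then have be: "L / 2 \<le> norm (b ?m *\<^sub>R sgn (x - y))" using bb(1)[OF mc] by (simp only:)
    show "L / 8 \<le> norm (barrier_px b Z x y)"
    proof -
      have "norm (b ?m *\<^sub>R sgn (x - y)) \<le> norm (barrier_px b Z x y) + norm (Z ?m) + norm (?M /\<^sub>R 2)"
      proof -
        have "b ?m *\<^sub>R sgn (x - y) = barrier_px b Z x y + Z ?m - ?M /\<^sub>R 2" by (simp add: barrier_px_def)
        then show ?thesis
          using order_trans[OF norm_triangle_ineq4 add_right_mono[OF norm_triangle_ineq], of "barrier_px b Z x y" "Z ?m" "?M /\<^sub>R 2"]
          by (simp only:)
      qed
      then show ?thesis using be M Zle[OF mc] L(1) by linarith
    qed
    show "L / 8 \<le> norm (barrier_py b Z x y)"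
    proof -
      have "norm (b ?m *\<^sub>R sgn (x - y)) \<le> norm (barrier_py b Z x y) + norm (Z ?m) + norm (?M /\<^sub>R 2)"
      proof -
        have "b ?m *\<^sub>R sgn (x - y) = barrier_py b Z x y + Z ?m + ?M /\<^sub>R 2" by (simp add: barrier_py_def)
        then show ?thesis
          using order_trans[OF norm_triangle_ineq add_right_mono[OF norm_triangle_ineq], of "barrier_py b Z x y" "Z ?m" "?M /\<^sub>R 2"]
          by (simp only:)
      qed
      then show ?thesis using be M Zle[OF mc] L(1) by linarith
    qed
  qed
  \<comment> \<open>The two momenta of the barrier differ from the explicit covector built with \<open>W z\<close> at an endpoint \<open>z\<close> by \<open>O(L * norm (x - y) * \<delta>)\<close>.  For \<open>z\<close> on the boundary that covector is exactly the one which the boundary condition of the flow treats best.\<close>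
  have near: "norm (b ((x + y) /\<^sub>R 2) *\<^sub>R sgn (x - y) - Z ((x + y) /\<^sub>R 2) + \<sigma> *\<^sub>R drift b Z x y -
      (b ((x + y) /\<^sub>R 2) *\<^sub>R sgn (x - y) - sqrt (1 + (b ((x + y) /\<^sub>R 2))\<^sup>2) *\<^sub>R W z)) \<le> L * norm (x - y) * (2 * \<delta>)"
    if xy: "x \<in> closure \<Omega>" "y \<in> closure \<Omega>" "x \<noteq> y" and z: "z = x \<or> z = y" and \<sigma>: "\<bar>\<sigma>\<bar> = 1/2" for x y z \<sigma>
  proof -
    let ?m = "(x + y) /\<^sub>R 2" and ?M = "drift b Z x y"
    have mc: "?m \<in> closure \<Omega>" by (rule closure_midpoint[OF xy(1,2)])
    have zc: "z \<in> closure \<Omega>" using z xy by auto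
    have zm: "norm (z - ?m) \<le> norm (x - y)"
    proof -
      have "z - ?m = (x - y) /\<^sub>R 2 \<or> z - ?m = (y - x) /\<^sub>R 2" using z by (auto simp: vec_eq_iff field_simps)
      then show ?thesis by (auto simp: norm_minus_commute)
    qed
    have "b ?m *\<^sub>R sgn (x - y) - Z ?m + \<sigma> *\<^sub>R ?M - (b ?m *\<^sub>R sgn (x - y) - sqrt (1 + (b ?m)\<^sup>2) *\<^sub>R W z) =
        sqrt (1 + (b ?m)\<^sup>2) *\<^sub>R (W z - W ?m) + \<sigma> *\<^sub>R ?M" (is "?lhs = _")
      by (simp add: Z_def algebra_simps)
    then have "norm ?lhs \<le> norm (sqrt (1 + (b ?m)\<^sup>2) *\<^sub>R (W z - W ?m)) + norm (\<sigma> *\<^sub>R ?M)"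
      by (simp only: norm_triangle_ineq)
    also have "norm (sqrt (1 + (b ?m)\<^sup>2) *\<^sub>R (W z - W ?m)) \<le> (2 * L) * (K * norm (x - y))"
    proof -
      have "norm (W z - W ?m) \<le> K * norm (x - y)"
        using W(3)[OF zc mc] mult_left_mono[OF zm K(1)] by linarith
      then have "sqrt (1 + (b ?m)\<^sup>2) * norm (W z - W ?m) \<le> (2 * L) * (K * norm (x - y))"
        using Ale[OF mc] L by (intro mult_mono) auto
      then show ?thesis by (simp add: add_nonneg_nonneg)
    qed
    also have "norm (\<sigma> *\<^sub>R ?M) \<le> L * norm (x - y) * \<delta>"
    proof -
      have "norm (\<sigma> *\<^sub>R ?M) = norm ?M / 2" unfolding norm_scaleR \<sigma> by simp
      then show ?thesis using drift[OF xy] norm_ge_zero[of ?M] by linarith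
    qed
    also have "(2 * L) * (K * norm (x - y)) + L * norm (x - y) * \<delta> = L * norm (x - y) * (2 * K + \<delta>)"
      by (simp add: algebra_simps)
    also have "\<dots> \<le> L * norm (x - y) * (2 * \<delta>)"
    proof (rule mult_left_mono)
      have "0 \<le> 2 * \<eta> * R" using \<eta> R by simp
      moreover have "2 * K + (e + 13 * K) \<le> 2 * (e + 13 * K)" if "0 \<le> e" for e
        using that K(1) by simp
      ultimately show "2 * K + \<delta> \<le> 2 * \<delta>" unfolding \<delta>_def by blast
    qed (use L in simp)
    finally show ?thesis by simp
  qed
  \<comment> \<open>The gain from convexity exceeds the boundary error because \<open>\<eta> * R\<close> is small compared with \<open>\<kappa>\<close>.\<close>
  have final: "L / 2 * (- (\<kappa> * r)) / 2 + 2 * (L * r * (2 * \<delta>)) < 0" if "r > 0" for r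
  proof -
    have "16 * \<delta> < \<kappa>"
    proof -
      have "16 * \<delta> \<le> 48 * (\<eta> * R)" using \<delta> by linarith
      also have "48 * (\<eta> * R) < 100 * (\<eta> * R)" using \<eta> R by simp
      also have "100 * (\<eta> * R) \<le> \<kappa>" using \<eta>(3) by (simp add: mult_ac)
      finally show ?thesis .
    qed
    then have "L * r * (16 * \<delta>) < L * r * \<kappa>" using L that by (intro mult_strict_left_mono) auto
    then show ?thesis by (simp add: algebra_simps)
  qed
  have N1: "norm (inward_normal \<Omega> x) = 1" if "x \<in> frontier \<Omega>" for x by (rule norm_normal[OF that])
  have L0: "0 \<le> 2 * L" using L by simp
  show ?thesis
  proof (intro exI[of _ "2 * L"] conjI L0 allI impI ballI)
    fix T :: real and u x y t
    assume T: "0 < T" and flow: "flow_solution F \<Omega> \<theta> u0 T u"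
      and x: "x \<in> closure \<Omega>" and y: "y \<in> closure \<Omega>" and t: "t \<in> {0..T}"
    have "u x t - u y t \<le> ?R x y"
    proof (rule two_point_comparison[OF flow T barrier_continuous[OF bc Zc], where px = "barrier_px b Z" and py = "barrier_py b Z"])
      show "0 \<le> ?R x x" if "x \<in> closure \<Omega>" for x by (simp add: barrier_def)
      show "u0 x - u0 y \<le> ?R x y" if "x \<in> \<Omega>" "y \<in> \<Omega>" for x y
      proof -
        have c: "x \<in> closure \<Omega>" "y \<in> closure \<Omega>" using that closure_subset by blast+
        have "B * norm (x - y) \<le> L / 4 * norm (x - y)" using L by (intro mult_right_mono) auto
        then show ?thesis using u0[OF that] Rlow[OF c] by linarith
      qed
      fix x y assume xy: "x \<in> closure \<Omega>" "y \<in> closure \<Omega>" "x \<noteq> y"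
      obtain Z1 where Z1: "(Z has_derivative Z1) (at ((x + y) /\<^sub>R 2))" using point[OF midpoint_in[OF xy]] by blast
      show "((\<lambda>x'. ?R x' y) has_derivative (\<lambda>v. barrier_px b Z x y \<bullet> v)) (at x within closure \<Omega>)"
        and "((\<lambda>y'. ?R x y') has_derivative (\<lambda>v. - (barrier_py b Z x y \<bullet> v))) (at y within closure \<Omega>)"
        by (rule has_derivative_at_withinI[OF barrier_has_derivative(1)[OF db Z1 xy(3)]],
            rule has_derivative_at_withinI[OF barrier_has_derivative(2)[OF db Z1 xy(3)]])
    next
      fix x y assume x: "x \<in> frontier \<Omega>" and y: "y \<in> closure \<Omega>" and ne: "x \<noteq> y"
      let ?m = "(x + y) /\<^sub>R 2" and ?N = "inward_normal \<Omega> x" and ?k = "cos (\<theta> x)"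
      have xc: "x \<in> closure \<Omega>" by (rule frontier_closure[OF x])
      have mc: "?m \<in> closure \<Omega>" by (rule closure_midpoint[OF xc y])
      have r: "norm (x - y) > 0" using ne by simp
      define v where "v = b ?m *\<^sub>R sgn (x - y) - (sqrt (1 + (b ?m)\<^sup>2) * (?k / sqrt (1 - ?k\<^sup>2))) *\<^sub>R ?N"
      have v: "v = b ?m *\<^sub>R sgn (x - y) - sqrt (1 + (b ?m)\<^sup>2) *\<^sub>R W x" by (simp add: v_def bd(2)[OF x])
      have "\<kappa> * (norm (y - x))\<^sup>2 \<le> (y - x) \<bullet> ?N" by (rule \<kappa>[OF x y])
      then have "(x - y) \<bullet> ?N \<le> - (\<kappa> * norm (x - y)) * norm (x - y)"
        by (simp add: inner_diff_left norm_minus_commute power2_eq_square)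
      then have s: "sgn (x - y) \<bullet> ?N \<le> - (\<kappa> * norm (x - y))"
        unfolding sgn_inner by (simp only: pos_divide_le_eq[OF r])
      have \<kappa>0: "\<kappa> \<ge> 0" using \<eta> R order_trans[of 0 "100 * R * \<eta>" \<kappa>] by simp
      then have s0: "sgn (x - y) \<bullet> ?N \<le> 0" using s r by (smt (verit) mult_nonneg_nonneg norm_ge_zero)
      have "v \<bullet> ?N + ?k * sqrt (1 + (norm v)\<^sup>2) \<le> b ?m * (sgn (x - y) \<bullet> ?N) / 2"
        unfolding v_def
        by (rule capillary_tangential[OF _ N1[OF x] _ bd(1)[OF x] s0]) (use ne bb[OF mc] L in \<open>auto simp: norm_sgn\<close>)
      also have "b ?m * (sgn (x - y) \<bullet> ?N) \<le> L / 2 * (sgn (x - y) \<bullet> ?N)"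
        using bb[OF mc] s0 by (intro mult_right_mono_neg) auto
      also have "L / 2 * (sgn (x - y) \<bullet> ?N) \<le> L / 2 * (- (\<kappa> * norm (x - y)))" using s L by (intro mult_left_mono) auto
      finally have 1: "v \<bullet> ?N + ?k * sqrt (1 + (norm v)\<^sup>2) \<le> L / 2 * (- (\<kappa> * norm (x - y))) / 2" by simp
      have "norm (barrier_px b Z x y - v) \<le> L * norm (x - y) * (2 * \<delta>)"
        using near[OF xc y ne, of x "1/2"] unfolding v barrier_px_def by (simp add: inverse_eq_divide)
      then have "\<bar>(barrier_px b Z x y \<bullet> ?N + ?k * sqrt (1 + (norm (barrier_px b Z x y))\<^sup>2)) - (v \<bullet> ?N + ?k * sqrt (1 + (norm v)\<^sup>2))\<bar>
          \<le> 2 * (L * norm (x - y) * (2 * \<delta>))"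
        using capillary_lipschitz[OF N1[OF x] abs_cos_le_one, of "barrier_px b Z x y" "\<theta> x" v] by linarith
      then show "barrier_px b Z x y \<bullet> ?N + ?k * sqrt (1 + (norm (barrier_px b Z x y))\<^sup>2) < 0"
        using 1 final[OF r] by linarith
    next
      fix x y assume x: "x \<in> closure \<Omega>" and y: "y \<in> frontier \<Omega>" and ne: "x \<noteq> y"
      let ?m = "(x + y) /\<^sub>R 2" and ?N = "inward_normal \<Omega> y" and ?k = "cos (\<theta> y)"
      have yc: "y \<in> closure \<Omega>" by (rule frontier_closure[OF y])
      have mc: "?m \<in> closure \<Omega>" by (rule closure_midpoint[OF x yc])
      have r: "norm (x - y) > 0" using ne by simp
      define v where "v = b ?m *\<^sub>R (- sgn (x - y)) - (sqrt (1 + (b ?m)\<^sup>2) * ((- ?k) / sqrt (1 - (- ?k)\<^sup>2))) *\<^sub>R ?N"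
      have v: "- v = b ?m *\<^sub>R sgn (x - y) - sqrt (1 + (b ?m)\<^sup>2) *\<^sub>R W y" by (simp add: v_def bd(2)[OF y])
      have "\<kappa> * (norm (x - y))\<^sup>2 \<le> (x - y) \<bullet> ?N" by (rule \<kappa>[OF y x])
      then have "(\<kappa> * norm (x - y)) * norm (x - y) \<le> (x - y) \<bullet> ?N"
        by (simp add: power2_eq_square)
      then have s: "\<kappa> * norm (x - y) \<le> sgn (x - y) \<bullet> ?N"
        unfolding sgn_inner by (simp only: pos_le_divide_eq[OF r])
      have \<kappa>0: "\<kappa> \<ge> 0" using \<eta> R order_trans[of 0 "100 * R * \<eta>" \<kappa>] by simp
      then have s0: "- sgn (x - y) \<bullet> ?N \<le> 0" using s r by (smt (verit) inner_minus_left mult_nonneg_nonneg norm_ge_zero)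
      have "v \<bullet> ?N + (- ?k) * sqrt (1 + (norm v)\<^sup>2) \<le> b ?m * (- sgn (x - y) \<bullet> ?N) / 2"
        unfolding v_def
        by (rule capillary_tangential[OF _ N1[OF y] _ _ s0]) (use ne bb[OF mc] L bd(1)[OF y] in \<open>auto simp: norm_sgn\<close>)
      also have "b ?m * (- sgn (x - y) \<bullet> ?N) \<le> L / 2 * (- sgn (x - y) \<bullet> ?N)"
        using bb[OF mc] s0 by (intro mult_right_mono_neg) auto
      also have "L / 2 * (- sgn (x - y) \<bullet> ?N) \<le> L / 2 * (- (\<kappa> * norm (x - y)))" using s L by (intro mult_left_mono) auto
      finally have 1: "v \<bullet> ?N + (- ?k) * sqrt (1 + (norm v)\<^sup>2) \<le> L / 2 * (- (\<kappa> * norm (x - y))) / 2" by simp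
      have "norm (barrier_py b Z x y - (- v)) \<le> L * norm (x - y) * (2 * \<delta>)"
        using near[OF x yc ne, of y "-1/2"] unfolding v barrier_py_def by (simp add: inverse_eq_divide)
      then have "\<bar>(barrier_py b Z x y \<bullet> ?N + ?k * sqrt (1 + (norm (barrier_py b Z x y))\<^sup>2)) - ((- v) \<bullet> ?N + ?k * sqrt (1 + (norm (- v))\<^sup>2))\<bar>
          \<le> 2 * (L * norm (x - y) * (2 * \<delta>))"
        using capillary_lipschitz[OF N1[OF y] abs_cos_le_one, of "barrier_py b Z x y" "\<theta> y" "- v"] by linarith
      moreover have "(- v) \<bullet> ?N + ?k * sqrt (1 + (norm (- v))\<^sup>2) = - (v \<bullet> ?N + (- ?k) * sqrt (1 + (norm v)\<^sup>2))" by simp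
      ultimately show "barrier_py b Z x y \<bullet> ?N + ?k * sqrt (1 + (norm (barrier_py b Z x y))\<^sup>2) > 0"
        using 1 final[OF r] by linarith
    next
      fix x y assume xy: "x \<in> \<Omega>" "y \<in> \<Omega>" "x \<noteq> y"
      let ?m = "(x + y) /\<^sub>R 2" and ?K = "sq_index (CARD('n))"
      have xyc: "x \<in> closure \<Omega>" "y \<in> closure \<Omega>" using xy closure_subset by blast+
      have m: "?m \<in> \<Omega>" by (rule midpoint_in[OF xyc xy(3)])
      then have mc: "?m \<in> closure \<Omega>" using closure_subset by blast
      define r where "r = norm (x - y)"
      have r: "r > 0" using xy by (simp add: r_def)
      \<comment> \<open>The relative distance of the two momenta at the scale \<open>L / 8\<close>.\<close>
      define D where "D = 8 * \<delta> * r"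
      have D0: "0 \<le> D" using \<delta>0 r by (simp add: D_def)
      have "barrier_px b Z x y - barrier_py b Z x y = drift b Z x y"
        by (simp add: barrier_px_def barrier_py_def scaleR_add_left[symmetric])
      then have pd: "norm (barrier_px b Z x y - barrier_py b Z x y) \<le> D * (L / 8)"
        using drift[OF xyc xy(3)] by (simp add: D_def r_def mult_ac)
      have D1: "128 * n * D\<^sup>2 \<le> 1"
      proof -
        have "128 * n * D\<^sup>2 = (8192 * n * \<delta>\<^sup>2) * r\<^sup>2" by (simp add: D_def power_mult_distrib)
        also have "\<dots> \<le> \<eta> * (4 * R\<^sup>2)"
        proof (rule mult_mono)
          have "8192 * (n * \<delta>\<^sup>2) \<le> 65537 * (n * \<delta>\<^sup>2)" using n by (intro mult_right_mono) auto
          then show "8192 * n * \<delta>\<^sup>2 \<le> \<eta>" using \<delta>sq by (simp add: mult.assoc)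
          have "r\<^sup>2 \<le> (2 * R)\<^sup>2" using dist2R[OF xyc] r by (intro power_mono) (auto simp: r_def)
          then show "r\<^sup>2 \<le> 4 * R\<^sup>2" by (simp add: power_mult_distrib)
        qed (use \<eta> in auto)
        also have "\<dots> \<le> 1" using R2\<eta> by (simp add: mult.commute)
        finally show ?thesis .
      qed
      obtain w z :: "nat \<times> nat \<times> bool \<Rightarrow> real^'n" where wz:
         "\<forall>a c. (\<Sum>k\<in>?K. (w k \<bullet> a) * (w k \<bullet> c)) = aniso_tau F (barrier_px b Z x y) a c"
         "\<forall>a c. (\<Sum>k\<in>?K. (z k \<bullet> a) * (z k \<bullet> c)) = aniso_tau F (barrier_py b Z x y) a c"
         "(\<Sum>k\<in>?K. (norm (w k - z k))\<^sup>2) \<le> 512 * n * D\<^sup>2 * (\<Sum>k\<in>?K. (norm ((w k + z k) /\<^sub>R 2))\<^sup>2)"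
        using l0(2)[OF L(3) plow[OF xyc xy(3)] pd D0 D1] by blast
      obtain Z1 Z2 where Z12: "\<forall>\<^sub>F m' in nhds ?m. (Z has_derivative Z1 m') (at m')" "\<And>v. ((\<lambda>m'. Z1 m' v) has_derivative Z2 v) (at ?m)"
        "\<And>v. norm (Z1 ?m v) \<le> L * (13 * K) * norm v" "\<And>v w. norm (Z2 v w) \<le> L * (13 * K) * norm v * norm w"
        using point[OF m] by blast
      define s where "s k = b ?m * (((norm (w k - z k))\<^sup>2 - (sgn (x - y) \<bullet> (w k - z k))\<^sup>2) / norm (x - y)) +
          2 * (b1 ?m ((w k + z k) /\<^sub>R 2) * (sgn (x - y) \<bullet> (w k - z k))) + b2 ((w k + z k) /\<^sub>R 2) ((w k + z k) /\<^sub>R 2) * norm (x - y)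
          - (2 * (Z1 ?m ((w k + z k) /\<^sub>R 2) \<bullet> (w k - z k)) + Z2 ((w k + z k) /\<^sub>R 2) ((w k + z k) /\<^sub>R 2) \<bullet> (x - y))" for k
      have sa: "second_along (\<lambda>t. ?R (x + t *\<^sub>R w k) (y + t *\<^sub>R z k)) (s k)" for k
        unfolding s_def by (rule barrier_second_along[OF _ db1 Z12(1,2) xy(3)]) (intro always_eventually allI db)
      have sk: "s k \<le> L * (2 * ((norm (w k - z k))\<^sup>2 / r) - (2 * \<eta> - 13 * K - \<delta>\<^sup>2) * (r * (norm ((w k + z k) /\<^sub>R 2))\<^sup>2))" for k
      proof -
        let ?g = "(w k + z k) /\<^sub>R 2" and ?d = "w k - z k"
        have "b2 ?g ?g = - 2 * L * \<eta> * (norm ?g)\<^sup>2" by (simp only: b2_def power2_norm_eq_inner)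
        moreover have "b ?m * (((norm ?d)\<^sup>2 - (sgn (x - y) \<bullet> ?d)\<^sup>2) / r) + 2 * (b1 ?m ?g * (sgn (x - y) \<bullet> ?d)) +
            (- 2 * L * \<eta> * (norm ?g)\<^sup>2) * r - (2 * (Z1 ?m ?g \<bullet> ?d) + Z2 ?g ?g \<bullet> (x - y))
            \<le> L * (2 * ((norm ?d)\<^sup>2 / r) - (2 * \<eta> - 13 * K - \<delta>\<^sup>2) * (r * (norm ?g)\<^sup>2))"
        proof (rule barrier_second_order_estimate[OF r])
          show "\<bar>sgn (x - y) \<bullet> ?d\<bar> \<le> norm ?d"
            using Cauchy_Schwarz_ineq2[of "sgn (x - y)" ?d] xy(3) by (simp add: norm_sgn)
          show "\<bar>b1 ?m ?g\<bar> \<le> 2 * L * \<eta> * R * norm ?g" by (rule b1le[OF mc])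
          show "\<bar>Z1 ?m ?g \<bullet> ?d\<bar> \<le> L * (13 * K) * norm ?g * norm ?d"
            by (rule order_trans[OF Cauchy_Schwarz_ineq2 mult_right_mono[OF Z12(3)]]) simp
          have "\<bar>Z2 ?g ?g \<bullet> (x - y)\<bar> \<le> (L * (13 * K) * norm ?g * norm ?g) * norm (x - y)"
            by (rule order_trans[OF Cauchy_Schwarz_ineq2 mult_right_mono[OF Z12(4)]]) simp
          then show "\<bar>Z2 ?g ?g \<bullet> (x - y)\<bar> \<le> L * (13 * K) * (norm ?g)\<^sup>2 * r" by (simp only: r_def power2_eq_square mult.assoc)
          show "\<delta> = 2 * \<eta> * R + 13 * K" by (rule \<delta>_def)
        qed (use bb[OF mc] L in auto)
        ultimately show ?thesis by (simp only: s_def r_def)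
      qed
      define Q where "Q = (\<Sum>k\<in>?K. (norm (w k - z k))\<^sup>2)"
      define G where "G = (\<Sum>k\<in>?K. (norm ((w k + z k) /\<^sub>R 2))\<^sup>2)"
      have G0: "0 \<le> G" unfolding G_def by (intro sum_nonneg) auto
      have "(\<Sum>k\<in>?K. s k) \<le> (\<Sum>k\<in>?K. L * (2 * ((norm (w k - z k))\<^sup>2 / r) - (2 * \<eta> - 13 * K - \<delta>\<^sup>2) * (r * (norm ((w k + z k) /\<^sub>R 2))\<^sup>2)))"
        by (intro sum_mono sk)
      also have "\<dots> = L * (2 * (Q / r) - (2 * \<eta> - 13 * K - \<delta>\<^sup>2) * (r * G))"
        unfolding Q_def G_def sum_distrib_left[symmetric] sum_subtractf sum_divide_distrib[symmetric] by simp
      also have "\<dots> \<le> 0"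
      proof -
        have "Q \<le> 512 * n * D\<^sup>2 * G" using wz(3) by (simp only: Q_def G_def)
        then have "Q / r \<le> (512 * n * D\<^sup>2 * G) / r" using r by (simp add: divide_right_mono)
        also have "\<dots> = 32768 * n * \<delta>\<^sup>2 * (r * G)" using r by (simp add: D_def power2_eq_square)
        finally have 1: "2 * (Q / r) \<le> 65536 * n * \<delta>\<^sup>2 * (r * G)" by linarith
        have "65536 * n * \<delta>\<^sup>2 + \<delta>\<^sup>2 \<le> 65537 * n * \<delta>\<^sup>2"
          using n mult_right_mono[of 1 n "\<delta>\<^sup>2"] by (simp add: algebra_simps)
        then have "65536 * n * \<delta>\<^sup>2 \<le> 2 * \<eta> - 13 * K - \<delta>\<^sup>2" using \<delta>sq K by linarith
        then have "65536 * n * \<delta>\<^sup>2 * (r * G) \<le> (2 * \<eta> - 13 * K - \<delta>\<^sup>2) * (r * G)" using r G0 by (intro mult_right_mono) auto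
        then have "2 * (Q / r) - (2 * \<eta> - 13 * K - \<delta>\<^sup>2) * (r * G) \<le> 0" using 1 by linarith
        then show ?thesis using L by (simp add: mult_nonneg_nonpos)
      qed
      finally have "(\<Sum>k\<in>?K. s k) \<le> 0" .
      moreover have "finite ?K" by (simp add: sq_index_def)
      ultimately show "\<exists>(K :: (nat \<times> nat \<times> bool) set) w z s. finite K \<and> (\<forall>k\<in>K. second_along (\<lambda>t. ?R (x + t *\<^sub>R w k) (y + t *\<^sub>R z k)) (s k)) \<and>
         (\<forall>a c. (\<Sum>k\<in>K. (w k \<bullet> a) * (w k \<bullet> c)) = aniso_tau F (barrier_px b Z x y) a c) \<and>
         (\<forall>a c. (\<Sum>k\<in>K. (z k \<bullet> a) * (z k \<bullet> c)) = aniso_tau F (barrier_py b Z x y) a c) \<and> (\<Sum>k\<in>K. s k) \<le> 0"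
        using sa wz(1,2) by (intro exI[of _ ?K] exI[of _ w] exI[of _ z] exI[of _ s]) blast
    qed (rule x, rule y, rule t)
    then show "u x t - u y t \<le> 2 * L * norm (x - y)" using Rup[OF x y] by linarith
  qed
qed

end

section \<open>From the contact angle to the gradient bound\<close>

context smooth_convex_domain
begin

text \<open>All directions from a point of the closure into the convex open set are admissible, and their differences span.\<close>

lemma has_derivative_closure_unique:
  fixes f :: "real^'n \<Rightarrow> 'b::real_normed_vector"
  assumes x: "x \<in> closure \<Omega>" and f1: "(f has_derivative f1) (at x within closure \<Omega>)"
    and f2: "(f has_derivative f2) (at x within closure \<Omega>)"
  shows "f1 = f2"
proof -
  note lin = has_derivative_linear[OF f1] has_derivative_linear[OF f2]
  have eq: "f1 (y - x) = f2 (y - x)" if y: "y \<in> \<Omega>" for y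
  proof (rule has_derivative_within_unique_inward[OF f1 f2, of 1])
    fix t :: real assume t: "0 < t" "t < 1"
    have "y \<in> closure \<Omega>" using y closure_subset by blast
    from convexD[OF convex_cl x this, of "1 - t" t] t
    show "x + t *\<^sub>R (y - x) \<in> closure \<Omega>" by (simp add: algebra_simps)
  qed simp
  obtain y where y: "y \<in> \<Omega>" using ne by blast
  have "f1 v = f2 v" for v
  proof -
    have "\<forall>\<^sub>F s in at_right (0::real). y + s *\<^sub>R v \<in> \<Omega>"
      using eventually_line_in_open[OF op y, of v] by (simp add: eventually_at_filter eventually_mono)
    moreover have "\<forall>\<^sub>F s in at_right (0::real). s > 0" by (rule eventually_at_right_less)
    ultimately obtain s :: real where s: "y + s *\<^sub>R v \<in> \<Omega>" "s > 0"
      using eventually_happens[of _ "at_right (0::real)"] by (metis (mono_tags, lifting) eventually_conj trivial_limit_at_right_real)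
    have "f (s *\<^sub>R v) = f (y + s *\<^sub>R v - x) - f (y - x)" if "linear f" for f :: "real^'n \<Rightarrow> 'b"
      using linear_diff[OF that, of "y + s *\<^sub>R v - x" "y - x"] by simp
    from this[OF lin(1)] this[OF lin(2)] have "f1 (s *\<^sub>R v) = f2 (s *\<^sub>R v)"
      using eq[OF s(1)] eq[OF y] by (simp only:)
    then show ?thesis using s(2) by (simp add: linear_scale[OF lin(1)] linear_scale[OF lin(2)])
  qed
  then show ?thesis by (rule ext)
qed

text \<open>The supremum of a set of reals that is unbounded above carries no information, so boundedness must come first.  It follows from
compactness of the closure, once the derivative of the gradient is identified with the matrix of continuous second derivatives.\<close>

lemma C1_norm_bounds:
  assumes f: "Ck_on (Suc (Suc k)) (closure \<Omega>) f" and e: "C1_norm (closure \<Omega>) (grad (closure \<Omega>) f) \<le> e"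
    and x: "x \<in> closure \<Omega>"
  shows "norm (grad (closure \<Omega>) f x) \<le> e" and "norm (dderiv (closure \<Omega>) (grad (closure \<Omega>) f) v x) \<le> e * norm v"
proof -
  let ?C = "closure \<Omega>" and ?G = "grad (closure \<Omega>) f"
  let ?H = "\<lambda>x v. (\<chi> i. dderiv ?C (dderiv ?C f (axis i 1)) v x) :: real^'n"
  have dG: "(?G has_derivative ?H x) (at x within ?C)" if "x \<in> ?C" for x
    by (rule grad_has_derivative_within[OF f that])
  have DG: "dderiv ?C ?G v x = ?H x v" if "x \<in> ?C" for x v
  proof -
    have "?G differentiable (at x within ?C)" using dG[OF that] unfolding differentiable_def by blast
    from has_derivative_closure_unique[OF that differentiable_has_dderiv[OF this] dG[OF that]]
    show ?thesis by (rule fun_cong)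
  qed
  have "continuous_on ?C ?G"
    by (rule has_derivative_continuous_on[OF dG])
  then have "bounded (?G ` ?C)" by (intro compact_imp_bounded compact_continuous_image compact_cl)
  then have bG: "bdd_above ((\<lambda>x. norm (?G x)) ` ?C)" by (auto simp: bounded_iff bdd_above_def)
  have cH: "continuous_on ?C (dderiv ?C (dderiv ?C f (axis (fst ij) 1)) (axis (snd ij) 1))" for ij :: "'n \<times> 'n"
    using f by (auto intro: Ck_on_cont)
  obtain M where M: "0 \<le> M" "\<And>ij x. x \<in> ?C \<Longrightarrow> \<bar>dderiv ?C (dderiv ?C f (axis (fst ij) 1)) (axis (snd ij) 1) x\<bar> \<le> M"
    by (rule bounded_on_compact[OF compact_cl, of "\<lambda>ij. dderiv ?C (dderiv ?C f (axis (fst ij) 1)) (axis (snd ij) 1)"])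
      (use cH in blast)+
  have Hb: "norm (?H x v) \<le> (real CARD('n) * (real CARD('n) * M)) * norm v" if x: "x \<in> ?C" for x v
  proof -
    have c: "\<bar>dderiv ?C (dderiv ?C f (axis i 1)) v x\<bar> \<le> real CARD('n) * M * norm v" for i
    proof -
      have "dderiv ?C (dderiv ?C f (axis i 1)) v x = (\<Sum>j\<in>UNIV. dderiv ?C (dderiv ?C f (axis i 1)) (axis j 1) x * v $ j)"
        by (subst grad_inner[OF Ck_on_differentiable[OF Ck_on_dderiv[OF f] x]]) (simp add: grad_def inner_vec_def)
      also have "\<bar>\<dots>\<bar> \<le> (\<Sum>j\<in>(UNIV::'n set). M * norm v)"
      proof (rule order_trans[OF sum_abs sum_mono])
        fix j
        show "\<bar>dderiv ?C (dderiv ?C f (axis i 1)) (axis j 1) x * v $ j\<bar> \<le> M * norm v"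
          unfolding abs_mult using M(2)[OF x, of "(i, j)"] M(1) component_le_norm_cart[of v j] by (intro mult_mono) auto
      qed
      finally show ?thesis by simp
    qed
    have "norm (?H x v) \<le> (\<Sum>i\<in>UNIV. \<bar>?H x v $ i\<bar>)" by (rule norm_le_l1_cart)
    also have "\<dots> \<le> (\<Sum>i\<in>(UNIV::'n set). real CARD('n) * M * norm v)" using c by (intro sum_mono) simp
    finally show ?thesis by (simp add: mult_ac)
  qed
  have DGf: "(\<lambda>v. dderiv ?C ?G v x) = ?H x" if "x \<in> ?C" for x by (rule ext) (rule DG[OF that])
  have "onorm (\<lambda>v. dderiv ?C ?G v x) \<le> real CARD('n) * (real CARD('n) * M)" if "x \<in> ?C" for x
    unfolding DGf[OF that] using M(1) by (intro onorm_bound Hb[OF that]) simp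
  then have bH: "bdd_above ((\<lambda>x. onorm (\<lambda>v. dderiv ?C ?G v x)) ` ?C)" unfolding bdd_above_def by blast
  have bl: "bounded_linear (\<lambda>v. dderiv ?C ?G v x)"
    unfolding DGf[OF x] using dG[OF x] by (rule has_derivative_bounded_linear)
  have 1: "norm (?G x) \<le> (SUP x\<in>?C. norm (?G x))" by (rule cSUP_upper[OF x bG])
  have 2: "onorm (\<lambda>v. dderiv ?C ?G v x) \<le> (SUP x\<in>?C. onorm (\<lambda>v. dderiv ?C ?G v x))" by (rule cSUP_upper[OF x bH])
  have 3: "0 \<le> onorm (\<lambda>v. dderiv ?C ?G v x)" by (rule onorm_pos_le[OF bl])
  show "norm (?G x) \<le> e" using 1 2 3 e unfolding C1_norm_def by linarith
  have "onorm (\<lambda>v. dderiv ?C ?G v x) \<le> e" using 1 2 norm_ge_zero[of "?G x"] e unfolding C1_norm_def by linarith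
  then show "norm (dderiv ?C ?G v x) \<le> e * norm v"
    using onorm[OF bl, of v] mult_right_mono[of _ e "norm v"] by (meson norm_ge_zero order_trans)
qed

lemma C2_bounds_from_C1_norm:
  assumes f: "Ck_on (Suc (Suc k)) (closure \<Omega>) f" and e: "C1_norm (closure \<Omega>) (grad (closure \<Omega>) f) \<le> e"
    and x: "x \<in> \<Omega>"
  shows "C2_bounds_at \<bar>f x\<bar> e e f x"
proof -
  let ?C = "closure \<Omega>" and ?G = "grad (closure \<Omega>) f"
  have int: "y \<in> ?C" "at y within ?C = at y" if "y \<in> \<Omega>" for y
    using that closure_subset at_within_interior[of y ?C] interior_maximal[OF closure_subset op] by blast+
  have df: "(f has_derivative (\<lambda>v. ?G y \<bullet> v)) (at y)" if "y \<in> \<Omega>" for y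
    using differentiable_has_dderiv[OF Ck_on_differentiable[OF f int(1)[OF that]]]
    unfolding grad_inner[OF Ck_on_differentiable[OF f int(1)[OF that]]] int(2)[OF that] .
  have dG: "(?G has_derivative (\<lambda>v. dderiv ?C ?G v x)) (at x)"
    using differentiable_has_dderiv[of ?G x ?C] grad_has_derivative_within[OF f int(1)[OF x]] int(2)[OF x]
    unfolding differentiable_def by metis
  note b = C1_norm_bounds[OF f e int(1)[OF x]]
  show ?thesis unfolding C2_bounds_at_def
  proof (rule exI[of _ "\<lambda>y v. ?G y \<bullet> v"], rule exI[of _ "\<lambda>v w. dderiv ?C ?G w x \<bullet> v"], intro conjI allI)
    show "\<forall>\<^sub>F y in nhds x. (f has_derivative (\<lambda>v. ?G y \<bullet> v)) (at y)"
      using eventually_nhds_in_open[OF op x] by eventually_elim (rule df)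
    show "((\<lambda>y. ?G y \<bullet> v) has_derivative (\<lambda>w. dderiv ?C ?G w x \<bullet> v)) (at x)" for v
      by (rule has_derivative_inner_left[OF dG])
    show "norm (f x) \<le> \<bar>f x\<bar>" by simp
    show "norm (?G x \<bullet> v) \<le> e * norm v" for v
      using Cauchy_Schwarz_ineq2[of "?G x" v] mult_right_mono[OF b(1) norm_ge_zero[of v]] by simp
    show "norm (dderiv ?C ?G w x \<bullet> v) \<le> e * norm v * norm w" for v w
      using Cauchy_Schwarz_ineq2[of "dderiv ?C ?G w x" v] mult_right_mono[OF b(2)[of w] norm_ge_zero[of v]]
      by (simp add: mult_ac)
  qed
qed

text \<open>The function \<open>cos \<theta> / sqrt (1 - cos\<^sup>2 \<theta>)\<close> is small in \<open>C\<^sup>2\<close> because \<open>cos \<theta>\<close> is, with a universal factor as long as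
\<open>\<bar>cos \<theta>\<bar> \<le> 1/2\<close>.\<close>

lemma C2_bounds_cotangent:
  fixes f :: "real^'n \<Rightarrow> real"
  assumes f: "C2_bounds_at A e e f x" and c: "\<bar>cos (f x)\<bar> \<le> e" and e: "e \<le> 1/2"
  shows "C2_bounds_at (10 * e) (10 * e) (10 * e) (\<lambda>y. cos (f y) / sqrt (1 - (cos (f y))\<^sup>2)) x"
proof -
  have e0: "0 \<le> e" using c by linarith
  have kC: "C2_bounds_at e e (2 * e) (\<lambda>y. cos (f y)) x"
  proof (rule C2_bounds_at_compose[OF f open_UNIV])
    show "f x \<in> UNIV" by (rule UNIV_I)
    show "(cos has_real_derivative - sin w) (at w)" for w :: real by (rule DERIV_cos)
    show "((\<lambda>w. - sin w) has_real_derivative - cos (f x)) (at (f x))" by (intro DERIV_minus DERIV_sin)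
    show "\<bar>cos (f x)\<bar> \<le> e" by (rule c)
    have s: "\<bar>- sin (f x)\<bar> * e \<le> 1 * e" using e0 by (intro mult_right_mono) auto
    then show "\<bar>- sin (f x)\<bar> * e \<le> e" by simp
    have "\<bar>- cos (f x)\<bar> * e\<^sup>2 \<le> 1 * e\<^sup>2" by (intro mult_right_mono) auto
    also have "\<dots> \<le> 1 * e" unfolding power2_eq_square using e e0 by (simp add: mult_left_le_one_le)
    finally show "\<bar>- cos (f x)\<bar> * e\<^sup>2 + \<bar>- sin (f x)\<bar> * e \<le> 2 * e" using s by simp
  qed
  let ?k = "cos (f x)"
  define \<phi>1 where "\<phi>1 t = 1 / (sqrt (1 - t\<^sup>2)) ^ 3" for t :: real
  have sq: "1 - w\<^sup>2 > 0" if "w \<in> {-1<..<1}" for w :: real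
    using that abs_square_less_1[of w] by (auto simp: abs_less_iff)
  have ds: "((\<lambda>t. sqrt (1 - t\<^sup>2)) has_real_derivative - w / sqrt (1 - w\<^sup>2)) (at w)" if "w \<in> {-1<..<1}" for w :: real
    using sq[OF that] by (auto intro!: derivative_eq_intros simp: field_simps)
  have d1: "((\<lambda>t. t / sqrt (1 - t\<^sup>2)) has_real_derivative \<phi>1 w) (at w)" if w: "w \<in> {-1<..<1}" for w :: real
  proof -
    define s where "s = sqrt (1 - w\<^sup>2)"
    have s: "s > 0" "s * s = 1 - w\<^sup>2" using sq[OF w] by (simp_all add: s_def)
    have "((\<lambda>t. t / sqrt (1 - t\<^sup>2)) has_real_derivative (1 * s - w * (- w / s)) / (s * s)) (at w)"
      unfolding s_def by (rule DERIV_divide[OF DERIV_ident ds[OF w]]) (use sq[OF w] in simp)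
    moreover have "1 * s - w * (- w / s) = (s * s + w\<^sup>2) / s" using s(1) by (simp add: field_simps power2_eq_square)
    moreover have "(s * s + w\<^sup>2) / s = 1 / s" unfolding s(2) by simp
    ultimately show ?thesis unfolding \<phi>1_def s_def[symmetric] by (simp add: power3_eq_cube mult.assoc)
  qed
  have d2: "(\<phi>1 has_real_derivative 3 * w / (sqrt (1 - w\<^sup>2)) ^ 5) (at w)" if w: "w \<in> {-1<..<1}" for w :: real
  proof -
    define s where "s = sqrt (1 - w\<^sup>2)"
    have s: "s > 0" using sq[OF w] by (simp add: s_def)
    have p: "((\<lambda>t. (sqrt (1 - t\<^sup>2)) ^ 3) has_real_derivative 3 * s ^ 2 * (- w / s)) (at w)"
      unfolding s_def using DERIV_power[OF ds[OF w], of 3] by (simp add: mult_ac)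
    have "(\<phi>1 has_real_derivative - (3 * s ^ 2 * (- w / s)) / (s ^ 3 * s ^ 3)) (at w)"
      unfolding \<phi>1_def[abs_def]
      using DERIV_divide[OF DERIV_const[of 1] p] s by (simp add: s_def)
    moreover have "- (3 * s ^ 2 * (- w / s)) / (s ^ 3 * s ^ 3) = 3 * w / s ^ 5"
      using s by (simp add: field_simps power_numeral_reduce)
    ultimately show ?thesis by (simp add: s_def)
  qed
  have k: "\<bar>?k\<bar> \<le> 1/2" using c e by linarith
  then have kJ: "?k \<in> {-1<..<1}" by (auto simp: abs_le_iff)
  define s where "s = sqrt (1 - ?k\<^sup>2)"
  have k2: "?k\<^sup>2 \<le> 1/4" using power2_le_iff_abs_le[of "1/2" ?k] k by (simp add: power_divide)
  have s: "3/4 \<le> s" unfolding s_def by (rule real_le_rsqrt) (use k2 in \<open>simp add: power_divide\<close>)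
  have inv: "1 / s ^ m \<le> 1 / (3/4) ^ m" for m
    using s by (intro divide_left_mono power_mono) auto
  have 0: "C2_bounds_at (10 * e) (10 * e) (10 * e) (\<lambda>y. (\<lambda>t. t / sqrt (1 - t\<^sup>2)) (cos (f y))) x"
  proof (rule C2_bounds_at_compose[OF kC open_greaterThanLessThan kJ d1 d2[OF kJ]])
    have "\<bar>?k\<bar> * (1 / s) \<le> e * (4/3)" using c e0 inv[of 1] s by (intro mult_mono) auto
    moreover have "\<bar>?k / s\<bar> = \<bar>?k\<bar> * (1 / s)" using s by (simp add: abs_divide)
    ultimately show "\<bar>?k / sqrt (1 - ?k\<^sup>2)\<bar> \<le> 10 * e" unfolding s_def[symmetric] using e0 by linarith
    have "(1 / s ^ 3) * e \<le> (1 / (3/4) ^ 3) * e" using e0 inv by (intro mult_right_mono) auto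
    also have "\<dots> \<le> 3 * e" using e0 by (simp add: power3_eq_cube)
    finally have B: "(1 / s ^ 3) * e \<le> 3 * e" .
    have 3: "\<bar>\<phi>1 ?k\<bar> = 1 / s ^ 3" unfolding \<phi>1_def s_def[symmetric] using s by simp
    show "\<bar>\<phi>1 ?k\<bar> * e \<le> 10 * e" unfolding 3 using B e0 by linarith
    have "\<bar>3 * ?k / s ^ 5\<bar> = (3 * \<bar>?k\<bar>) * (1 / s ^ 5)" using s by (simp add: abs_mult abs_divide)
    also have "\<dots> \<le> (3/2) * (1 / (3/4) ^ 5)" using k inv s by (intro mult_mono) auto
    also have "\<dots> \<le> 7" by (simp add: power_numeral_reduce)
    finally have "\<bar>3 * ?k / s ^ 5\<bar> * e\<^sup>2 \<le> 7 * e\<^sup>2" by (rule mult_right_mono) simp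
    also have "\<dots> \<le> 7 * (e * (1/2))" unfolding power2_eq_square using e e0 by (intro mult_left_mono) auto
    finally have "\<bar>3 * ?k / s ^ 5\<bar> * e\<^sup>2 \<le> 7 * (e * (1/2))" .
    moreover have "1 / s ^ 3 * (2 * e) = 2 * (1 / s ^ 3 * e)" by simp
    ultimately show "\<bar>3 * ?k / sqrt (1 - ?k\<^sup>2) ^ 5\<bar> * e\<^sup>2 + \<bar>\<phi>1 ?k\<bar> * (2 * e) \<le> 10 * e"
      unfolding 3 s_def[symmetric] using B e0 by linarith
  qed
  then show ?thesis by simp
qed

lemma lipschitz_on_closure_of_Ck:
  assumes f: "Ck_on (Suc (Suc k)) (closure \<Omega>) f"
  obtains B where "\<And>x y. x \<in> closure \<Omega> \<Longrightarrow> y \<in> closure \<Omega> \<Longrightarrow> f x - f y \<le> B * norm (x - y)"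
proof -
  let ?C = "closure \<Omega>"
  have "continuous_on ?C (grad ?C f)" by (rule has_derivative_continuous_on[OF grad_has_derivative_within[OF f]])
  then have "bounded (grad ?C f ` ?C)" by (intro compact_imp_bounded compact_continuous_image compact_cl)
  then obtain B where B: "\<And>x. x \<in> ?C \<Longrightarrow> norm (grad ?C f x) \<le> B" by (auto simp: bounded_iff)
  have "norm (f x - f y) \<le> B * norm (x - y)" if "x \<in> ?C" "y \<in> ?C" for x y
  proof (rule differentiable_bound[OF convex_cl _ _ that])
    fix z assume z: "z \<in> ?C"
    note fd = Ck_on_differentiable[OF f z]
    show "(f has_derivative (\<lambda>v. grad ?C f z \<bullet> v)) (at z within ?C)"
      using differentiable_has_dderiv[OF fd] unfolding grad_inner[OF fd] .
    have "onorm (\<lambda>v. grad ?C f z \<bullet> v) \<le> norm (grad ?C f z)"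
      by (rule onorm_bound) (use Cauchy_Schwarz_ineq2[of "grad ?C f z"] in auto)
    then show "onorm (\<lambda>v. grad ?C f z \<bullet> v) \<le> B" using B[OF z] by linarith
  qed
  then have "f x - f y \<le> B * norm (x - y)" if "x \<in> ?C" "y \<in> ?C" for x y
    using order_trans[OF abs_ge_self] that unfolding real_norm_def by blast
  then show ?thesis by (rule that)
qed

text \<open>In the interior, differentiate in the direction of the gradient; the closure follows by continuity.\<close>

lemma gradient_bound_from_lipschitz:
  assumes f: "Ck_on (Suc (Suc k)) (closure \<Omega>) f" and L: "L \<ge> 0"
    and lip: "\<And>x y. x \<in> closure \<Omega> \<Longrightarrow> y \<in> closure \<Omega> \<Longrightarrow> f x - f y \<le> L * norm (x - y)"
    and x: "x \<in> closure \<Omega>"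
  shows "norm (grad (closure \<Omega>) f x) \<le> L"
proof -
  let ?C = "closure \<Omega>" and ?G = "grad (closure \<Omega>) f"
  have "continuous_on ?C ?G" by (rule has_derivative_continuous_on[OF grad_has_derivative_within[OF f]])
  moreover have "\<forall>z\<in>\<Omega>. norm (?G z) \<le> L"
  proof
    fix z assume z: "z \<in> \<Omega>"
    have zc: "z \<in> ?C" using z closure_subset by blast
    note fd = Ck_on_differentiable[OF f zc]
    have "at z within ?C = at z"
      using z at_within_interior[of z ?C] interior_maximal[OF closure_subset op] by blast
    then have fdz: "(f has_derivative (\<lambda>v. ?G z \<bullet> v)) (at z)"
      using differentiable_has_dderiv[OF fd] unfolding grad_inner[OF fd] by simp
    let ?v = "?G z"
    define g where "g t = f (z + t *\<^sub>R ?v) - L * norm ?v * t" for t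
    have "((\<lambda>t. f (z + t *\<^sub>R ?v)) has_real_derivative ?v \<bullet> ?v) (at 0)"
      using has_vector_derivative_line[of f "\<lambda>v. ?G z \<bullet> v" z 0 ?v] fdz
      by (simp add: has_real_derivative_iff_has_vector_derivative)
    then have dg: "(g has_real_derivative ?v \<bullet> ?v - L * norm ?v) (at 0)"
      unfolding g_def by (auto intro!: derivative_eq_intros)
    have "\<not> 0 < ?v \<bullet> ?v - L * norm ?v"
    proof
      assume "0 < ?v \<bullet> ?v - L * norm ?v"
      from DERIV_pos_inc_right[OF dg this] obtain d where d: "d > 0" "\<And>h. 0 < h \<Longrightarrow> h < d \<Longrightarrow> g 0 < g (0 + h)" by blast
      have "\<forall>\<^sub>F t in at_right 0. z + t *\<^sub>R ?v \<in> \<Omega>"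
        using eventually_line_in_open[OF op z, of ?v] by (simp add: eventually_at_filter eventually_mono)
      moreover have "\<forall>\<^sub>F t in at_right (0::real). t \<in> {0<..<d}" by (rule eventually_at_right_real[OF d(1)])
      ultimately obtain t where t: "z + t *\<^sub>R ?v \<in> \<Omega>" "t \<in> {0<..<d}"
        using eventually_happens[of _ "at_right (0::real)"] by (metis (mono_tags, lifting) eventually_conj trivial_limit_at_right_real)
      have "f (z + t *\<^sub>R ?v) - f z \<le> L * norm (z + t *\<^sub>R ?v - z)"
        by (rule lip) (use t zc closure_subset in blast)+
      then have "g t \<le> g 0" using t(2) by (simp add: g_def mult_ac)
      then show False using d(2)[of t] t(2) by simp
    qed
    then have "norm ?v * norm ?v \<le> L * norm ?v"
      by (simp add: power2_norm_eq_inner[symmetric] power2_eq_square)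
    then show "norm ?v \<le> L" using L by (cases "?v = 0") auto
  qed
  ultimately show ?thesis using x by (rule continuous_on_closure_norm_le)
qed

text \<open>All bounds for the barrier field at once, linear in the smallness \<open>e\<close> of the contact angle.  The Lipschitz estimate is needed
up to the boundary, where the field has no two-sided derivative.\<close>

lemma capillary_field_bounds:
  assumes \<theta>: "Ck_on (Suc (Suc k)) (closure \<Omega>) \<theta>" "\<And>x. x \<in> closure \<Omega> \<Longrightarrow> \<bar>cos (\<theta> x)\<bar> \<le> e"
      "C1_norm (closure \<Omega>) (grad (closure \<Omega>) \<theta>) \<le> e" and e: "e \<le> 1/2"
    and \<nu>: "\<And>x. x \<in> closure \<Omega> \<Longrightarrow> C2_bounds_at M M M \<nu> x"
  defines "W \<equiv> \<lambda>x. (cos (\<theta> x) / sqrt (1 - (cos (\<theta> x))\<^sup>2)) *\<^sub>R \<nu> x" and "K \<equiv> 40 * (e * M)"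
  shows "continuous_on (closure \<Omega>) W" and "m \<in> \<Omega> \<Longrightarrow> C2_bounds_at K K K W m"
    and "x \<in> closure \<Omega> \<Longrightarrow> y \<in> closure \<Omega> \<Longrightarrow> norm (W x - W y) \<le> K * norm (x - y)"
    and "m \<in> closure \<Omega> \<Longrightarrow> norm (W m) \<le> K" and "0 \<le> K"
proof -
  let ?C = "closure \<Omega>"
  obtain x0 where x0: "x0 \<in> \<Omega>" using ne by blast
  then have x0c: "x0 \<in> ?C" using closure_subset by blast
  have M0: "0 \<le> M" by (rule C2_bounds_at_nonneg(1)[OF \<nu>[OF x0c]])
  have e0: "0 \<le> e" using \<theta>(2)[OF x0c] by linarith
  have eM: "0 \<le> e * M" using e0 M0 by simp
  then show K0: "0 \<le> K" by (simp add: K_def)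
  have one: "C2_bounds_at K K K W m" if m: "m \<in> \<Omega>" for m
  proof -
    have mc: "m \<in> ?C" using m closure_subset by blast
    note c = C2_bounds_cotangent[OF C2_bounds_from_C1_norm[OF \<theta>(1,3) m] \<theta>(2)[OF mc] e]
    from C2_bounds_at_prod[OF bounded_bilinear_scaleR _ c \<nu>[OF mc]]
    show ?thesis unfolding W_def by (rule C2_bounds_at_mono) (use eM in \<open>simp_all add: K_def mult.commute\<close>)
  qed
  then show "m \<in> \<Omega> \<Longrightarrow> C2_bounds_at K K K W m" .
  have \<nu>c: "continuous_on ?C \<nu>"
    by (intro continuous_at_imp_continuous_on ballI C2_bounds_at_continuous[OF \<nu>])
  have pos: "1 - (cos (\<theta> x))\<^sup>2 > 0" if "x \<in> ?C" for x
  proof -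
    have "\<bar>cos (\<theta> x)\<bar> < 1" using \<theta>(2)[OF that] e by linarith
    then show ?thesis by (simp add: abs_square_less_1)
  qed
  have "continuous_on ?C \<theta>" by (rule Ck_on_cont[OF \<theta>(1)])
  then show Wc: "continuous_on ?C W"
    unfolding W_def by (intro continuous_intros \<nu>c) (use pos in force)+
  have "K-lipschitz_on \<Omega> W"
    by (rule lipschitz_onI[OF _ K0]) (use C2_bounds_at_lipschitz[OF convex one] in \<open>simp add: dist_norm\<close>)
  then have "K-lipschitz_on ?C W" by (rule lipschitz_on_closure[OF _ Wc])
  then show "x \<in> ?C \<Longrightarrow> y \<in> ?C \<Longrightarrow> norm (W x - W y) \<le> K * norm (x - y)"
    unfolding lipschitz_on_def dist_norm by blast
  have "norm (W z) \<le> K" if "z \<in> \<Omega>" for z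
    using one[OF that] unfolding C2_bounds_at_def by blast
  then show "m \<in> ?C \<Longrightarrow> norm (W m) \<le> K"
    using continuous_on_closure_norm_le[OF Wc] by blast
qed

text \<open>The parameter \<open>\<eta>\<close> is chosen from the domain (its size \<open>R\<close>, its convexity \<open>\<kappa>\<close>) and the dimension; then \<open>\<epsilon>\<close> from \<open>\<eta>\<close> and the size of the extended normal.\<close>

lemma uniform_lipschitz_higher_dim:
  assumes n2: "CARD('n) \<ge> 2" and k0: "curvature_ge \<Omega> k0" "k0 > 0"
  obtains \<epsilon> where "0 < \<epsilon>" "\<epsilon> \<le> 1/2"
    "\<And>F c1 c2 c3 C5 C6 \<theta> u0 B. anisotropy_bounds F c1 c2 c3 C5 C6 \<Longrightarrow> c2 \<le> c1 / (4 * real CARD('n)) \<Longrightarrow>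
      Ck_on 3 (closure \<Omega>) \<theta> \<Longrightarrow> (\<And>x. x \<in> closure \<Omega> \<Longrightarrow> \<bar>cos (\<theta> x)\<bar> \<le> \<epsilon>) \<Longrightarrow>
      C1_norm (closure \<Omega>) (grad (closure \<Omega>) \<theta>) \<le> \<epsilon> \<Longrightarrow>
      (\<And>x y. x \<in> \<Omega> \<Longrightarrow> y \<in> \<Omega> \<Longrightarrow> u0 x - u0 y \<le> B * norm (x - y)) \<Longrightarrow>
      \<exists>L\<ge>0. \<forall>T>0. \<forall>u. flow_solution F \<Omega> \<theta> u0 T u \<longrightarrow>
        (\<forall>x\<in>closure \<Omega>. \<forall>y\<in>closure \<Omega>. \<forall>t\<in>{0..T}. u x t - u y t \<le> L * norm (x - y))"
proof -
  obtain \<kappa> where \<kappa>: "\<kappa> > 0"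
    "\<And>x y. x \<in> frontier \<Omega> \<Longrightarrow> y \<in> closure \<Omega> \<Longrightarrow> (y - x) \<bullet> inward_normal \<Omega> x \<ge> \<kappa> * (norm (y - x))\<^sup>2"
    by (rule quantitative_convexity[OF n2 k0]) (rule that)
  obtain \<nu> :: "real^'n \<Rightarrow> real^'n" where \<nu>: "C2_bounded_on (closure \<Omega>) \<nu>" "\<And>x. x \<in> frontier \<Omega> \<Longrightarrow> \<nu> x = inward_normal \<Omega> x"
    by (rule normal_extension) (rule that)
  obtain M where M: "\<And>x. x \<in> closure \<Omega> \<Longrightarrow> C2_bounds_at M M M \<nu> x" using \<nu>(1) unfolding C2_bounded_on_def by blast
  obtain x0 where "x0 \<in> \<Omega>" using ne by blast
  then have M0: "0 \<le> M" using C2_bounds_at_nonneg(1)[OF M] closure_subset by blast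
  obtain R0 where R0: "\<And>x. x \<in> closure \<Omega> \<Longrightarrow> norm x \<le> R0" using compact_imp_bounded[OF compact_cl] by (auto simp: bounded_iff)
  define R where "R = max 1 R0"
  have R: "R \<ge> 1" "\<And>x. x \<in> closure \<Omega> \<Longrightarrow> norm x \<le> R" using R0 by (auto simp: R_def le_max_iff_disj)
  \<comment> \<open>The first bound makes the interior errors, quadratic in \<open>\<eta>\<close>, negligible; the second lets convexity win at the boundary.\<close>
  define \<eta> where "\<eta> = min (1 / (1000000 * real CARD('n) * R\<^sup>2)) (\<kappa> / (100 * R))"
  have p: "0 < 1000000 * real CARD('n) * R\<^sup>2" "0 < 100 * R" using R(1) by simp_all
  have \<eta>: "\<eta> > 0" using p \<kappa>(1) by (simp add: \<eta>_def)
  have \<eta>1: "1000000 * real CARD('n) * R\<^sup>2 * \<eta> \<le> 1"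
  proof -
    have "\<eta> \<le> 1 / (1000000 * real CARD('n) * R\<^sup>2)" unfolding \<eta>_def by (rule min.cobounded1)
    then show ?thesis unfolding pos_le_divide_eq[OF p(1)] by (simp only: mult.commute)
  qed
  have \<eta>2: "100 * R * \<eta> \<le> \<kappa>"
    using mult_left_mono[of \<eta> "\<kappa> / (100 * R)" "100 * R"] p(2) by (simp add: \<eta>_def)
  \<comment> \<open>\<open>520 = 13 * 40\<close> collects the losses in the derivatives of the barrier field; the summand 1 avoids a division by zero.\<close>
  define \<epsilon> where "\<epsilon> = min (1/2) (\<eta> / (520 * M + 1))"
  have q: "0 < 520 * M + 1" using M0 by simp
  show thesis
  proof (rule that[of \<epsilon>])
    show "0 < \<epsilon>" using \<eta> q by (simp add: \<epsilon>_def)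
    show \<epsilon>2: "\<epsilon> \<le> 1/2" unfolding \<epsilon>_def by (rule min.cobounded1)
    have "\<epsilon> * (520 * M + 1) \<le> \<eta>"
      using mult_right_mono[of \<epsilon> "\<eta> / (520 * M + 1)" "520 * M + 1"] q by (simp add: \<epsilon>_def)
    then have K: "13 * (40 * (\<epsilon> * M)) \<le> \<eta>" using \<open>0 < \<epsilon>\<close> by (simp add: algebra_simps)
    fix F :: "(real^'n) \<times> real \<Rightarrow> real" and c1 c2 c3 C5 C6 \<theta> u0 B
    assume ab: "anisotropy_bounds F c1 c2 c3 C5 C6" and ratio: "c2 \<le> c1 / (4 * real CARD('n))"
      and \<theta>: "Ck_on 3 (closure \<Omega>) \<theta>" "\<And>x. x \<in> closure \<Omega> \<Longrightarrow> \<bar>cos (\<theta> x)\<bar> \<le> \<epsilon>"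
        "C1_norm (closure \<Omega>) (grad (closure \<Omega>) \<theta>) \<le> \<epsilon>"
      and u0: "\<And>x y. x \<in> \<Omega> \<Longrightarrow> y \<in> \<Omega> \<Longrightarrow> u0 x - u0 y \<le> B * norm (x - y)"
    note W = capillary_field_bounds[OF \<theta>(1)[unfolded numeral_3_eq_3] \<theta>(2,3) \<epsilon>2 M]
    show "\<exists>L\<ge>0. \<forall>T>0. \<forall>u. flow_solution F \<Omega> \<theta> u0 T u \<longrightarrow>
        (\<forall>x\<in>closure \<Omega>. \<forall>y\<in>closure \<Omega>. \<forall>t\<in>{0..T}. u x t - u y t \<le> L * norm (x - y))"
    proof (rule uniform_lipschitz_of_field[OF ab ratio R \<kappa>(2) \<eta> \<eta>1 \<eta>2 W K _ _ u0])
      fix x assume x: "x \<in> frontier \<Omega>"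
      show "\<bar>cos (\<theta> x)\<bar> \<le> 1/2" using \<theta>(2)[OF frontier_closure[OF x]] \<epsilon>2 by linarith
      show "(cos (\<theta> x) / sqrt (1 - (cos (\<theta> x))\<^sup>2)) *\<^sub>R \<nu> x = (cos (\<theta> x) / sqrt (1 - (cos (\<theta> x))\<^sup>2)) *\<^sub>R inward_normal \<Omega> x"
        by (simp only: \<nu>(2)[OF x])
    qed
  qed
qed

text \<open>In dimension one the two momenta \<open>L * sgn (x - y)\<close> coincide, so the same vector decomposes both diffusion matrices and the barrier is
constant along it.  At an endpoint the normal component of the momentum is \<open>\<plusminus>L\<close>, which exceeds
\<open>\<bar>k\<bar> * sqrt (1 + L\<^sup>2)\<close>.\<close>

lemma uniform_lipschitz_interval:
  assumes n1: "CARD('n) = 1" and F: "smooth_anisotropy F" and c: "0 < c1" "tau_bounds F c1 c2 c3"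
    and \<theta>: "\<And>x. x \<in> frontier \<Omega> \<Longrightarrow> \<bar>cos (\<theta> x)\<bar> \<le> 1/2"
    and u0: "\<And>x y. x \<in> \<Omega> \<Longrightarrow> y \<in> \<Omega> \<Longrightarrow> u0 x - u0 y \<le> B * norm (x - y)"
  shows "\<exists>L\<ge>0. \<forall>T>0. \<forall>u. flow_solution F \<Omega> \<theta> u0 T u \<longrightarrow>
     (\<forall>x\<in>closure \<Omega>. \<forall>y\<in>closure \<Omega>. \<forall>t\<in>{0..T}. u x t - u y t \<le> L * norm (x - y))"
proof -
  interpret A: smooth_anisotropy F by (rule F)
  have on: "orthonormal_frame (\<lambda>_. e)" if "norm e = 1" for e :: "real^'n"
    using that n1 by (simp add: orthonormal_frame_def norm_eq_1)
  have expand: "a = (e \<bullet> a) *\<^sub>R e" if "norm e = 1" for e a :: "real^'n"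
    using orthonormal_frame_expand[OF on[OF that], of a] n1 by simp
  define L where "L = max 1 B"
  have L: "L \<ge> 1" "B \<le> L" by (simp_all add: L_def)
  have sq: "sqrt (1 + L\<^sup>2) < 2 * L"
  proof (rule real_less_lsqrt)
    have "L\<^sup>2 \<ge> 1" using L by simp
    then show "1 + L\<^sup>2 < (2 * L)\<^sup>2" by (simp add: power_mult_distrib)
  qed (use L in simp)
  define p where "p x y = L *\<^sub>R sgn (x - y)" for x y :: "real^'n"
  have np: "norm (p x y) = L" if "x \<noteq> y" for x y using that L by (simp add: p_def norm_sgn)
  have sn: "sgn (x - y) \<bullet> inward_normal \<Omega> z = (if z = x then -1 else 1)"
    if z: "z \<in> frontier \<Omega>" "z = x \<or> z = y" and xy: "x \<in> closure \<Omega>" "y \<in> closure \<Omega>" "x \<noteq> y" for x y z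
  proof -
    let ?N = "inward_normal \<Omega> z" and ?s = "sgn (x - y)"
    have 1: "norm ?N = 1" by (rule norm_normal[OF z(1)])
    have "?s = (?N \<bullet> ?s) *\<^sub>R ?N" by (rule expand[OF 1])
    then have "norm ?s = \<bar>?N \<bullet> ?s\<bar> * norm ?N" by (metis norm_scaleR)
    then have abs: "\<bar>?s \<bullet> ?N\<bar> = 1" using 1 xy(3) by (simp add: norm_sgn inner_commute)
    have "?s \<bullet> ?N = (x - y) \<bullet> ?N / norm (x - y)" by (rule sgn_inner)
    moreover have "z = x \<Longrightarrow> (x - y) \<bullet> ?N < 0"
      using strictly_supporting[OF z(1) xy(2)] xy(3) by (simp add: inner_diff_left)
    moreover have "z \<noteq> x \<Longrightarrow> (x - y) \<bullet> ?N > 0"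
      using strictly_supporting[OF z(1) xy(1)] z(2) by simp
    moreover have "norm (x - y) > 0" using xy(3) by simp
    ultimately have "z = x \<Longrightarrow> ?s \<bullet> ?N < 0" "z \<noteq> x \<Longrightarrow> ?s \<bullet> ?N > 0"
      by (simp_all add: divide_less_0_iff)
    then show ?thesis using abs by (auto simp: abs_if split: if_splits)
  qed
  have kb: "\<bar>k * sqrt (1 + L\<^sup>2)\<bar> < L" if "\<bar>k\<bar> \<le> 1/2" for k
  proof -
    have "\<bar>k\<bar> * sqrt (1 + L\<^sup>2) \<le> 1/2 * sqrt (1 + L\<^sup>2)" using that by (intro mult_right_mono) auto
    then show ?thesis using sq by (simp add: abs_mult)
  qed
  show ?thesis
  proof (intro exI[of _ L] conjI allI impI ballI)
    show "0 \<le> L" using L by simp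
    fix T :: real and u x y t
    assume T: "0 < T" and flow: "flow_solution F \<Omega> \<theta> u0 T u"
      and x: "x \<in> closure \<Omega>" and y: "y \<in> closure \<Omega>" and t: "t \<in> {0..T}"
    show "u x t - u y t \<le> L * norm (x - y)"
    proof (rule two_point_comparison[OF flow T, where R = "\<lambda>x y. L * norm (x - y)" and px = p and py = p])
      show "continuous_on (closure \<Omega> \<times> closure \<Omega>) (\<lambda>(x, y). L * norm (x - y))"
        unfolding case_prod_unfold by (intro continuous_intros)
      show "0 \<le> L * norm (x - x)" for x :: "real^'n" by simp
      show "u0 x - u0 y \<le> L * norm (x - y)" if "x \<in> \<Omega>" "y \<in> \<Omega>" for x y
        using u0[OF that] mult_right_mono[OF L(2) norm_ge_zero[of "x - y"]] by linarith
    next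
      fix x y assume xy: "x \<in> closure \<Omega>" "y \<in> closure \<Omega>" "x \<noteq> y"
      have hx: "((\<lambda>x'. x' - y) has_derivative (\<lambda>v. v)) (at x within closure \<Omega>)"
        and hy: "((\<lambda>y'. x - y') has_derivative (\<lambda>v. - v)) (at y within closure \<Omega>)"
        by (auto intro!: derivative_eq_intros)
      have nz: "x - y \<noteq> 0" using xy by simp
      from has_derivative_compose[OF hx has_derivative_norm[OF nz]]
      show "((\<lambda>x'. L * norm (x' - y)) has_derivative (\<lambda>v. p x y \<bullet> v)) (at x within closure \<Omega>)"
        by (rule has_derivative_eq_rhs[OF has_derivative_mult_right]) (simp add: p_def inner_commute)
      from has_derivative_compose[OF hy has_derivative_norm[OF nz]]
      show "((\<lambda>y'. L * norm (x - y')) has_derivative (\<lambda>v. - (p x y \<bullet> v))) (at y within closure \<Omega>)"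
        by (rule has_derivative_eq_rhs[OF has_derivative_mult_right]) (simp add: p_def inner_commute)
    next
      fix x y assume x: "x \<in> frontier \<Omega>" and y: "y \<in> closure \<Omega>" and ne: "x \<noteq> y"
      show "p x y \<bullet> inward_normal \<Omega> x + cos (\<theta> x) * sqrt (1 + (norm (p x y))\<^sup>2) < 0"
        using sn[OF x _ frontier_closure[OF x] y ne] kb[OF \<theta>[OF x]] unfolding np[OF ne] by (simp add: p_def)
    next
      fix x y assume x: "x \<in> closure \<Omega>" and y: "y \<in> frontier \<Omega>" and ne: "x \<noteq> y"
      show "p x y \<bullet> inward_normal \<Omega> y + cos (\<theta> y) * sqrt (1 + (norm (p x y))\<^sup>2) > 0"
        using sn[OF y _ x frontier_closure[OF y] ne] kb[OF \<theta>[OF y]] ne unfolding np[OF ne] by (simp add: p_def)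
    next
      fix x y :: "real^'n" assume xy: "x \<noteq> y"
      let ?p = "p x y" and ?P = "(norm (p x y, -1::real))\<^sup>2"
      define e where "e = ?p /\<^sub>R norm ?p"
      have p0: "?p \<noteq> 0" using np[OF xy] L by auto
      then have e: "norm e = 1" by (simp add: e_def)
      have "adapted_frame ?p (\<lambda>_. e)" unfolding adapted_frame_def using on[OF e] by (simp add: e_def)
      then have "c1 / ?P \<le> aniso_tau F ?p e e"
        using c(2) p0 unfolding tau_bounds_def Let_def by blast
      moreover have "0 \<le> c1 / ?P" using c(1) by simp
      ultimately have \<tau>: "0 \<le> aniso_tau F ?p e e" by linarith
      have fam: "((sqrt (aniso_tau F ?p e e) *\<^sub>R e) \<bullet> a) * ((sqrt (aniso_tau F ?p e e) *\<^sub>R e) \<bullet> b) = aniso_tau F ?p a b" for a b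
      proof -
        have "aniso_tau F ?p a b = aniso_tau F ?p ((e \<bullet> a) *\<^sub>R e) ((e \<bullet> b) *\<^sub>R e)"
          using expand[OF e, of a] expand[OF e, of b] by (simp only:)
        also have "\<dots> = (sqrt (aniso_tau F ?p e e) * sqrt (aniso_tau F ?p e e)) * ((e \<bullet> a) * (e \<bullet> b))"
          using \<tau> by (simp add: A.aniso_tau_simps)
        finally show ?thesis by simp
      qed
      have "second_along (\<lambda>t. L * norm (x + t *\<^sub>R w - (y + t *\<^sub>R w))) 0" for w :: "real^'n"
        unfolding second_along_def by (intro exI[of _ "\<lambda>_. 0"]) simp
      then show "\<exists>(K :: unit set) w z s. finite K \<and> (\<forall>k\<in>K. second_along (\<lambda>t. L * norm (x + t *\<^sub>R w k - (y + t *\<^sub>R z k))) (s k)) \<and>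
         (\<forall>a b. (\<Sum>k\<in>K. (w k \<bullet> a) * (w k \<bullet> b)) = aniso_tau F ?p a b) \<and>
         (\<forall>a b. (\<Sum>k\<in>K. (z k \<bullet> a) * (z k \<bullet> b)) = aniso_tau F ?p a b) \<and> (\<Sum>k\<in>K. s k) \<le> 0"
        by (intro exI[of _ "{()}"] exI[of _ "\<lambda>_. sqrt (aniso_tau F ?p e e) *\<^sub>R e"] exI[of _ "\<lambda>_. 0"]) (simp del: inner_scaleR_left add: fam)
    qed (rule x, rule y, rule t)
  qed
qed

end

lemma structure_constants_bounds:
  fixes F :: "(real^'n) \<times> real \<Rightarrow> real"
  assumes F: "admissible_anisotropy F" and s: "structure_constants F c1 c2 c3" and n2: "CARD('n) \<ge> 2"
  obtains C5 C6 where "anisotropy_bounds F c1 c2 c3 C5 C6"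
proof -
  from s obtain C4 C5 C6 where C: "0 < C5" "0 < C6" "T3_bounds F C4 C5 C6" "C4 \<le> c2"
    unfolding structure_constants_def by blast
  have c: "0 < c1" "0 < c2" "0 < c3" "tau_bounds F c1 c2 c3" using s unfolding structure_constants_def by blast+
  have "T3_bounds F c2 C5 C6" unfolding T3_bounds_def Let_def
  proof (intro allI impI)
    fix q and \<phi> :: "nat \<Rightarrow> real^'n" assume q: "norm q > 1 \<and> adapted_frame q \<phi>"
    let ?P = "norm (q, -1::real)"
    have P: "0 \<le> ?P" by simp
    have "C4 / ?P \<le> c2 / ?P" "C4 / ?P ^ 3 \<le> c2 / ?P ^ 3"
      by (rule divide_right_mono[OF C(4)], simp)+
    then have up: "t \<le> C4 / ?P \<Longrightarrow> t \<le> c2 / ?P" "t \<le> C4 / ?P ^ 3 \<Longrightarrow> t \<le> c2 / ?P ^ 3" for t by linarith+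
    show "(\<forall>\<alpha>\<in>{1..<CARD('n)}. \<forall>\<beta>\<in>{1..<CARD('n)}. \<bar>aniso_T3 F q (\<phi> \<alpha>) (\<phi> \<alpha>) (\<phi> \<beta>)\<bar> \<le> c2 / ?P) \<and>
      (\<forall>\<alpha>\<in>{1..<CARD('n)}. \<forall>\<beta>\<in>{1..<CARD('n)}. \<alpha> \<noteq> \<beta> \<longrightarrow> \<bar>aniso_T3 F q (\<phi> \<alpha>) (\<phi> CARD('n)) (\<phi> \<beta>)\<bar> \<le> c2 / ?P) \<and>
      (\<forall>\<alpha>\<in>{1..<CARD('n)}. \<bar>aniso_T3 F q (\<phi> \<alpha>) (\<phi> \<alpha>) (\<phi> CARD('n))\<bar> \<le> c2 / ?P ^ 3 \<and>
        \<bar>aniso_T3 F q (\<phi> \<alpha>) (\<phi> CARD('n)) (\<phi> CARD('n))\<bar> \<le> c2 / ?P ^ 3 \<and>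
        \<bar>aniso_T3 F q (\<phi> CARD('n)) (\<phi> CARD('n)) (\<phi> \<alpha>)\<bar> \<le> c2 / ?P ^ 3) \<and>
      (\<forall>\<alpha>\<in>{1..<CARD('n)}. C5 / ?P \<le> aniso_T3 F q (\<phi> \<alpha>) (\<phi> CARD('n)) (\<phi> \<alpha>) \<and>
        aniso_T3 F q (\<phi> \<alpha>) (\<phi> CARD('n)) (\<phi> \<alpha>) \<le> C6 / ?P) \<and>
      C5 / ?P ^ 3 \<le> aniso_T3 F q (\<phi> CARD('n)) (\<phi> CARD('n)) (\<phi> CARD('n)) \<and>
      aniso_T3 F q (\<phi> CARD('n)) (\<phi> CARD('n)) (\<phi> CARD('n)) \<le> C6 / ?P ^ 3"
      using C(3)[unfolded T3_bounds_def Let_def, rule_format, OF q] up by meson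
  qed
  moreover have "smooth_fun_on (- {0}) F" using F unfolding admissible_anisotropy_def by blast
  ultimately show ?thesis using C c n2
    by (intro that[of C5 C6] anisotropy_bounds.intro smooth_anisotropy.intro anisotropy_bounds_axioms.intro)
qed

theorem theorem3p1:
  shows "\<exists>\<epsilon>2>0. \<forall>\<Omega> :: (real^'n) set.
    open \<Omega> \<and> connected \<Omega> \<and> \<Omega> \<noteq> {} \<and> bounded \<Omega> \<and> strictly_convex_set \<Omega> \<and> smooth_boundary \<Omega> \<and>
    (\<exists>k0>0. curvature_ge \<Omega> k0) \<longrightarrow>
    (\<exists>\<epsilon>1. 0 < \<epsilon>1 \<and> \<epsilon>1 < 1 \<and>
      (\<forall>F c1 c2 c3 \<theta> u0.
        admissible_anisotropy F \<and> structure_constants F c1 c2 c3 \<and> c2 / c1 < \<epsilon>2 \<and>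
        Ck_on 3 (closure \<Omega>) \<theta> \<and> (\<forall>x\<in>closure \<Omega>. \<bar>cos (\<theta> x)\<bar> \<le> \<epsilon>1) \<and>
        C1_norm (closure \<Omega>) (grad (closure \<Omega>) \<theta>) \<le> \<epsilon>1 \<and>
        Ck_on 3 (closure \<Omega>) u0 \<and> capillary_condition \<Omega> \<theta> u0 \<longrightarrow>
        (\<exists>C. \<forall>T>0. \<forall>u. flow_solution F \<Omega> \<theta> u0 T u \<longrightarrow>
          (\<forall>x\<in>closure \<Omega>. \<forall>t\<in>{0..T}. norm (grad (closure \<Omega>) (\<lambda>y. u y t) x) \<le> C))))"
proof (rule exI[of _ "1 / (4 * real CARD('n))"], intro conjI allI impI)
  show "0 < 1 / (4 * real CARD('n))" by simp
  fix \<Omega> :: "(real^'n) set"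
  assume \<Omega>: "open \<Omega> \<and> connected \<Omega> \<and> \<Omega> \<noteq> {} \<and> bounded \<Omega> \<and> strictly_convex_set \<Omega> \<and> smooth_boundary \<Omega> \<and>
    (\<exists>k0>0. curvature_ge \<Omega> k0)"
  then interpret smooth_convex_domain \<Omega> by unfold_locales blast+
  obtain k0 where k0: "k0 > 0" "curvature_ge \<Omega> k0" using \<Omega> by blast
  have CARD1: "CARD('n) \<ge> 1" by (simp add: Suc_leI)
  have "\<exists>\<epsilon>1. 0 < \<epsilon>1 \<and> \<epsilon>1 \<le> 1/2 \<and> (\<forall>F c1 c2 c3 \<theta> u0 B.
      admissible_anisotropy F \<and> structure_constants F c1 c2 c3 \<and> c2 / c1 < 1 / (4 * real CARD('n)) \<and>
      Ck_on 3 (closure \<Omega>) \<theta> \<and> (\<forall>x\<in>closure \<Omega>. \<bar>cos (\<theta> x)\<bar> \<le> \<epsilon>1) \<and>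
      C1_norm (closure \<Omega>) (grad (closure \<Omega>) \<theta>) \<le> \<epsilon>1 \<and>
      (\<forall>x\<in>\<Omega>. \<forall>y\<in>\<Omega>. u0 x - u0 y \<le> B * norm (x - y)) \<longrightarrow>
      (\<exists>L\<ge>0. \<forall>T>0. \<forall>u. flow_solution F \<Omega> \<theta> u0 T u \<longrightarrow>
        (\<forall>x\<in>closure \<Omega>. \<forall>y\<in>closure \<Omega>. \<forall>t\<in>{0..T}. u x t - u y t \<le> L * norm (x - y))))"
  proof (cases "CARD('n) = 1")
    case True
    show ?thesis
    proof (rule exI[of _ "1/2"], intro conjI allI impI, goal_cases)
      case (3 F c1 c2 c3 \<theta> u0 B)
      have "smooth_anisotropy F" using 3 unfolding admissible_anisotropy_def smooth_anisotropy_def by blast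
      moreover have "0 < c1" "tau_bounds F c1 c2 c3" using 3 unfolding structure_constants_def by blast+
      ultimately show ?case
        by (rule uniform_lipschitz_interval[OF True]) (use 3 frontier_closure in blast)+
    qed simp_all
  next
    case False
    then have n2: "CARD('n) \<ge> 2" using CARD1 by linarith
    show ?thesis
    proof (rule uniform_lipschitz_higher_dim[OF n2 k0(2,1)], rule exI, intro conjI allI impI, assumption, assumption, goal_cases)
      case (1 \<epsilon> F c1 c2 c3 \<theta> u0 B)
      have ad: "admissible_anisotropy F" "structure_constants F c1 c2 c3" "c2 / c1 < 1 / (4 * real CARD('n))" using 1(4) by blast+
      have "0 < c1" using ad(2) unfolding structure_constants_def by blast
      then have ratio: "c2 \<le> c1 / (4 * real CARD('n))" using ad(3) by (simp add: divide_less_eq)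
      obtain C5 C6 where "anisotropy_bounds F c1 c2 c3 C5 C6" by (rule structure_constants_bounds[OF ad(1,2) n2])
      from 1(3)[OF this ratio] show ?case using 1(4) by blast
    qed
  qed
  then obtain \<epsilon>1 :: real where \<epsilon>1: "0 < \<epsilon>1" "\<epsilon>1 \<le> 1/2" and main: "\<And>(F :: (real^'n) \<times> real \<Rightarrow> real) c1 c2 c3 \<theta> u0 B.
      admissible_anisotropy F \<and> structure_constants F c1 c2 c3 \<and> c2 / c1 < 1 / (4 * real CARD('n)) \<and>
      Ck_on 3 (closure \<Omega>) \<theta> \<and> (\<forall>x\<in>closure \<Omega>. \<bar>cos (\<theta> x)\<bar> \<le> \<epsilon>1) \<and>
      C1_norm (closure \<Omega>) (grad (closure \<Omega>) \<theta>) \<le> \<epsilon>1 \<and>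
      (\<forall>x\<in>\<Omega>. \<forall>y\<in>\<Omega>. u0 x - u0 y \<le> B * norm (x - y)) \<Longrightarrow>
      (\<exists>L\<ge>0. \<forall>T>0. \<forall>u. flow_solution F \<Omega> \<theta> u0 T u \<longrightarrow>
        (\<forall>x\<in>closure \<Omega>. \<forall>y\<in>closure \<Omega>. \<forall>t\<in>{0..T}. u x t - u y t \<le> L * norm (x - y)))"
    by blast
  show "\<exists>\<epsilon>1. 0 < \<epsilon>1 \<and> \<epsilon>1 < 1 \<and>
      (\<forall>F c1 c2 c3 \<theta> u0.
        admissible_anisotropy F \<and> structure_constants F c1 c2 c3 \<and> c2 / c1 < 1 / (4 * real CARD('n)) \<and>
        Ck_on 3 (closure \<Omega>) \<theta> \<and> (\<forall>x\<in>closure \<Omega>. \<bar>cos (\<theta> x)\<bar> \<le> \<epsilon>1) \<and>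
        C1_norm (closure \<Omega>) (grad (closure \<Omega>) \<theta>) \<le> \<epsilon>1 \<and>
        Ck_on 3 (closure \<Omega>) u0 \<and> capillary_condition \<Omega> \<theta> u0 \<longrightarrow>
        (\<exists>C. \<forall>T>0. \<forall>u. flow_solution F \<Omega> \<theta> u0 T u \<longrightarrow>
          (\<forall>x\<in>closure \<Omega>. \<forall>t\<in>{0..T}. norm (grad (closure \<Omega>) (\<lambda>y. u y t) x) \<le> C)))"
  proof (rule exI[of _ \<epsilon>1], intro conjI allI impI)
    show "0 < \<epsilon>1" "\<epsilon>1 < 1" using \<epsilon>1 by linarith+
    fix F :: "(real^'n) \<times> real \<Rightarrow> real" and c1 c2 c3 \<theta> u0
    assume a: "admissible_anisotropy F \<and> structure_constants F c1 c2 c3 \<and> c2 / c1 < 1 / (4 * real CARD('n)) \<and>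
        Ck_on 3 (closure \<Omega>) \<theta> \<and> (\<forall>x\<in>closure \<Omega>. \<bar>cos (\<theta> x)\<bar> \<le> \<epsilon>1) \<and>
        C1_norm (closure \<Omega>) (grad (closure \<Omega>) \<theta>) \<le> \<epsilon>1 \<and>
        Ck_on 3 (closure \<Omega>) u0 \<and> capillary_condition \<Omega> \<theta> u0"
    then have "Ck_on (Suc (Suc (Suc 0))) (closure \<Omega>) u0" unfolding numeral_3_eq_3 by blast
    then obtain B where "\<And>x y. x \<in> closure \<Omega> \<Longrightarrow> y \<in> closure \<Omega> \<Longrightarrow> u0 x - u0 y \<le> B * norm (x - y)"
      by (rule lipschitz_on_closure_of_Ck) (rule that)
    then have "\<forall>x\<in>\<Omega>. \<forall>y\<in>\<Omega>. u0 x - u0 y \<le> B * norm (x - y)" using closure_subset by blast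
    with a obtain L where L: "L \<ge> 0" and lip: "\<forall>T>0. \<forall>u. flow_solution F \<Omega> \<theta> u0 T u \<longrightarrow>
        (\<forall>x\<in>closure \<Omega>. \<forall>y\<in>closure \<Omega>. \<forall>t\<in>{0..T}. u x t - u y t \<le> L * norm (x - y))"
      using main[of F c1 c2 c3 \<theta> u0 B] by blast
    show "\<exists>C. \<forall>T>0. \<forall>u. flow_solution F \<Omega> \<theta> u0 T u \<longrightarrow>
          (\<forall>x\<in>closure \<Omega>. \<forall>t\<in>{0..T}. norm (grad (closure \<Omega>) (\<lambda>y. u y t) x) \<le> C)"
    proof (intro exI[of _ L] allI impI ballI)
      fix T :: real and u x t assume T: "0 < T" and flow: "flow_solution F \<Omega> \<theta> u0 T u"
        and x: "x \<in> closure \<Omega>" and t: "t \<in> {0..T}"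
      have "Ck_fst_on 3 (closure \<Omega>) {0..T} u" using flow unfolding flow_solution_def C32_on_def by blast
      then have "Ck_on 3 (closure \<Omega>) (\<lambda>y. u y t)" by (rule Ck_fst_on_slice[OF _ t])
      then have "Ck_on (Suc (Suc (Suc 0))) (closure \<Omega>) (\<lambda>y. u y t)" unfolding numeral_3_eq_3 .
      then show "norm (grad (closure \<Omega>) (\<lambda>y. u y t) x) \<le> L"
        by (rule gradient_bound_from_lipschitz[OF _ L _ x]) (use lip T flow t in blast)
    qed
  qed
qed

end
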